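(* For a fixed $*$-subfield $\mathbb F$ of $\mathbb C$ there are the following polynomial-time (many-one) reductions: (a) from $\mathrm{SAT}$ to $\mathrm{SAT}_{\mathrm L(\mathbb F^* )}$, and from $\mathrm{SAT}_{\mathrm L(\mathbb F^* )}$ to $\mathrm{FEAS}^\dagger_{\mathbb Z,\mathbb F^*}$; (b) if $\mathbb F$ is Pythagorean, from $\mathrm{FEAS}^\dagger_{\mathbb Z,\mathbb F^*}$ to $\mathrm{SAT}_{\mathrm L(\mathbb F^* )}$; (c) if $\mathbb F$ is real closed or algebraically closed, from $\mathrm{FEAS}^\dagger_{\mathbb Z,\mathbb F}$ to $\mathrm{SAT}_{\mathrm L(\mathbb F^* )}$.
   Context: A $*$-subfield of $\mathbb C$ is a subfield closed under complex conjugation. It is Pythagorean if in $\mathbb F\cap\mathbb R$ every sum of squares is a square. $\mathrm L(\mathbb F^d)$ is the ortholattice of linear subspaces of $\mathbb F^d$ under $\cap$, $+$, $^\perp$ (with respect to $\sum_i\overline{x_i}y_i$), $\{\vec0\}$ (as $0$), $\mathbb F^d$ (as $1$). An ortholattice term is built from variables with $\wedge,\vee,\neg,0,1$. $\mathrm{SAT}_{\mathrm L(\mathbb F^* )}\subseteq\{0,1\}^*$ is the set of binary encodings of terms $t$ such that for some $d\in\mathbb N=\{1,2,\ldots\}$ there is an assignment $\bar a$ in $\mathrm L(\mathbb F^d)$ with $t_{\mathrm L(\mathbb F^d)}(\bar a)=1$. $\mathrm{SAT}$ is the classical Boolean satisfiability problem. A $*$-ring is a ring with an involution $*$ satisfying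 $(r^* )^*=r$, $(r+s)^*=r^*+s^*$, $(rs)^*=s^*r^*$; $\mathbb F^{d\times d}$ is a $*$-ring under conjugate transpose, and $\mathbb F$ under conjugation. For a $*$-ring $R$, $\mathrm{FEAS}^\dagger_{\mathbb Z,R}$ is the problem: given (binary encodings of) finitely many polynomials $p_j\in\mathbb Z\langle X_1,X_1^\dagger,\ldots,X_n,X_n^\dagger\rangle$ in non-commuting variables, do they admit a common root in $R$, i.e. is there $\bar x\in R^n$ with $p_j(x_1,x_1^*,\ldots,x_n,x_n^* )=0$ for all $j$? $\mathrm{FEAS}^\dagger_{\mathbb Z,\mathbb F^*}:=\bigcup_{d\in\mathbb N}\mathrm{FEAS}^\dagger_{\mathbb Z,\mathbb F^{d\times d}}$, i.e. it asks for a common root in $\mathbb F^{d\times d}$ for some $d$. *)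

theory Defs
  imports
    "HOL-Computational_Algebra.Polynomial"
    "HOL-Algebra.Ring"
    "Jordan_Normal_Form.Schur_Decomposition"
begin

section \<open>Polynomial-time many-one reductions\<close>

text \<open>
  Deterministic multi-tape Turing machines with two-way infinite tapes. Tape symbols and states
  are natural numbers: symbol 0 is the blank, symbols 1 and 2 stand for the bits False and True;
  state 0 is initial and state 1 is the halting state. The components of the machine
  other than the transition function bound the number of tapes, symbols and states, so that the
  transition function is a finite table.
\<close>

datatype move = Move_Left | Stay | Move_Right

record tm =
  num_tapes :: nat
  num_symbols :: nat
  num_states :: nat
  delta :: "nat \<Rightarrow> nat list \<Rightarrow> nat \<times> (nat \<times> move) list"

definition wf_tm :: "tm \<Rightarrow> bool" where
  "wf_tm M \<longleftrightarrow>
     2 \<le> num_tapes M \<and> 3 \<le> num_symbols M \<and> 2 \<le> num_states M \<and>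
     (\<forall>q < num_states M. \<forall>ss. length ss = num_tapes M \<and> set ss \<subseteq> {..<num_symbols M} \<longrightarrow>
        (case delta M q ss of (q', acts) \<Rightarrow>
           q' < num_states M \<and> length acts = num_tapes M \<and>
           fst ` set acts \<subseteq> {..<num_symbols M}))"

text \<open>A tape consists of its cell contents and the position of the head.\<close>

type_synonym tape = "(int \<Rightarrow> nat) \<times> int"
type_synonym config = "nat \<times> tape list"

fun read_tape :: "tape \<Rightarrow> nat" where
  "read_tape (c, h) = c h"

fun head_shift :: "move \<Rightarrow> int" where
  "head_shift Move_Left = - 1"
| "head_shift Stay = 0"
| "head_shift Move_Right = 1"

fun act_tape :: "nat \<times> move \<Rightarrow> tape \<Rightarrow> tape" where
  "act_tape (s, m) (c, h) = (c(h := s), h + head_shift m)"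

fun tm_step :: "tm \<Rightarrow> config \<Rightarrow> config" where
  "tm_step M (q, ts) =
     (if q = 1 then (q, ts)
      else (case delta M q (map read_tape ts) of (q', acts) \<Rightarrow> (q', map2 act_tape acts ts)))"

definition word_cells :: "bool list \<Rightarrow> int \<Rightarrow> nat" where
  "word_cells w i =
     (if 0 \<le> i \<and> i < int (length w) then (if w ! nat i then 2 else 1) else 0)"

definition tm_init :: "tm \<Rightarrow> bool list \<Rightarrow> config" where
  "tm_init M x = (0, (word_cells x, 0) # replicate (num_tapes M - 1) (word_cells [], 0))"

text \<open>The input is on the first tape; the output is the content of the second tape.\<close>

definition tm_outputs_within :: "tm \<Rightarrow> bool list \<Rightarrow> bool list \<Rightarrow> nat \<Rightarrow> bool" where
  "tm_outputs_within M x y t \<longleftrightarrow>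
     (case (tm_step M ^^ t) (tm_init M x) of (q, ts) \<Rightarrow> q = 1 \<and> fst (ts ! 1) = word_cells y)"

definition poly_time :: "(bool list \<Rightarrow> bool list) \<Rightarrow> bool" where
  "poly_time f \<longleftrightarrow>
     (\<exists>M. wf_tm M \<and>
        (\<exists>p :: nat poly. \<forall>x. tm_outputs_within M x (f x) (poly p (length x))))"

definition poly_reducible :: "bool list set \<Rightarrow> bool list set \<Rightarrow> bool" (infix "\<le>\<^sub>p" 50) where
  "A \<le>\<^sub>p B \<longleftrightarrow> (\<exists>f. poly_time f \<and> (\<forall>x. x \<in> A \<longleftrightarrow> f x \<in> B))"


section \<open>Binary encodings of numbers and lists\<close>

text \<open>
  Self-delimiting encodings. In the encoding of a number each binary digit, least
  significant first, is preceded by True, and False terminates.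
\<close>

fun enc_nat :: "nat \<Rightarrow> bool list" where
  "enc_nat n = (if n = 0 then [False] else True # odd n # enc_nat (n div 2))"

declare enc_nat.simps [simp del]

definition enc_int :: "int \<Rightarrow> bool list" where
  "enc_int i = (i < 0) # enc_nat (nat \<bar>i\<bar>)"

fun enc_list :: "('a \<Rightarrow> bool list) \<Rightarrow> 'a list \<Rightarrow> bool list" where
  "enc_list e [] = [False]"
| "enc_list e (x # xs) = True # e x @ enc_list e xs"

definition prefix_code :: "('a \<Rightarrow> bool list) \<Rightarrow> bool" where
  "prefix_code e \<longleftrightarrow> (\<forall>x y r s. e x @ r = e y @ s \<longrightarrow> x = y \<and> r = s)"

lemma prefix_codeI: "(\<And>x y r s. e x @ r = e y @ s \<Longrightarrow> x = y \<and> r = s) \<Longrightarrow> prefix_code e"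
  by (auto simp: prefix_code_def)

lemma prefix_codeD: "prefix_code e \<Longrightarrow> e x @ r = e y @ s \<Longrightarrow> x = y \<and> r = s"
  by (auto simp: prefix_code_def)

lemma prefix_code_inj: "prefix_code e \<Longrightarrow> inj e"
  by (metis injI prefix_codeD)

lemma prefix_code_enc_nat: "prefix_code enc_nat"
proof (rule prefix_codeI)
  fix m n r s
  show "enc_nat m @ r = enc_nat n @ s \<Longrightarrow> m = n \<and> r = s"
  proof (induction m arbitrary: n rule: less_induct)
    case (less m)
    show ?case
    proof (cases "m = 0 \<or> n = 0")
      case True
      with less.prems show ?thesis
        by (subst (asm) (1 2) enc_nat.simps) (auto split: if_splits)
    next
      case False
      with less.prems have par: "odd m = odd n"
        and eq: "enc_nat (m div 2) @ r = enc_nat (n div 2) @ s"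
        by (subst (asm) (1 2) enc_nat.simps; simp)+
      have "m div 2 = n div 2 \<and> r = s"
        using less.IH[OF _ eq] False by simp
      then show ?thesis
        using par by (metis dvd_mult_div_cancel odd_two_times_div_two_succ)
    qed
  qed
qed

lemma prefix_code_enc_int: "prefix_code enc_int"
proof (rule prefix_codeI)
  fix i j r s
  assume "enc_int i @ r = enc_int j @ s"
  then have sgn: "(i < 0) = (j < 0)" and "enc_nat (nat \<bar>i\<bar>) @ r = enc_nat (nat \<bar>j\<bar>) @ s"
    by (auto simp: enc_int_def)
  from prefix_codeD[OF prefix_code_enc_nat this(2)] sgn show "i = j \<and> r = s"
    by linarith
qed

lemma prefix_code_enc_list:
  assumes "prefix_code e"
  shows "prefix_code (enc_list e)"
proof (rule prefix_codeI)
  fix xs ys r s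
  show "enc_list e xs @ r = enc_list e ys @ s \<Longrightarrow> xs = ys \<and> r = s"
  proof (induction xs arbitrary: ys)
    case Nil
    then show ?case by (cases ys) auto
  next
    case (Cons x xs)
    then show ?case
      by (cases ys) (auto dest!: prefix_codeD[OF assms])
  qed
qed


section \<open>Satisfiability of ortholattice terms\<close>

datatype ol_term =
    Var nat
  | Zero
  | One
  | Neg ol_term
  | Meet ol_term ol_term
  | Join ol_term ol_term

record 'a ortholattice = "'a partial_object" +
  ol_meet :: "'a \<Rightarrow> 'a \<Rightarrow> 'a"
  ol_join :: "'a \<Rightarrow> 'a \<Rightarrow> 'a"
  ol_neg :: "'a \<Rightarrow> 'a"
  ol_zero :: 'a
  ol_one :: 'a

primrec eval_term :: "('a, 'm) ortholattice_scheme \<Rightarrow> (nat \<Rightarrow> 'a) \<Rightarrow> ol_term \<Rightarrow> 'a" where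
  "eval_term L a (Var i) = a i"
| "eval_term L a Zero = ol_zero L"
| "eval_term L a One = ol_one L"
| "eval_term L a (Neg t) = ol_neg L (eval_term L a t)"
| "eval_term L a (Meet s t) = ol_meet L (eval_term L a s) (eval_term L a t)"
| "eval_term L a (Join s t) = ol_join L (eval_term L a s) (eval_term L a t)"

primrec enc_term :: "ol_term \<Rightarrow> bool list" where
  "enc_term (Var i) = [False, False, False] @ enc_nat i"
| "enc_term Zero = [False, False, True]"
| "enc_term One = [False, True, False]"
| "enc_term (Neg t) = [False, True, True] @ enc_term t"
| "enc_term (Meet s t) = [True, False, False] @ enc_term s @ enc_term t"
| "enc_term (Join s t) = [True, False, True] @ enc_term s @ enc_term t"

lemma prefix_code_enc_term: "prefix_code enc_term"
proof (rule prefix_codeI)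
  fix t u r s
  show "enc_term t @ r = enc_term u @ s \<Longrightarrow> t = u \<and> r = s"
  proof (induction t arbitrary: u r s)
    case (Var i)
    then show ?case
      by (cases u) (auto dest: prefix_codeD[OF prefix_code_enc_nat])
  next
    case Zero
    then show ?case by (cases u) auto
  next
    case One
    then show ?case by (cases u) auto
  next
    case (Neg t)
    then show ?case by (cases u) auto
  next
    case (Meet t1 t2)
    show ?case
      using Meet.prems by (cases u) (auto dest!: Meet.IH)
  next
    case (Join t1 t2)
    show ?case
      using Join.prems by (cases u) (auto dest!: Join.IH)
  qed
qed

definition sat_terms :: "('a, 'm) ortholattice_scheme \<Rightarrow> ol_term set" where
  "sat_terms L = {t. \<exists>a. (\<forall>i. a i \<in> carrier L) \<and> eval_term L a t = ol_one L}"

definition bool_ortholattice :: "bool ortholattice" where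
  "bool_ortholattice =
     \<lparr>carrier = UNIV, ol_meet = (\<and>), ol_join = (\<or>), ol_neg = Not,
      ol_zero = False, ol_one = True\<rparr>"

definition SAT :: "bool list set" where
  "SAT = enc_term ` sat_terms bool_ortholattice"


section \<open>Star-subfields of the complex numbers\<close>

definition star_subfield :: "complex set \<Rightarrow> bool" where
  "star_subfield F \<longleftrightarrow>
     0 \<in> F \<and> 1 \<in> F \<and>
     (\<forall>x\<in>F. \<forall>y\<in>F. x + y \<in> F \<and> x * y \<in> F) \<and>
     (\<forall>x\<in>F. - x \<in> F \<and> inverse x \<in> F \<and> cnj x \<in> F)"

definition sums_of_squares :: "complex set \<Rightarrow> complex set" where
  "sums_of_squares K = {\<Sum>x\<leftarrow>xs. x\<^sup>2 | xs. set xs \<subseteq> K}"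

definition pythagorean :: "complex set \<Rightarrow> bool" where
  "pythagorean F \<longleftrightarrow> (\<forall>s \<in> sums_of_squares (F \<inter> \<real>). \<exists>y \<in> F \<inter> \<real>. s = y\<^sup>2)"

definition alg_closed_subfield :: "complex set \<Rightarrow> bool" where
  "alg_closed_subfield F \<longleftrightarrow>
     (\<forall>p :: complex poly. (\<forall>i. coeff p i \<in> F) \<and> 0 < degree p \<longrightarrow> (\<exists>x\<in>F. poly p x = 0))"

text \<open>
  Real closedness is a property of the abstract field: it is not required that the
  field consists of real numbers.
\<close>

definition real_closed_subfield :: "complex set \<Rightarrow> bool" where
  "real_closed_subfield F \<longleftrightarrow>
     - 1 \<notin> sums_of_squares F \<and>
     (\<forall>x\<in>F. \<exists>y\<in>F. x = y\<^sup>2 \<or> x = - (y\<^sup>2)) \<and>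
     (\<forall>p :: complex poly. (\<forall>i. coeff p i \<in> F) \<and> odd (degree p) \<longrightarrow> (\<exists>x\<in>F. poly p x = 0))"


section \<open>The ortholattice of subspaces\<close>

definition vec_space_over :: "complex set \<Rightarrow> nat \<Rightarrow> complex vec set" where
  "vec_space_over F d = {v \<in> carrier_vec d. \<forall>i<d. v $ i \<in> F}"

definition subspace_over :: "complex set \<Rightarrow> nat \<Rightarrow> complex vec set \<Rightarrow> bool" where
  "subspace_over F d U \<longleftrightarrow>
     U \<subseteq> vec_space_over F d \<and> 0\<^sub>v d \<in> U \<and>
     (\<forall>u\<in>U. \<forall>v\<in>U. u + v \<in> U) \<and> (\<forall>c\<in>F. \<forall>u\<in>U. c \<cdot>\<^sub>v u \<in> U)"

definition subspace_lattice :: "complex set \<Rightarrow> nat \<Rightarrow> complex vec set ortholattice" where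
  "subspace_lattice F d =
     \<lparr>carrier = {U. subspace_over F d U},
      ol_meet = (\<inter>),
      ol_join = (\<lambda>U V. {u + v | u v. u \<in> U \<and> v \<in> V}),
      ol_neg = (\<lambda>U. {y \<in> vec_space_over F d. \<forall>x\<in>U. conjugate x \<bullet> y = 0}),
      ol_zero = {0\<^sub>v d},
      ol_one = vec_space_over F d\<rparr>"

definition SAT_L :: "complex set \<Rightarrow> bool list set" where
  "SAT_L F = enc_term ` (\<Union>d\<in>{1..}. sat_terms (subspace_lattice F d))"


section \<open>Feasibility of non-commutative polynomials over star-rings\<close>

record 'a star_ring = "'a ring" +
  star :: "'a \<Rightarrow> 'a"

text \<open>
  A polynomial is given as the list of its terms, each consisting of an integer
  coefficient and a word of letters. The letter \<open>(i, False)\<close> is the \<open>i\<close>-th variable and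
  \<open>(i, True)\<close> is its formal adjoint.
\<close>

type_synonym nc_monom = "(nat \<times> bool) list"
type_synonym nc_poly = "(int \<times> nc_monom) list"

definition eval_letter :: "('a, 'm) star_ring_scheme \<Rightarrow> (nat \<Rightarrow> 'a) \<Rightarrow> nat \<times> bool \<Rightarrow> 'a" where
  "eval_letter R x l = (case l of (i, b) \<Rightarrow> if b then star R (x i) else x i)"

definition eval_monom :: "('a, 'm) star_ring_scheme \<Rightarrow> (nat \<Rightarrow> 'a) \<Rightarrow> nc_monom \<Rightarrow> 'a" where
  "eval_monom R x w = foldr (\<lambda>l y. eval_letter R x l \<otimes>\<^bsub>R\<^esub> y) w \<one>\<^bsub>R\<^esub>"

definition eval_poly :: "('a, 'm) star_ring_scheme \<Rightarrow> (nat \<Rightarrow> 'a) \<Rightarrow> nc_poly \<Rightarrow> 'a" where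
  "eval_poly R x p =
     foldr (\<lambda>(c, w) y. ([c] \<cdot>\<^bsub>R\<^esub> eval_monom R x w) \<oplus>\<^bsub>R\<^esub> y) p \<zero>\<^bsub>R\<^esub>"

definition enc_letter :: "nat \<times> bool \<Rightarrow> bool list" where
  "enc_letter l = (case l of (i, b) \<Rightarrow> b # enc_nat i)"

definition enc_summand :: "int \<times> nc_monom \<Rightarrow> bool list" where
  "enc_summand m = (case m of (c, w) \<Rightarrow> enc_int c @ enc_list enc_letter w)"

definition enc_polys :: "nc_poly list \<Rightarrow> bool list" where
  "enc_polys = enc_list (enc_list enc_summand)"

lemma prefix_code_enc_polys: "prefix_code enc_polys"
proof -
  have letter: "prefix_code enc_letter"
    by (rule prefix_codeI)
       (auto simp: enc_letter_def dest: prefix_codeD[OF prefix_code_enc_nat])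
  have "prefix_code enc_summand"
    by (rule prefix_codeI)
       (auto simp: enc_summand_def dest!: prefix_codeD[OF prefix_code_enc_int]
          dest: prefix_codeD[OF prefix_code_enc_list[OF letter]])
  then show ?thesis
    unfolding enc_polys_def by (intro prefix_code_enc_list)
qed

text \<open>
  Total assignments to all variables \<open>x 0, x 1, \<dots>\<close> serve for every finite number of variables.
\<close>

definition feasible_polys :: "('a, 'm) star_ring_scheme \<Rightarrow> nc_poly list set" where
  "feasible_polys R =
     {ps. \<exists>x. (\<forall>i. x i \<in> carrier R) \<and> (\<forall>p \<in> set ps. eval_poly R x p = \<zero>\<^bsub>R\<^esub>)}"

definition FEAS :: "('a, 'm) star_ring_scheme \<Rightarrow> bool list set" where
  "FEAS R = enc_polys ` feasible_polys R"

definition field_star_ring :: "complex set \<Rightarrow> complex star_ring" where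
  "field_star_ring F =
     \<lparr>carrier = F, monoid.mult = (*), one = 1, zero = 0, add = (+), star = cnj\<rparr>"

definition matrix_star_ring :: "complex set \<Rightarrow> nat \<Rightarrow> complex mat star_ring" where
  "matrix_star_ring F d =
     \<lparr>carrier = {A \<in> carrier_mat d d. elements_mat A \<subseteq> F},
      monoid.mult = (*), one = 1\<^sub>m d, zero = 0\<^sub>m d d, add = (+), star = mat_adjoint\<rparr>"

definition FEAS_all_dims :: "complex set \<Rightarrow> bool list set" where
  "FEAS_all_dims F = (\<Union>d\<in>{1..}. FEAS (matrix_star_ring F d))"

end

theory Submission
  imports Defs "HOL-Computational_Algebra.Polynomial_FPS"
begin

text \<open>
  All reductions are computed by programs of a small loop language that compiles to Turing machines
  and terminates in polynomial time by construction.

  From a satisfiable Boolean term one gets a lattice assignment with values \<open>0\<close> and \<open>1\<close>. Conversely, if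
  a term is satisfied together with the conditions that its variables commute pairwise, then some
  nonzero vector lies in each variable or in its orthogonal complement, and this gives truth values.
  Subspaces become matrices as orthogonal projections, with the subspace operations expressed by
  polynomial identities and auxiliary matrices.

  For the way back, finitely many lattice identities force a decomposition of \<open>F^d\<close> into three
  isomorphic orthogonal summands \<open>F^k\<close>, as in von Neumann's coordinatization: matrices correspond to
  graphs, and ring operations and adjoints to lattice terms. Choosing orthonormal coordinates needs
  square roots of norms, which exist over a Pythagorean field. Over a real closed or
  algebraically closed field one also demands that all matrices and their adjoints commute
  (and are hermitian in the real case); then a common eigenvector turns matrix solutions into scalar ones.
\<close>

notation mult_mat_vec (infixl "*v" 70)
notation smult_vec (infixl "*s" 70)

section \<open>A loop language with polynomial running time\<close>

text \<open>
  Programs work on stacks of natural numbers and an append-only output. The loop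
  \<open>For c0 c1\<close> runs through the bits of the input word and executes \<open>c0\<close> or \<open>c1\<close> according
  to the current bit. As no other iteration is available, every program terminates
  in polynomial time.
\<close>

datatype com =
    Skip
  | Emit bool
  | Push nat nat
  | Pop nat
  | Seq com com  (infixr ";;" 60)
  | IfTop nat nat com com
  | For com com

type_synonym store = "(nat => nat list) \<times> bool list"

primrec sem :: "bool list => com => store => store" where
  "sem x Skip = (\<lambda>s. s)"
| "sem x (Emit b) = (\<lambda>s. (fst s, snd s @ [b]))"
| "sem x (Push r k) = (\<lambda>s. ((fst s)(r := k # fst s r), snd s))"
| "sem x (Pop r) = (\<lambda>s. ((fst s)(r := tl (fst s r)), snd s))"
| "sem x (c1 ;; c2) = (\<lambda>s. sem x c2 (sem x c1 s))"
| "sem x (IfTop r k c1 c2) =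
     (\<lambda>s. if fst s r \<noteq> [] \<and> hd (fst s r) = k then sem x c1 s else sem x c2 s)"
| "sem x (For c0 c1) = (\<lambda>s. foldl (\<lambda>s b. if b then sem x c1 s else sem x c0 s) s x)"

primrec fits :: "nat => com => bool" where
  "fits N Skip = True"
| "fits N (Emit b) = True"
| "fits N (Push r k) = (r < N \<and> Suc k < N)"
| "fits N (Pop r) = (r < N)"
| "fits N (c1 ;; c2) = (fits N c1 \<and> fits N c2)"
| "fits N (IfTop r k c1 c2) = (r < N \<and> fits N c1 \<and> fits N c2)"
| "fits N (For c0 c1) = (fits N c0 \<and> fits N c1)"

lemma fits_mono: "fits N c ==> N \<le> N' ==> fits N' c" by (induction c) auto

lemma ex_fits: "\<exists>N\<ge>3. fits N c"
proof (induction c)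
  case (Push r k)
  show ?case by (intro exI[of _ "r + k + 3"]) auto
next
  case (Pop r)
  show ?case by (intro exI[of _ "r + 3"]) auto
next
  case (Seq c1 c2)
  then obtain N1 N2 where "N1 \<ge> 3" "fits N1 c1" "N2 \<ge> 3" "fits N2 c2" by blast
  thus ?case by (intro exI[of _ "max N1 N2"]) (auto intro: fits_mono)
next
  case (IfTop r k c1 c2)
  then obtain N1 N2 where "N1 \<ge> 3" "fits N1 c1" "N2 \<ge> 3" "fits N2 c2" by blast
  thus ?case by (intro exI[of _ "max (Suc r) (max N1 N2)"]) (auto intro: fits_mono)
next
  case (For c1 c2)
  then obtain N1 N2 where "N1 \<ge> 3" "fits N1 c1" "N2 \<ge> 3" "fits N2 c2" by blast
  thus ?case by (intro exI[of _ "max N1 N2"]) (auto intro: fits_mono)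
qed auto

primrec loop_depth :: "com => nat" where
  "loop_depth Skip = 0"
| "loop_depth (Emit b) = 0"
| "loop_depth (Push r k) = 0"
| "loop_depth (Pop r) = 0"
| "loop_depth (c1 ;; c2) = max (loop_depth c1) (loop_depth c2)"
| "loop_depth (IfTop r k c1 c2) = max (loop_depth c1) (loop_depth c2)"
| "loop_depth (For c0 c1) = Suc (max (loop_depth c0) (loop_depth c1))"

subsection \<open>Compilation to Turing machines\<close>

text \<open>
  An instruction \<open>(t, nx, act)\<close> branches on the symbol under the head of tape \<open>t\<close>; \<open>act s i s'\<close>
  is the action on tape \<open>i\<close> showing \<open>s'\<close> if tape \<open>t\<close> shows \<open>s\<close>. Tape 0 holds the input and tape 1
  the output, tape \<open>2 + r\<close> holds stack \<open>r\<close> with its top under the head, where \<open>k\<close> is stored as the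
  symbol \<open>Suc k\<close>, and tape \<open>2 + N + l\<close> holds the copy of the input for loops at nesting depth \<open>l\<close>.
\<close>

type_synonym instr = "nat \<times> (nat => nat) \<times> (nat => nat => nat => nat \<times> move)"

definition on_tape :: "nat => (nat => nat) => (nat => nat \<times> move) => instr" where
  "on_tape t nx w = (t, nx, \<lambda>s i s'. if i = t then w s else (s', Stay))"

primrec code_size :: "com => nat" where
  "code_size Skip = 0"
| "code_size (Emit b) = 1"
| "code_size (Push r k) = 2"
| "code_size (Pop r) = 1"
| "code_size (c1 ;; c2) = code_size c1 + code_size c2"
| "code_size (IfTop r k c1 c2) = code_size c1 + code_size c2 + 2"
| "code_size (For c0 c1) = code_size c0 + code_size c1 + 5"

primrec compile :: "nat => com => nat => nat => instr list" where
  "compile N Skip l p = []"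
| "compile N (Emit b) l p =
     [on_tape 1 (\<lambda>_. Suc p) (\<lambda>_. (if b then 2 else 1, Move_Right))]"
| "compile N (Push r k) l p =
     [on_tape (2 + r) (\<lambda>_. Suc p) (\<lambda>s. (s, Move_Left)),
      on_tape (2 + r) (\<lambda>_. Suc (Suc p)) (\<lambda>_. (Suc k, Stay))]"
| "compile N (Pop r) l p = [on_tape (2 + r) (\<lambda>_. Suc p) (\<lambda>_. (0, Move_Right))]"
| "compile N (c1 ;; c2) l p = compile N c1 l p @ compile N c2 l (p + code_size c1)"
| "compile N (IfTop r k c1 c2) l p =
     on_tape (2 + r) (\<lambda>s. if s = Suc k then Suc p else p + code_size c1 + 2) (\<lambda>s. (s, Stay)) #
     compile N c1 l (Suc p) @
     on_tape 0 (\<lambda>_. p + code_size c1 + code_size c2 + 2) (\<lambda>s. (s, Stay)) #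
     compile N c2 l (p + code_size c1 + 2)"
| "compile N (For c0 c1) l p =
     on_tape (2 + N + l)
       (\<lambda>s. if s = 0 then p + code_size c0 + code_size c1 + 3
            else if s = 1 then Suc p else p + code_size c0 + 2)
       (\<lambda>s. (s, Stay)) #
     compile N c0 (Suc l) (Suc p) @
     on_tape (2 + N + l) (\<lambda>_. p) (\<lambda>s. (s, Move_Right)) #
     compile N c1 (Suc l) (p + code_size c0 + 2) @
     [on_tape (2 + N + l) (\<lambda>_. p) (\<lambda>s. (s, Move_Right)),
      on_tape (2 + N + l) (\<lambda>_. p + code_size c0 + code_size c1 + 4) (\<lambda>s. (s, Move_Left)),
      on_tape (2 + N + l)
        (\<lambda>s. p + code_size c0 + code_size c1 + (if s = 0 then 5 else 4))
        (\<lambda>s. (s, if s = 0 then Move_Right else Move_Left))]"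

lemma length_compile [simp]: "length (compile N c l p) = code_size c"
  by (induction c arbitrary: l p) auto

definition instr_ok :: "nat => nat => nat => instr => bool" where
  "instr_ok n N K I \<longleftrightarrow> (case I of (t, nx, act) =>
     t < K \<and> (\<forall>s. nx s < n) \<and> (\<forall>s i s'. s < N \<and> s' < N --> fst (act s i s') < N))"

lemma instr_ok_on_tape:
  assumes "t < K" "\<And>s. nx s < n" "\<And>s. s < N ==> fst (w s) < N"
  shows "instr_ok n N K (on_tape t nx w)" using assms by (auto simp: instr_ok_def on_tape_def)

lemma compile_ok:
  assumes "fits N c" "N \<ge> 3" "l + loop_depth c \<le> L" "p + code_size c < n"
    and "I \<in> set (compile N c l p)"
  shows "instr_ok n N (2 + N + L) I" using assms
proof (induction c arbitrary: l p)
  case (For c1 c2)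
  have "I \<in> set (compile N c1 (Suc l) (Suc p)) ==> ?case"
    by (rule For.IH(1)[of "Suc l" "Suc p"]) (use For.prems in auto)
  moreover have "I \<in> set (compile N c2 (Suc l) (p + code_size c1 + 2)) ==> ?case"
    by (rule For.IH(2)[of "Suc l" "p + code_size c1 + 2"]) (use For.prems in auto)
  ultimately show ?case using For.prems by (auto intro!: instr_ok_on_tape)
next
  case (IfTop r k c1 c2)
  have "I \<in> set (compile N c1 l (Suc p)) ==> ?case"
    by (rule IfTop.IH(1)[of l "Suc p"]) (use IfTop.prems in auto)
  moreover have "I \<in> set (compile N c2 l (p + code_size c1 + 2)) ==> ?case"
    by (rule IfTop.IH(2)[of l "p + code_size c1 + 2"]) (use IfTop.prems in auto)
  ultimately show ?case using IfTop.prems by (auto intro!: instr_ok_on_tape)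
next
  case (Seq c1 c2)
  have "I \<in> set (compile N c1 l p) ==> ?case"
    by (rule Seq.IH(1)[of l p]) (use Seq.prems in auto)
  moreover have "I \<in> set (compile N c2 l (p + code_size c1)) ==> ?case"
    by (rule Seq.IH(2)[of l "p + code_size c1"]) (use Seq.prems in auto)
  ultimately show ?case using Seq.prems by auto
qed (auto intro!: instr_ok_on_tape)

type_synonym fconfig = "nat \<times> (nat => tape)"

definition fstep :: "instr list => fconfig => fconfig" where
  "fstep code = (\<lambda>(q, tp).
     if q = 1 then (q, tp)
     else (case code ! q of (t, nx, act) =>
       (nx (read_tape (tp t)),
        \<lambda>i. act_tape (act (read_tape (tp t)) i (read_tape (tp i))) (tp i))))"

definition code_at :: "instr list => nat => instr list => bool" where
  "code_at code p cs \<longleftrightarrow> (\<forall>i<length cs. code ! (p + i) = cs ! i)"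

lemma code_at_Cons: "code_at code p (I # cs) \<longleftrightarrow> code ! p = I \<and> code_at code (Suc p) cs"
  unfolding code_at_def by (auto simp: nth_Cons less_Suc_eq_0_disj split: nat.splits)

lemma code_at_append:
  "code_at code p (cs @ ds) \<longleftrightarrow> code_at code p cs \<and> code_at code (p + length cs) ds"
  by (induction cs arbitrary: p) (auto simp: code_at_Cons, auto simp: code_at_def)

lemma fstep_on_tape:
  assumes "code ! q = on_tape t nx w" "q > 1"
  shows "fstep code (q, tp) =
    (nx (read_tape (tp t)), tp(t := act_tape (w (read_tape (tp t))) (tp t)))"
proof -
  have "act_tape (read_tape y, Stay) y = y" for y by (cases y) auto
  thus ?thesis using assms by (auto simp: fstep_def on_tape_def fun_eq_iff)
qed

definition reaches :: "instr list => nat => fconfig => fconfig => bool" where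
  "reaches code n a b \<longleftrightarrow> (\<exists>k\<le>n. (fstep code ^^ k) a = b)"

lemma reaches_refl: "reaches code n a a" by (auto simp: reaches_def intro: exI[of _ 0])

lemma reaches_trans:
  assumes "reaches code m a b" "reaches code n b c"
  shows "reaches code (m + n) a c"
proof -
  obtain i j where "i \<le> m" "(fstep code ^^ i) a = b" "j \<le> n" "(fstep code ^^ j) b = c"
    using assms by (auto simp: reaches_def)
  thus ?thesis unfolding reaches_def by (intro exI[of _ "j + i"]) (auto simp: funpow_add)
qed

lemma reaches_step: "fstep code a = b ==> reaches code n b c ==> reaches code (Suc n) a c"
  unfolding reaches_def by (metis Suc_le_mono funpow_Suc_right o_apply)

lemma reaches_one: "fstep code a = b ==> reaches code 1 a b"
  using reaches_step[OF _ reaches_refl, of code a b 0] by simp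

lemma reaches_mono: "reaches code m a b ==> m \<le> n ==> reaches code n a b"
  unfolding reaches_def using order_trans by blast

fun holds_stack :: "nat list => tape => bool" where
  "holds_stack xs (c, h) \<longleftrightarrow>
     (\<forall>i. c i = (if h \<le> i \<and> i < h + int (length xs) then Suc (xs ! nat (i - h)) else 0))"

lemma read_tape_stack: "holds_stack xs tp ==> read_tape tp = (if xs = [] then 0 else Suc (hd xs))"
  by (cases tp) (auto simp: hd_conv_nth)

lemma holds_stack_push:
  assumes "holds_stack xs tp"
  shows "holds_stack (k # xs) (act_tape (Suc k, Stay) (act_tape (read_tape tp, Move_Left) tp))"
proof (cases tp)
  case (Pair c h)
  have "nat (i - (h - 1)) = Suc (nat (i - h))" if "i \<ge> h" for i using that by linarith
  thus ?thesis using assms Pair by auto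
qed

lemma holds_stack_pop:
  assumes "holds_stack xs tp"
  shows "holds_stack (tl xs) (act_tape (0, Move_Right) tp)"
proof (cases tp)
  case (Pair c h)
  have "nat (i - h) = Suc (nat (i - (h + 1)))" if "i > h" for i using that by linarith
  thus ?thesis using assms Pair by (cases xs) (auto simp: nth_Cons')
qed

lemma word_cells_snoc:
  "(word_cells w)(int (length w) := (if b then 2 else 1)) = word_cells (w @ [b])"
proof
  fix i :: int
  have "nat i < length w" if "0 \<le> i" "i < int (length w)" using that by linarith
  thus "((word_cells w)(int (length w) := (if b then 2 else 1))) i = word_cells (w @ [b]) i"
    by (auto simp: nth_append word_cells_def)
qed

lemma word_cells_simps:
  "word_cells x (- 1) = 0"
  "word_cells x (int (length x)) = 0"
  "k < length x ==> word_cells x (int k) = (if x ! k then 2 else 1)" by (auto simp: word_cells_def)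

lemma word_cells_upd: "word_cells x i = v ==> (word_cells x)(i := v) = word_cells x" by auto

definition represents :: "nat => nat => bool list => nat => store => (nat => tape) => bool" where
  "represents N L x l s tp \<longleftrightarrow>
     tp 1 = (word_cells (snd s), int (length (snd s))) \<and>
     (\<forall>r<N. holds_stack (fst s r) (tp (2 + r))) \<and>
     (\<forall>j. l \<le> j \<and> j < L --> tp (2 + N + j) = (word_cells x, 0))"

primrec cost :: "com => nat poly" where
  "cost Skip = 0"
| "cost (Emit b) = 1"
| "cost (Push r k) = 2"
| "cost (Pop r) = 1"
| "cost (c1 ;; c2) = cost c1 + cost c2"
| "cost (IfTop r k c1 c2) = cost c1 + cost c2 + 2"
| "cost (For c0 c1) = [:3, 1:] + [:0, 1:] * (cost c0 + cost c1 + 2)"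

lemma rewind:
  assumes "code ! q = on_tape t (\<lambda>s. if s = 0 then q' else q)
      (\<lambda>s. (s, if s = 0 then Move_Right else Move_Left))" "q > 1"
    and "tp t = (word_cells x, int k - 1)" "k \<le> length x"
  shows "reaches code (Suc k) (q, tp) (q', tp(t := (word_cells x, 0)))" using assms(3,4)
proof (induction k arbitrary: tp)
  case 0
  thus ?case
    by (intro reaches_step[OF _ reaches_refl]) (auto simp: fstep_on_tape[OF assms(1,2)] word_cells_simps word_cells_upd)
next
  case (Suc k)
  have "reaches code (Suc k) (q, tp(t := (word_cells x, int k - 1)))
     (q', (tp(t := (word_cells x, int k - 1)))(t := (word_cells x, 0)))"
    using Suc by (intro Suc.IH) auto
  hence "reaches code (Suc k) (q, tp(t := (word_cells x, int k - 1)))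
     (q', tp(t := (word_cells x, 0)))" by simp
  moreover have "fstep code (q, tp) = (q, tp(t := (word_cells x, int k - 1)))"
    using Suc.prems by (auto simp: fstep_on_tape[OF assms(1,2)] word_cells_simps word_cells_upd)
  ultimately show ?case by (rule reaches_step[rotated])
qed

lemma compile_correct:
  assumes "fits N c" "l + loop_depth c \<le> L" "p > 1" "code_at code p (compile N c l p)"
    and "represents N L x l s tp"
  shows "\<exists>tp'. reaches code (poly (cost c) (length x)) (p, tp) (p + code_size c, tp') \<and>
     represents N L x l (sem x c s) tp' \<and> (\<forall>i\<ge>2 + N. tp' i = tp i)" using assms
proof (induction c arbitrary: l p s tp)
  case Skip
  thus ?case by (auto intro: reaches_refl)
next
  case (Emit b)
  let ?tp = "tp(1 := (word_cells (snd s @ [b]), int (length (snd s @ [b]))))"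
  have "fstep code (p, tp) = (Suc p, ?tp)" using Emit by (subst fstep_on_tape)
       (auto simp: code_at_Cons represents_def simp flip: word_cells_snoc)
  hence "reaches code 1 (p, tp) (Suc p, ?tp)" by (rule reaches_one)
  hence "reaches code (poly (cost (Emit b)) (length x)) (p, tp) (p + code_size (Emit b), ?tp)"
    by simp
  moreover have "represents N L x l (sem x (Emit b) s) ?tp" "\<forall>i\<ge>2 + N. ?tp i = tp i"
    using Emit by (auto simp: represents_def)
  ultimately show ?case by blast
next
  case (Push r k)
  let ?tp1 = "tp(2 + r := act_tape (read_tape (tp (2 + r)), Move_Left) (tp (2 + r)))"
  let ?tp2 = "?tp1(2 + r := act_tape (Suc k, Stay) (?tp1 (2 + r)))"
  have "fstep code (p, tp) = (Suc p, ?tp1)"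
    using Push by (subst fstep_on_tape) (auto simp: code_at_Cons)
  moreover have "fstep code (Suc p, ?tp1) = (Suc (Suc p), ?tp2)"
    using Push by (subst fstep_on_tape) (auto simp: code_at_Cons)
  ultimately have "reaches code 2 (p, tp) (Suc (Suc p), ?tp2)"
    by (auto intro!: reaches_step[OF _ reaches_step[OF _ reaches_refl, of _ _ _ 0]]
        simp: numeral_2_eq_2)
  moreover have "holds_stack (k # fst s r) (?tp2 (2 + r))"
    using Push holds_stack_push[of "fst s r" "tp (2 + r)" k] by (auto simp: represents_def)
  ultimately have "represents N L x l (sem x (Push r k) s) ?tp2" "\<forall>i\<ge>2 + N. ?tp2 i = tp i"
    using Push.prems by (auto simp: represents_def)
  moreover have "reaches code (poly (cost (Push r k)) (length x)) (p, tp)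
      (p + code_size (Push r k), ?tp2)" using `reaches code 2 _ _` by simp
  ultimately show ?case by blast
next
  case (Pop r)
  let ?tp = "tp(2 + r := act_tape (0, Move_Right) (tp (2 + r)))"
  have "fstep code (p, tp) = (Suc p, ?tp)"
    using Pop by (subst fstep_on_tape) (auto simp: code_at_Cons)
  hence "reaches code 1 (p, tp) (Suc p, ?tp)" by (rule reaches_one)
  moreover have "holds_stack (tl (fst s r)) (?tp (2 + r))"
    using Pop holds_stack_pop[of "fst s r" "tp (2 + r)"] by (auto simp: represents_def)
  ultimately have "represents N L x l (sem x (Pop r) s) ?tp" "\<forall>i\<ge>2 + N. ?tp i = tp i"
    using Pop.prems by (auto simp: represents_def)
  moreover have "reaches code (poly (cost (Pop r)) (length x)) (p, tp) (p + code_size (Pop r), ?tp)"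
    using `reaches code 1 _ _` by simp
  ultimately show ?case by blast
next
  case (Seq c1 c2)
  have d: "l + loop_depth c1 \<le> L" "l + loop_depth c2 \<le> L"
    using Seq.prems(2) by (auto simp: max_def split: if_splits)
  obtain tp1 where 1: "reaches code (poly (cost c1) (length x)) (p, tp) (p + code_size c1, tp1)"
    "represents N L x l (sem x c1 s) tp1" "\<forall>i\<ge>2 + N. tp1 i = tp i"
    using Seq.IH(1)[of l p s tp] Seq.prems d by (auto simp: code_at_append)
  obtain tp2 where 2: "reaches code (poly (cost c2) (length x)) (p + code_size c1, tp1)
       (p + code_size c1 + code_size c2, tp2)"
    "represents N L x l (sem x c2 (sem x c1 s)) tp2" "\<forall>i\<ge>2 + N. tp2 i = tp1 i"
    using Seq.IH(2)[of l "p + code_size c1" "sem x c1 s" tp1] Seq.prems d 1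
    by (auto simp: code_at_append)
  show ?case using reaches_trans[OF 1(1) 2(1)] 1 2 by (intro exI[of _ tp2]) (auto simp: add_ac)
next
  case (IfTop r k c1 c2)
  have d: "l + loop_depth c1 \<le> L" "l + loop_depth c2 \<le> L"
    using IfTop.prems(2) by (auto simp: max_def split: if_splits)
  let ?e = "p + code_size c1 + code_size c2 + 2"
  have c: "code ! p = on_tape (2 + r)
       (\<lambda>s. if s = Suc k then Suc p else p + code_size c1 + 2) (\<lambda>s. (s, Stay))"
    "code_at code (Suc p) (compile N c1 l (Suc p))"
    "code ! (p + code_size c1 + 1) = on_tape 0 (\<lambda>_. ?e) (\<lambda>s. (s, Stay))"
    "code_at code (p + code_size c1 + 2) (compile N c2 l (p + code_size c1 + 2))"
    using IfTop.prems by (auto simp: code_at_Cons code_at_append)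
  have st: "act_tape (read_tape y, Stay) y = y" for y by (cases y) auto
  have s0: "fstep code (p, tp) =
      (if read_tape (tp (2 + r)) = Suc k then Suc p else p + code_size c1 + 2, tp)"
    using IfTop.prems by (subst fstep_on_tape[OF c(1)]) (auto simp: st)
  have rd: "read_tape (tp (2 + r)) = (if fst s r = [] then 0 else Suc (hd (fst s r)))"
    using IfTop.prems by (intro read_tape_stack) (auto simp: represents_def)
  show ?case
  proof (cases "fst s r \<noteq> [] \<and> hd (fst s r) = k")
    case True
    hence s1: "fstep code (p, tp) = (Suc p, tp)" using rd s0 by auto
    obtain tp1 where 1: "reaches code (poly (cost c1) (length x)) (Suc p, tp)
        (Suc p + code_size c1, tp1)"
      "represents N L x l (sem x c1 s) tp1" "\<forall>i\<ge>2 + N. tp1 i = tp i"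
      using IfTop.IH(1)[of l "Suc p" s tp] IfTop.prems c d by auto
    have "fstep code (Suc p + code_size c1, tp1) = (?e, tp1)"
      using fstep_on_tape[of code "Suc p + code_size c1"] c(3) IfTop.prems(3) by (auto simp: st)
    hence "reaches code 1 (Suc p + code_size c1, tp1) (?e, tp1)" by (rule reaches_one)
    from reaches_step[OF s1 reaches_trans[OF 1(1) this]] show ?thesis
      using 1 True by (intro exI[of _ tp1]) (auto simp: add_ac elim!: reaches_mono)
  next
    case False
    hence s1: "fstep code (p, tp) = (p + code_size c1 + 2, tp)" using rd s0 by auto
    obtain tp1 where 1: "reaches code (poly (cost c2) (length x)) (p + code_size c1 + 2, tp)
        (p + code_size c1 + 2 + code_size c2, tp1)"
      "represents N L x l (sem x c2 s) tp1" "\<forall>i\<ge>2 + N. tp1 i = tp i"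
      using IfTop.IH(2)[of l "p + code_size c1 + 2" s tp] IfTop.prems c d by auto
    from reaches_step[OF s1 1(1)] show ?thesis
      using 1 False by (intro exI[of _ tp1]) (auto simp: add_ac elim!: reaches_mono)
  qed
next
  case (For c0 c1)
  have d: "Suc l + loop_depth c0 \<le> L" "Suc l + loop_depth c1 \<le> L"
    using For.prems(2) by (auto simp: max_def split: if_splits)
  let ?t = "2 + N + l"
  let ?a = "p + code_size c0 + code_size c1"
  let ?body = "\<lambda>s b. if b then sem x c1 s else sem x c0 s"
  let ?T = "poly (cost c0) (length x) + poly (cost c1) (length x) + 2"
  have c: "code ! p = on_tape ?t
       (\<lambda>s. if s = 0 then ?a + 3 else if s = 1 then Suc p else p + code_size c0 + 2)
       (\<lambda>s. (s, Stay))"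
    "code_at code (Suc p) (compile N c0 (Suc l) (Suc p))"
    "code ! (Suc p + code_size c0) = on_tape ?t (\<lambda>_. p) (\<lambda>s. (s, Move_Right))"
    "code_at code (p + code_size c0 + 2) (compile N c1 (Suc l) (p + code_size c0 + 2))"
    "code ! (p + code_size c0 + 2 + code_size c1) = on_tape ?t (\<lambda>_. p) (\<lambda>s. (s, Move_Right))"
    "code ! (?a + 3) = on_tape ?t (\<lambda>_. ?a + 4) (\<lambda>s. (s, Move_Left))"
    "code ! (?a + 4) = on_tape ?t (\<lambda>s. if s = 0 then ?a + 5 else ?a + 4)
        (\<lambda>s. (s, if s = 0 then Move_Right else Move_Left))"
    using For.prems by (auto simp: code_at_Cons code_at_append if_distrib numeral_eq_Suc)
  have st: "act_tape (read_tape y, Stay) y = y" for y by (cases y) auto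
  have s0: "fstep code (p, tp) = (if read_tape (tp ?t) = 0 then ?a + 3
      else if read_tape (tp ?t) = 1 then Suc p else p + code_size c0 + 2, tp)" for tp
    using For.prems by (subst fstep_on_tape[OF c(1)]) (auto simp: st)
  have iter: "\<exists>tp'. reaches code (k * ?T) (p, tp) (p, tp') \<and> tp' ?t = (word_cells x, int k) \<and>
      represents N L x (Suc l) (foldl ?body s (take k x)) tp' \<and>
      (\<forall>i\<ge>2 + N. i \<noteq> ?t --> tp' i = tp i)" if "k \<le> length x" for k using that
  proof (induction k)
    case 0
    thus ?case using For.prems by (intro exI[of _ tp]) (auto simp: reaches_refl represents_def)
  next
    case (Suc k)
    let ?s = "foldl ?body s (take k x)"
    obtain tp1 where 1: "reaches code (k * ?T) (p, tp) (p, tp1)" "tp1 ?t = (word_cells x, int k)"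
      "represents N L x (Suc l) ?s tp1" "\<forall>i\<ge>2 + N. i \<noteq> ?t --> tp1 i = tp i"
      using Suc by auto
    have rd: "read_tape (tp1 ?t) = (if x ! k then 2 else 1)"
      using 1(2) Suc.prems by (auto simp: word_cells_def)
    let ?c = "if x ! k then c1 else c0" and ?q = "if x ! k then p + code_size c0 + 2 else Suc p"
    obtain tp2 where 2: "reaches code (poly (cost ?c) (length x)) (?q, tp1) (?q + code_size ?c, tp2)"
      "represents N L x (Suc l) (?body ?s (x ! k)) tp2" "\<forall>i\<ge>2 + N. tp2 i = tp1 i"
      using For.IH(1)[of "Suc l" "Suc p" ?s tp1] For.IH(2)[of "Suc l" "p + code_size c0 + 2" ?s tp1]
        For.prems c d 1 by (cases "x ! k") (auto simp: represents_def)
    let ?tp = "tp2(?t := (word_cells x, int (Suc k)))"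
    have "code ! (?q + code_size ?c) = on_tape ?t (\<lambda>_. p) (\<lambda>s. (s, Move_Right))" "?q + code_size ?c > 1"
      using c For.prems(3) by auto
    from fstep_on_tape[OF this, of tp2] have "fstep code (?q + code_size ?c, tp2) = (p, ?tp)"
      using 1 2 by auto
    hence 3: "reaches code 1 (?q + code_size ?c, tp2) (p, ?tp)" by (rule reaches_one)
    have "fstep code (p, tp1) = (?q, tp1)" using rd s0 by simp
    from reaches_trans[OF 1(1) reaches_step[OF this reaches_trans[OF 2(1) 3]]]
    have "reaches code (Suc k * ?T) (p, tp) (p, ?tp)" by (auto elim!: reaches_mono)
    moreover have "foldl ?body s (take (Suc k) x) = ?body ?s (x ! k)"
      using Suc.prems by (simp add: take_Suc_conv_app_nth)
    ultimately have "represents N L x (Suc l) (foldl ?body s (take (Suc k) x)) ?tp"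
      using 2(2) unfolding represents_def by auto
    moreover note `reaches code (Suc k * ?T) _ _`
    moreover have "?tp ?t = (word_cells x, int (Suc k))" "\<forall>i\<ge>2 + N. i \<noteq> ?t --> ?tp i = tp i"
      using 1 2 by auto
    ultimately show ?case by blast
  qed
  let ?n = "length x"
  obtain tp1 where 1: "reaches code (?n * ?T) (p, tp) (p, tp1)" "tp1 ?t = (word_cells x, int ?n)"
    "represents N L x (Suc l) (foldl ?body s x) tp1" "\<forall>i\<ge>2 + N. i \<noteq> ?t --> tp1 i = tp i"
    using iter[of ?n] by auto
  have rd: "read_tape (tp1 ?t) = 0" using 1(2) by (auto simp: word_cells_def)
  have s1: "fstep code (p, tp1) = (?a + 3, tp1)" using rd s0 by simp
  have s2: "fstep code (?a + 3, tp1) = (?a + 4, tp1(?t := (word_cells x, int ?n - 1)))"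
    using 1(2) by (subst fstep_on_tape[OF c(6)]) auto
  have s3: "reaches code (Suc ?n) (?a + 4, tp1(?t := (word_cells x, int ?n - 1)))
      (?a + 5, (tp1(?t := (word_cells x, int ?n - 1)))(?t := (word_cells x, 0)))"
    by (rule rewind[OF c(7)]) auto
  have "reaches code (?n * ?T + Suc (Suc (Suc ?n))) (p, tp) (?a + 5, tp1(?t := (word_cells x, 0)))"
    using reaches_trans[OF 1(1) reaches_step[OF s1 reaches_step[OF s2 s3]]] by simp
  moreover have "represents N L x l (sem x (For c0 c1) s) (tp1(?t := (word_cells x, 0)))"
    using 1(3) by (auto simp: represents_def)
  moreover have "\<forall>i\<ge>2 + N. (tp1(?t := (word_cells x, 0))) i = tp i"
    using 1(4) For.prems by (auto simp: represents_def)
  moreover have "poly (cost (For c0 c1)) ?n = ?n * ?T + Suc (Suc (Suc ?n))"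
    "p + code_size (For c0 c1) = ?a + 5" by (simp_all add: algebra_simps)
  ultimately show ?case by (simp only:) blast
qed

definition machine_code :: "nat => com => instr list" where
  "machine_code N c =
     [(0, \<lambda>s. if s = 0 then 2 else 0,
        \<lambda>s i s'. if i = 0 \<or> 2 + N \<le> i then (s, if s = 0 then Move_Left else Move_Right)
                 else (s', Stay)),
      on_tape 0 (\<lambda>_. 0) (\<lambda>s. (s, Stay)),
      (0, \<lambda>s. if s = 0 then 3 else 2,
        \<lambda>s i s'. if i = 0 \<or> 2 + N \<le> i then (s', if s = 0 then Move_Right else Move_Left)
                 else (s', Stay))] @
     compile N c 0 3 @ [on_tape 0 (\<lambda>_. 1) (\<lambda>s. (s, Stay))]"

definition machine :: "nat => com => tm" where
  "machine N c = (let K = 2 + N + loop_depth c in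
     \<lparr>num_tapes = K, num_symbols = N, num_states = length (machine_code N c),
      delta = \<lambda>q ss. case machine_code N c ! q of (t, nx, act) =>
        (nx (ss ! t), map (\<lambda>i. act (ss ! t) i (ss ! i)) [0..<K])\<rparr>)"

lemma machine_code_ok:
  assumes "fits N c" "N \<ge> 3" "I \<in> set (machine_code N c)"
  shows "instr_ok (length (machine_code N c)) N (2 + N + loop_depth c) I"
proof -
  have "I \<in> set (compile N c 0 3) ==> ?thesis"
    by (rule compile_ok[OF assms(1,2), of 0 _ 3]) (auto simp: machine_code_def)
  thus ?thesis using assms by (auto simp: machine_code_def instr_ok_def on_tape_def)
qed

lemma wf_machine:
  assumes "fits N c" "N \<ge> 3"
  shows "wf_tm (machine N c)"
proof -
  let ?K = "2 + N + loop_depth c"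
  let ?M = "machine N c"
  have "case delta ?M q ss of (q', acts) =>
      q' < num_states ?M \<and> length acts = num_tapes ?M \<and> fst ` set acts \<subseteq> {..<num_symbols ?M}"
    if "q < num_states ?M" "length ss = num_tapes ?M" "set ss \<subseteq> {..<num_symbols ?M}" for q ss
  proof -
    obtain t nx act where I: "machine_code N c ! q = (t, nx, act)"
      by (cases "machine_code N c ! q") auto
    have "q < length (machine_code N c)" using that by (simp add: machine_def Let_def)
    hence "instr_ok (length (machine_code N c)) N ?K (t, nx, act)"
      using machine_code_ok[OF assms] I by (metis nth_mem)
    moreover have "ss ! i < N" if "i < ?K" for i
    proof -
      have "ss ! i \<in> set ss" using that `length ss = _` by (simp add: machine_def Let_def)
      thus ?thesis using `set ss \<subseteq> _` by (auto simp: machine_def Let_def)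
    qed
    ultimately show ?thesis using I by (auto simp: machine_def Let_def instr_ok_def)
  qed
  thus ?thesis using assms by (auto simp: wf_tm_def machine_def Let_def machine_code_def)
qed

lemma tm_step_machine:
  assumes "fits N c" "N \<ge> 3" "q < length (machine_code N c)"
  shows "tm_step (machine N c) (q, map tp [0..<2 + N + loop_depth c]) =
      (case fstep (machine_code N c) (q, tp) of (q', tp') =>
        (q', map tp' [0..<2 + N + loop_depth c]))"
    and "fst (fstep (machine_code N c) (q, tp)) < length (machine_code N c)"
proof -
  obtain t nx act where I: "machine_code N c ! q = (t, nx, act)"
    by (cases "machine_code N c ! q") auto
  have ok: "instr_ok (length (machine_code N c)) N (2 + N + loop_depth c) (t, nx, act)"
    using machine_code_ok[OF assms(1,2)] I assms(3) by (metis nth_mem)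
  hence t: "t < 2 + N + loop_depth c" by (auto simp: instr_ok_def)
  show "tm_step (machine N c) (q, map tp [0..<2 + N + loop_depth c]) =
      (case fstep (machine_code N c) (q, tp) of (q', tp') =>
        (q', map tp' [0..<2 + N + loop_depth c]))"
    using t I by (auto simp: machine_def Let_def fstep_def intro!: nth_equalityI
        simp del: upt_Suc upt.simps)
  show "fst (fstep (machine_code N c) (q, tp)) < length (machine_code N c)"
    using ok I assms(3) by (auto simp: fstep_def instr_ok_def)
qed

lemma funpow_machine:
  assumes "fits N c" "N \<ge> 3" "q < length (machine_code N c)"
  shows "(tm_step (machine N c) ^^ k) (q, map tp [0..<2 + N + loop_depth c]) =
      (case (fstep (machine_code N c) ^^ k) (q, tp) of (q', tp') =>
        (q', map tp' [0..<2 + N + loop_depth c])) \<and>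
     fst ((fstep (machine_code N c) ^^ k) (q, tp)) < length (machine_code N c)"
proof (induction k)
  case 0
  thus ?case using assms by auto
next
  case (Suc k)
  obtain q' tp' where e: "(fstep (machine_code N c) ^^ k) (q, tp) = (q', tp')"
    by (cases "(fstep (machine_code N c) ^^ k) (q, tp)") auto
  with Suc have "q' < length (machine_code N c)" by auto
  from tm_step_machine[OF assms(1,2) this, of tp'] show ?case using Suc e by simp
qed

lemma setup_copy:
  assumes "code = machine_code N c" "k \<le> length x"
  shows "reaches code k (0, \<lambda>i. if i = 0 then (word_cells x, 0) else (word_cells [], 0))
    (0, \<lambda>i. if i = 0 then (word_cells x, int k)
            else if 2 + N \<le> i then (word_cells (take k x), int k) else (word_cells [], 0))"
  using assms(2)
proof (induction k)
  case 0
  have "(\<lambda>i. if i = 0 then (word_cells x, int 0)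
            else if 2 + N \<le> i then (word_cells (take 0 x), int 0) else (word_cells [], 0)) =
     (\<lambda>i. if i = 0 then (word_cells x, 0) else (word_cells [], 0))" by auto
  thus ?case by (metis reaches_refl)
next
  case (Suc k)
  have 0: "code ! 0 = (0, \<lambda>s. if s = 0 then 2 else 0,
        \<lambda>s i s'. if i = 0 \<or> 2 + N \<le> i then (s, if s = 0 then Move_Left else Move_Right)
                 else (s', Stay))" using assms(1) by (simp add: machine_code_def)
  have w: "(word_cells (take k x))(int k := if x ! k then 2 else 1) = word_cells (take (Suc k) x)"
    using word_cells_snoc[of "take k x" "x ! k"] Suc.prems by (simp add: take_Suc_conv_app_nth)
  have w': "(word_cells x)(int k := if x ! k then 2 else 1) = word_cells x"
    using Suc.prems by (auto simp: fun_eq_iff word_cells_def)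
  have "fstep code (0, \<lambda>i. if i = 0 then (word_cells x, int k)
            else if 2 + N \<le> i then (word_cells (take k x), int k) else (word_cells [], 0)) =
     (0, \<lambda>i. if i = 0 then (word_cells x, int (Suc k))
            else if 2 + N \<le> i then (word_cells (take (Suc k) x), int (Suc k))
            else (word_cells [], 0))" using Suc.prems w w'
    by (auto simp: fstep_def 0 fun_eq_iff word_cells_simps word_cells_upd simp del: fun_upd_apply)
  from reaches_trans[OF Suc.IH reaches_step[OF this reaches_refl, of 0]] show ?case
    using Suc.prems by simp
qed

lemma setup_rewind:
  assumes "code = machine_code N c" "k \<le> length x"
  shows "reaches code (Suc k) (2, \<lambda>i. if i = 0 \<or> 2 + N \<le> i then (word_cells x, int k - 1)
       else (word_cells [], 0))
    (3, \<lambda>i. if i = 0 \<or> 2 + N \<le> i then (word_cells x, 0) else (word_cells [], 0))"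
  using assms(2)
proof (induction k)
  have 2: "code ! 2 = (0, \<lambda>s. if s = 0 then 3 else 2,
        \<lambda>s i s'. if i = 0 \<or> 2 + N \<le> i then (s', if s = 0 then Move_Right else Move_Left)
                 else (s', Stay))" using assms(1) by (simp add: machine_code_def)
  have w': "(word_cells y)(j := word_cells y j) = word_cells y" for y j by auto
  {
    case 0
    have "word_cells y (int 0 - 1) = 0" for y by (simp add: word_cells_def)
    hence "fstep code (2, \<lambda>i. if i = 0 \<or> 2 + N \<le> i then (word_cells x, int 0 - 1)
         else (word_cells [], 0)) =
       (3, \<lambda>i. if i = 0 \<or> 2 + N \<le> i then (word_cells x, 0) else (word_cells [], 0))"
      by (auto simp: fstep_def 2 fun_eq_iff word_cells_simps word_cells_upd simp del: fun_upd_apply)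
    from reaches_step[OF this reaches_refl] show ?case .
  next
    case (Suc k)
    have "fstep code (2, \<lambda>i. if i = 0 \<or> 2 + N \<le> i then (word_cells x, int (Suc k) - 1)
         else (word_cells [], 0)) =
       (2, \<lambda>i. if i = 0 \<or> 2 + N \<le> i then (word_cells x, int k - 1) else (word_cells [], 0))"
      using Suc.prems
      by (auto simp: fstep_def 2 fun_eq_iff word_cells_simps word_cells_upd simp del: fun_upd_apply)
    from reaches_step[OF this Suc.IH] show ?case using Suc.prems by auto
  }
qed

theorem poly_time_loop_program: "poly_time (\<lambda>x. snd (sem x c ((\<lambda>_. []), [])))"
proof -
  obtain N where N: "N \<ge> 3" "fits N c" using ex_fits by blast
  define code where "code = machine_code N c"
  define K where "K = 2 + N + loop_depth c"
  define p :: "nat poly" where "p = [:0, 1:] + 1 + [:1, 1:] + cost c + 1"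
  have "tm_outputs_within (machine N c) x (snd (sem x c ((\<lambda>_. []), []))) (poly p (length x))" for x
  proof -
    let ?n = "length x"
    let ?t0 = "\<lambda>i. if i = 0 then (word_cells x, 0) else (word_cells [], 0)"
    let ?t1 = "\<lambda>i. if i = 0 then (word_cells x, int ?n)
            else if 2 + N \<le> i then (word_cells (take ?n x), int ?n) else (word_cells [], 0)"
    let ?t2 = "\<lambda>i. if i = 0 \<or> 2 + N \<le> i then (word_cells x, int ?n - 1) else (word_cells [], 0)"
    let ?t3 = "\<lambda>i. if i = 0 \<or> 2 + N \<le> i then (word_cells x, 0) else (word_cells [], 0)"
    have 0: "code ! 0 = (0, \<lambda>s. if s = 0 then 2 else 0,
        \<lambda>s i s'. if i = 0 \<or> 2 + N \<le> i then (s, if s = 0 then Move_Left else Move_Right)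
                 else (s', Stay))" by (simp add: code_def machine_code_def)
    have "(word_cells x)(int ?n := 0) = word_cells x" by (auto simp: word_cells_def)
    hence "fstep code (0, ?t1) = (2, ?t2)"
      by (auto simp: fstep_def 0 fun_eq_iff word_cells_simps word_cells_upd simp del: fun_upd_apply)
    hence r1: "reaches code (Suc (Suc ?n)) (2 - 2, ?t1) (3, ?t3)"
      using reaches_step[OF _ setup_rewind[OF code_def, of ?n x]] by simp
    have r2: "reaches code (?n + Suc (Suc ?n)) (0, ?t0) (3, ?t3)"
      using reaches_trans[OF setup_copy[OF code_def, of ?n x] r1[simplified]] by simp
    have "code_at code (0 + length (take 3 code)) (compile N c 0 3 @
         [on_tape 0 (\<lambda>_. 1) (\<lambda>s. (s, Stay))])"
    proof -
      have "code_at code 0 code" by (auto simp: code_at_def)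
      hence "code_at code 0 (take 3 code @ (compile N c 0 3 @
         [on_tape 0 (\<lambda>_. 1) (\<lambda>s. (s, Stay))]))"
        by (simp add: code_def machine_code_def)
      thus ?thesis unfolding code_at_append[of _ 0] by blast
    qed
    moreover have "length (take 3 code) = 3" by (simp add: code_def machine_code_def)
    ultimately have c: "code_at code 3 (compile N c 0 3)"
      "code ! (3 + code_size c) = on_tape 0 (\<lambda>_. 1) (\<lambda>s. (s, Stay))"
      by (auto simp: code_at_append code_at_Cons)
    have "represents N (loop_depth c) x 0 ((\<lambda>_. []), []) ?t3"
      by (auto simp: represents_def word_cells_def)
    from compile_correct[OF N(2) _ _ c(1) this] obtain tp where
      tp: "reaches code (poly (cost c) ?n) (3, ?t3) (3 + code_size c, tp)"
        "represents N (loop_depth c) x 0 (sem x c ((\<lambda>_. []), [])) tp" by auto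
    have "fstep code (3 + code_size c, tp) = (1, tp(0 := act_tape (read_tape (tp 0), Stay) (tp 0)))"
      by (subst fstep_on_tape[OF c(2)]) auto
    from reaches_trans[OF reaches_trans[OF r2 tp(1)] reaches_step[OF this reaches_refl, of 0]]
    obtain k tp' where k: "k \<le> poly p ?n" "(fstep code ^^ k) (0, ?t0) = (1, tp')" "tp' 1 = tp 1"
      by (auto simp: reaches_def p_def)
    have "(fstep code ^^ (poly p ?n - k)) (1, tp') = (1, tp')"
    proof -
      have "(fstep code ^^ j) (1, tp') = (1, tp')" for j by (induction j) (auto simp: fstep_def)
      thus ?thesis .
    qed
    hence fin: "(fstep code ^^ poly p ?n) (0, ?t0) = (1, tp')"
      using k funpow_add[of "poly p ?n - k" k "fstep code"] by simp
    have "tm_init (machine N c) x = (0, map ?t0 [0..<K])"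
      by (auto simp: tm_init_def machine_def Let_def K_def intro!: nth_equalityI
          simp: nth_Cons' simp del: upt_Suc upt.simps)
    hence "(tm_step (machine N c) ^^ poly p ?n) (tm_init (machine N c) x) =
        (1, map tp' [0..<K])" using funpow_machine[OF N(2,1), of 0 "poly p ?n" ?t0] fin
      by (simp add: K_def code_def machine_code_def del: upt_Suc upt.simps)
    thus ?thesis using tp(2) k(3)
      by (simp add: tm_outputs_within_def represents_def K_def del: upt_Suc upt.simps)
  qed
  thus ?thesis unfolding poly_time_def using wf_machine[OF N(2,1)] by blast
qed

section \<open>Scanning programs\<close>

primrec emits :: "bool list => com" where
  "emits [] = Skip"
| "emits (b # bs) = Emit b ;; emits bs"

lemma sem_emits [simp]: "sem x (emits bs) s = (fst s, snd s @ bs)"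
  by (induction bs arbitrary: s) auto

primrec switch :: "nat => nat => (nat => com) => com" where
  "switch r 0 f = Skip"
| "switch r (Suc m) f = IfTop r m (f m) (switch r m f)"

lemma sem_switch: "fst s r = [q] ==> q < m ==> sem x (switch r m f) s = sem x (f q) s"
  by (induction m) (auto simp: less_Suc_eq)

definition set_reg :: "nat => nat => com" where
  "set_reg r k = Pop r ;; Push r k"

lemma sem_set_reg: "length (fst s r) \<le> 1 ==> sem x (set_reg r k) s = ((fst s)(r := [k]), snd s)"
  by (cases "fst s r") (auto simp: set_reg_def)

lemma For_invariant:
  assumes "I [] s"
    and "\<And>ys b zs s. x = ys @ b # zs ==> I ys s ==> I (ys @ [b]) (sem x (if b then c1 else c0) s)"
  shows "I x (sem x (For c0 c1) s)"
proof -
  have "I (take k x) (foldl (\<lambda>s b. if b then sem x c1 s else sem x c0 s) s (take k x))"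
    if "k \<le> length x" for k using that
  proof (induction k)
    case 0
    thus ?case using assms(1) by simp
  next
    case (Suc k)
    thus ?case using assms(2)[of "take k x" "x ! k" "drop (Suc k) x"
          "foldl (\<lambda>s b. if b then sem x c1 s else sem x c0 s) s (take k x)"]
      by (auto simp: take_Suc_conv_app_nth Cons_nth_drop_Suc split: if_splits)
  qed
  from this[of "length x"] show ?thesis by simp
qed

definition auto_loop ::
  "nat => nat => (nat => bool => nat) => (nat => bool => com) => com" where
  "auto_loop r m d h =
     set_reg r 0 ;; For (switch r m (\<lambda>q. set_reg r (d q False) ;; h q False))
                       (switch r m (\<lambda>q. set_reg r (d q True) ;; h q True))"

lemma auto_loop_invariant:
  assumes closed: "\<And>q b. q < m ==> d q b < m" "0 < m"
    and init: "length (fst s r) \<le> 1" "I [] ((fst s)(r := [0]), snd s)"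
    and step: "\<And>ys b zs s q. x = ys @ b # zs ==> I ys s ==> q = foldl d 0 ys ==> fst s r = [q] ==>
      I (ys @ [b]) (sem x (h q b) ((fst s)(r := [d q b]), snd s)) \<and>
      fst (sem x (h q b) ((fst s)(r := [d q b]), snd s)) r = [d q b]"
  shows "I x (sem x (auto_loop r m d h) s)"
    and "fst (sem x (auto_loop r m d h) s) r = [foldl d 0 x]"
proof -
  have lt: "foldl d 0 ys < m" for ys by (induction ys rule: rev_induct) (auto simp: closed)
  let ?J = "\<lambda>ys s. I ys s \<and> fst s r = [foldl d 0 ys]"
  have "?J x (sem x (auto_loop r m d h) s)" unfolding auto_loop_def sem.simps(5)
  proof (rule For_invariant[where I = ?J])
    show "?J [] (sem x (set_reg r 0) s)" using init by (simp add: sem_set_reg)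
  next
    fix ys b zs s
    assume "x = ys @ b # zs" "?J ys s"
    thus "?J (ys @ [b]) (sem x (if b then switch r m (\<lambda>q. set_reg r (d q True) ;; h q True)
       else switch r m (\<lambda>q. set_reg r (d q False) ;; h q False)) s)"
      using step[of ys b zs s "foldl d 0 ys"] lt[of ys]
      by (cases b) (auto simp: sem_switch sem_set_reg)
  qed
  thus "I x (sem x (auto_loop r m d h) s)"
    "fst (sem x (auto_loop r m d h) s) r = [foldl d 0 x]" by auto
qed

abbreviation repeat :: "com => com" where
  "repeat c \<equiv> For c c"

lemma sem_repeat: "sem x (repeat c) s = (sem x c ^^ length x) s"
proof -
  have "foldl (\<lambda>s b. if b then f s else f s) s x = (f ^^ length x) s" for f :: "store => store"
    by (induction x arbitrary: s) (auto simp: funpow_swap1)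
  thus ?thesis by simp
qed

definition clear :: "nat => com" where
  "clear r = repeat (Pop r)"

lemma sem_clear:
  assumes "length (fst s r) \<le> length x"
  shows "sem x (clear r) s = ((fst s)(r := []), snd s)"
proof -
  have "(sem x (Pop r) ^^ n) s = ((fst s)(r := drop n (fst s r)), snd s)" for n
    by (induction n) (auto simp: drop_Suc tl_drop)
  thus ?thesis unfolding clear_def sem_repeat using assms by simp
qed

definition move_out :: "nat => nat => (nat => bool list) => com" where
  "move_out r r' w = repeat (IfTop r 0 (Pop r ;; Push r' 0 ;; emits (w 0))
     (IfTop r 1 (Pop r ;; Push r' 1 ;; emits (w 1)) Skip))"

lemma sem_move_out:
  assumes "r \<noteq> r'" "fst s r = xs" "set xs \<subseteq> {0, 1}" "length xs \<le> length x"
  shows "sem x (move_out r r' w) s =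
    ((fst s)(r := [], r' := rev xs @ fst s r'), snd s @ concat (map w xs))"
proof -
  let ?c = "IfTop r 0 (Pop r ;; Push r' 0 ;; emits (w 0))
     (IfTop r 1 (Pop r ;; Push r' 1 ;; emits (w 1)) Skip)"
  have "(sem x ?c ^^ n) s =
      ((fst s)(r := drop n xs, r' := rev (take n xs) @ fst s r'), snd s @ concat (map w (take n xs)))"
    for n
  proof (induction n)
    case 0
    thus ?case using assms by (auto simp: fun_eq_iff prod_eq_iff)
  next
    case (Suc n)
    show ?case
    proof (cases "n < length xs")
      case True
      hence dr: "drop n xs = xs ! n # drop (Suc n) xs" "xs ! n \<in> {0, 1}"
        using assms(3) nth_mem[OF True] Cons_nth_drop_Suc[OF True] by (metis, blast)
      thus ?thesis using assms(1) Suc True by (auto simp: take_Suc_conv_app_nth fun_eq_iff)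
    next
      case False
      thus ?thesis using assms(1) Suc by auto
    qed
  qed
  from this[of "length x"] show ?thesis unfolding move_out_def sem_repeat using assms by simp
qed

definition emit_reg :: "nat => nat => (nat => bool list) => com" where
  "emit_reg r r' w = move_out r r' (\<lambda>_. []) ;; move_out r' r w"

lemma sem_emit_reg:
  assumes "r \<noteq> r'" "fst s r = xs" "set xs \<subseteq> {0, 1}" "length xs \<le> length x" "fst s r' = []"
  shows "sem x (emit_reg r r' w) s = (fst s, snd s @ concat (map w (rev xs)))"
  using assms unfolding emit_reg_def
  by (auto simp: sem_move_out[where xs = xs] sem_move_out[where xs = "rev xs"] fun_eq_iff)

definition sym_of :: "bool => nat" where
  "sym_of b = (if b then 1 else 0)"

lemma concat_bits [simp]: "concat (map (\<lambda>k. [k = 1]) (map sym_of bs)) = bs"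
  by (induction bs) (auto simp: sym_of_def)

lemma set_bits [simp]: "set (map sym_of bs) \<subseteq> {0, 1}" by (auto simp: sym_of_def)

datatype piece = Const "bool list" | Hole nat

primrec fill :: "(nat => bool list) => piece => bool list" where
  "fill v (Const bs) = bs"
| "fill v (Hole r) = v r"

definition fills :: "(nat => bool list) => piece list => bool list" where
  "fills v ps = concat (map (fill v) ps)"

text \<open>Holes name the stacks with the strings to be inserted; stack 5 is used as scratch space.\<close>

primrec emit_pieces :: "(nat => bool list) => piece list => com" where
  "emit_pieces w [] = Skip"
| "emit_pieces w (p # ps) =
     (case p of Const bs => emits bs | Hole r => emit_reg r 5 w) ;; emit_pieces w ps"

lemma sem_emit_pieces:
  assumes "fst s 5 = []"
    and "\<And>r. Hole r \<in> set ps ==> r \<noteq> 5 \<and> set (fst s r) \<subseteq> {0, 1} \<and> length (fst s r) \<le> length x"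
  shows "sem x (emit_pieces w ps) s =
    (fst s, snd s @ fills (\<lambda>r. concat (map w (rev (fst s r)))) ps)" using assms
proof (induction ps arbitrary: s)
  case Nil
  thus ?case by (simp add: fills_def)
next
  case (Cons p ps)
  show ?case
  proof (cases p)
    case (Const bs)
    thus ?thesis using Cons.IH[of "(fst s, snd s @ bs)"] Cons.prems by (auto simp: fills_def)
  next
    case (Hole r)
    have "sem x (emit_reg r 5 w) s = (fst s, snd s @ concat (map w (rev (fst s r))))"
      using Cons.prems(1) Cons.prems(2)[of r] Hole by (intro sem_emit_reg) auto
    thus ?thesis using Hole Cons.IH[of "(fst s, snd s @ concat (map w (rev (fst s r))))"] Cons.prems
      by (auto simp: fills_def)
  qed
qed

subsection \<open>Acceptance with a counter\<close>

definition count_step :: "(nat => bool => nat) => (nat => bool => int) => nat =>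
    nat \<times> nat => bool => nat \<times> nat" where
  "count_step d ca err = (\<lambda>(q, c) b. if c = 0 then (err, 0) else (d q b, nat (int c + ca q b)))"

definition accepted :: "(nat => bool => nat) => (nat => bool => int) => nat => bool list => bool" where
  "accepted d ca err x \<longleftrightarrow> foldl (count_step d ca err) (0, 1) x = (0, 0)"

definition count_loop :: "nat => (nat => bool => nat) => (nat => bool => int) => nat => com" where
  "count_loop m d ca err =
     (let h = (\<lambda>b. IfTop 1 0 (switch 0 m (\<lambda>q. set_reg 0 (d q b) ;;
        (if ca q b = 1 then Push 1 0 else if ca q b = - 1 then Pop 1 else Skip))) (set_reg 0 err))
      in Push 0 0 ;; Push 1 0 ;; For (h False) (h True))"

lemma sem_count_loop:
  assumes closed: "\<And>q b. q < m ==> d q b < m" "0 < m" "err < m"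
    and ca: "\<And>q b. ca q b \<in> {-1, 0, 1}"
    and s: "fst s = (\<lambda>_. [])"
  shows "\<exists>q c. foldl (count_step d ca err) (0, 1) x = (q, c) \<and>
    sem x (count_loop m d ca err) s = ((\<lambda>_. [])(0 := [q], 1 := replicate c 0), snd s)"
proof -
  have lt: "fst (foldl (count_step d ca err) (0, 1) ys) < m" for ys
    by (induction ys rule: rev_induct)
       (auto simp: closed count_step_def split: prod.splits)
  define I :: "bool list => store => bool" where "I ys t \<longleftrightarrow> (case foldl (count_step d ca err) (0, 1) ys of (q, c) =>
     t = ((\<lambda>_. [])(0 := [q], 1 := replicate c 0), snd s))" for ys t
  define h where "h b = IfTop 1 0 (switch 0 m (\<lambda>q. set_reg 0 (d q b) ;;
        (if ca q b = 1 then Push 1 0 else if ca q b = - 1 then Pop 1 else Skip))) (set_reg 0 err)"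
    for b
  have "I x (sem x (For (h False) (h True)) (sem x (Push 0 0 ;; Push 1 0) s))"
  proof (rule For_invariant)
    show "I [] (sem x (Push 0 0 ;; Push 1 0) s)" using s by (auto simp: I_def fun_eq_iff)
  next
    fix ys b zs t
    assume "I ys t"
    obtain q c where qc: "foldl (count_step d ca err) (0, 1) ys = (q, c)" by fastforce
    hence t: "t = ((\<lambda>_. [])(0 := [q], 1 := replicate c 0), snd s)" and q: "q < m"
      using `I ys t` lt[of ys] by (auto simp: I_def)
    have "I (ys @ [b]) (sem x (h b) t)"
    proof (cases c)
      case 0
      thus ?thesis using qc t by (auto simp: I_def h_def count_step_def sem_set_reg fun_eq_iff)
    next
      case (Suc c')
      have *: "nat (2 + int c') = Suc (Suc c')" "nat (1 + int c') = Suc c'" by auto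
      consider "ca q b = - 1" | "ca q b = 0" | "ca q b = 1" using ca[of q b] by blast
      thus ?thesis using qc t q Suc unfolding I_def
        by cases (auto simp: h_def count_step_def sem_switch sem_set_reg fun_eq_iff *)
    qed
    thus "I (ys @ [b]) (sem x (if b then h True else h False) t)" by (cases b) auto
  qed
  thus ?thesis by (auto simp: I_def count_loop_def Let_def h_def split: prod.splits)
qed

subsection \<open>Pairs of occurrences\<close>

text \<open>
  An occurrence is collected from the bits read in transitions marked by \<open>st\<close> and is
  completed by a transition marked by \<open>fin\<close>.
\<close>

definition occ_step :: "(nat => bool => nat) => (nat => bool => bool) => (nat => bool => bool) =>
    nat \<times> bool list \<times> bool list list => bool => nat \<times> bool list \<times> bool list list" where
  "occ_step d st fin = (\<lambda>(q, a, os) b.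
     let a' = (if st q b then a @ [b] else a)
     in if fin q b then (d q b, [], os @ [a']) else (d q b, a', os))"

definition occ_scan where
  "occ_scan d st fin = foldl (occ_step d st fin) (0, [], [])"

definition occs where
  "occs d st fin x = snd (snd (occ_scan d st fin x))"

lemma fst_occ_scan: "fst (occ_scan d st fin ys) = foldl d 0 ys" by (induction ys rule: rev_induct)
     (auto simp: occ_scan_def occ_step_def Let_def split: prod.splits)

lemma length_occ_scan: "length (fst (snd (occ_scan d st fin ys))) \<le> length ys"
  by (induction ys rule: rev_induct)
     (auto simp: occ_scan_def occ_step_def Let_def split: prod.splits)

lemma occ_scan_snoc:
  "occ_scan d st fin (ys @ [b]) = occ_step d st fin (occ_scan d st fin ys) b"
  by (simp add: occ_scan_def)

lemma length_occ_step: "x = ys @ b # zs ==> occ_scan d st fin ys = (q, a, os) ==> length a < length x"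
  using length_occ_scan[of d st fin ys] by simp

definition inner_loop where
  "inner_loop m d st fin ps = auto_loop 3 m d (\<lambda>q b.
     (if st q b then Push 4 (sym_of b) else Skip) ;;
     (if fin q b then emit_pieces (\<lambda>k. [k = 1]) ps ;; clear 4 else Skip)) ;; clear 3 ;; clear 4"

definition holes :: "bool list => bool list => nat => bool list" where
  "holes a b r = (if r = 2 then a else b)"

lemma fills_cong: "(\<And>r. Hole r \<in> set ps ==> v r = v' r) ==> fills v ps = fills v' ps"
  unfolding fills_def
proof (induction ps)
  case (Cons p ps)
  thus ?case by (cases p) auto
qed auto

lemma sem_inner_loop:
  assumes closed: "\<And>q b. q < m ==> d q b < m" "0 < m"
    and s: "fst s 2 = rev (map sym_of a)" "length a \<le> length x" "fst s 3 = []" "fst s 4 = []"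
      "fst s 5 = []"
    and ps: "\<And>r. Hole r \<in> set ps ==> r = 2 \<or> r = 4" and x: "x \<noteq> []"
  shows "sem x (inner_loop m d st fin ps) s =
    (fst s, snd s @ concat (map (\<lambda>b. fills (holes a b) ps) (occs d st fin x)))"
proof -
  let ?h = "\<lambda>q b. (if st q b then Push 4 (sym_of b) else Skip) ;;
     (if fin q b then emit_pieces (\<lambda>k. [k = 1]) ps ;; clear 4 else Skip)"
  define I :: "bool list => store => bool" where "I ys t \<longleftrightarrow> (case occ_scan d st fin ys of (q, b, os) =>
     t = ((fst s)(3 := [q], 4 := rev (map sym_of b)),
          snd s @ concat (map (\<lambda>b. fills (holes a b) ps) os)))" for ys t
  have "I x (sem x (auto_loop 3 m d ?h) s)"
  proof (rule auto_loop_invariant(1)[OF closed])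
    show "length (fst s 3) \<le> 1" "I [] ((fst s)(3 := [0]), snd s)"
      using s by (auto simp: I_def occ_scan_def fun_eq_iff)
  next
    fix ys b zs t q
    assume xs: "x = ys @ b # zs" and I: "I ys t" and q: "q = foldl d 0 ys" "fst t 3 = [q]"
    obtain B os where sc: "occ_scan d st fin ys = (q, B, os)"
      using fst_occ_scan[of d st fin ys] q by (metis prod.exhaust_sel)
    hence t: "t = ((fst s)(3 := [q], 4 := rev (map sym_of B)),
          snd s @ concat (map (\<lambda>b. fills (holes a b) ps) os))" using I by (simp add: I_def)
    have len: "length B < length x" by (rule length_occ_step[OF xs sc])
    let ?B = "if st q b then B @ [b] else B"
    let ?t = "((fst s)(3 := [d q b], 4 := rev (map sym_of ?B)),
          snd s @ concat (map (\<lambda>b. fills (holes a b) ps) os))"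
    have 1: "sem x (if st q b then Push 4 (sym_of b) else Skip) ((fst t)(3 := [d q b]), snd t) = ?t"
      using t by (auto simp: fun_eq_iff)
    have 2: "sem x (emit_pieces (\<lambda>k. [k = 1]) ps) ?t =
      (fst ?t, snd ?t @ fills (holes a ?B) ps)"
    proof -
      have "sem x (emit_pieces (\<lambda>k. [k = 1]) ps) ?t =
        (fst ?t, snd ?t @ fills (\<lambda>r. concat (map (\<lambda>k. [k = 1]) (rev (fst ?t r)))) ps)"
      proof (rule sem_emit_pieces)
        fix r assume "Hole r \<in> set ps"
        with ps have "r = 2 \<or> r = 4" by blast
        thus "r \<noteq> 5 \<and> set (fst ?t r) \<subseteq> {0, 1} \<and> length (fst ?t r) \<le> length x"
          using len s by (auto simp: sym_of_def)
      qed (use s in auto)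
      also have "fills (\<lambda>r. concat (map (\<lambda>k. [k = 1]) (rev (fst ?t r)))) ps = fills (holes a ?B) ps"
      proof (rule fills_cong)
        fix r assume "Hole r \<in> set ps"
        with ps have "r = 2 \<or> r = 4" by blast
        thus "concat (map (\<lambda>k. [k = 1]) (rev (fst ?t r))) = holes a ?B r"
          using s concat_bits by (auto simp: holes_def rev_map[symmetric] simp del: map_map)
      qed
      finally show ?thesis .
    qed
    have 3: "sem x (clear 4) (fst ?t, o') = ((fst s)(3 := [d q b], 4 := []), o')" for o'
      using len by (subst sem_clear) (auto simp: fun_eq_iff)
    have "sem x (?h q b) ((fst t)(3 := [d q b]), snd t) =
       (if fin q b then ((fst s)(3 := [d q b], 4 := []), snd ?t @ fills (holes a ?B) ps) else ?t)"
    proof (cases "fin q b")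
      case True
      show ?thesis by (simp only: sem.simps(5) 1 True if_True 2 3)
    next
      case False
      show ?thesis by (simp only: sem.simps(1,5) 1 False if_False)
    qed
    thus "I (ys @ [b]) (sem x (?h q b) ((fst t)(3 := [d q b]), snd t)) \<and>
      fst (sem x (?h q b) ((fst t)(3 := [d q b]), snd t)) 3 = [d q b]"
      using sc by (auto simp: I_def occ_scan_snoc occ_step_def Let_def)
  qed
  then obtain q B where "sem x (auto_loop 3 m d ?h) s = ((fst s)(3 := [q], 4 := rev (map sym_of B)),
      snd s @ concat (map (\<lambda>b. fills (holes a b) ps) (occs d st fin x)))" "length B \<le> length x"
    using length_occ_scan[of d st fin x] by (auto simp: I_def occs_def split: prod.splits)
  thus ?thesis using s x unfolding inner_loop_def by (auto simp: sem_clear fun_eq_iff Suc_le_eq)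
qed

definition pair_loop where
  "pair_loop m d st fin ps = auto_loop 0 m d (\<lambda>q b.
     (if st q b then Push 2 (sym_of b) else Skip) ;;
     (if fin q b then inner_loop m d st fin ps ;; clear 2 else Skip)) ;; clear 2"

lemma sem_pair_loop:
  assumes closed: "\<And>q b. q < m ==> d q b < m" "0 < m"
    and s: "length (fst s 0) \<le> 1" "fst s 2 = []" "fst s 3 = []" "fst s 4 = []" "fst s 5 = []"
    and ps: "\<And>r. Hole r \<in> set ps ==> r = 2 \<or> r = 4"
  shows "\<exists>q. sem x (pair_loop m d st fin ps) s =
    ((fst s)(0 := [q]), snd s @ concat (map (\<lambda>a. concat (map (\<lambda>b. fills (holes a b) ps)
       (occs d st fin x))) (occs d st fin x)))"
proof -
  let ?h = "\<lambda>q b. (if st q b then Push 2 (sym_of b) else Skip) ;;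
     (if fin q b then inner_loop m d st fin ps ;; clear 2 else Skip)"
  let ?f = "\<lambda>a. concat (map (\<lambda>b. fills (holes a b) ps) (occs d st fin x))"
  define I :: "bool list => store => bool" where "I ys t \<longleftrightarrow> (case occ_scan d st fin ys of (q, a, os) =>
     t = ((fst s)(0 := [q], 2 := rev (map sym_of a)), snd s @ concat (map ?f os)))" for ys t
  have "I x (sem x (auto_loop 0 m d ?h) s)"
  proof (rule auto_loop_invariant(1)[OF closed])
    show "length (fst s 0) \<le> 1" "I [] ((fst s)(0 := [0]), snd s)"
      using s by (auto simp: I_def occ_scan_def fun_eq_iff)
  next
    fix ys b zs t q
    assume xs: "x = ys @ b # zs" and I: "I ys t" and q: "q = foldl d 0 ys" "fst t 0 = [q]"
    obtain A os where sc: "occ_scan d st fin ys = (q, A, os)"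
      using fst_occ_scan[of d st fin ys] q by (metis prod.exhaust_sel)
    hence t: "t = ((fst s)(0 := [q], 2 := rev (map sym_of A)), snd s @ concat (map ?f os))"
      using I by (simp add: I_def)
    have len: "length A < length x" by (rule length_occ_step[OF xs sc])
    let ?A = "if st q b then A @ [b] else A"
    let ?t = "((fst s)(0 := [d q b], 2 := rev (map sym_of ?A)), snd s @ concat (map ?f os))"
    have 1: "sem x (if st q b then Push 2 (sym_of b) else Skip) ((fst t)(0 := [d q b]), snd t) = ?t"
      using t by (auto simp: fun_eq_iff)
    have 2: "sem x (inner_loop m d st fin ps) ?t = (fst ?t, snd ?t @ ?f ?A)"
      using s len xs by (intro sem_inner_loop closed ps) auto
    have 3: "sem x (clear 2) (fst ?t, o') = ((fst s)(0 := [d q b], 2 := []), o')" for o'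
      using len by (subst sem_clear) (auto simp: fun_eq_iff)
    have "sem x (?h q b) ((fst t)(0 := [d q b]), snd t) =
       (if fin q b then ((fst s)(0 := [d q b], 2 := []), snd ?t @ ?f ?A) else ?t)"
    proof (cases "fin q b")
      case True
      show ?thesis by (simp only: sem.simps(5) 1 True if_True 2 3)
    next
      case False
      show ?thesis by (simp only: sem.simps(1,5) 1 False if_False)
    qed
    thus "I (ys @ [b]) (sem x (?h q b) ((fst t)(0 := [d q b]), snd t)) \<and>
      fst (sem x (?h q b) ((fst t)(0 := [d q b]), snd t)) 0 = [d q b]"
      using sc by (auto simp: I_def occ_scan_snoc occ_step_def Let_def)
  qed
  then obtain q A where "sem x (auto_loop 0 m d ?h) s = ((fst s)(0 := [q], 2 := rev (map sym_of A)),
      snd s @ concat (map ?f (occs d st fin x)))" "length A \<le> length x"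
    using length_occ_scan[of d st fin x] by (auto simp: I_def occs_def split: prod.splits)
  thus ?thesis using s unfolding pair_loop_def
    by (intro exI[of _ q]) (auto simp: sem_clear fun_eq_iff)
qed

subsection \<open>Transducers\<close>

definition transduce :: "(nat => bool => nat) => (nat => bool => bool list) => bool list => bool list" where
  "transduce d tab x = snd (foldl (\<lambda>(q, o') b. (d q b, o' @ tab q b)) (0, []) x)"

definition pass where
  "pass m d tab = auto_loop 0 m d (\<lambda>q b. emits (tab q b))"

lemma sem_pass:
  assumes closed: "\<And>q b. q < m ==> d q b < m" "0 < m" and s: "length (fst s 0) \<le> 1"
  shows "\<exists>q. sem x (pass m d tab) s = ((fst s)(0 := [q]), snd s @ transduce d tab x)"
proof -
  let ?F = "foldl (\<lambda>(q, o') b. (d q b, o' @ tab q b)) (0, [])"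
  define I :: "bool list => store => bool" where
    "I ys t \<longleftrightarrow> t = ((fst s)(0 := [fst (?F ys)]), snd s @ snd (?F ys))" for ys t
  have F: "?F (ys @ [b]) = (d (fst (?F ys)) b, snd (?F ys) @ tab (fst (?F ys)) b)" for ys b
    by (simp split: prod.splits)
  have q: "fst (?F ys) = foldl d 0 ys" for ys
    by (induction ys rule: rev_induct) (auto simp: case_prod_beta)
  have "I x (sem x (pass m d tab) s)" unfolding pass_def
  proof (rule auto_loop_invariant(1)[OF closed])
    show "length (fst s 0) \<le> 1" "I [] ((fst s)(0 := [0]), snd s)" using s by (auto simp: I_def)
  next
    fix ys b zs t q'
    assume "I ys t" and q': "q' = foldl d 0 ys" "fst t 0 = [q']"
    hence "t = ((fst s)(0 := [q']), snd s @ snd (?F ys))" by (simp add: I_def q)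
    thus "I (ys @ [b]) (sem x (emits (tab q' b)) ((fst t)(0 := [d q' b]), snd t)) \<and>
      fst (sem x (emits (tab q' b)) ((fst t)(0 := [d q' b]), snd t)) 0 = [d q' b]"
      by (simp only: I_def F) (simp add: q q'(1))
  qed
  thus ?thesis by (auto simp: I_def transduce_def)
qed

primrec passes where
  "passes m d [] = Skip"
| "passes m d (tab # tabs) = pass m d tab ;; passes m d tabs"

lemma sem_passes:
  assumes closed: "\<And>q b. q < m ==> d q b < m" "0 < m" and s: "length (fst s 0) \<le> 1"
  shows "snd (sem x (passes m d tabs) s) = snd s @ concat (map (\<lambda>tab. transduce d tab x) tabs)"
  using s
proof (induction tabs arbitrary: s)
  case (Cons tab tabs)
  obtain q where "sem x (pass m d tab) s = ((fst s)(0 := [q]), snd s @ transduce d tab x)"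
    using sem_pass[of m d s x tab, OF closed Cons.prems] by blast
  thus ?case using Cons.IH[of "((fst s)(0 := [q]), snd s @ transduce d tab x)"] by simp
qed auto

theorem poly_time_scan:
  assumes closed: "\<And>q b. q < m ==> d q b < m" "0 < m" "err < m"
    and ca: "\<And>q b. ca q b \<in> {-1, 0, 1}"
    and ps: "\<And>r. Hole r \<in> set ps ==> r = 2 \<or> r = 4"
  shows "poly_time (\<lambda>x. if accepted d ca err x
     then pre @ concat (map (\<lambda>a. concat (map (\<lambda>b. fills (holes a b) ps) (occs d st fin x)))
         (occs d st fin x)) @ concat (map (\<lambda>tab. transduce d tab x) tabs)
     else bad)"
proof -
  define c where "c = count_loop m d ca err ;;
     IfTop 1 0 (emits bad) (IfTop 0 0
       (emits pre ;; pair_loop m d st fin ps ;; passes m d tabs) (emits bad))"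
  have "snd (sem x c (\<lambda>_. [], [])) = (if accepted d ca err x
     then pre @ concat (map (\<lambda>a. concat (map (\<lambda>b. fills (holes a b) ps) (occs d st fin x)))
         (occs d st fin x)) @ concat (map (\<lambda>tab. transduce d tab x) tabs)
     else bad)" for x
  proof -
    obtain q k where qk: "foldl (count_step d ca err) (0, 1) x = (q, k)"
      "sem x (count_loop m d ca err) (\<lambda>_. [], []) = ((\<lambda>_. [])(0 := [q], 1 := replicate k 0), [])"
      using sem_count_loop[of m d err ca "(\<lambda>_. [], [])" x, OF closed ca] by auto
    show ?thesis
    proof (cases "q = 0 \<and> k = 0")
      case True
      obtain q' where "sem x (pair_loop m d st fin ps) ((\<lambda>_. [])(0 := [q], 1 := replicate k 0), pre) =
        (((\<lambda>_. [])(0 := [q], 1 := replicate k 0))(0 := [q']),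
         pre @ concat (map (\<lambda>a. concat (map (\<lambda>b. fills (holes a b) ps)
           (occs d st fin x))) (occs d st fin x)))"
        using sem_pair_loop[of m d "((\<lambda>_. [])(0 := [q], 1 := replicate k 0), pre)" ps x st fin,
            OF closed(1,2) _ _ _ _ _ ps] by auto
      thus ?thesis using True qk by (simp add: c_def accepted_def sem_passes[OF closed(1,2)])
    next
      case False
      thus ?thesis using qk by (auto simp: c_def accepted_def)
    qed
  qed
  with poly_time_loop_program[of c] show ?thesis by simp
qed

section \<open>Recognizing encodings\<close>

lemma enc_nat_double: "2 * n + of_bool b > 0 ==> enc_nat (2 * n + of_bool b) = True # b # enc_nat n"
  by (subst enc_nat.simps) auto

lemma enc_nat_0: "enc_nat 0 = [False]" by (subst enc_nat.simps) auto

lemma enc_nat_pos: "n > 0 ==> enc_nat n = True # odd n # enc_nat (n div 2)"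
  by (subst enc_nat.simps) auto

lemma enc_nat_nonempty [simp]: "enc_nat n \<noteq> []" by (subst enc_nat.simps) auto

text \<open>
  A scanner for binary numbers uses three states: \<open>z\<close> at a position where the number may end,
  \<open>n\<close> where it must not end because the last digit was zero, and \<open>e\<close> before a digit.
\<close>

lemma foldl_enc_nat:
  assumes "\<And>a. f (S z a) True = S e (h a True)" "\<And>a. f (S n a) True = S e (h a True)"
    and "\<And>a b. f (S e a) b = S (if b then z else n) (h a b)"
  shows "foldl f (S z a) (enc_nat k @ r) =
      foldl f (f (S z (foldl h a (butlast (enc_nat k)))) False) r" (is "?A k a")
    and "k > 0 ==> foldl f (S n a) (enc_nat k @ r) =
      foldl f (f (S z (foldl h a (butlast (enc_nat k)))) False) r"
proof -
  have "?A k a \<and> (k > 0 --> foldl f (S n a) (enc_nat k @ r) =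
      foldl f (f (S z (foldl h a (butlast (enc_nat k)))) False) r)" for a
  proof (induction k arbitrary: a rule: less_induct)
    case (less k)
    show ?case
    proof (cases "k = 0")
      case True
      thus ?thesis by (simp add: enc_nat_0)
    next
      case False
      hence "even k ==> k div 2 > 0" and "k div 2 < k" by auto
      thus ?thesis using less.IH[of "k div 2" "h (h a True) (odd k)"] enc_nat_pos[of k] False
        by (cases "odd k") (simp_all add: assms)
    qed
  qed
  thus "?A k a" and "k > 0 ==> foldl f (S n a) (enc_nat k @ r) =
      foldl f (f (S z (foldl h a (butlast (enc_nat k)))) False) r" by auto
qed

lemma enc_nat_snoc: "butlast (enc_nat k) @ [False] = enc_nat k"
proof (induction k rule: less_induct)
  case (less k)
  thus ?case using less[of "k div 2"] enc_nat_pos[of k] by (cases "k = 0") (simp_all add: enc_nat_0)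
qed

lemma foldl_snoc_id: "foldl (\<lambda>a b. a @ [b]) a bs = a @ bs"
  by (induction bs arbitrary: a) auto

lemma foldl_const: "foldl (\<lambda>a b. a) a bs = a" by (induction bs) auto

definition next_state :: "(nat \<times> nat) list => nat => bool => nat" where
  "next_state tbl q b = (if b then snd (tbl ! q) else fst (tbl ! q))"

lemma next_state_less:
  assumes "\<forall>(f, t) \<in> set tbl. f < m \<and> t < m" "q < m" "length tbl = m"
  shows "next_state tbl q b < m"
proof -
  have "tbl ! q \<in> set tbl" using assms(2,3) by simp
  with assms(1) show ?thesis by (auto simp: next_state_def)
qed

definition prepend :: "('a => bool list) => bool list set => bool list set" where
  "prepend e Y = {e a @ y | a y. y \<in> Y}"

lemma prependI: "y \<in> Y ==> e a @ y \<in> prepend e Y" unfolding prepend_def by blast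

lemma prependE:
  assumes "x \<in> prepend e Y"
  obtains a y where "x = e a @ y" "y \<in> Y" using assms unfolding prepend_def by blast

lemma prepend_list_Nil: "y \<in> Y ==> False # y \<in> prepend (enc_list e) Y"
  using prependI[of y Y "enc_list e" "[]"] by simp

lemma prepend_list_Cons: "y \<in> prepend e (prepend (enc_list e) Y) ==> True # y \<in> prepend (enc_list e) Y"
proof -
  assume "y \<in> prepend e (prepend (enc_list e) Y)"
  then obtain a as z where "z \<in> Y" "y = e a @ enc_list e as @ z" by (auto simp: prepend_def)
  thus "True # y \<in> prepend (enc_list e) Y" using prependI[of z Y "enc_list e" "a # as"] by simp
qed

definition digit_words :: "bool list set => bool list set" where
  "digit_words Y = {d # enc_nat n @ y | d n y. y \<in> Y \<and> (d \<or> n > 0)}"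

definition pos_words :: "bool list set => bool list set" where
  "pos_words Y = {enc_nat n @ y | n y. y \<in> Y \<and> n > 0}"

lemma pos_words_digit:
  assumes "x \<in> digit_words Y"
  shows "True # x \<in> pos_words Y"
proof -
  obtain d n y where x: "x = d # enc_nat n @ y" "y \<in> Y" "d \<or> n > 0"
    using assms unfolding digit_words_def by blast
  hence pos: "2 * n + of_bool d > (0::nat)" by auto
  hence "enc_nat (2 * n + of_bool d) @ y \<in> pos_words Y"
    unfolding pos_words_def using x(2) by blast
  thus ?thesis unfolding x(1) enc_nat_double[OF pos] by simp
qed

lemma prepend_pos: "x \<in> pos_words Y ==> x \<in> prepend enc_nat Y"
  unfolding pos_words_def prepend_def by blast

lemma prepend_nat_0: "x \<in> Y ==> False # x \<in> prepend enc_nat Y"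
  using prependI[of x Y enc_nat 0] by (simp add: enc_nat_0)

lemma digit_words_True:
  assumes "x \<in> prepend enc_nat Y"
  shows "True # x \<in> digit_words Y"
proof -
  obtain n y where "x = enc_nat n @ y" "y \<in> Y" using assms unfolding prepend_def by blast
  thus ?thesis unfolding digit_words_def by blast
qed

lemma digit_words_False:
  assumes "x \<in> pos_words Y"
  shows "False # x \<in> digit_words Y"
proof -
  obtain n y where "x = enc_nat n @ y" "y \<in> Y" "n > 0"
    using assms unfolding pos_words_def by blast
  thus ?thesis unfolding digit_words_def by blast
qed

lemma prepend_int:
  "x \<in> prepend enc_nat Y ==> False # x \<in> prepend enc_int Y"
  "x \<in> pos_words Y ==> True # x \<in> prepend enc_int Y"
proof -
  assume "x \<in> prepend enc_nat Y"
  then obtain n y where "x = enc_nat n @ y" "y \<in> Y" by (auto simp: prepend_def)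
  thus "False # x \<in> prepend enc_int Y"
    using prependI[of y Y enc_int "int n"] by (simp add: enc_int_def)
next
  assume "x \<in> pos_words Y"
  then obtain n y where "x = enc_nat n @ y" "y \<in> Y" "n > 0" by (auto simp: pos_words_def)
  thus "True # x \<in> prepend enc_int Y"
    using prependI[of y Y enc_int "- int n"] by (simp add: enc_int_def)
qed

subsection \<open>Terms\<close>

text \<open>
  States 0 to 5 are the proper prefixes of the token tags, states 6, 7, 8 scan the index of a
  variable and state 9 rejects. The counter holds the number of pending subterms.
\<close>

definition term_delta :: "nat => bool => nat" where
  "term_delta = next_state [(1, 2), (3, 4), (5, 9), (6, 0), (0, 0), (0, 0),
     (0, 8), (9, 8), (7, 6), (9, 9)]"

definition term_count :: "nat => bool => int" where
  "term_count q b = (if (q, b) \<in> {(3, True), (4, False), (6, False)} then - 1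
     else if q = 5 then 1 else 0)"

definition term_store :: "nat => bool => bool" where
  "term_store q b \<longleftrightarrow> q \<in> {6, 7, 8}"

definition term_fin :: "nat => bool => bool" where
  "term_fin q b \<longleftrightarrow> q = 6 \<and> \<not> b"

lemma term_delta_simps:
  "term_delta 0 b = (if b then 2 else 1)"
  "term_delta (Suc 0) b = (if b then 4 else 3)"
  "term_delta 2 b = (if b then 9 else 5)"
  "term_delta 3 b = (if b then 0 else 6)"
  "term_delta 4 b = 0"
  "term_delta 5 b = 0"
  "term_delta 6 b = (if b then 8 else 0)"
  "term_delta 7 b = (if b then 8 else 9)"
  "term_delta 8 b = (if b then 6 else 7)"
  "term_delta 9 b = 9" by (auto simp: term_delta_def next_state_def)

lemma term_count_simps:
  "term_count 0 b = 0"
  "term_count (Suc 0) b = 0"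
  "term_count 2 b = 0"
  "term_count 3 b = (if b then - 1 else 0)"
  "term_count 4 b = (if b then 0 else - 1)"
  "term_count 5 b = 1"
  "term_count 6 b = (if b then 0 else - 1)"
  "term_count 7 b = 0"
  "term_count 8 b = 0"
  "term_count 9 b = 0" by (auto simp: term_count_def)

lemma term_store_simps:
  "term_store 0 b = False"
  "term_store (Suc 0) b = False"
  "term_store 2 b = False"
  "term_store 3 b = False"
  "term_store 4 b = False"
  "term_store 5 b = False"
  "term_store 6 b = True"
  "term_store 7 b = True"
  "term_store 8 b = True"
  "term_store 9 b = False" by (auto simp: term_store_def)

lemma term_fin_simps:
  "term_fin 0 b = False"
  "term_fin (Suc 0) b = False"
  "term_fin 2 b = False"
  "term_fin 3 b = False"
  "term_fin 4 b = False"
  "term_fin 5 b = False"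
  "term_fin 6 b = (\<not> b)"
  "term_fin 7 b = False"
  "term_fin 8 b = False"
  "term_fin 9 b = False" by (auto simp: term_fin_def)

lemma term_delta_less: "q < 10 ==> term_delta q b < 10"
  unfolding term_delta_def by (rule next_state_less) auto

abbreviation "term_step \<equiv> count_step term_delta term_count 9"

lemma term_step_simps:
  "term_step (q, Suc c) b = (term_delta q b, nat (int (Suc c) + term_count q b))"
  "term_step (q, 0) b = (9, 0)"
  "nat (1 + int c) = Suc c" "nat (2 + int c) = Suc (Suc c)" by (auto simp: count_step_def)

lemma foldl_term_step_nat:
  "foldl term_step (6, Suc c) (enc_nat n @ r) = foldl term_step (0, c) r"
  using foldl_enc_nat(1)[of term_step "\<lambda>q c. (q, Suc c)" 6 8 "\<lambda>a b. a" 7 c n r]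
  by (simp add: term_step_simps term_delta_simps term_count_simps foldl_const)

lemma foldl_term_step:
  "foldl term_step (0, Suc c) (enc_term t @ r) = foldl term_step (0, c) r"
proof (induction t arbitrary: c r)
  case (Meet t1 t2)
  thus ?case by (simp add: term_step_simps term_delta_simps term_count_simps)
next
  case (Join t1 t2)
  thus ?case by (simp add: term_step_simps term_delta_simps term_count_simps)
qed (simp_all add: term_step_simps term_delta_simps term_count_simps foldl_term_step_nat[simplified])

lemma foldl_term_step_reject: "foldl term_step (9, c) x \<noteq> (0, 0)"
proof (induction x arbitrary: c)
  case (Cons b x)
  thus ?case by (cases c) (auto simp: term_step_simps term_delta_simps term_count_simps)
qed auto

definition term_words :: "nat => bool list set" where
  "term_words c = {concat (map enc_term ts) | ts. length ts = c}"

lemma term_words_0: "[] \<in> term_words 0" by (auto simp: term_words_def)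

lemma term_words_Suc: "x \<in> term_words c ==> enc_term t @ x \<in> term_words (Suc c)"
proof -
  assume "x \<in> term_words c"
  then obtain ts where "x = concat (map enc_term ts)" "length ts = c" by (auto simp: term_words_def)
  hence "enc_term t @ x = concat (map enc_term (t # ts))" "length (t # ts) = Suc c" by simp_all
  thus "enc_term t @ x \<in> term_words (Suc c)" unfolding term_words_def by blast
qed

lemma term_words_token:
  "y \<in> prepend enc_nat (term_words c) ==> False # False # False # y \<in> term_words (Suc c)"
  "y \<in> term_words c ==> False # False # True # y \<in> term_words (Suc c)"
  "y \<in> term_words c ==> False # True # False # y \<in> term_words (Suc c)"
  "y \<in> term_words (Suc c) ==> False # True # True # y \<in> term_words (Suc c)"
  "y \<in> term_words (Suc (Suc c)) ==> True # False # b # y \<in> term_words (Suc c)"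
proof -
  assume "y \<in> prepend enc_nat (term_words c)"
  then obtain n z where "z \<in> term_words c" "y = enc_nat n @ z" by (auto simp: prepend_def)
  thus "False # False # False # y \<in> term_words (Suc c)"
    using term_words_Suc[of z c "Var n"] by simp
next
  assume "y \<in> term_words c"
  thus "False # False # True # y \<in> term_words (Suc c)"
    "False # True # False # y \<in> term_words (Suc c)"
    using term_words_Suc[of y c Zero] term_words_Suc[of y c One] by simp_all
next
  assume "y \<in> term_words (Suc c)"
  then obtain t ts where "y = concat (map enc_term (t # ts))" "length ts = c"
    by (auto simp: term_words_def length_Suc_conv)
  moreover from this have "concat (map enc_term ts) \<in> term_words c"
    by (auto simp: term_words_def)
  ultimately show "False # True # True # y \<in> term_words (Suc c)"
    using term_words_Suc[of "concat (map enc_term ts)" c "Neg t"] by simp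
next
  assume "y \<in> term_words (Suc (Suc c))"
  then obtain t u ts where "y = concat (map enc_term (t # u # ts))" "length ts = c"
    by (auto simp: term_words_def length_Suc_conv)
  moreover from this have "concat (map enc_term ts) \<in> term_words c"
    by (auto simp: term_words_def)
  ultimately show "True # False # b # y \<in> term_words (Suc c)"
    using term_words_Suc[of "concat (map enc_term ts)" c "Join t u"]
      term_words_Suc[of "concat (map enc_term ts)" c "Meet t u"] by (cases b) simp_all
qed

lemma term_words_accepted:
  "(foldl term_step (0, c) x = (0, 0) --> x \<in> term_words c) \<and>
   (foldl term_step (1, Suc c) x = (0, 0) --> False # x \<in> term_words (Suc c)) \<and>
   (foldl term_step (2, Suc c) x = (0, 0) --> True # x \<in> term_words (Suc c)) \<and>
   (foldl term_step (3, Suc c) x = (0, 0) --> False # False # x \<in> term_words (Suc c)) \<and>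
   (foldl term_step (4, Suc c) x = (0, 0) --> False # True # x \<in> term_words (Suc c)) \<and>
   (foldl term_step (5, Suc c) x = (0, 0) --> True # False # x \<in> term_words (Suc c)) \<and>
   (foldl term_step (6, Suc c) x = (0, 0) --> x \<in> prepend enc_nat (term_words c)) \<and>
   (foldl term_step (7, Suc c) x = (0, 0) --> x \<in> pos_words (term_words c)) \<and>
   (foldl term_step (8, Suc c) x = (0, 0) --> x \<in> digit_words (term_words c))"
proof (induction x arbitrary: c)
  case Nil
  thus ?case by (auto simp: term_words_0)
next
  case (Cons b x)
  note simps = term_step_simps term_delta_simps term_count_simps foldl_term_step_reject
  have "foldl term_step (0, c) (b # x) = (0, 0) --> b # x \<in> term_words c"
    using Cons.IH[of "c - 1"] by (cases c; cases b) (simp_all add: simps)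
  thus ?case using Cons.IH[of c] Cons.IH[of "Suc c"] Cons.IH[of "Suc (Suc c)"]
    by (cases b) (simp_all add: simps term_words_token prepend_pos pos_words_digit prepend_nat_0
        digit_words_True digit_words_False)
qed

lemma term_accepted_iff: "accepted term_delta term_count 9 x \<longleftrightarrow> x \<in> range enc_term"
proof
  assume "accepted term_delta term_count 9 x"
  hence "x \<in> term_words 1" using term_words_accepted[of 1 x] by (simp add: accepted_def)
  thus "x \<in> range enc_term" by (auto simp: term_words_def length_Suc_conv)
next
  assume "x \<in> range enc_term"
  thus "accepted term_delta term_count 9 x"
    using foldl_term_step[of 0 _ "[]"] by (auto simp: accepted_def)
qed

primrec term_vars :: "ol_term => nat list" where
  "term_vars (Var i) = [i]"
| "term_vars Zero = []"
| "term_vars One = []"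
| "term_vars (Neg t) = term_vars t"
| "term_vars (Meet s t) = term_vars s @ term_vars t"
| "term_vars (Join s t) = term_vars s @ term_vars t"

abbreviation "term_occ_step \<equiv> occ_step term_delta term_store term_fin"

lemma foldl_term_occ_step_nat:
  "foldl term_occ_step (6, a, os) (enc_nat n @ r) = foldl term_occ_step (0, [], os @ [a @ enc_nat n]) r"
proof -
  have "foldl term_occ_step (6, a, os) (enc_nat n @ r) =
     foldl term_occ_step (term_occ_step (6, a @ butlast (enc_nat n), os) False) r"
    using foldl_enc_nat(1)[of term_occ_step "\<lambda>q a. (q, a, os)" 6 8 "\<lambda>a b. a @ [b]" 7 a n r]
    by (simp add: occ_step_def term_delta_simps term_store_simps term_fin_simps foldl_snoc_id)
  thus ?thesis
    using enc_nat_snoc[of n] by (simp add: occ_step_def term_delta_simps term_store_simps term_fin_simps)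
qed

lemma foldl_term_occ_step:
  "foldl term_occ_step (0, [], os) (enc_term t @ r) =
   foldl term_occ_step (0, [], os @ map enc_nat (term_vars t)) r"
proof (induction t arbitrary: os r)
  case (Var n)
  have "foldl term_occ_step (0, [], os) ([False, False, False] @ y) =
      foldl term_occ_step (6, [], os) y" for y
    by (simp add: occ_step_def term_delta_simps term_store_simps term_fin_simps)
  thus ?case using foldl_term_occ_step_nat[of "[]"] by simp
qed (simp_all add: occ_step_def term_delta_simps term_store_simps term_fin_simps)

lemma occs_enc_term: "occs term_delta term_store term_fin (enc_term t) = map enc_nat (term_vars t)"
  using foldl_term_occ_step[of "[]" t "[]"] by (simp add: occs_def occ_scan_def)

subsection \<open>Polynomials\<close>

text \<open>
  States 0, 1, 6 are at the beginning of the rest of a list of polynomials, summands and letters,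
  respectively. State 2 reads the sign of a coefficient and states 3, 4, 5 scan its absolute value,
  state 7 reads the kind of a letter, and the index is scanned in states 8, 9, 10 for a plain
  variable and in states 11, 12, 13 for an adjoint. State 14 rejects.
\<close>

definition poly_delta :: "nat => bool => nat" where
  "poly_delta = next_state [(0, 1), (0, 2), (3, 4), (6, 5), (14, 5), (4, 3), (1, 7), (8, 11),
     (6, 10), (14, 10), (9, 8), (6, 13), (14, 13), (12, 11), (14, 14)]"

definition poly_count :: "nat => bool => int" where
  "poly_count q b = (if q = 0 \<and> \<not> b then - 1 else 0)"

definition poly_store :: "nat => bool => bool" where
  "poly_store q b \<longleftrightarrow> q \<in> {8, 9, 10, 11, 12, 13}"

definition poly_fin :: "nat => bool => bool" where
  "poly_fin q b \<longleftrightarrow> q \<in> {8, 11} \<and> \<not> b"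

lemma poly_delta_simps:
  "poly_delta 0 b = (if b then 1 else 0)"
  "poly_delta (Suc 0) b = (if b then 2 else 0)"
  "poly_delta 2 b = (if b then 4 else 3)"
  "poly_delta 3 b = (if b then 5 else 6)"
  "poly_delta 4 b = (if b then 5 else 14)"
  "poly_delta 5 b = (if b then 3 else 4)"
  "poly_delta 6 b = (if b then 7 else 1)"
  "poly_delta 7 b = (if b then 11 else 8)"
  "poly_delta 8 b = (if b then 10 else 6)"
  "poly_delta 9 b = (if b then 10 else 14)"
  "poly_delta 10 b = (if b then 8 else 9)"
  "poly_delta 11 b = (if b then 13 else 6)"
  "poly_delta 12 b = (if b then 13 else 14)"
  "poly_delta 13 b = (if b then 11 else 12)"
  "poly_delta 14 b = 14" by (auto simp: poly_delta_def next_state_def)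

lemma poly_count_simps:
  "poly_count 0 b = (if b then 0 else - 1)"
  "poly_count (Suc 0) b = 0"
  "poly_count 2 b = 0"
  "poly_count 3 b = 0"
  "poly_count 4 b = 0"
  "poly_count 5 b = 0"
  "poly_count 6 b = 0"
  "poly_count 7 b = 0"
  "poly_count 8 b = 0"
  "poly_count 9 b = 0"
  "poly_count 10 b = 0"
  "poly_count 11 b = 0"
  "poly_count 12 b = 0"
  "poly_count 13 b = 0"
  "poly_count 14 b = 0" by (auto simp: poly_count_def)

lemma poly_store_simps:
  "poly_store 0 b = False"
  "poly_store (Suc 0) b = False"
  "poly_store 2 b = False"
  "poly_store 3 b = False"
  "poly_store 4 b = False"
  "poly_store 5 b = False"
  "poly_store 6 b = False"
  "poly_store 7 b = False"
  "poly_store 8 b = True"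
  "poly_store 9 b = True"
  "poly_store 10 b = True"
  "poly_store 11 b = True"
  "poly_store 12 b = True"
  "poly_store 13 b = True"
  "poly_store 14 b = False" by (auto simp: poly_store_def)

lemma poly_fin_simps:
  "poly_fin 0 b = False"
  "poly_fin (Suc 0) b = False"
  "poly_fin 2 b = False"
  "poly_fin 3 b = False"
  "poly_fin 4 b = False"
  "poly_fin 5 b = False"
  "poly_fin 6 b = False"
  "poly_fin 7 b = False"
  "poly_fin 8 b = (\<not> b)"
  "poly_fin 9 b = False"
  "poly_fin 10 b = False"
  "poly_fin 11 b = (\<not> b)"
  "poly_fin 12 b = False"
  "poly_fin 13 b = False"
  "poly_fin 14 b = False" by (auto simp: poly_fin_def)

lemma enc_letter_simp: "enc_letter (i, b) = b # enc_nat i" by (simp add: enc_letter_def)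

lemma enc_summand_simp: "enc_summand (c, w) = enc_int c @ enc_list enc_letter w"
  by (simp add: enc_summand_def)

lemma poly_delta_less: "q < 15 ==> poly_delta q b < 15"
  unfolding poly_delta_def by (rule next_state_less) auto

abbreviation "poly_step \<equiv> count_step poly_delta poly_count 14"

lemma poly_step_simps:
  "poly_step (q, Suc c) b = (poly_delta q b, nat (int (Suc c) + poly_count q b))"
  "poly_step (q, 0) b = (14, 0)"
  "nat (1 + int c) = Suc c" by (auto simp: count_step_def)

lemma foldl_poly_step_nat:
  "foldl poly_step (3, Suc c) (enc_nat n @ r) = foldl poly_step (6, Suc c) r"
  "n > 0 ==> foldl poly_step (4, Suc c) (enc_nat n @ r) = foldl poly_step (6, Suc c) r"
  "foldl poly_step (8, Suc c) (enc_nat n @ r) = foldl poly_step (6, Suc c) r"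
  "foldl poly_step (11, Suc c) (enc_nat n @ r) = foldl poly_step (6, Suc c) r"
  using foldl_enc_nat[where f = poly_step and S = "\<lambda>q c. (q, Suc c)" and z = 3 and n = 4 and e = 5
      and h = "\<lambda>a b. a" and a = c and k = n and r = r]
    foldl_enc_nat(1)[of poly_step "\<lambda>q c. (q, Suc c)" 8 10 "\<lambda>a b. a" 9 c n r]
    foldl_enc_nat(1)[of poly_step "\<lambda>q c. (q, Suc c)" 11 13 "\<lambda>a b. a" 12 c n r]
  by (simp_all add: poly_step_simps poly_delta_simps poly_count_simps foldl_const)

lemma foldl_poly_step_word:
  "foldl poly_step (6, Suc c) (enc_list enc_letter w @ r) = foldl poly_step (1, Suc c) r"
proof (induction w)
  case (Cons l w)
  thus ?case
    by (cases l) (auto simp: poly_step_simps poly_delta_simps poly_count_simps foldl_poly_step_nat[simplified]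
        enc_letter_simp)
qed (simp add: poly_step_simps poly_delta_simps poly_count_simps)

lemma foldl_poly_step_poly:
  "foldl poly_step (1, Suc c) (enc_list enc_summand p @ r) = foldl poly_step (0, Suc c) r"
proof (induction p)
  case (Cons m p)
  obtain i w where m: "m = (i, w)" by fastforce
  show ?case
    using Cons by (cases "i < 0") (auto simp: m poly_step_simps poly_delta_simps poly_count_simps
        foldl_poly_step_nat[simplified] foldl_poly_step_word[simplified] enc_summand_simp enc_int_def)
qed (simp add: poly_step_simps poly_delta_simps poly_count_simps)

lemma foldl_poly_step: "foldl poly_step (0, 1) (enc_polys ps) = (0, 0)" unfolding enc_polys_def
proof (induction ps)
  case (Cons p ps)
  thus ?case using foldl_poly_step_poly[of 0 p "enc_list (enc_list enc_summand) ps"]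
    by (simp add: poly_step_simps poly_delta_simps poly_count_simps)
qed (simp add: poly_step_simps poly_delta_simps poly_count_simps)

lemma foldl_poly_step_reject: "foldl poly_step (14, c) x \<noteq> (0, 0)"
proof (induction x arbitrary: c)
  case (Cons b x)
  thus ?case by (cases c) (auto simp: poly_step_simps poly_delta_simps poly_count_simps)
qed auto

lemma prepend_letter: "y \<in> prepend enc_nat Y ==> b # y \<in> prepend enc_letter Y"
proof -
  assume "y \<in> prepend enc_nat Y"
  then obtain n z where "y = enc_nat n @ z" "z \<in> Y" unfolding prepend_def by blast
  thus "b # y \<in> prepend enc_letter Y"
    using prependI[of z Y enc_letter "(n, b)"] by (simp add: enc_letter_simp)
qed

lemma prepend_summand:
  assumes "x \<in> prepend enc_int (prepend (enc_list enc_letter) Y)"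
  shows "x \<in> prepend enc_summand Y"
proof -
  obtain c w y where "x = enc_int c @ enc_list enc_letter w @ y" "y \<in> Y"
    using assms unfolding prepend_def by blast
  thus ?thesis using prependI[of y Y enc_summand "(c, w)"] by (simp add: enc_summand_simp)
qed

lemma poly_words_accepted:
  defines "Y0 \<equiv> range enc_polys"
  defines "Y1 \<equiv> prepend (enc_list enc_summand) Y0"
  defines "Y6 \<equiv> prepend (enc_list enc_letter) Y1"
  defines "W \<equiv> [Y0, Y1, prepend enc_int Y6, prepend enc_nat Y6, pos_words Y6, digit_words Y6, Y6,
     prepend enc_letter Y6, prepend enc_nat Y6, pos_words Y6, digit_words Y6, prepend enc_nat Y6,
     pos_words Y6, digit_words Y6]"
  assumes "q < 14" "foldl poly_step (q, 1) x = (0, 0)"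
  shows "x \<in> W ! q" using assms(5,6)
proof (induction x arbitrary: q)
  case Nil
  thus ?case by (auto simp: poly_step_simps)
next
  case (Cons b x)
  note simps = poly_step_simps poly_delta_simps poly_count_simps foldl_poly_step_reject
  have nil: "x = []" if "foldl poly_step (0, 0) x = (0, 0)"
    using that foldl_poly_step_reject by (cases x) (auto simp: simps)
  have Y0_Nil: "[False] \<in> Y0"
    unfolding Y0_def by (rule image_eqI[of _ _ "[]"]) (auto simp: enc_polys_def)
  have Y0_end: "False # x \<in> Y0" if "foldl poly_step (0, 0) x = (0, 0)"
    using nil[OF that] Y0_Nil by simp
  have Y0_Cons: "True # y \<in> Y0" if y: "y \<in> Y1" for y
  proof -
    obtain p z where "y = enc_list enc_summand p @ z" "z \<in> Y0"
      by (rule prependE[OF y[unfolded Y1_def]])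
    moreover from this obtain ps where "z = enc_polys ps" unfolding Y0_def by blast
    ultimately show ?thesis
      unfolding Y0_def by (intro image_eqI[of _ _ "p # ps"]) (auto simp: enc_polys_def)
  qed
  have Y1_Cons: "True # y \<in> Y1" if "y \<in> prepend enc_int Y6" for y
    using that unfolding Y1_def Y6_def by (intro prepend_list_Cons prepend_summand)
  have Y1_Nil: "False # y \<in> Y1" if "y \<in> Y0" for y
    using that unfolding Y1_def by (rule prepend_list_Nil)
  have Y6_Cons: "True # y \<in> Y6" if "y \<in> prepend enc_letter Y6" for y
    using that unfolding Y6_def by (rule prepend_list_Cons)
  have Y6_Nil: "False # y \<in> Y6" if "y \<in> Y1" for y
    using that unfolding Y6_def by (rule prepend_list_Nil)
  have pos: "True # y \<in> prepend enc_nat Y6" if "y \<in> digit_words Y6" for y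
    using that by (intro prepend_pos pos_words_digit)
  note IH = Cons.IH[of 0, unfolded W_def, simplified]
    Cons.IH[of 1, unfolded W_def, simplified]
    Cons.IH[of 2, unfolded W_def, simplified]
    Cons.IH[of 3, unfolded W_def, simplified]
    Cons.IH[of 4, unfolded W_def, simplified]
    Cons.IH[of 5, unfolded W_def, simplified]
    Cons.IH[of 6, unfolded W_def, simplified]
    Cons.IH[of 7, unfolded W_def, simplified]
    Cons.IH[of 8, unfolded W_def, simplified]
    Cons.IH[of 9, unfolded W_def, simplified]
    Cons.IH[of 10, unfolded W_def, simplified]
    Cons.IH[of 11, unfolded W_def, simplified]
    Cons.IH[of 12, unfolded W_def, simplified]
    Cons.IH[of 13, unfolded W_def, simplified]
  note rules = prepend_int pos pos_words_digit prepend_nat_0 digit_words_True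
    digit_words_False prepend_letter Y0_end Y0_Cons Y1_Nil Y1_Cons Y6_Nil Y6_Cons
  have "q \<in> {0, 1, 2, 3, 4, 5, 6}" if "q < 7" using that by auto
  moreover have "q \<in> {7, 8, 9, 10, 11, 12, 13}" if "\<not> q < 7"
    using that Cons.prems(1) by auto
  ultimately have "q \<in> {0, 1, 2, 3, 4, 5, 6, 7, 8, 9, 10, 11, 12, 13}" by blast
  thus ?case using Cons.prems(2) unfolding insert_iff empty_iff W_def
    by (elim disjE FalseE; hypsubst; cases b; simp add: simps; blast intro: rules IH)
qed

lemma poly_accepted_iff: "accepted poly_delta poly_count 14 x \<longleftrightarrow> x \<in> range enc_polys"
  using poly_words_accepted[of 0 x] foldl_poly_step by (auto simp: accepted_def)

definition poly_vars :: "nc_poly list => nat list" where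
  "poly_vars ps = concat (map (\<lambda>p. concat (map (\<lambda>(c, w). map fst w) p)) ps)"

abbreviation "poly_occ_step \<equiv> occ_step poly_delta poly_store poly_fin"

lemma foldl_poly_occ_step_nat:
  assumes "q \<in> {8, 11}"
  shows "foldl poly_occ_step (q, a, os) (enc_nat n @ r) =
     foldl poly_occ_step (6, [], os @ [a @ enc_nat n]) r"
proof -
  have "foldl poly_occ_step (q, a, os) (enc_nat n @ r) =
     foldl poly_occ_step (poly_occ_step (q, a @ butlast (enc_nat n), os) False) r" using assms
      foldl_enc_nat(1)[of poly_occ_step "\<lambda>q a. (q, a, os)" q "q + 2" "\<lambda>a b. a @ [b]" "q + 1" a n r]
    by (auto simp: occ_step_def poly_delta_simps poly_store_simps poly_fin_simps foldl_snoc_id)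
  thus ?thesis using assms enc_nat_snoc[of n]
    by (auto simp: occ_step_def poly_delta_simps poly_store_simps poly_fin_simps)
qed

lemma foldl_poly_occ_step_coeff:
  "foldl poly_occ_step (3, [], os) (enc_nat n @ r) = foldl poly_occ_step (6, [], os) r"
  "n > 0 ==> foldl poly_occ_step (4, [], os) (enc_nat n @ r) = foldl poly_occ_step (6, [], os) r"
  using foldl_enc_nat[where f = poly_occ_step and S = "\<lambda>q a. (q, [], os)" and z = 3 and n = 4
      and e = 5 and h = "\<lambda>a b. a" and a = "[]" and k = n and r = r]
  by (simp_all add: occ_step_def poly_delta_simps poly_store_simps poly_fin_simps foldl_const)

lemma poly_occ_step_simps:
  "foldl poly_occ_step (6, [], os) (True # b # r) =
     foldl poly_occ_step (if b then 11 else 8, [], os) r"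
  "foldl poly_occ_step (6, [], os) (False # r) = foldl poly_occ_step (1, [], os) r"
  "foldl poly_occ_step (1, [], os) (True # b # r) =
     foldl poly_occ_step (if b then 4 else 3, [], os) r"
  "foldl poly_occ_step (1, [], os) (False # r) = foldl poly_occ_step (0, [], os) r"
  "foldl poly_occ_step (0, [], os) (True # r) = foldl poly_occ_step (1, [], os) r"
  by (simp_all add: occ_step_def poly_delta_simps poly_store_simps poly_fin_simps)

lemma foldl_poly_occ_step_word:
  "foldl poly_occ_step (6, [], os) (enc_list enc_letter w @ r) =
   foldl poly_occ_step (1, [], os @ map (\<lambda>l. enc_nat (fst l)) w) r"
proof (induction w arbitrary: os)
  case Nil
  thus ?case by (simp only: enc_list.simps append_Cons append_Nil poly_occ_step_simps) simp
next
  case (Cons l w)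
  obtain i b where l: "l = (i, b)" by fastforce
  have "(if b then 11 else 8) \<in> {8, 11::nat}" by simp
  from foldl_poly_occ_step_nat[OF this, of "[]" os i] Cons show ?case
    by (simp only: l enc_list.simps append_Cons append_assoc poly_occ_step_simps enc_letter_simp) simp
qed

lemma foldl_poly_occ_step_poly:
  "foldl poly_occ_step (1, [], os) (enc_list enc_summand p @ r) =
   foldl poly_occ_step (0, [], os @ concat (map (\<lambda>(c, w). map (\<lambda>l. enc_nat (fst l)) w) p)) r"
proof (induction p arbitrary: os)
  case Nil
  thus ?case by (simp only: enc_list.simps append_Cons append_Nil poly_occ_step_simps) simp
next
  case (Cons m p)
  obtain i w where m: "m = (i, w)" by fastforce
  have "foldl poly_occ_step (if i < 0 then 4 else 3, [], os) (enc_nat (nat \<bar>i\<bar>) @ y) =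
      foldl poly_occ_step (6, [], os) y" for y using foldl_poly_occ_step_coeff by simp
  thus ?case using Cons by (simp only: m enc_list.simps append_Cons append_assoc poly_occ_step_simps
        enc_summand_simp enc_int_def foldl_poly_occ_step_word) simp
qed

lemma foldl_poly_occ_step:
  "foldl poly_occ_step (0, [], os) (enc_polys ps) = (0, [], os @ map enc_nat (poly_vars ps))"
  unfolding enc_polys_def
proof (induction ps arbitrary: os)
  case (Cons p ps)
  have "concat (map (\<lambda>(c, w). map (\<lambda>l. enc_nat (fst l)) w) p) =
      map enc_nat (concat (map (\<lambda>(c, w). map fst w) p))" by (induction p) auto
  hence "foldl poly_occ_step (0, [], os) (enc_list (enc_list enc_summand) (p # ps)) =
      foldl poly_occ_step (0, [], os @ map enc_nat (concat (map (\<lambda>(c, w). map fst w) p)))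
        (enc_list (enc_list enc_summand) ps)"
    by (simp only: enc_list.simps poly_occ_step_simps foldl_poly_occ_step_poly)
  thus ?case using Cons by (simp add: poly_vars_def)
qed (simp add: occ_step_def poly_delta_simps poly_store_simps poly_fin_simps poly_vars_def)

lemma occs_enc_polys:
  "occs poly_delta poly_store poly_fin (enc_polys ps) = map enc_nat (poly_vars ps)"
  using foldl_poly_occ_step[of "[]" ps] by (simp add: occs_def occ_scan_def)

section \<open>Subspaces over star-subfields\<close>

locale star_field =
  fixes F :: "complex set"
  assumes star_subfield: "star_subfield F"
begin

lemma F_0 [simp]: "0 \<in> F" and F_1 [simp]: "1 \<in> F"
  and F_add [intro]: "x \<in> F ==> y \<in> F ==> x + y \<in> F"
  and F_mult [intro]: "x \<in> F ==> y \<in> F ==> x * y \<in> F"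
  and F_uminus [intro]: "x \<in> F ==> - x \<in> F"
  and F_inverse [intro]: "x \<in> F ==> inverse x \<in> F"
  and F_cnj [intro]: "x \<in> F ==> cnj x \<in> F"
  using star_subfield by (auto simp: star_subfield_def)

lemma F_diff [intro]: "x \<in> F ==> y \<in> F ==> x - y \<in> F"
  using F_add[of x "- y"] F_uminus by auto

lemma F_divide [intro]: "x \<in> F ==> y \<in> F ==> x / y \<in> F"
  using F_mult[of x "inverse y"] F_inverse by (auto simp: divide_inverse)

lemma F_sum [intro]: "(\<And>i. i \<in> A ==> f i \<in> F) ==> sum f A \<in> F"
  by (induction A rule: infinite_finite_induct) auto

lemma F_of_nat [simp]: "of_nat n \<in> F" by (induction n) auto

lemma F_of_int [simp]: "of_int n \<in> F" by (cases n rule: int_cases2) auto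

lemma F_power [intro]: "x \<in> F ==> x ^ n \<in> F" by (induction n) auto

abbreviation V :: "nat => complex vec set" where
  "V d \<equiv> vec_space_over F d"

lemma V_carrier: "v \<in> V d ==> v \<in> carrier_vec d" by (auto simp: vec_space_over_def)

lemma V_dim: "v \<in> V d ==> dim_vec v = d" by (auto simp: vec_space_over_def)

lemma V_index: "v \<in> V d ==> i < d ==> v $ i \<in> F" by (auto simp: vec_space_over_def)

lemma V_I: "dim_vec v = d ==> (\<And>i. i < d ==> v $ i \<in> F) ==> v \<in> V d"
  by (auto simp: vec_space_over_def)

lemma subspace_V: "subspace_over F d (V d)"
  by (auto simp: subspace_over_def vec_space_over_def intro!: F_add F_mult)

lemma V_zero [simp]: "0\<^sub>v d \<in> V d" by (auto simp: vec_space_over_def)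

declare V_carrier [simp] V_dim [simp]

lemma subspace_0: "subspace_over F d {0\<^sub>v d}" by (auto simp: subspace_over_def)

lemma subspaceD:
  assumes "subspace_over F d U"
  shows "u \<in> U ==> u \<in> V d" "0\<^sub>v d \<in> U" "u \<in> U ==> v \<in> U ==> u + v \<in> U"
    "c \<in> F ==> u \<in> U ==> c *s u \<in> U" using assms unfolding subspace_over_def by blast+

lemma minus_smult_vec: "u \<in> carrier_vec d ==> v \<in> carrier_vec d ==>
    u - v = u + (- 1 :: complex) *s v" by (rule eq_vecI) auto

lemma subspace_diff:
  assumes "subspace_over F d U" "u \<in> U" "v \<in> U"
  shows "u - v \<in> U"
proof -
  have "u - v = u + (- 1 :: complex) *s v"
    using assms by (intro minus_smult_vec[of u d v] V_carrier subspaceD(1)[OF assms(1)])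
  also have "... \<in> U" using assms(2,3) by (intro subspaceD(3,4)[OF assms(1)]) auto
  finally show ?thesis .
qed

lemma subspace_uminus:
  assumes "subspace_over F d U" "u \<in> U"
  shows "- u \<in> U"
proof -
  have "- u = (- 1) *s u" by (rule eq_vecI) auto
  also have "... \<in> U" using assms(2) by (intro subspaceD(4)[OF assms(1)]) auto
  finally show ?thesis .
qed

lemmas V_add = subspaceD(3)[OF subspace_V]
lemmas V_smult = subspaceD(4)[OF subspace_V]
lemmas V_diff = subspace_diff[OF subspace_V]
lemmas V_uminus = subspace_uminus[OF subspace_V]

abbreviation ip :: "complex vec => complex vec => complex" where
  "ip x y \<equiv> conjugate x \<bullet> y"

lemma ip_sum: "dim_vec x = d ==> dim_vec y = d ==> ip x y = (\<Sum>i<d. cnj (x $ i) * y $ i)"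
  by (auto simp: scalar_prod_def lessThan_atLeast0 intro!: sum.cong)

lemma ip_in: "x \<in> V d ==> y \<in> V d ==> ip x y \<in> F"
  by (auto simp: ip_sum[of _ d] intro: V_index)

lemma ip_add:
  assumes "x \<in> carrier_vec d" "y \<in> carrier_vec d" "z \<in> carrier_vec d"
  shows "ip x (y + z) = ip x y + ip x z" "ip (x + y) z = ip x z + ip y z"
  using assms by (auto simp: ip_sum[of _ d] ring_distribs sum.distrib)

lemma ip_diff:
  assumes "x \<in> carrier_vec d" "y \<in> carrier_vec d" "z \<in> carrier_vec d"
  shows "ip x (y - z) = ip x y - ip x z" "ip (x - y) z = ip x z - ip y z"
  using assms by (auto simp: ip_sum[of _ d] ring_distribs sum_subtractf)

lemma ip_smult:
  assumes "x \<in> carrier_vec d" "y \<in> carrier_vec d"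
  shows "ip x (c *s y) = c * ip x y" "ip (c *s x) y = cnj c * ip x y"
  using assms by (auto simp: ip_sum[of _ d] sum_distrib_left mult_ac)

lemma ip_uminus:
  assumes "x \<in> carrier_vec d" "y \<in> carrier_vec d"
  shows "ip x (- y) = - ip x y" "ip (- x) y = - ip x y"
  using assms by (auto simp: ip_sum[of _ d] sum_negf)

lemma ip_zero [simp]: "x \<in> carrier_vec d ==> ip x (0\<^sub>v d) = 0" "x \<in> carrier_vec d ==> ip (0\<^sub>v d) x = 0"
  by (auto simp: ip_sum[of _ d] intro: V_index)

lemma ip_swap: "x \<in> carrier_vec d ==> y \<in> carrier_vec d ==> ip y x = cnj (ip x y)"
  by (auto simp: ip_sum[of _ d] mult.commute)

lemma ip_swap_0: "x \<in> carrier_vec d ==> y \<in> carrier_vec d ==> ip y x = 0 \<longleftrightarrow> ip x y = 0"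
  using ip_swap[of x d y] by auto

lemma ip_self: "x \<in> carrier_vec d ==> ip x x = of_real (\<Sum>i<d. (cmod (x $ i))\<^sup>2)"
  by (auto simp: ip_sum[of _ d] complex_norm_square mult.commute intro!: sum.cong
      simp del: of_real_power)

lemma ip_self_eq_0: "x \<in> carrier_vec d ==> ip x x = 0 \<longleftrightarrow> x = 0\<^sub>v d"
proof
  assume x: "x \<in> carrier_vec d" "ip x x = 0"
  have "complex_of_real (\<Sum>i<d. (cmod (x $ i))\<^sup>2) = 0"
    using x(2) unfolding ip_self[OF x(1)] .
  hence "(\<Sum>i<d. (cmod (x $ i))\<^sup>2) = 0" unfolding of_real_eq_0_iff .
  hence "\<forall>i<d. x $ i = 0" by (subst (asm) sum_nonneg_eq_0_iff) auto
  thus "x = 0\<^sub>v d" using x by (intro eq_vecI) auto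
qed auto

definition perp :: "nat => complex vec set => complex vec set" where
  "perp d U = {y \<in> V d. \<forall>x\<in>U. ip x y = 0}"

definition plus_sets :: "complex vec set => complex vec set => complex vec set" where
  "plus_sets U W = {u + v | u v. u \<in> U \<and> v \<in> W}"

lemma plus_setsI: "u \<in> U ==> w \<in> W ==> u + w \<in> plus_sets U W"
  by (auto simp: plus_sets_def)

lemma perp_D: "y \<in> perp d U ==> x \<in> U ==> ip x y = 0" "y \<in> perp d U ==> y \<in> V d"
  by (auto simp: perp_def)

lemma subspace_perp:
  assumes "U \<subseteq> V d"
  shows "subspace_over F d (perp d U)" unfolding subspace_over_def perp_def
  using assms by (auto intro!: V_add V_smult simp: ip_add[of _ d] ip_smult[of _ d] subset_iff)

lemma subspace_inter:
  "subspace_over F d U ==> subspace_over F d W ==> subspace_over F d (U \<inter> W)"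
  by (auto simp: subspace_over_def)

lemma subspace_plus:
  assumes "subspace_over F d U" "subspace_over F d W"
  shows "subspace_over F d (plus_sets U W)" unfolding subspace_over_def plus_sets_def
proof (intro conjI ballI subsetI)
  note U = subspaceD[OF assms(1)] and W = subspaceD[OF assms(2)]
  show "x \<in> V d" if "x \<in> {u + v |u v. u \<in> U \<and> v \<in> W}" for x
    using that U(1) W(1) by (auto intro!: V_add)
  show "0\<^sub>v d \<in> {u + v |u v. u \<in> U \<and> v \<in> W}"
    using U(2) W(2) by (force intro!: exI[of _ "0\<^sub>v d"])
  show "x + y \<in> {u + v |u v. u \<in> U \<and> v \<in> W}"
    if xy: "x \<in> {u + v |u v. u \<in> U \<and> v \<in> W}" "y \<in> {u + v |u v. u \<in> U \<and> v \<in> W}" for x y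
  proof -
    obtain u v u' v' where *: "x = u + v" "y = u' + v'" "u \<in> U" "u' \<in> U" "v \<in> W" "v' \<in> W"
      using xy by auto
    hence "dim_vec u = d" "dim_vec u' = d" "dim_vec v = d" "dim_vec v' = d"
      using V_dim[OF U(1)] V_dim[OF W(1)] by auto
    hence "x + y = (u + u') + (v + v')" using * by (intro eq_vecI) auto
    thus ?thesis using * U(3) W(3) by blast
  qed
  show "c *s x \<in> {u + v |u v. u \<in> U \<and> v \<in> W}"
    if c: "c \<in> F" and x: "x \<in> {u + v |u v. u \<in> U \<and> v \<in> W}" for c x
  proof -
    obtain u v where *: "x = u + v" "u \<in> U" "v \<in> W" using x by auto
    hence "c *s x = c *s u + c *s v"
      using V_carrier[OF U(1)] V_carrier[OF W(1)] by (auto intro: smult_add_distrib_vec)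
    thus ?thesis using * c U(4) W(4) by blast
  qed
qed

abbreviation L :: "nat => complex vec set ortholattice" where
  "L d \<equiv> subspace_lattice F d"

lemma L_simps [simp]:
  "carrier (L d) = {U. subspace_over F d U}"
  "ol_meet (L d) = (\<inter>)" "ol_join (L d) = plus_sets" "ol_neg (L d) = perp d"
  "ol_zero (L d) = {0\<^sub>v d}" "ol_one (L d) = V d"
  by (auto simp: subspace_lattice_def plus_sets_def perp_def fun_eq_iff)

lemma subspace_eval:
  assumes "\<forall>i. subspace_over F d (a i)"
  shows "subspace_over F d (eval_term (L d) a t)"
proof (induction t)
  case (Neg t)
  thus ?case by (auto intro!: subspace_perp subspaceD(1))
qed (use assms in \<open>auto intro: subspace_V subspace_0 subspace_inter subspace_plus\<close>)

definition comb :: "nat => nat => (nat => complex) => (nat => complex vec) => complex vec" where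
  "comb d n c b = vec d (\<lambda>j. \<Sum>i<n. c i * b i $ j)"

lemma comb_Suc:
  "b n \<in> carrier_vec d ==> comb d (Suc n) c b = comb d n c b + c n *s b n"
  by (auto simp: comb_def)

lemma comb_carrier [simp]: "comb d n c b \<in> carrier_vec d" by (auto simp: comb_def)

lemma comb_in:
  assumes U: "subspace_over F d U" and "\<And>i. i < n ==> c i \<in> F" "\<And>i. i < n ==> b i \<in> U"
  shows "comb d n c b \<in> U" using assms(2,3)
proof (induction n)
  case 0
  have "comb d 0 c b = 0\<^sub>v d" by (auto simp: comb_def)
  thus ?case using subspaceD(2)[OF U] by simp
next
  case (Suc n)
  thus ?case using subspaceD(1)[OF U, of "b n"] by (subst comb_Suc) (auto intro!: subspaceD[OF U])
qed

lemma ip_comb: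
  assumes "y \<in> carrier_vec d" "\<And>i. i < n ==> b i \<in> carrier_vec d"
  shows "ip y (comb d n c b) = (\<Sum>i<n. c i * ip y (b i))" using assms(2)
proof (induction n)
  case 0
  have "comb d 0 c b = 0\<^sub>v d" by (auto simp: comb_def)
  thus ?case using assms(1) by simp
next
  case (Suc n)
  thus ?case using assms(1) by (auto simp: comb_Suc ip_add[of _ d] ip_smult[of _ d])
qed

lemma linear_relation:
  assumes "finite I" "card I > n" "\<And>i j. i \<in> I ==> j < n ==> f i j \<in> F"
  shows "\<exists>c. (\<forall>i\<in>I. c i \<in> F) \<and> (\<exists>i\<in>I. c i \<noteq> 0) \<and> (\<forall>j<n. (\<Sum>i\<in>I. c i * f i j) = 0)"
  using assms
proof (induction n arbitrary: I f)
  case 0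
  hence "I \<noteq> {}" by auto
  thus ?case by (intro exI[of _ "\<lambda>_. 1"]) auto
next
  case (Suc n)
  show ?case
  proof (cases "\<forall>i\<in>I. f i n = 0")
    case True
    obtain c where "\<forall>i\<in>I. c i \<in> F" "\<exists>i\<in>I. c i \<noteq> 0" "\<forall>j<n. (\<Sum>i\<in>I. c i * f i j) = 0"
      using Suc.IH[of I f] Suc.prems by auto
    with True show ?thesis by (intro exI[of _ c]) (auto simp: less_Suc_eq)
  next
    case False
    then obtain p where p: "p \<in> I" "f p n \<noteq> 0" by blast
    define g where "g i j = f i j - f i n / f p n * f p j" for i j
    have g: "g i j \<in> F" if "i \<in> I" "j < n" for i j
      using that p Suc.prems(3) unfolding g_def by (intro F_diff F_mult F_divide) auto
    have "card (I - {p}) > n" using Suc.prems p by simp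
    then obtain c where c: "\<forall>i\<in>I - {p}. c i \<in> F" "\<exists>i\<in>I - {p}. c i \<noteq> 0"
      "\<forall>j<n. (\<Sum>i\<in>I - {p}. c i * g i j) = 0"
      using Suc.IH[of "I - {p}" g] Suc.prems g by auto
    define e where "e = - (\<Sum>i\<in>I - {p}. c i * (f i n / f p n))"
    have e: "e \<in> F"
      unfolding e_def using c(1) p Suc.prems(3) by (intro F_uminus F_sum F_mult F_divide) auto
    have "(\<Sum>i\<in>I. (c(p := e)) i * f i j) = 0" if "j < Suc n" for j
    proof -
      have "(\<Sum>i\<in>I. (c(p := e)) i * f i j) = e * f p j + (\<Sum>i\<in>I - {p}. c i * f i j)"
        using Suc.prems(1) p by (subst sum.remove[of _ p]) auto
      also have "... = (\<Sum>i\<in>I - {p}. c i * g i j)" unfolding e_def g_def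
        by (simp add: sum_distrib_right right_diff_distrib sum_subtractf mult.assoc)
      also have "... = 0" using c(3) that p(2) by (cases "j = n") (auto simp: g_def)
      finally show ?thesis .
    qed
    thus ?thesis using c e by (intro exI[of _ "c(p := e)"]) auto
  qed
qed

definition orthogonal_family :: "nat => complex vec set => nat => (nat => complex vec) => bool" where
  "orthogonal_family d U n b \<longleftrightarrow> (\<forall>i<n. b i \<in> U \<and> b i \<noteq> 0\<^sub>v d) \<and>
     (\<forall>i<n. \<forall>j<n. i \<noteq> j --> ip (b i) (b j) = 0)"

lemma orthogonal_family_le:
  assumes "orthogonal_family d U n b" "subspace_over F d U"
  shows "n \<le> d"
proof (rule ccontr)
  assume "\<not> n \<le> d"
  have b: "b i \<in> V d" "b i \<noteq> 0\<^sub>v d" if "i < n" for i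
    using assms subspaceD(1)[OF assms(2)] that by (auto simp: orthogonal_family_def)
  obtain c where c: "\<exists>i<n. c i \<noteq> 0" "\<forall>j<d. (\<Sum>i<n. c i * b i $ j) = 0"
    using linear_relation[of "{..<n}" d "\<lambda>i j. b i $ j"] `\<not> n \<le> d` V_index[OF b(1)]
    by (auto simp: Bex_def)
  have "comb d n c b = 0\<^sub>v d" using c(2) by (auto simp: comb_def)
  obtain k where k: "k < n" "c k \<noteq> 0" using c by blast
  have "0 = ip (b k) (comb d n c b)" using b k by (simp add: `comb d n c b = 0\<^sub>v d`)
  also have "... = (\<Sum>i<n. c i * ip (b k) (b i))" using b k by (intro ip_comb) auto
  also have "... = (\<Sum>i<n. if i = k then c k * ip (b k) (b k) else 0)"
    using k assms(1) by (intro sum.cong) (auto simp: orthogonal_family_def)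
  also have "... = c k * ip (b k) (b k)" using k by simp
  finally show False using k b[of k] ip_self_eq_0[of "b k" d] by auto
qed

definition project :: "nat => nat => (nat => complex vec) => complex vec => complex vec" where
  "project d n b v = comb d n (\<lambda>i. ip (b i) v / ip (b i) (b i)) b"

lemma project_residue:
  assumes "orthogonal_family d U n b" "subspace_over F d U" "v \<in> V d" "i < n"
  shows "ip (b i) (v - project d n b v) = 0"
proof -
  have b: "b i \<in> V d" "b i \<noteq> 0\<^sub>v d" if "i < n" for i
    using assms subspaceD(1)[OF assms(2)] that by (auto simp: orthogonal_family_def)
  have "ip (b i) (project d n b v) = (\<Sum>j<n. ip (b j) v / ip (b j) (b j) * ip (b i) (b j))"
    unfolding project_def using b assms(4) by (intro ip_comb) auto
  also have "... = (\<Sum>j<n. if j = i then ip (b i) v else 0)"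
    using b assms(1,4) by (intro sum.cong) (auto simp: orthogonal_family_def ip_self_eq_0[of _ d])
  also have "... = ip (b i) v" using assms(4) by simp
  finally show ?thesis using assms(3,4) b by (subst ip_diff[of _ d]) (auto simp: project_def)
qed

lemma project_in:
  assumes "orthogonal_family d U n b" "subspace_over F d U" "v \<in> V d"
  shows "project d n b v \<in> U" unfolding project_def using assms subspaceD(1)[OF assms(2)]
  by (intro comb_in) (auto simp: orthogonal_family_def intro!: F_divide ip_in[of _ d])

lemma ex_orthogonal_basis:
  assumes U: "subspace_over F d U"
  shows "\<exists>n b. orthogonal_family d U n b \<and> (\<forall>x\<in>U. x = project d n b x)"
proof -
  define P where "P n \<longleftrightarrow> (\<exists>b. orthogonal_family d U n b)" for n
  have "P 0" by (auto simp: P_def orthogonal_family_def)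
  moreover have "\<forall>n. P n --> n \<le> d"
    using orthogonal_family_le[OF _ U] by (auto simp: P_def)
  ultimately have "P (GREATEST n. P n)" and max: "\<And>n. P n ==> n \<le> (GREATEST n. P n)"
    using GreatestI_nat[of P 0 d] Greatest_le_nat[of P _ d] by blast+
  define n where "n = (GREATEST n. P n)"
  obtain b where b: "orthogonal_family d U n b"
    using `P (GREATEST n. P n)` by (auto simp: P_def n_def)
  have bV: "b i \<in> V d" if "i < n" for i
    using b subspaceD(1)[OF U] that by (auto simp: orthogonal_family_def)
  have "x = project d n b x" if x: "x \<in> U" for x
  proof (rule ccontr)
    assume ne: "x \<noteq> project d n b x"
    define y where "y = x - project d n b x"
    have xV: "x \<in> V d" and pV: "project d n b x \<in> V d"
      using x project_in[OF b U] subspaceD(1)[OF U] by auto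
    have y: "y \<in> U"
      unfolding y_def using x xV project_in[OF b U] by (intro subspace_diff[OF U]) auto
    have "y \<noteq> 0\<^sub>v d"
    proof
      assume "y = 0\<^sub>v d"
      have "x = project d n b x + y" using xV pV unfolding y_def by (intro eq_vecI) auto
      with `y = 0\<^sub>v d` ne pV show False by (metis V_carrier right_zero_vec)
    qed
    moreover have "ip (b i) y = 0" "ip y (b i) = 0" if "i < n" for i
    proof -
      show "ip (b i) y = 0" unfolding y_def by (rule project_residue[OF b U xV that])
      thus "ip y (b i) = 0" using ip_swap_0[of y d "b i"] bV[OF that] subspaceD(1)[OF U y] by simp
    qed
    ultimately have "orthogonal_family d U (Suc n) (b(n := y))"
      using b y by (auto simp: orthogonal_family_def less_Suc_eq)
    hence "P (Suc n)" by (auto simp: P_def)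
    from max[OF this] show False by (simp add: n_def)
  qed
  with b show ?thesis by blast
qed

lemma orthogonal_decomposition:
  assumes U: "subspace_over F d U" and v: "v \<in> V d"
  shows "\<exists>u\<in>U. \<exists>w\<in>perp d U. v = u + w"
proof -
  obtain n b where b: "orthogonal_family d U n b" "\<forall>x\<in>U. x = project d n b x"
    using ex_orthogonal_basis[OF U] by blast
  let ?u = "project d n b v"
  have u: "?u \<in> U" by (rule project_in[OF b(1) U v])
  hence uV: "?u \<in> V d" by (rule subspaceD(1)[OF U])
  have bV: "b i \<in> V d" if "i < n" for i
    using b subspaceD(1)[OF U] that by (auto simp: orthogonal_family_def)
  have w: "v - ?u \<in> V d" using v uV by (intro V_diff)
  have "ip x (v - ?u) = 0" if "x \<in> U" for x
  proof -
    have "ip (v - ?u) (b i) = 0" if "i < n" for i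
      using project_residue[OF b(1) U v that] ip_swap_0[of "v - ?u" d "b i"] w bV[OF that] by simp
    moreover have "ip (v - ?u) (project d n b x) =
        (\<Sum>i<n. ip (b i) x / ip (b i) (b i) * ip (v - ?u) (b i))"
      unfolding project_def[of d n b x] using w bV by (intro ip_comb) auto
    ultimately have "ip (v - ?u) (project d n b x) = 0" by simp
    hence "ip (v - ?u) x = 0" using b(2) that by simp
    thus ?thesis using ip_swap_0[of "v - ?u" d x] w subspaceD(1)[OF U that] by simp
  qed
  hence "v - ?u \<in> perp d U" using w by (auto simp: perp_def)
  moreover have "v = ?u + (v - ?u)" using v uV by (intro eq_vecI) auto
  ultimately show ?thesis using u by blast
qed

lemma inter_perp: "U \<subseteq> V d ==> x \<in> U ==> x \<in> perp d U ==> x = 0\<^sub>v d"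
  using ip_self_eq_0[of x d] by (auto simp: perp_def)

lemma perp_perp:
  assumes U: "subspace_over F d U"
  shows "perp d (perp d U) = U"
proof
  have UV: "U \<subseteq> V d" using subspaceD(1)[OF U] by blast
  show "U \<subseteq> perp d (perp d U)"
  proof
    fix x assume x: "x \<in> U"
    have "ip y x = 0" if "y \<in> perp d U" for y
      using ip_swap_0[of x d y] perp_D[OF that] x UV by (auto simp: subset_iff)
    thus "x \<in> perp d (perp d U)" using x UV by (auto simp: perp_def)
  qed
  show "perp d (perp d U) \<subseteq> U"
  proof
    fix x assume x: "x \<in> perp d (perp d U)"
    obtain u w where uw: "u \<in> U" "w \<in> perp d U" "x = u + w"
      using orthogonal_decomposition[OF U perp_D(2)[OF x]] by blast
    have V: "u \<in> V d" "w \<in> V d" using uw UV perp_D(2) by auto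
    have "ip w u = 0" using ip_swap_0[of u d w] perp_D(1)[OF uw(2,1)] V by simp
    moreover have "ip w x = 0" using perp_D(1)[OF x uw(2)] .
    ultimately have "ip w w = 0" using V uw(3) by (simp add: ip_add[of _ d])
    hence "w = 0\<^sub>v d" using ip_self_eq_0[of w d] V by simp
    thus "x \<in> U" using uw V by simp
  qed
qed

lemma perp_plus:
  assumes "subspace_over F d U" "subspace_over F d W"
  shows "perp d (plus_sets U W) = perp d U \<inter> perp d W"
proof
  note U = subspaceD[OF assms(1)] and W = subspaceD[OF assms(2)]
  have "U \<subseteq> plus_sets U W" "W \<subseteq> plus_sets U W"
  proof safe
    fix x assume "x \<in> U"
    thus "x \<in> plus_sets U W" using plus_setsI[of x U "0\<^sub>v d" W] U(1)[of x] W(2) by simp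
  next
    fix x assume "x \<in> W"
    thus "x \<in> plus_sets U W" using plus_setsI[of "0\<^sub>v d" U x W] W(1)[of x] U(2) by simp
  qed
  thus "perp d (plus_sets U W) \<subseteq> perp d U \<inter> perp d W" by (auto simp: perp_def)
  show "perp d U \<inter> perp d W \<subseteq> perp d (plus_sets U W)"
    using U(1) W(1) by (auto simp: perp_def plus_sets_def ip_add[of _ d] subset_iff)
qed

lemma perp_inter:
  assumes U: "subspace_over F d U" and W: "subspace_over F d W"
  shows "perp d (U \<inter> W) = plus_sets (perp d U) (perp d W)"
proof -
  have P: "subspace_over F d (perp d U)" "subspace_over F d (perp d W)"
    by (rule subspace_perp, rule subsetI, erule subspaceD(1)[OF U])
       (rule subspace_perp, rule subsetI, erule subspaceD(1)[OF W])
  have "perp d (plus_sets (perp d U) (perp d W)) = U \<inter> W"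
    unfolding perp_plus[OF P] perp_perp[OF U] perp_perp[OF W] ..
  hence "perp d (U \<inter> W) = perp d (perp d (plus_sets (perp d U) (perp d W)))"
    by (rule arg_cong[OF sym])
  also have "... = plus_sets (perp d U) (perp d W)" by (rule perp_perp[OF subspace_plus[OF P]])
  finally show ?thesis .
qed

lemma perp_0: "perp d {0\<^sub>v d} = V d"
proof -
  have "ip (0\<^sub>v d) y = 0" if "y \<in> V d" for y by (rule ip_zero(2)[OF V_carrier[OF that]])
  thus ?thesis unfolding perp_def by blast
qed

lemma perp_V: "perp d (V d) = {0\<^sub>v d}"
proof
  show "perp d (V d) \<subseteq> {0\<^sub>v d}"
  proof
    fix x assume "x \<in> perp d (V d)"
    from inter_perp[OF order_refl perp_D(2)[OF this] this] show "x \<in> {0\<^sub>v d}" by simp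
  qed
  have "ip y (0\<^sub>v d) = 0" if "y \<in> V d" for y by (rule ip_zero(1)[OF V_carrier[OF that]])
  thus "{0\<^sub>v d} \<subseteq> perp d (V d)" unfolding perp_def using V_zero by blast
qed

end

section \<open>From Boolean satisfiability to ortholattices\<close>

primrec rename :: "(nat => nat) => ol_term => ol_term" where
  "rename f (Var i) = Var (f i)"
| "rename f Zero = Zero"
| "rename f One = One"
| "rename f (Neg t) = Neg (rename f t)"
| "rename f (Meet s t) = Meet (rename f s) (rename f t)"
| "rename f (Join s t) = Join (rename f s) (rename f t)"

lemma eval_rename: "eval_term L a (rename f t) = eval_term L (\<lambda>i. a (f i)) t"
  by (induction t) auto

primrec term_pieces :: "(nat => piece list) => ol_term => piece list" where
  "term_pieces p (Var i) = Const [False, False, False] # p i"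
| "term_pieces p Zero = [Const [False, False, True]]"
| "term_pieces p One = [Const [False, True, False]]"
| "term_pieces p (Neg t) = Const [False, True, True] # term_pieces p t"
| "term_pieces p (Meet s t) = Const [True, False, False] # term_pieces p s @ term_pieces p t"
| "term_pieces p (Join s t) = Const [True, False, True] # term_pieces p s @ term_pieces p t"

lemma fills_Cons: "fills v (p # ps) = fill v p @ fills v ps"
  and fills_append: "fills v (ps @ qs) = fills v ps @ fills v qs"
  and fills_Nil: "fills v [] = []" by (auto simp: fills_def)

lemma fills_term_pieces:
  "(\<And>i. fills v (p i) = enc_nat (f i)) ==> fills v (term_pieces p t) = enc_term (rename f t)"
  by (induction t) (auto simp: fills_Cons fills_append fills_Nil)

lemma Hole_term_pieces: "Hole r \<in> set (term_pieces p t) ==> \<exists>i. Hole r \<in> set (p i)"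
  by (induction t) auto

definition meets :: "ol_term list => ol_term => ol_term" where
  "meets cs t = foldr Meet cs t"

lemma meets_simps: "meets [] t = t" "meets (c # cs) t = Meet c (meets cs t)"
  by (auto simp: meets_def)

lemma enc_meets:
  "enc_term (meets cs t) = concat (map (\<lambda>c. [True, False, False] @ enc_term c) cs) @ enc_term t"
  by (induction cs) (auto simp: meets_simps)

lemma meets_append: "meets (cs @ ds) t = meets cs (meets ds t)" by (simp add: meets_def)

definition pairs :: "'a list => ('a \<times> 'a) list" where
  "pairs xs = concat (map (\<lambda>a. map (Pair a) xs) xs)"

lemma set_pairs [simp]: "set (pairs xs) = set xs \<times> set xs" by (auto simp: pairs_def)

lemma concat_pairs:
  "concat (map (\<lambda>a. concat (map (f a) xs)) xs) = concat (map (\<lambda>(a, b). f a b) (pairs xs))"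
proof -
  have "concat (map (\<lambda>a. concat (map (f a) ys)) xs) =
      concat (map (\<lambda>(a, b). f a b) (concat (map (\<lambda>a. map (Pair a) ys) xs)))" for ys
    by (induction xs) (auto simp: comp_def)
  thus ?thesis by (simp add: pairs_def)
qed

lemma pairs_map: "pairs (map f xs) = map (\<lambda>(a, b). (f a, f b)) (pairs xs)"
  by (simp add: pairs_def map_concat comp_def)

definition pick :: "nat \<times> nat => nat => nat" where
  "pick = (\<lambda>(i, j) k. if k = 0 then i else j)"

definition commutes_term :: ol_term where
  "commutes_term =
     Join (Join (Meet (Var 0) (Var 1)) (Meet (Var 0) (Neg (Var 1))))
          (Join (Meet (Neg (Var 0)) (Var 1)) (Meet (Neg (Var 0)) (Neg (Var 1))))"

definition commuting_term :: "ol_term => ol_term" where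
  "commuting_term t = meets (map (\<lambda>p. rename (pick p) commutes_term) (pairs (term_vars t))) t"

abbreviation eval_bool :: "(nat => bool) => ol_term => bool" where
  "eval_bool \<equiv> eval_term bool_ortholattice"

lemma bool_simps [simp]:
  "carrier bool_ortholattice = UNIV" "ol_meet bool_ortholattice = (\<and>)"
  "ol_join bool_ortholattice = (\<or>)" "ol_neg bool_ortholattice = Not"
  "ol_zero bool_ortholattice = False" "ol_one bool_ortholattice = True"
  by (auto simp: bool_ortholattice_def)

lemma eval_bool_commuting_term: "eval_bool a t ==> eval_bool a (commuting_term t)"
proof -
  assume t: "eval_bool a t"
  have "eval_bool a (rename f commutes_term)" for f by (auto simp: eval_rename commutes_term_def)
  hence "eval_bool a (meets (map (\<lambda>p. rename (pick p) commutes_term) ps) t)" for ps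
    by (induction ps) (auto simp: meets_simps t)
  thus ?thesis by (simp add: commuting_term_def)
qed

context star_field
begin

lemma plus_V: "subspace_over F d W ==> plus_sets (V d) W = V d"
  "subspace_over F d W ==> plus_sets W (V d) = V d"
proof -
  assume W: "subspace_over F d W"
  note sub = subspaceD[OF W]
  show "plus_sets (V d) W = V d"
  proof
    show "plus_sets (V d) W \<subseteq> V d"
      using subspaceD(1)[OF subspace_plus[OF subspace_V W]] by blast
    show "V d \<subseteq> plus_sets (V d) W"
    proof
      fix v assume "v \<in> V d"
      thus "v \<in> plus_sets (V d) W" using plus_setsI[of v "V d" "0\<^sub>v d" W] sub(2) by simp
    qed
  qed
  show "plus_sets W (V d) = V d"
  proof
    show "plus_sets W (V d) \<subseteq> V d"
      using subspaceD(1)[OF subspace_plus[OF W subspace_V]] by blast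
    show "V d \<subseteq> plus_sets W (V d)"
    proof
      fix v assume "v \<in> V d"
      thus "v \<in> plus_sets W (V d)" using plus_setsI[of "0\<^sub>v d" W v "V d"] sub(2) by simp
    qed
  qed
qed

lemma plus_0: "plus_sets {0\<^sub>v d} {0\<^sub>v d} = {0\<^sub>v d}" by (auto simp: plus_sets_def)

lemma eval_two_valued:
  "eval_term (L d) (\<lambda>i. if a i then V d else {0\<^sub>v d}) t = (if eval_bool a t then V d else {0\<^sub>v d})"
  by (induction t) (auto simp: plus_V plus_0 subspace_V subspace_0 perp_0 perp_V)

lemma eval_meets:
  assumes "\<forall>i. subspace_over F d (a i)"
  shows "eval_term (L d) a (meets cs t) = V d \<longleftrightarrow>
     (\<forall>c\<in>set cs. eval_term (L d) a c = V d) \<and> eval_term (L d) a t = V d"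
proof (induction cs)
  case (Cons c cs)
  have "eval_term (L d) a u \<subseteq> V d" for u
    using subspaceD(1)[OF subspace_eval[OF assms]] by blast
  hence "eval_term (L d) a c \<inter> eval_term (L d) a (meets cs t) = V d \<longleftrightarrow>
      eval_term (L d) a c = V d \<and> eval_term (L d) a (meets cs t) = V d" by blast
  thus ?case using Cons by (simp add: meets_simps)
qed (simp add: meets_simps)

definition decided :: "nat => complex vec => complex vec set => bool" where
  "decided d v U \<longleftrightarrow> v \<in> U \<or> v \<in> perp d U"

lemma eval_decided:
  assumes a: "\<forall>i. subspace_over F d (a i)" and v: "v \<in> V d" "v \<noteq> 0\<^sub>v d"
    and dec: "\<forall>i\<in>set (term_vars t). decided d v (a i)"
  shows "decided d v (eval_term (L d) a t) \<and>
    (v \<in> eval_term (L d) a t \<longleftrightarrow> eval_bool (\<lambda>i. v \<in> a i) t)"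
  using dec
proof (induction t)
  case Zero
  thus ?case using v by (auto simp: decided_def perp_0)
next
  case One
  thus ?case using v by (auto simp: decided_def)
next
  case (Neg t)
  let ?U = "eval_term (L d) a t"
  have U: "subspace_over F d ?U" by (rule subspace_eval[OF a])
  have "v \<notin> ?U \<or> v \<notin> perp d ?U"
    using inter_perp[of ?U d v] subspaceD(1)[OF U] v by blast
  thus ?case using Neg perp_perp[OF U] by (auto simp: decided_def)
next
  case (Meet s t)
  let ?U = "eval_term (L d) a s" and ?W = "eval_term (L d) a t"
  have U: "subspace_over F d ?U" "subspace_over F d ?W" by (rule subspace_eval[OF a])+
  have "perp d ?U \<subseteq> perp d (?U \<inter> ?W)" "perp d ?W \<subseteq> perp d (?U \<inter> ?W)"
    by (auto simp: perp_def)
  thus ?case using Meet by (auto simp: decided_def)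
next
  case (Join s t)
  let ?U = "eval_term (L d) a s" and ?W = "eval_term (L d) a t"
  have U: "subspace_over F d ?U" "subspace_over F d ?W" by (rule subspace_eval[OF a])+
  have dec: "decided d v ?U" "decided d v ?W" using Join by auto
  have 1: "v \<in> plus_sets ?U ?W" if "v \<in> ?U \<or> v \<in> ?W"
    using that plus_setsI[of v ?U "0\<^sub>v d" ?W] plus_setsI[of "0\<^sub>v d" ?U v ?W]
      subspaceD(2)[OF U(1)] subspaceD(2)[OF U(2)] v by auto
  have 2: "v \<in> perp d (plus_sets ?U ?W)" if "\<not> (v \<in> ?U \<or> v \<in> ?W)"
    using that dec by (auto simp: perp_plus[OF U] decided_def)
  have 3: "v \<notin> plus_sets ?U ?W" if "v \<in> perp d (plus_sets ?U ?W)"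
    using that inter_perp[of "plus_sets ?U ?W" d v] v
      subspaceD(1)[OF subspace_plus[OF U]] by blast
  show ?case using Join 1 2 3 by (auto simp: decided_def)
qed auto

lemma add_eq_0_vec:
  fixes p q :: "complex vec"
  assumes "p \<in> carrier_vec d" "q \<in> carrier_vec d" "p + q = 0\<^sub>v d"
  shows "p = - q"
proof (rule eq_vecI)
  fix i assume i: "i < dim_vec (- q)"
  have "(p + q) $ i = 0\<^sub>v d $ i" using assms(3) by simp
  thus "p $ i = (- q) $ i" using i assms(1,2) by (simp add: eq_neg_iff_add_eq_0)
qed (use assms in auto)

lemma commutes_D:
  assumes U: "subspace_over F d U" and W: "subspace_over F d W"
    and comm: "plus_sets (plus_sets (U \<inter> W) (U \<inter> perp d W))
        (plus_sets (perp d U \<inter> W) (perp d U \<inter> perp d W)) = V d"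
    and v: "v \<in> V d" "decided d v U"
  shows "\<exists>p\<in>W. \<exists>q\<in>perp d W. v = p + q \<and> ((v \<in> U --> p \<in> U \<and> q \<in> U) \<and>
    (v \<in> perp d U --> p \<in> perp d U \<and> q \<in> perp d U))"
proof -
  have U': "subspace_over F d (perp d U)" and W': "subspace_over F d (perp d W)"
    using subspaceD(1)[OF U] subspaceD(1)[OF W] by (auto intro!: subspace_perp)
  obtain p1 q1 p2 q2 where pq: "p1 \<in> U" "p1 \<in> W" "q1 \<in> U" "q1 \<in> perp d W" "p2 \<in> perp d U" "p2 \<in> W"
    "q2 \<in> perp d U" "q2 \<in> perp d W" "v = (p1 + q1) + (p2 + q2)"
    using v(1) unfolding comm[symmetric] plus_sets_def by blast
  have V: "p1 \<in> V d" "q1 \<in> V d" "p2 \<in> V d" "q2 \<in> V d"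
    using pq subspaceD(1)[OF U] perp_D(2) by auto
  hence dims: "dim_vec p1 = d" "dim_vec q1 = d" "dim_vec p2 = d" "dim_vec q2 = d" "dim_vec v = d"
    using v(1) by auto
  have zero: "x = 0\<^sub>v d" if "x \<in> U" "x \<in> perp d U" for x
    using inter_perp[of U d x] that subspaceD(1)[OF U] by blast
  have s1: "p1 + q1 \<in> U" and s2: "p2 + q2 \<in> perp d U"
    using pq subspaceD(3)[OF U] subspaceD(3)[OF U'] by auto
  show ?thesis using v(2) unfolding decided_def
  proof
    assume vU: "v \<in> U"
    have "p2 + q2 = v - (p1 + q1)" using dims pq(9) by (intro eq_vecI) auto
    hence "p2 + q2 \<in> U" using subspace_diff[OF U vU s1] by simp
    hence z: "p2 + q2 = 0\<^sub>v d" using zero s2 by blast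
    hence ve: "v = p1 + q1" using pq(9) V by simp
    have "p1 \<in> perp d U \<and> q1 \<in> perp d U" if "v \<in> perp d U"
    proof -
      have "v = 0\<^sub>v d" using zero vU that by blast
      hence "p1 = - q1" using ve V by (intro add_eq_0_vec[of p1 d q1]) auto
      hence "p1 \<in> perp d W" using subspace_uminus[OF W' pq(4)] by simp
      hence "p1 = 0\<^sub>v d" using inter_perp[of W d p1] pq(2) subspaceD(1)[OF W] by blast
      moreover from this have "q1 = 0\<^sub>v d" using `v = 0\<^sub>v d` ve V by simp
      ultimately show ?thesis using subspaceD(2)[OF U'] by simp
    qed
    thus ?thesis using ve pq by blast
  next
    assume vU: "v \<in> perp d U"
    have "p1 + q1 = v - (p2 + q2)" using dims pq(9) by (intro eq_vecI) auto
    hence "p1 + q1 \<in> perp d U" using subspace_diff[OF U' vU s2] by simp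
    hence z: "p1 + q1 = 0\<^sub>v d" using zero s1 by blast
    hence ve: "v = p2 + q2" using pq(9) V by simp
    have "p2 \<in> U \<and> q2 \<in> U" if "v \<in> U"
    proof -
      have "v = 0\<^sub>v d" using zero vU that by blast
      hence "p2 = - q2" using ve V by (intro add_eq_0_vec[of p2 d q2]) auto
      hence "p2 \<in> perp d W" using subspace_uminus[OF W' pq(8)] by simp
      hence "p2 = 0\<^sub>v d" using inter_perp[of W d p2] pq(6) subspaceD(1)[OF W] by blast
      moreover from this have "q2 = 0\<^sub>v d" using `v = 0\<^sub>v d` ve V by simp
      ultimately show ?thesis using subspaceD(2)[OF U] by simp
    qed
    thus ?thesis using ve pq by blast
  qed
qed

lemma unique_decomposition:
  assumes W: "subspace_over F d W"
    and "p \<in> W" "p' \<in> W" "q \<in> perp d W" "q' \<in> perp d W" "p + q = p' + q'"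
  shows "p = p'" "q = q'"
proof -
  have W': "subspace_over F d (perp d W)" using subspaceD(1)[OF W] by (auto intro!: subspace_perp)
  have dims: "dim_vec p = d" "dim_vec q = d" "dim_vec p' = d" "dim_vec q' = d"
    using assms subspaceD(1)[OF W] subspaceD(1)[OF W'] by auto
  have "(p + q) $ i = (p' + q') $ i" for i using assms(6) by simp
  hence eq: "p $ i + q $ i = p' $ i + q' $ i" if "i < d" for i
    using that dims by (metis index_add_vec(1))
  have "p - p' = q' - q" using dims eq by (intro eq_vecI) (auto simp: algebra_simps)
  hence "p - p' \<in> perp d W" using subspace_diff[OF W' assms(5,4)] by simp
  moreover have "p - p' \<in> W" using assms by (intro subspace_diff[OF W])
  ultimately have z: "p - p' = 0\<^sub>v d" using inter_perp[of W d] subspaceD(1)[OF W] by blast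
  hence "(p - p') $ i = 0" if "i < d" for i using that by simp
  hence eq': "p $ i = p' $ i" if "i < d" for i
    using that dims by (metis eq_iff_diff_eq_0 index_minus_vec(1))
  thus "p = p'" using dims by (intro eq_vecI) auto
  show "q = q'" using dims eq eq' by (intro eq_vecI) (auto simp: algebra_simps)
qed

lemma ex_decided:
  assumes a: "\<forall>i. subspace_over F d (a i)" and d: "d \<ge> 1"
    and comm: "\<forall>i\<in>set is. \<forall>j\<in>set is. eval_term (L d) a (rename (pick (i, j)) commutes_term) = V d"
  shows "\<exists>v\<in>V d. v \<noteq> 0\<^sub>v d \<and> (\<forall>i\<in>set is. decided d v (a i))"
  using comm
proof (induction "is")
  case Nil
  have "unit_vec d 0 \<in> V d" by (auto intro!: V_I simp: unit_vec_def)
  moreover have "unit_vec d 0 \<noteq> (0\<^sub>v d :: complex vec)"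
    using d by (auto dest!: arg_cong[of _ _ "\<lambda>w. w $ 0"])
  ultimately show ?case by auto
next
  case (Cons j js)
  then obtain v where v: "v \<in> V d" "v \<noteq> 0\<^sub>v d" "\<forall>i\<in>set js. decided d v (a i)"
    by auto
  have sub: "subspace_over F d (a i)" for i using a by simp
  have comm: "plus_sets (plus_sets (a i \<inter> a j) (a i \<inter> perp d (a j)))
        (plus_sets (perp d (a i) \<inter> a j) (perp d (a i) \<inter> perp d (a j))) = V d"
    if "i \<in> set (j # js)" for i
    using Cons.prems that unfolding eval_rename by (auto simp: commutes_term_def pick_def)
  obtain p q where pq: "p \<in> a j" "q \<in> perp d (a j)" "v = p + q"
    using orthogonal_decomposition[OF sub v(1)] by blast
  have pqV: "p \<in> V d" "q \<in> V d" using pq subspaceD(1)[OF sub] perp_D(2) by auto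
  have split: "decided d p (a i) \<and> decided d q (a i)" if "i \<in> set js" for i
  proof -
    have "i \<in> set (j # js)" "decided d v (a i)" using that v(3) by auto
    from commutes_D[OF sub sub comm[OF this(1)] v(1) this(2)]
    obtain p' q' where "p' \<in> a j" "q' \<in> perp d (a j)" "v = p' + q'"
      "(v \<in> a i --> p' \<in> a i \<and> q' \<in> a i) \<and> (v \<in> perp d (a i) --> p' \<in> perp d (a i) \<and> q' \<in> perp d (a i))"
      by blast
    moreover from this have "p = p'" "q = q'"
      using unique_decomposition[OF sub[of j], of p p' q q'] pq by auto
    ultimately show ?thesis using v(3) that by (auto simp: decided_def)
  qed
  show ?case
  proof (cases "p = 0\<^sub>v d")
    case True
    hence "v = q" using pq pqV by simp
    thus ?thesis using v pq split by (intro bexI[of _ v]) (auto simp: decided_def)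
  next
    case False
    thus ?thesis using pq pqV split by (intro bexI[of _ p]) (auto simp: decided_def)
  qed
qed

lemma commuting_term_sat:
  "t \<in> sat_terms bool_ortholattice \<longleftrightarrow>
   commuting_term t \<in> (\<Union>d\<in>{1..}. sat_terms (subspace_lattice F d))"
proof
  assume "t \<in> sat_terms bool_ortholattice"
  then obtain a where "eval_bool a t" by (auto simp: sat_terms_def)
  hence "eval_bool a (commuting_term t)" by (rule eval_bool_commuting_term)
  hence "eval_term (L 1) (\<lambda>i. if a i then V 1 else {0\<^sub>v 1}) (commuting_term t) = V 1"
    by (simp only: eval_two_valued if_True)
  hence "commuting_term t \<in> sat_terms (L 1)"
    unfolding sat_terms_def using subspace_V[of 1] subspace_0[of 1]
    by (intro CollectI exI[of _ "\<lambda>i. if a i then V 1 else {0\<^sub>v 1}"]) auto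
  thus "commuting_term t \<in> (\<Union>d\<in>{1..}. sat_terms (subspace_lattice F d))" by blast
next
  assume "commuting_term t \<in> (\<Union>d\<in>{1..}. sat_terms (subspace_lattice F d))"
  then obtain d a where d: "d \<ge> 1" and a: "\<forall>i. subspace_over F d (a i)"
    and e: "eval_term (L d) a (commuting_term t) = V d" by (auto simp: sat_terms_def)
  have comm: "eval_term (L d) a (rename (pick (i, j)) commutes_term) = V d"
    if "i \<in> set (term_vars t)" "j \<in> set (term_vars t)" for i j
    using e that unfolding commuting_term_def eval_meets[OF a] by auto
  have t: "eval_term (L d) a t = V d" using e unfolding commuting_term_def eval_meets[OF a] by auto
  obtain v where v: "v \<in> V d" "v \<noteq> 0\<^sub>v d" "\<forall>i\<in>set (term_vars t). decided d v (a i)"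
    using ex_decided[OF a d, of "term_vars t"] comm by blast
  hence "eval_bool (\<lambda>i. v \<in> a i) t" using eval_decided[OF a v] t by simp
  thus "t \<in> sat_terms bool_ortholattice" by (auto simp: sat_terms_def)
qed

end

lemma transduce_id: "transduce d (\<lambda>_ b. [b]) x = x"
proof -
  have "snd (foldl (\<lambda>(q, o') b. (d q b, o' @ [b])) s x) = snd s @ x" for s
    by (induction x arbitrary: s) (auto split: prod.splits)
  from this[of "(0, [])"] show ?thesis by (simp add: transduce_def)
qed

lemma inj_enc_term: "enc_term t = enc_term u \<longleftrightarrow> t = u"
  using prefix_code_inj[OF prefix_code_enc_term] by (auto dest: injD)

theorem SAT_reducible_SAT_L:
  assumes "star_subfield F"
  shows "SAT \<le>\<^sub>p SAT_L F"
proof -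
  interpret star_field F by unfold_locales (rule assms)
  define ps where "ps = Const [True, False, False] #
     term_pieces (\<lambda>k. [Hole (if k = 0 then 2 else 4)]) commutes_term"
  define f where "f x = (if accepted term_delta term_count 9 x
     then [] @ concat (map (\<lambda>a. concat (map (\<lambda>b. fills (holes a b) ps)
         (occs term_delta term_store term_fin x))) (occs term_delta term_store term_fin x)) @
       concat (map (\<lambda>tab. transduce term_delta tab x) [\<lambda>_ b. [b]])
     else enc_term Zero)" for x
  have "Hole r \<in> set ps ==> r = 2 \<or> r = 4" for r
    unfolding ps_def by (auto dest!: Hole_term_pieces split: if_splits)
  hence "poly_time f" unfolding f_def
    by (intro poly_time_scan[of 10]) (auto simp: term_delta_less term_count_def)
  moreover have "x \<in> SAT \<longleftrightarrow> f x \<in> SAT_L F" for x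
  proof (cases "x \<in> range enc_term")
    case True
    then obtain t where x: "x = enc_term t" by blast
    have ps: "fills (holes (enc_nat i) (enc_nat j)) ps =
        [True, False, False] @ enc_term (rename (pick (i, j)) commutes_term)" for i j
      unfolding ps_def fills_Cons by (subst fills_term_pieces[where f = "pick (i, j)"])
         (auto simp: fills_Cons fills_Nil holes_def pick_def)
    have "f x = concat (map (\<lambda>(a, b). fills (holes a b) ps) (pairs (map enc_nat (term_vars t)))) @ x"
      using True x by (simp add: f_def term_accepted_iff occs_enc_term transduce_id concat_pairs
          del: map_map)
    also have "... = enc_term (commuting_term t)" unfolding commuting_term_def enc_meets pairs_map
      by (simp add: x ps comp_def case_prod_beta)
    finally show ?thesis
      using commuting_term_sat[of t] by (auto simp: x SAT_def SAT_L_def inj_enc_term image_iff)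
  next
    case False
    have "V d \<noteq> {0\<^sub>v d}" if "d \<ge> 1" for d
    proof
      assume "V d = {0\<^sub>v d}"
      moreover have "unit_vec d 0 \<in> V d" by (auto intro!: V_I simp: unit_vec_def)
      ultimately have "unit_vec d 0 = (0\<^sub>v d :: complex vec)" by blast
      thus False using that by (auto dest!: arg_cong[of _ _ "\<lambda>w. w $ 0"])
    qed
    hence "enc_term Zero \<notin> SAT_L F"
      by (fastforce simp: SAT_L_def image_iff inj_enc_term sat_terms_def simp del: enc_term.simps)
    with False show ?thesis by (auto simp: f_def term_accepted_iff SAT_def)
  qed
  ultimately show ?thesis unfolding poly_reducible_def by blast
qed

section \<open>Matrix rings over star-subfields\<close>

lemma mat_adjoint_carrier [simp]: "A \<in> carrier_mat n m ==> mat_adjoint A \<in> carrier_mat m n"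
  by (auto simp: mat_adjoint_def)

lemma mat_adjoint_index:
  fixes A :: "complex mat"
  assumes "A \<in> carrier_mat n m" "i < m" "j < n"
  shows "mat_adjoint A $$ (i, j) = cnj (A $$ (j, i))"
  using assms by (auto simp: mat_adjoint_def mat_of_rows_index)

lemma mult_unit_vec_index:
  fixes A :: "complex mat"
  assumes "A \<in> carrier_mat n m" "i < n" "j < m"
  shows "(A *v unit_vec m j) $ i = A $$ (i, j)" using assms by (auto simp: scalar_prod_right_unit)

lemma diff_eq_0_vec:
  fixes u v :: "complex vec"
  assumes "u \<in> carrier_vec d" "v \<in> carrier_vec d" "u - v = 0\<^sub>v d"
  shows "u = v"
proof (rule eq_vecI)
  fix i assume i: "i < dim_vec v"
  have "(u - v) $ i = 0\<^sub>v d $ i" using assms(3) by simp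
  thus "u $ i = v $ i" using i assms(1,2) by simp
qed (use assms in auto)

context star_field
begin

definition Fmat :: "nat => nat => complex mat => bool" where
  "Fmat n m A \<longleftrightarrow> A \<in> carrier_mat n m \<and> (\<forall>i<n. \<forall>j<m. A $$ (i, j) \<in> F)"

lemma Fmat_carrier [simp]: "Fmat n m A ==> A \<in> carrier_mat n m" by (simp add: Fmat_def)

lemma Fmat_index: "Fmat n m A ==> i < n ==> j < m ==> A $$ (i, j) \<in> F" by (simp add: Fmat_def)

lemma FmatI: "A \<in> carrier_mat n m ==> (\<And>i j. i < n ==> j < m ==> A $$ (i, j) \<in> F) ==> Fmat n m A"
  by (simp add: Fmat_def)

lemma Fmat_add: "Fmat n m A ==> Fmat n m B ==> Fmat n m (A + B)"
  by (auto simp: Fmat_def intro!: F_add)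

lemma Fmat_smult: "c \<in> F ==> Fmat n m A ==> Fmat n m (c \<cdot>\<^sub>m A)"
  by (auto simp: Fmat_def intro!: F_mult)

lemma Fmat_zero: "Fmat n m (0\<^sub>m n m)" and Fmat_one: "Fmat n n (1\<^sub>m n)"
  by (auto simp: Fmat_def one_mat_def)

lemma Fmat_mult:
  assumes "Fmat n m A" "Fmat m k B"
  shows "Fmat n k (A * B)"
proof (rule FmatI)
  have c: "A \<in> carrier_mat n m" "B \<in> carrier_mat m k" using assms by simp_all
  thus "A * B \<in> carrier_mat n k" by simp
  fix i j assume ij: "i < n" "j < k"
  hence "(A * B) $$ (i, j) = (\<Sum>l<m. A $$ (i, l) * B $$ (l, j))"
    using c by (auto simp: scalar_prod_def lessThan_atLeast0 intro!: sum.cong)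
  also have "... \<in> F"
    using ij Fmat_index[OF assms(1)] Fmat_index[OF assms(2)] by (intro F_sum F_mult) auto
  finally show "(A * B) $$ (i, j) \<in> F" .
qed

lemma Fmat_adjoint: "Fmat n m A ==> Fmat m n (mat_adjoint A)"
  by (rule FmatI) (auto simp: mat_adjoint_index[of _ n m] intro!: F_cnj Fmat_index)

lemma mult_vec_sum:
  assumes "(A :: complex mat) \<in> carrier_mat n m" "v \<in> carrier_vec m" "i < n"
  shows "(A *v v) $ i = (\<Sum>j<m. A $$ (i, j) * v $ j)"
  using assms by (auto simp: scalar_prod_def lessThan_atLeast0 intro!: sum.cong)

lemma mult_vec_V:
  assumes "Fmat n m A" "v \<in> V m"
  shows "A *v v \<in> V n"
proof (rule V_I)
  show "dim_vec (A *v v) = n" using Fmat_carrier[OF assms(1)] by auto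
  fix i assume "i < n"
  thus "(A *v v) $ i \<in> F" using Fmat_index[OF assms(1)] V_index[OF assms(2)]
    by (subst mult_vec_sum[OF Fmat_carrier[OF assms(1)] V_carrier[OF assms(2)]])
       (auto intro!: F_sum F_mult)
qed

lemma ip_adjoint:
  assumes "A \<in> carrier_mat n m" "x \<in> carrier_vec m" "y \<in> carrier_vec n"
  shows "ip (A *v x) y = ip x (mat_adjoint A *v y)"
proof -
  have d: "dim_vec (A *v x) = n" "dim_vec (mat_adjoint A *v y) = m"
    using assms(1) mat_adjoint_carrier[OF assms(1)] by (auto simp del: mat_adjoint_carrier)
  have "ip (A *v x) y = (\<Sum>i<n. cnj (\<Sum>j<m. A $$ (i, j) * x $ j) * y $ i)"
    using assms d by (subst ip_sum[of _ n]) (auto simp: mult_vec_sum[OF assms(1,2)] simp del: index_mult_mat_vec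
        intro!: sum.cong)
  also have "... = (\<Sum>i<n. \<Sum>j<m. cnj (x $ j) * (cnj (A $$ (i, j)) * y $ i))"
    by (simp add: sum_distrib_right sum_distrib_left mult_ac)
  also have "... = (\<Sum>j<m. \<Sum>i<n. cnj (x $ j) * (cnj (A $$ (i, j)) * y $ i))"
    by (rule sum.swap)
  also have "... = (\<Sum>j<m. cnj (x $ j) * (\<Sum>i<n. mat_adjoint A $$ (j, i) * y $ i))"
    using assms(1) by (auto simp: sum_distrib_left mat_adjoint_index[of _ n m] intro!: sum.cong)
  also have "... = ip x (mat_adjoint A *v y)"
    using assms d by (subst ip_sum[of _ m]) (auto simp: mult_vec_sum[OF mat_adjoint_carrier[OF assms(1)] assms(3)]
        simp del: index_mult_mat_vec intro!: sum.cong)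
  finally show ?thesis .
qed

lemma unit_vec_V: "unit_vec n j \<in> V n" by (auto intro!: V_I simp: unit_vec_def)

lemma mat_eqI:
  fixes A B :: "complex mat"
  assumes "A \<in> carrier_mat n m" "B \<in> carrier_mat n m" "\<And>v. v \<in> V m ==> A *v v = B *v v"
  shows "A = B"
proof (rule eq_matI)
  fix i j assume "i < dim_row B" "j < dim_col B"
  hence ij: "i < n" "j < m" using assms by auto
  thus "A $$ (i, j) = B $$ (i, j)"
    using mult_unit_vec_index[OF assms(1) ij] mult_unit_vec_index[OF assms(2) ij]
      assms(3)[OF unit_vec_V] by metis
qed (use assms in auto)

lemma ip_all_eq_0:
  assumes "x \<in> V d" "\<And>w. w \<in> V d ==> ip x w = 0"
  shows "x = 0\<^sub>v d" using assms(2)[OF assms(1)] ip_self_eq_0[of x d] assms(1) by simp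

abbreviation R :: "nat => complex mat star_ring" where
  "R d \<equiv> matrix_star_ring F d"

lemma carrier_R: "A \<in> carrier (R d) \<longleftrightarrow> Fmat d d A"
proof
  assume "A \<in> carrier (R d)"
  thus "Fmat d d A" by (force simp: matrix_star_ring_def Fmat_def subset_iff)
next
  assume A: "Fmat d d A"
  hence "elements_mat A \<subseteq> F" by (auto simp: Fmat_def dest!: elements_matD)
  thus "A \<in> carrier (R d)" using A by (simp add: matrix_star_ring_def)
qed

lemma R_simps [simp]:
  "monoid.mult (R d) = (*)" "monoid.one (R d) = 1\<^sub>m d" "ring.zero (R d) = 0\<^sub>m d d"
  "ring.add (R d) = (+)"
  "star (R d) = mat_adjoint" by (auto simp: matrix_star_ring_def)

lemma of_nat_pow_R:
  assumes "Fmat d d A"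
  shows "A [^]\<^bsub>add_monoid (R d)\<^esub> (n :: nat) = of_nat n \<cdot>\<^sub>m A"
proof (induction n)
  case 0
  thus ?case using Fmat_carrier[OF assms] by (auto simp: nat_pow_def intro!: eq_matI)
next
  case (Suc n)
  have "A [^]\<^bsub>add_monoid (R d)\<^esub> Suc n = A [^]\<^bsub>add_monoid (R d)\<^esub> n + A"
    by (simp add: nat_pow_def)
  thus ?case using Suc Fmat_carrier[OF assms] by (auto simp: algebra_simps intro!: eq_matI)
qed

lemma add_pow_R:
  assumes A: "Fmat d d A"
  shows "[c] \<cdot>\<^bsub>R d\<^esub> A = of_int c \<cdot>\<^sub>m A"
proof (cases "c < 0")
  case False
  thus ?thesis unfolding add_pow_def int_pow_def2 if_not_P[OF False] of_nat_pow_R[OF A]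
    by (simp add: of_nat_nat)
next
  case True
  let ?B = "of_nat (nat (- c)) \<cdot>\<^sub>m A"
  have Ac: "A \<in> carrier_mat d d" using A by (rule Fmat_carrier)
  have neg: "of_nat (nat (- c)) = (- of_int c :: complex)" using True by (simp add: of_nat_nat)
  have "inv\<^bsub>add_monoid (R d)\<^esub> ?B = of_int c \<cdot>\<^sub>m A" unfolding m_inv_def
  proof (rule the_equality, goal_cases)
    case 1
    have "of_int c \<cdot>\<^sub>m A \<in> carrier (R d)"
      unfolding carrier_R by (rule Fmat_smult[OF F_of_int A])
    moreover have "?B + of_int c \<cdot>\<^sub>m A = 0\<^sub>m d d" "of_int c \<cdot>\<^sub>m A + ?B = 0\<^sub>m d d"
      unfolding neg using Ac by (intro eq_matI; simp)+
    ultimately show ?case by simp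
  next
    case (2 C)
    hence "C \<in> carrier (R d)" and eq: "?B + C = 0\<^sub>m d d" by simp_all
    hence Cc: "C \<in> carrier_mat d d" unfolding carrier_R by (rule_tac Fmat_carrier)
    show "C = of_int c \<cdot>\<^sub>m A"
    proof (rule eq_matI)
      fix i j assume "i < dim_row (of_int c \<cdot>\<^sub>m A)" "j < dim_col (of_int c \<cdot>\<^sub>m A)"
      hence ij: "i < d" "j < d" using Ac by auto
      have "(?B + C) $$ (i, j) = 0" unfolding eq using ij by simp
      thus "C $$ (i, j) = (of_int c \<cdot>\<^sub>m A) $$ (i, j)"
        unfolding neg using ij Cc Ac by simp
    qed (use Cc Ac in auto)
  qed
  thus ?thesis unfolding add_pow_def int_pow_def2 if_P[OF True] of_nat_pow_R[OF A] .
qed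

lemma Fmat_eval_letter: "\<forall>i. Fmat d d (x i) ==> Fmat d d (eval_letter (R d) x l)"
  by (cases l) (auto simp: eval_letter_def Fmat_adjoint)

lemma eval_monom_R:
  "eval_monom (R d) x [] = 1\<^sub>m d"
  "eval_monom (R d) x (l # w) = eval_letter (R d) x l * eval_monom (R d) x w"
  by (auto simp: eval_monom_def)

lemma Fmat_eval_monom: "\<forall>i. Fmat d d (x i) ==> Fmat d d (eval_monom (R d) x w)"
  by (induction w) (auto simp: eval_monom_R Fmat_one intro!: Fmat_mult[of d d] Fmat_eval_letter)

lemma eval_poly_R:
  assumes "\<forall>i. Fmat d d (x i)"
  shows "eval_poly (R d) x [] = 0\<^sub>m d d"
    "eval_poly (R d) x ((c, w) # p) = of_int c \<cdot>\<^sub>m eval_monom (R d) x w + eval_poly (R d) x p"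
  by (auto simp: eval_poly_def add_pow_R[OF Fmat_eval_monom[OF assms]])

lemma Fmat_eval_poly: "\<forall>i. Fmat d d (x i) ==> Fmat d d (eval_poly (R d) x p)"
  by (induction p) (auto simp: eval_poly_R Fmat_zero intro!: Fmat_add Fmat_smult Fmat_eval_monom)

lemma feasible_R:
  "ps \<in> feasible_polys (R d) \<longleftrightarrow>
   (\<exists>x. (\<forall>i. Fmat d d (x i)) \<and> (\<forall>p\<in>set ps. eval_poly (R d) x p = 0\<^sub>m d d))"
  by (auto simp: feasible_polys_def carrier_R)

definition cols_mat :: "nat => nat => (nat => complex vec) => complex mat" where
  "cols_mat n m f = mat n m (\<lambda>(i, j). f j $ i)"

lemma cols_mat_carrier [simp]: "cols_mat n m f \<in> carrier_mat n m" by (simp add: cols_mat_def)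

lemma Fmat_cols_mat: "(\<And>j. j < m ==> f j \<in> V n) ==> Fmat n m (cols_mat n m f)"
  by (auto simp: Fmat_def cols_mat_def intro!: V_index)

lemma cols_mat_mult:
  assumes "v \<in> carrier_vec m"
  shows "cols_mat n m f *v v = comb n m (\<lambda>j. v $ j) f"
proof (rule eq_vecI)
  fix i assume "i < dim_vec (comb n m (\<lambda>j. v $ j) f)"
  hence "i < n" by (simp add: comb_def)
  thus "(cols_mat n m f *v v) $ i = comb n m (\<lambda>j. v $ j) f $ i"
    by (subst mult_vec_sum[OF cols_mat_carrier assms])
       (auto simp: comb_def cols_mat_def mult.commute)
qed (auto simp: comb_def cols_mat_def)

lemma mat_mult_comb_unit:
  assumes A: "Fmat n m A" and v: "v \<in> V m"
  shows "A *v v = comb n m (\<lambda>j. v $ j) (\<lambda>j. A *v unit_vec m j)"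
proof (rule eq_vecI)
  fix i assume "i < dim_vec (comb n m (\<lambda>j. v $ j) (\<lambda>j. A *v unit_vec m j))"
  hence i: "i < n" by (simp add: comb_def)
  thus "(A *v v) $ i = comb n m (\<lambda>j. v $ j) (\<lambda>j. A *v unit_vec m j) $ i"
    unfolding mult_vec_sum[OF Fmat_carrier[OF A] V_carrier[OF v] i]
    by (simp add: comb_def mult_unit_vec_index[OF Fmat_carrier[OF A]] mult.commute del: index_mult_mat_vec)
qed (use Fmat_carrier[OF A] in \<open>auto simp: comb_def\<close>)

lemma comb_unit: "v \<in> carrier_vec d ==> comb d d (\<lambda>j. v $ j) (unit_vec d) = v"
  by (rule eq_vecI) (auto simp: comb_def unit_vec_def if_distrib cong: if_cong)

lemma comb_diff:
  assumes "\<And>i. i < n ==> f i \<in> carrier_vec d" "\<And>i. i < n ==> g i \<in> carrier_vec d"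
  shows "comb d n c f - comb d n c g = comb d n c (\<lambda>i. f i - g i)"
proof (rule eq_vecI)
  fix j assume "j < dim_vec (comb d n c (\<lambda>i. f i - g i))"
  hence j: "j < d" by (simp add: comb_def)
  hence "(f i - g i) $ j = f i $ j - g i $ j" if "i < n" for i using assms[OF that] j by auto
  thus "(comb d n c f - comb d n c g) $ j = comb d n c (\<lambda>i. f i - g i) $ j"
    using j by (simp add: comb_def right_diff_distrib sum_subtractf)
qed (auto simp: comb_def)

lemma comb_add:
  assumes "\<And>i. i < n ==> f i \<in> carrier_vec d" "\<And>i. i < n ==> g i \<in> carrier_vec d"
  shows "comb d n c (\<lambda>i. f i + g i) = comb d n c f + comb d n c g"
proof (rule eq_vecI)
  fix j assume "j < dim_vec (comb d n c f + comb d n c g)"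
  hence j: "j < d" by (simp add: comb_def)
  hence "(f i + g i) $ j = f i $ j + g i $ j" if "i < n" for i using assms[OF that] j by auto
  thus "comb d n c (\<lambda>i. f i + g i) $ j = (comb d n c f + comb d n c g) $ j"
    using j by (simp add: comb_def distrib_left sum.distrib)
qed (auto simp: comb_def)

subsection \<open>Orthogonal projections\<close>

definition range_sp :: "nat => complex mat => complex vec set" where
  "range_sp d P = {v \<in> V d. P *v v = v}"

lemma subspace_range_sp:
  assumes "Fmat d d P"
  shows "subspace_over F d (range_sp d P)" unfolding subspace_over_def range_sp_def
  using Fmat_carrier[OF assms] by (auto intro!: V_add V_smult eq_vecI
      simp: mult_add_distrib_mat_vec[of _ d d] mult_mat_vec[of _ d d])

definition is_projection :: "nat => complex mat => bool" where
  "is_projection d P \<longleftrightarrow> Fmat d d P \<and> P * P = P \<and> mat_adjoint P = P"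

lemma projection_range: "is_projection d P ==> v \<in> V d ==> P *v v \<in> range_sp d P"
proof -
  assume P: "is_projection d P" and v: "v \<in> V d"
  have c: "P \<in> carrier_mat d d" using P by (simp add: is_projection_def)
  have "P *v (P *v v) = (P * P) *v v" using c v by (intro assoc_mult_mat_vec[symmetric]) auto
  thus "P *v v \<in> range_sp d P"
    using P v by (auto simp: range_sp_def is_projection_def intro!: mult_vec_V)
qed

lemma projection_perp:
  assumes P: "is_projection d P"
  shows "perp d (range_sp d P) = {v \<in> V d. P *v v = 0\<^sub>v d}"
proof -
  have c: "P \<in> carrier_mat d d" "Fmat d d P" using P by (auto simp: is_projection_def)
  have sym: "ip (P *v x) y = ip x (P *v y)" if "x \<in> V d" "y \<in> V d" for x y
    using ip_adjoint[OF c(1), of x y] that P by (simp add: is_projection_def)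
  show ?thesis
  proof safe
    fix v assume v: "v \<in> perp d (range_sp d P)"
    thus vV: "v \<in> V d" by (rule perp_D)
    have "ip (P *v v) w = 0" if w: "w \<in> V d" for w
    proof -
      have "ip (P *v w) v = 0" using perp_D(1)[OF v projection_range[OF P w]] .
      hence "ip w (P *v v) = 0" using sym[OF w vV] by simp
      thus ?thesis using ip_swap_0[of w d "P *v v"] w mult_vec_V[OF c(2) vV] by simp
    qed
    thus "P *v v = 0\<^sub>v d" using mult_vec_V[OF c(2) vV] by (intro ip_all_eq_0) auto
  next
    fix v assume v: "v \<in> V d" "P *v v = 0\<^sub>v d"
    have "ip x v = 0" if "x \<in> range_sp d P" for x
      using sym[of x v] that v by (auto simp: range_sp_def)
    thus "v \<in> perp d (range_sp d P)" using v by (auto simp: perp_def)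
  qed
qed

definition proj :: "nat => complex vec set => complex mat" where
  "proj d U = cols_mat d d (\<lambda>j. SOME u. u \<in> U \<and> unit_vec d j - u \<in> perp d U)"

lemma proj_decomposes:
  assumes U: "subspace_over F d U"
  shows "Fmat d d (proj d U)" "v \<in> V d ==> proj d U *v v \<in> U"
    "v \<in> V d ==> v - proj d U *v v \<in> perp d U"
proof -
  define f where "f j = (SOME u. u \<in> U \<and> unit_vec d j - u \<in> perp d U)" for j
  have f: "f j \<in> U \<and> unit_vec d j - f j \<in> perp d U" for j unfolding f_def
  proof (rule someI_ex)
    obtain u w where uw: "u \<in> U" "w \<in> perp d U" "unit_vec d j = u + w"
      using orthogonal_decomposition[OF U unit_vec_V] by blast
    moreover have "u \<in> V d" "w \<in> V d" using uw subspaceD(1)[OF U] perp_D(2) by auto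
    ultimately have "unit_vec d j - u = w" by (intro eq_vecI) auto
    with uw show "\<exists>u. u \<in> U \<and> unit_vec d j - u \<in> perp d U" by auto
  qed
  have fV: "f j \<in> V d" for j using f subspaceD(1)[OF U] by blast
  have P: "proj d U = cols_mat d d f" unfolding proj_def f_def ..
  show "Fmat d d (proj d U)" unfolding P using fV by (rule Fmat_cols_mat)
  assume v: "v \<in> V d"
  have Pv: "proj d U *v v = comb d d (\<lambda>j. v $ j) f"
    unfolding P using v by (intro cols_mat_mult) auto
  show "proj d U *v v \<in> U" unfolding Pv using f V_index[OF v] by (intro comb_in[OF U]) auto
  have "v - proj d U *v v = comb d d (\<lambda>j. v $ j) (unit_vec d) - comb d d (\<lambda>j. v $ j) f"
    unfolding Pv using v by (simp add: comb_unit)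
  also have "... = comb d d (\<lambda>j. v $ j) (\<lambda>j. unit_vec d j - f j)"
    using fV by (intro comb_diff) auto
  also have "... \<in> perp d U"
    using f V_index[OF v] subspaceD(1)[OF U] by (intro comb_in[OF subspace_perp]) auto
  finally show "v - proj d U *v v \<in> perp d U" .
qed

lemma range_proj:
  assumes U: "subspace_over F d U"
  shows "range_sp d (proj d U) = U"
proof safe
  note P = proj_decomposes[OF U]
  fix v
  {
    assume "v \<in> range_sp d (proj d U)"
    thus "v \<in> U" using P(2)[of v] by (auto simp: range_sp_def)
  next
    assume v: "v \<in> U"
    hence vV: "v \<in> V d" by (rule subspaceD(1)[OF U])
    have PV: "proj d U *v v \<in> V d" using mult_vec_V[OF P(1) vV] .
    have "v - proj d U *v v \<in> U" using v P(2)[OF vV] by (rule subspace_diff[OF U])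
    hence "v - proj d U *v v = 0\<^sub>v d"
      using inter_perp[of U d] P(3)[OF vV] subspaceD(1)[OF U] by blast
    hence "v = proj d U *v v" by (rule diff_eq_0_vec[OF V_carrier[OF vV] V_carrier[OF PV]])
    thus "v \<in> range_sp d (proj d U)" using vV by (simp add: range_sp_def)
  }
qed

lemma is_projection_proj:
  assumes U: "subspace_over F d U"
  shows "is_projection d (proj d U)"
proof -
  let ?P = "proj d U"
  note P = proj_decomposes[OF U]
  have c: "?P \<in> carrier_mat d d" using P(1) by simp
  have id: "?P *v u = u" if "u \<in> U" for u
    using range_proj[OF U] that by (auto simp: range_sp_def)
  have PV: "?P *v v \<in> V d" if "v \<in> V d" for v using mult_vec_V[OF P(1) that] .
  have "?P * ?P = ?P"
  proof (rule mat_eqI)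
    fix v assume v: "v \<in> V d"
    have "(?P * ?P) *v v = ?P *v (?P *v v)" using c v by (intro assoc_mult_mat_vec) auto
    thus "(?P * ?P) *v v = ?P *v v" using id[OF P(2)[OF v]] by simp
  qed (use c in auto)
  moreover have "mat_adjoint ?P = ?P"
  proof (rule mat_eqI)
    fix y assume y: "y \<in> V d"
    have aV: "mat_adjoint ?P *v y \<in> V d" using Fmat_adjoint[OF P(1)] y by (rule mult_vec_V)
    have "ip (mat_adjoint ?P *v y - ?P *v y) x = 0" if x: "x \<in> V d" for x
    proof -
      have "ip (?P *v x) (y - ?P *v y) = 0" using perp_D(1)[OF P(3)[OF y] P(2)[OF x]] .
      hence 1: "ip (?P *v x) y = ip (?P *v x) (?P *v y)"
        using ip_diff(1)[of "?P *v x" d y "?P *v y"] y x PV by simp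
      have "ip (?P *v y) (x - ?P *v x) = 0" using perp_D(1)[OF P(3)[OF x] P(2)[OF y]] .
      hence "ip (?P *v y) x = ip (?P *v y) (?P *v x)"
        using ip_diff(1)[of "?P *v y" d x "?P *v x"] y x PV by simp
      hence 2: "ip x (?P *v y) = ip (?P *v x) (?P *v y)"
        using ip_swap[of x d "?P *v y"] ip_swap[of "?P *v x" d "?P *v y"] x y PV
        by (metis V_carrier complex_cnj_cancel_iff)
      have "ip x (mat_adjoint ?P *v y) = ip x (?P *v y)"
        using 1 2 ip_adjoint[OF c, of x y] x y by simp
      hence "ip x (mat_adjoint ?P *v y - ?P *v y) = 0"
        using ip_diff(1)[of x d "mat_adjoint ?P *v y" "?P *v y"] x y aV PV by simp
      thus ?thesis
        using ip_swap_0[of x d "mat_adjoint ?P *v y - ?P *v y"] x V_diff[OF aV PV[OF y]] by simp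
    qed
    hence "mat_adjoint ?P *v y - ?P *v y = 0\<^sub>v d"
      using V_diff[OF aV PV[OF y]] by (intro ip_all_eq_0)
    thus "mat_adjoint ?P *v y = ?P *v y"
      by (rule diff_eq_0_vec[OF V_carrier[OF aV] V_carrier[OF PV[OF y]]])
  qed (use c in auto)
  ultimately show ?thesis using P(1) by (simp add: is_projection_def)
qed

end

section \<open>From ortholattices to star-rings\<close>

text \<open>
  Variable \<open>i\<close> of the term becomes variable \<open>2 i + 1\<close>. The even number \<open>node_var k n\<close> is
  the \<open>k\<close>-th variable (the projection, one of two auxiliary matrices, or the complementary
  projection) of the subterm with name \<open>n\<close>; its encoding is linear in \<open>n\<close> and easily written down from the unary
  representation of \<open>n\<close>.
\<close>

definition node_var :: "nat => nat => nat" where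
  "node_var k n = 2 * (k + 4 * 2 ^ n)"

definition unary :: "nat => bool list" where
  "unary n = concat (replicate n [True, False])"

lemma unary_simps [simp]: "unary 0 = []" "unary (Suc n) = True # False # unary n"
  by (simp_all add: unary_def)

lemma unary_add: "unary (m + n) = unary m @ unary n" by (simp add: unary_def replicate_add)

lemma enc_nat_power: "enc_nat (2 ^ n) = unary n @ [True, True, False]"
proof (induction n)
  case 0
  thus ?case using enc_nat_double[of 0 True] by (simp add: enc_nat_0)
next
  case (Suc n)
  thus ?case using enc_nat_double[of "2 ^ n" False] by simp
qed

lemma enc_node_var:
  assumes "k < 4"
  shows "enc_nat (node_var k n) =
    [True, False, True, odd k, True, odd (k div 2)] @ unary n @ [True, True, False]"
proof -
  have 1: "node_var k n = 2 * (2 * (2 * 2 ^ n + of_bool (odd (k div 2))) + of_bool (odd k)) + of_bool False"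
  proof -
    have "k = 2 * (k div 2) + of_bool (odd k)" "k div 2 = of_bool (odd (k div 2))"
    proof -
      consider "k = 0" | "k = 1" | "k = 2" | "k = 3" using assms by linarith
      thus "k = 2 * (k div 2) + of_bool (odd k)" "k div 2 = of_bool (odd (k div 2))"
        by (cases; simp)+
    qed
    thus ?thesis by (simp add: node_var_def algebra_simps)
  qed
  have 2: "2 * 2 ^ n + of_bool b > (0 :: nat)" for b by simp
  have 3: "2 * (2 * 2 ^ n + of_bool b) + of_bool c > (0 :: nat)" for b c by simp
  have 4: "2 * (2 * (2 * 2 ^ n + of_bool b) + of_bool c) + of_bool e > (0 :: nat)" for b c e by simp
  show ?thesis
    unfolding 1 enc_nat_double[OF 4] enc_nat_double[OF 3] enc_nat_double[OF 2] enc_nat_power by simp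
qed

lemma node_var_inj: "k < 4 ==> k' < 4 ==> node_var k n = node_var k' n' \<longleftrightarrow> k = k' \<and> n = n'"
proof -
  assume k: "k < 4" "k' < 4"
  have "k = k' \<and> n = n'" if e: "node_var k n = node_var k' n'"
  proof -
    have e': "k + 4 * 2 ^ n = k' + 4 * 2 ^ n'" using e by (simp add: node_var_def)
    hence "(k + 4 * 2 ^ n) mod 4 = (k' + 4 * 2 ^ n') mod 4" by simp
    hence "k = k'" using k by simp
    with e' show ?thesis by simp
  qed
  thus ?thesis by blast
qed

lemma even_node_var: "even (node_var k n)" by (simp add: node_var_def)

lemma enc_odd_var: "enc_nat (2 * i + 1) = [True, True] @ enc_nat i"
  using enc_nat_double[of i True] by simp

subsection \<open>The polynomials\<close>

text \<open>
  Letters of the templates are tuples of a hole, an offset, the kind of the variable and the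
  adjoint flag; hole 2 stands for the name of a node, and hole 7 for the name of its first child.
\<close>

type_synonym hole_letter = "nat \<times> nat \<times> nat \<times> bool"
type_synonym template = "(int \<times> hole_letter list) list list"

definition inst_letter :: "(nat => nat) => hole_letter => nat \<times> bool" where
  "inst_letter v = (\<lambda>(h, e, k, b). (node_var k (v h + e), b))"

definition inst :: "(nat => nat) => template => nc_poly list" where
  "inst v = map (map (\<lambda>(c, w). (c, map (inst_letter v) w)))"

definition tP :: hole_letter where "tP = (2, 0, 0, False)"
definition tPa :: hole_letter where "tPa = (2, 0, 0, True)"
definition tY :: hole_letter where "tY = (2, 0, 1, False)"
definition tZ :: hole_letter where "tZ = (2, 0, 2, False)"
definition tN :: hole_letter where "tN = (2, 0, 3, False)"
definition tL :: "nat => hole_letter" where "tL k = (7, 0, k, False)"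
definition tR :: "nat => hole_letter" where "tR k = (7, 1, k, False)"

lemmas t_defs = tP_def tPa_def tY_def tZ_def tN_def tL_def tR_def

definition base_polys :: template where
  "base_polys = [[(1, [tP, tP]), (-1, [tP])], [(1, [tP]), (-1, [tPa])], [(1, [tP]), (1, [tN]), (-1, [])]]"

definition join_polys :: "hole_letter => nat => template" where
  "join_polys p k = [[(1, [p, tL k]), (-1, [tL k])], [(1, [p, tR k]), (-1, [tR k])],
     [(1, [p]), (-1, [tL k, tY]), (-1, [tR k, tZ])]]"

text \<open>By De Morgan's law, a meet is described by the conditions of a join of complements.\<close>

primrec extra_polys :: "ol_term => template" where
  "extra_polys (Var i) = []"
| "extra_polys Zero = [[(1, [tP])]]"
| "extra_polys One = [[(1, [tP]), (-1, [])]]"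
| "extra_polys (Neg t) = [[(1, [tP]), (-1, [tL 3])]]"
| "extra_polys (Meet s t) = join_polys tN 3"
| "extra_polys (Join s t) = join_polys tP 0"

definition var_poly :: "nat => nat => nc_poly" where
  "var_poly n i = [(1, [(node_var 0 n, False)]), (-1, [(2 * i + 1, False)])]"

definition names :: "nat => nat => nat => nat" where
  "names n c h = (if h = 2 then n else c)"

definition node_polys :: "nat => nat => ol_term => nc_poly list" where
  "node_polys n c t = inst (names n c) (base_polys @ extra_polys t) @
     (case t of Var i => [var_poly n i] | _ => [])"

primrec nodes :: "ol_term => nat" where
  "nodes (Var i) = 1"
| "nodes Zero = 1"
| "nodes One = 1"
| "nodes (Neg t) = Suc (nodes t)"
| "nodes (Meet s t) = Suc (nodes s + nodes t)"
| "nodes (Join s t) = Suc (nodes s + nodes t)"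

lemma nodes_pos: "nodes t > 0" by (induction t) auto

primrec node_table :: "ol_term => nat => nat => (nat \<times> nat \<times> ol_term) list" where
  "node_table (Var i) n c = [(n, c, Var i)]"
| "node_table Zero n c = [(n, c, Zero)]"
| "node_table One n c = [(n, c, One)]"
| "node_table (Neg t) n c = (n, c, Neg t) # node_table t c (c + 1)"
| "node_table (Meet s t) n c = (n, c, Meet s t) #
     node_table s c (c + 2) @ node_table t (c + 1) (c + 1 + nodes s)"
| "node_table (Join s t) n c = (n, c, Join s t) #
     node_table s c (c + 2) @ node_table t (c + 1) (c + 1 + nodes s)"

definition root_poly :: nc_poly where
  "root_poly = [(1, [(node_var 0 0, False)]), (-1, [])]"

definition table_polys :: "(nat \<times> nat \<times> ol_term) list => nc_poly list" where
  "table_polys tbl = concat (map (\<lambda>(n, c, t). node_polys n c t) tbl)"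

definition term_polys :: "ol_term => nc_poly list" where
  "term_polys t = root_poly # table_polys (node_table t 0 1)"

lemma hd_node_table: "\<exists>tbl. node_table t n c = (n, c, t) # tbl" by (cases t) auto

lemma node_table_root: "(n, c, t) \<in> set (node_table t n c)"
  using hd_node_table[of t n c] by auto

lemma distinct_names:
  fixes A B :: "nat list"
  assumes "set A \<subseteq> insert c {c + 2..<c + 2 + a - 1} \<and> distinct A"
    and "set B \<subseteq> insert (c + 1) {c + 1 + a..<c + 1 + a + b - 1} \<and> distinct B"
    and "n < c" "a > 0" "b > 0"
  shows "set (n # A @ B) \<subseteq> insert n {c..<c + Suc (a + b) - 1} \<and> distinct (n # A @ B)"
proof -
  have "set A \<inter> set B = {}" "n \<notin> set A" "n \<notin> set B" "set A \<union> set B \<subseteq> {c..<c + Suc (a + b) - 1}"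
    using assms by fastforce+
  thus ?thesis using assms by auto
qed

lemma node_table_names:
  "n < c ==> set (map fst (node_table t n c)) \<subseteq> insert n {c..<c + nodes t - 1} \<and>
    distinct (map fst (node_table t n c))"
proof (induction t arbitrary: n c)
  case (Neg t)
  from Neg.IH[of c "c + 1"] Neg.prems nodes_pos[of t] show ?case by fastforce
next
  case (Meet s t)
  from distinct_names[OF Meet.IH(1) Meet.IH(2) Meet.prems nodes_pos nodes_pos] nodes_pos[of s]
  show ?case by simp
next
  case (Join s t)
  from distinct_names[OF Join.IH(1) Join.IH(2) Join.prems nodes_pos nodes_pos] nodes_pos[of s]
  show ?case by simp
qed auto

lemma node_table_children:
  "(m, k, Neg u) \<in> set (node_table t n c) ==> \<exists>k'. (k, k', u) \<in> set (node_table t n c)"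
  "(m, k, Meet u w) \<in> set (node_table t n c) \<or> (m, k, Join u w) \<in> set (node_table t n c) ==>
     (\<exists>k'. (k, k', u) \<in> set (node_table t n c)) \<and> (\<exists>k'. (k + 1, k', w) \<in> set (node_table t n c))"
proof -
  have "((m, k, Neg u) \<in> set (node_table t n c) --> (\<exists>k'. (k, k', u) \<in> set (node_table t n c))) \<and>
    ((m, k, Meet u w) \<in> set (node_table t n c) \<or> (m, k, Join u w) \<in> set (node_table t n c) -->
     (\<exists>k'. (k, k', u) \<in> set (node_table t n c)) \<and> (\<exists>k'. (k + 1, k', w) \<in> set (node_table t n c)))"
    for u w
  proof (induction t arbitrary: n c)
    case (Neg t)
    from Neg.IH[of c "c + 1"] node_table_root[of c "c + 1" t] show ?case by auto
  next
    case (Meet s t)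
    from Meet.IH(1)[of c "c + 2"] Meet.IH(2)[of "c + 1" "c + 1 + nodes s"]
      node_table_root[of c "c + 2" s] node_table_root[of "c + 1" "c + 1 + nodes s" t]
    show ?case by auto
  next
    case (Join s t)
    from Join.IH(1)[of c "c + 2"] Join.IH(2)[of "c + 1" "c + 1 + nodes s"]
      node_table_root[of c "c + 2" s] node_table_root[of "c + 1" "c + 1 + nodes s" t]
    show ?case by auto
  qed auto
  thus "(m, k, Neg u) \<in> set (node_table t n c) ==> \<exists>k'. (k, k', u) \<in> set (node_table t n c)"
    "(m, k, Meet u w) \<in> set (node_table t n c) \<or> (m, k, Join u w) \<in> set (node_table t n c) ==>
     (\<exists>k'. (k, k', u) \<in> set (node_table t n c)) \<and> (\<exists>k'. (k + 1, k', w) \<in> set (node_table t n c))"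
    by blast+
qed

subsection \<open>Writing down the polynomials\<close>

definition list_pieces :: "('a => piece list) => 'a list => piece list" where
  "list_pieces f xs = concat (map (\<lambda>x. Const [True] # f x) xs) @ [Const [False]]"

lemma list_pieces_simps:
  "list_pieces f [] = [Const [False]]"
  "list_pieces f (x # xs) = Const [True] # f x @ list_pieces f xs"
  by (simp_all add: list_pieces_def)

lemma fills_list_pieces:
  "(\<And>x. x \<in> set xs ==> fills v (f x) = e (g x)) ==>
   fills v (list_pieces f xs) = enc_list e (map g xs)"
  by (induction xs) (auto simp: list_pieces_simps fills_Cons fills_append fills_Nil)

definition letter_pieces :: "hole_letter => piece list" where
  "letter_pieces = (\<lambda>(h, e, k, b).
     [Const ([b, True, False, True, odd k, True, odd (k div 2)] @ unary e), Hole h,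
      Const [True, True, False]])"

definition summand_pieces where
  "summand_pieces = (\<lambda>(c, w). Const (enc_int c) # list_pieces letter_pieces w)"

definition elems :: "nc_poly list => bool list" where
  "elems ps = concat (map (\<lambda>p. True # enc_list enc_summand p) ps)"

lemma enc_polys_elems: "enc_polys ps = elems ps @ [False]"
  by (induction ps) (auto simp: enc_polys_def elems_def)

lemma elems_simps: "elems [] = []" "elems (p # ps) = True # enc_list enc_summand p @ elems ps"
  "elems (ps @ qs) = elems ps @ elems qs" by (auto simp: elems_def)

definition poly_pieces :: "template => piece list" where
  "poly_pieces T = concat (map (\<lambda>p. Const [True] # list_pieces summand_pieces p) T)"

definition small_kinds :: "template => bool" where
  "small_kinds T \<longleftrightarrow> (\<forall>p\<in>set T. \<forall>(c, w)\<in>set p. \<forall>(h, e, k, b)\<in>set w. k < 4)"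

lemma fills_poly_pieces:
  assumes "small_kinds T"
  shows "fills (\<lambda>h. unary (v h)) (poly_pieces T) = elems (inst v T)" using assms
proof (induction T)
  case Nil
  thus ?case by (simp add: poly_pieces_def inst_def elems_def fills_Nil)
next
  case (Cons p T)
  have l: "fills (\<lambda>h. unary (v h)) (letter_pieces l) = enc_letter (inst_letter v l)"
    if "(c, w) \<in> set p" "l \<in> set w" for c w l
  proof -
    obtain h e k b where "l = (h, e, k, b)" by (metis prod.exhaust)
    moreover from this have "k < 4" using Cons.prems that unfolding small_kinds_def by fastforce
    ultimately show ?thesis using unary_add[of e "v h"] unary_add[of "v h" e]
      by (simp add: letter_pieces_def inst_letter_def enc_letter_simp enc_node_var fills_Cons
          fills_Nil add.commute)
  qed
  have "fills (\<lambda>h. unary (v h)) (summand_pieces m) =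
      enc_summand (case m of (c, w) => (c, map (inst_letter v) w))" if "m \<in> set p" for m
  proof -
    obtain c w where m: "m = (c, w)" by fastforce
    have "fills (\<lambda>h. unary (v h)) (list_pieces letter_pieces w) =
        enc_list enc_letter (map (inst_letter v) w)"
      using l that m by (intro fills_list_pieces) auto
    thus ?thesis by (simp add: m summand_pieces_def enc_summand_simp fills_Cons)
  qed
  hence "fills (\<lambda>h. unary (v h)) (list_pieces summand_pieces p) =
      enc_list enc_summand (map (\<lambda>(c, w). (c, map (inst_letter v) w)) p)"
    by (intro fills_list_pieces)
  moreover have "small_kinds T" using Cons.prems by (auto simp: small_kinds_def)
  ultimately show ?case
    using Cons.IH by (simp add: poly_pieces_def inst_def elems_def fills_Cons fills_append)
qed

lemma small_kinds_extra: "small_kinds (base_polys @ extra_polys t)"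
  by (cases t) (auto simp: small_kinds_def base_polys_def join_polys_def t_defs)

definition var_pieces :: "piece list" where
  "var_pieces = Const (True # True # enc_int 1) # list_pieces letter_pieces [tP] @
     [Const (True # enc_int (-1) @ [True, False, True, True])]"

lemma fills_var_pieces:
  "fills (\<lambda>h. unary (names n c h)) var_pieces @ enc_nat i @ [False, False] = elems [var_poly n i]"
  using enc_odd_var[of i]
  by (simp add: var_pieces_def elems_def var_poly_def enc_summand_simp enc_letter_simp fills_Cons
      fills_append fills_Nil list_pieces_simps letter_pieces_def tP_def enc_node_var names_def)

definition name_stack :: "nat list => nat list" where
  "name_stack ns = concat (map (\<lambda>n. replicate n 0 @ [1]) ns)"

definition node_store :: "nat => nat list => nat => nat => nat list" where
  "node_store q ns c = (\<lambda>_. [])(0 := [q], 6 := name_stack ns, 7 := replicate c 0)"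

lemma funpow_saturates:
  assumes "\<And>j. j < n ==> f (S j) = S (Suc j)" "f (S n) = S n"
  shows "(f ^^ k) (S 0) = S (min k n)"
proof (induction k)
  case (Suc k)
  thus ?case using assms by (cases "k < n") (simp_all add: min.absorb1 min.absorb2)
qed simp

definition pop_name :: com where
  "pop_name = repeat (IfTop 6 0 (Pop 6 ;; Push 2 0) Skip) ;; Pop 6"

lemma sem_pop_name:
  assumes "n \<le> length x"
  shows "sem x pop_name (node_store q (n # ns) c, o') =
    ((node_store q ns c)(2 := replicate n 0), o')"
proof -
  define S where "S j = ((node_store q (n # ns) c)(2 := replicate j 0,
    6 := replicate (n - j) 0 @ 1 # name_stack ns), o')" for j
  have "(sem x (IfTop 6 0 (Pop 6 ;; Push 2 0) Skip) ^^ k) (S 0) = S (min k n)" for k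
  proof (rule funpow_saturates)
    fix j assume "j < n"
    hence "n - j = Suc (n - Suc j)" by auto
    thus "sem x (IfTop 6 0 (Pop 6 ;; Push 2 0) Skip) (S j) = S (Suc j)"
      by (auto simp: S_def fun_eq_iff)
  qed (auto simp: S_def)
  from this[of "length x"] have "sem x (repeat (IfTop 6 0 (Pop 6 ;; Push 2 0) Skip)) (S 0) = S n"
    unfolding sem_repeat using assms by (simp add: min_def)
  moreover have "S 0 = (node_store q (n # ns) c, o')"
    by (auto simp: S_def node_store_def name_stack_def fun_eq_iff)
  ultimately have e: "sem x (repeat (IfTop 6 0 (Pop 6 ;; Push 2 0) Skip)) (node_store q (n # ns) c, o') = S n"
    by (simp only:)
  show ?thesis unfolding pop_name_def sem.simps(5) e by (auto simp: S_def node_store_def fun_eq_iff)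
qed

definition push_name :: "bool => com" where
  "push_name e = Push 6 1 ;; repeat (IfTop 7 0 (Pop 7 ;; Push 5 0 ;; Push 6 0) Skip) ;;
     move_out 5 7 (\<lambda>_. []) ;; (if e then Push 6 0 else Skip)"

lemma sem_push_name:
  assumes "c \<le> length x"
  shows "sem x (push_name e) (node_store q ns c, o') = (node_store q ((c + of_bool e) # ns) c, o')"
proof -
  define S where "S j = ((node_store q ns c)(5 := replicate j 0, 7 := replicate (c - j) 0,
        6 := replicate j 0 @ 1 # name_stack ns), o')" for j
  have loop: "(sem x (IfTop 7 0 (Pop 7 ;; Push 5 0 ;; Push 6 0) Skip) ^^ k) (S 0) = S (min k c)" for k
  proof (rule funpow_saturates)
    fix j assume "j < c"
    hence "c - j = Suc (c - Suc j)" by auto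
    thus "sem x (IfTop 7 0 (Pop 7 ;; Push 5 0 ;; Push 6 0) Skip) (S j) = S (Suc j)"
      by (auto simp: S_def fun_eq_iff)
  qed (auto simp: S_def)
  let ?t = "((node_store q ns c)(5 := replicate c 0, 7 := [],
        6 := replicate c 0 @ 1 # name_stack ns), o')"
  have 1: "sem x (Push 6 1) (node_store q ns c, o') = S 0"
    by (auto simp: S_def node_store_def fun_eq_iff)
  have 2: "sem x (repeat (IfTop 7 0 (Pop 7 ;; Push 5 0 ;; Push 6 0) Skip)) (S 0) = ?t"
    unfolding sem_repeat loop using assms by (simp add: min_def S_def)
  have 3: "sem x (move_out 5 7 (\<lambda>_. [])) ?t = (node_store q (c # ns) c, o')"
    using assms by (subst sem_move_out[where xs = "replicate c 0"])
      (auto simp: node_store_def name_stack_def fun_eq_iff)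
  have 4: "sem x (if e then Push 6 0 else Skip) (node_store q (c # ns) c, o') =
      (node_store q ((c + of_bool e) # ns) c, o')"
    by (auto simp: node_store_def name_stack_def fun_eq_iff)
  show ?thesis unfolding push_name_def sem.simps(5) 1 2 3 4 ..
qed

lemma sem_push_counter:
  "sem x (Push 7 0) (node_store q ns c, o') = (node_store q ns (Suc c), o')"
  by (auto simp: node_store_def fun_eq_iff)

definition emit_names :: "piece list => com" where
  "emit_names ps = emit_pieces (\<lambda>_. [True, False]) ps"

lemma sem_emit_names:
  assumes "n \<le> length x" "c \<le> length x" "\<forall>r. Hole r \<in> set ps --> r = 2 \<or> r = 7"
  shows "sem x (emit_names ps) ((node_store q ns c)(2 := replicate n 0), o') =
    ((node_store q ns c)(2 := replicate n 0), o' @ fills (\<lambda>h. unary (names n c h)) ps)"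
proof -
  let ?s = "((node_store q ns c)(2 := replicate n 0), o')"
  have u: "concat (map (\<lambda>_. [True, False]) (rev (replicate k (0::nat)))) = unary k" for k
    by (simp add: unary_def)
  have "sem x (emit_names ps) ?s =
    (fst ?s, snd ?s @ fills (\<lambda>r. concat (map (\<lambda>_. [True, False]) (rev (fst ?s r)))) ps)"
    unfolding emit_names_def
  proof (rule sem_emit_pieces)
    fix r assume "Hole r \<in> set ps"
    with assms(3) have "r = 2 \<or> r = 7" by simp
    thus "r \<noteq> 5 \<and> set (fst ?s r) \<subseteq> {0, 1} \<and> length (fst ?s r) \<le> length x"
      using assms(1,2) by (auto simp: node_store_def)
  qed (simp add: node_store_def)
  also have "fills (\<lambda>r. concat (map (\<lambda>_. [True, False]) (rev (fst ?s r)))) ps =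
      fills (\<lambda>h. unary (names n c h)) ps"
  proof (rule fills_cong)
    fix r assume "Hole r \<in> set ps"
    with assms(3) have "r = 2 \<or> r = 7" by simp
    thus "concat (map (\<lambda>_. [True, False]) (rev (fst ?s r))) = unary (names n c r)"
      by (auto simp: node_store_def names_def u simp del: rev_replicate)
  qed
  finally show ?thesis by (simp only: fst_conv snd_conv)
qed

lemma Hole_list_pieces: "Hole r \<in> set (list_pieces f xs) ==> \<exists>x\<in>set xs. Hole r \<in> set (f x)"
  by (auto simp: list_pieces_def split: if_splits)

lemma Hole_poly_pieces:
  assumes "\<And>p c w h e k b. p \<in> set T ==> (c, w) \<in> set p ==> (h, e, k, b) \<in> set w ==> h = 2 \<or> h = 7"
    and "Hole r \<in> set (poly_pieces T)"
  shows "r = 2 \<or> r = 7"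
proof -
  obtain p where p: "p \<in> set T" "Hole r \<in> set (list_pieces summand_pieces p)"
    using assms(2) by (auto simp: poly_pieces_def split: if_splits)
  obtain c w where w: "(c, w) \<in> set p" "Hole r \<in> set (summand_pieces (c, w))"
    using Hole_list_pieces[OF p(2)] by auto
  hence "Hole r \<in> set (list_pieces letter_pieces w)" by (simp add: summand_pieces_def)
  then obtain h e k b where "(h, e, k, b) \<in> set w" "Hole r \<in> set (letter_pieces (h, e, k, b))"
    using Hole_list_pieces by fastforce
  thus ?thesis using assms(1)[OF p(1) w(1)] by (auto simp: letter_pieces_def)
qed

lemma Hole_node_pieces:
  "\<forall>r. Hole r \<in> set (poly_pieces (base_polys @ extra_polys t)) --> r = 2 \<or> r = 7"
proof (intro allI impI)
  fix r assume "Hole r \<in> set (poly_pieces (base_polys @ extra_polys t))"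
  thus "r = 2 \<or> r = 7"
    by (rule Hole_poly_pieces[rotated]) (cases t; auto simp: base_polys_def join_polys_def t_defs)
qed

lemma Hole_var_pieces: "Hole r \<in> set var_pieces ==> r = 2"
  by (auto simp: var_pieces_def list_pieces_simps letter_pieces_def tP_def)

definition node_cmd :: "piece list => com => com" where
  "node_cmd ps kids = pop_name ;; emit_names ps ;; clear 2 ;; kids"

lemma sem_node_cmd:
  assumes "n \<le> length x" "c \<le> length x" "\<forall>r. Hole r \<in> set ps --> r = 2 \<or> r = 7"
  shows "sem x (node_cmd ps kids) (node_store q (n # ns) c, o') =
    sem x kids (node_store q ns c, o' @ fills (\<lambda>h. unary (names n c h)) ps)"
proof -
  have clr: "sem x (clear 2) ((node_store q ns c)(2 := replicate n 0), o'') = (node_store q ns c, o'')" for o''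
    using assms(1) by (subst sem_clear) (auto simp: node_store_def fun_eq_iff)
  show ?thesis
    unfolding node_cmd_def sem.simps(5) sem_pop_name[OF assms(1)] sem_emit_names[OF assms] clr ..
qed

definition feas_hook :: "nat => bool => com" where
  "feas_hook q b =
    (if q = 3 then
       if b then node_cmd (poly_pieces (base_polys @ extra_polys Zero)) Skip
       else node_cmd (poly_pieces (base_polys @ extra_polys (Var 0)) @ var_pieces) Skip
     else if q = 4 then
       if b then node_cmd (poly_pieces (base_polys @ extra_polys (Neg Zero)))
         (push_name False ;; Push 7 0)
       else node_cmd (poly_pieces (base_polys @ extra_polys One)) Skip
     else if q = 5 then
       node_cmd (poly_pieces (base_polys @ extra_polys (if b then Join Zero Zero else Meet Zero Zero)))
         (push_name True ;; push_name False ;; Push 7 0 ;; Push 7 0)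
     else if q \<in> {6, 7, 8} then emits (b # (if q = 6 \<and> \<not> b then [False, False] else []))
     else Skip)"

definition feas_step :: "bool list => store => bool => store" where
  "feas_step x s b =
     (if b then sem x (switch 0 10 (\<lambda>q. set_reg 0 (term_delta q True) ;; feas_hook q True)) s
      else sem x (switch 0 10 (\<lambda>q. set_reg 0 (term_delta q False) ;; feas_hook q False)) s)"

lemma feas_step:
  assumes "q < 10"
  shows "feas_step x (node_store q ns c, o') b =
    sem x (feas_hook q b) (node_store (term_delta q b) ns c, o')"
proof -
  have 1: "fst (node_store q ns c, o') 0 = [q]" by (simp add: node_store_def)
  have 2: "sem x (set_reg 0 k) (node_store q ns c, o') = (node_store k ns c, o')" for k
    by (subst sem_set_reg) (auto simp: node_store_def fun_eq_iff)
  show ?thesis unfolding feas_step_def sem_switch[OF 1 assms] sem.simps(5) 2 by (cases b) auto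
qed

lemma feas_hook_simps:
  "feas_hook 0 b = Skip" "feas_hook (Suc 0) b = Skip" "feas_hook 2 b = Skip"
  "feas_hook 3 True = node_cmd (poly_pieces (base_polys @ extra_polys Zero)) Skip"
  "feas_hook 3 False = node_cmd (poly_pieces (base_polys @ extra_polys (Var 0)) @ var_pieces) Skip"
  "feas_hook 4 True = node_cmd (poly_pieces (base_polys @ extra_polys (Neg Zero)))
     (push_name False ;; Push 7 0)"
  "feas_hook 4 False = node_cmd (poly_pieces (base_polys @ extra_polys One)) Skip"
  "feas_hook 5 b = node_cmd (poly_pieces (base_polys @
       extra_polys (if b then Join Zero Zero else Meet Zero Zero)))
     (push_name True ;; push_name False ;; Push 7 0 ;; Push 7 0)"
  "feas_hook 6 b = emits (b # (if b then [] else [False, False]))"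
  "feas_hook 7 b = emits [b]" "feas_hook 8 b = emits [b]" by (auto simp: feas_hook_def)

lemma foldl_feas_step_nat:
  "foldl (feas_step x) (node_store 6 ns c, o') (enc_nat i @ r) =
   foldl (feas_step x) (node_store 0 ns c, o' @ enc_nat i @ [False, False]) r"
proof -
  have "foldl (feas_step x) (node_store 6 ns c, o') (enc_nat i @ r) =
     foldl (feas_step x) (feas_step x (node_store 6 ns c, o' @ butlast (enc_nat i)) False) r"
    using foldl_enc_nat(1)[where f = "feas_step x" and S = "\<lambda>q a. (node_store q ns c, a)"
        and z = 6 and n = 7 and e = 8 and h = "\<lambda>a b. a @ [b]" and a = o' and k = i and r = r]
    by (simp add: feas_step term_delta_simps feas_hook_simps foldl_snoc_id)
  also have "feas_step x (node_store 6 ns c, o' @ butlast (enc_nat i)) False =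
      (node_store 0 ns c, o' @ (butlast (enc_nat i) @ [False]) @ [False, False])"
    by (simp add: feas_step term_delta_simps feas_hook_simps)
  finally show ?thesis unfolding enc_nat_snoc .
qed

lemma table_polys_simps:
  "table_polys [] = []" "table_polys ((n, c, t) # tbl) = node_polys n c t @ table_polys tbl"
  "table_polys (tbl @ tbl') = table_polys tbl @ table_polys tbl'" by (auto simp: table_polys_def)

lemma elems_node_polys:
  "fills (\<lambda>h. unary (names n c h)) (poly_pieces (base_polys @ extra_polys t)) =
   elems (inst (names n c) (base_polys @ extra_polys t))"
  by (rule fills_poly_pieces[OF small_kinds_extra])

lemma feas_step_prefix:
  "foldl (feas_step x) (node_store 0 ns c, o') ([False, False, b] @ r) =
     foldl (feas_step x) (feas_step x (node_store 3 ns c, o') b) r"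
  "foldl (feas_step x) (node_store 0 ns c, o') ([False, True, b] @ r) =
     foldl (feas_step x) (feas_step x (node_store 4 ns c, o') b) r"
  "foldl (feas_step x) (node_store 0 ns c, o') ([True, False, b] @ r) =
     foldl (feas_step x) (feas_step x (node_store 5 ns c, o') b) r"
  by (simp_all add: feas_step term_delta_simps feas_hook_simps)

definition writes_polys :: "bool list => ol_term => bool" where
  "writes_polys x t \<longleftrightarrow> (\<forall>n c ns o' r. n \<le> length x --> c + nodes t \<le> length x + 1 -->
     foldl (feas_step x) (node_store 0 (n # ns) c, o') (enc_term t @ r) =
     foldl (feas_step x) (node_store 0 ns (c + nodes t - 1),
       o' @ elems (table_polys (node_table t n c))) r)"

lemma writes_polys_binary:
  assumes "writes_polys x s" "writes_polys x t"
  shows "writes_polys x (if b then Join s t else Meet s t)" unfolding writes_polys_def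
proof (intro allI impI)
  let ?u = "if b then Join s t else Meet s t"
  fix n c ns o' r assume "n \<le> length x" and "c + nodes ?u \<le> length x + 1"
  hence c: "c \<le> length x" "n \<le> length x" "c + 2 + nodes s \<le> length x + 1"
    "c + 1 \<le> length x" "c + 1 + nodes s + nodes t \<le> length x + 1"
    using nodes_pos[of s] nodes_pos[of t] by (auto split: if_splits)
  let ?o = "o' @ elems (inst (names n c) (base_polys @
    extra_polys (if b then Join Zero Zero else Meet Zero Zero)))"
  let ?A = "elems (table_polys (node_table s c (c + 2)))"
  let ?B = "elems (table_polys (node_table t (c + 1) (c + 1 + nodes s)))"
  have "feas_step x (node_store 5 (n # ns) c, o') b = (node_store 0 (c # (c + 1) # ns) (c + 2), ?o)"
    unfolding feas_step[of 5, simplified] feas_hook_simps term_delta_simps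
      sem_node_cmd[OF c(2,1) Hole_node_pieces] elems_node_polys sem.simps(5) sem_push_name[OF c(1)]
      sem_push_counter by simp
  moreover have "enc_term ?u @ r = [True, False, b] @ enc_term s @ enc_term t @ r" by simp
  ultimately have "foldl (feas_step x) (node_store 0 (n # ns) c, o') (enc_term ?u @ r) =
      foldl (feas_step x) (node_store 0 (c # (c + 1) # ns) (c + 2), ?o)
        (enc_term s @ enc_term t @ r)" by (simp only: feas_step_prefix)
  also have "... = foldl (feas_step x) (node_store 0 ((c + 1) # ns) (c + 1 + nodes s), ?o @ ?A)
      (enc_term t @ r)" using assms(1) c unfolding writes_polys_def by simp
  also have "... = foldl (feas_step x) (node_store 0 ns (c + 1 + nodes s + nodes t - 1), (?o @ ?A) @ ?B) r"
    using assms(2) c unfolding writes_polys_def by blast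
  also have "(?o @ ?A) @ ?B = o' @ elems (table_polys (node_table ?u n c))"
    by (simp add: table_polys_simps elems_simps node_polys_def)
  finally show "foldl (feas_step x) (node_store 0 (n # ns) c, o') (enc_term ?u @ r) =
     foldl (feas_step x) (node_store 0 ns (c + nodes ?u - 1),
       o' @ elems (table_polys (node_table ?u n c))) r" by (simp add: add.assoc)
qed

lemma foldl_feas_step:
  assumes "n \<le> length x" "c + nodes t \<le> length x + 1"
  shows "foldl (feas_step x) (node_store 0 (n # ns) c, o') (enc_term t @ r) =
    foldl (feas_step x) (node_store 0 ns (c + nodes t - 1),
      o' @ elems (table_polys (node_table t n c))) r" using assms
proof (induction t arbitrary: n c ns o' r)
  case (Meet s t)
  hence "writes_polys x s" "writes_polys x t" unfolding writes_polys_def by blast+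
  from writes_polys_binary[OF this, of False] Meet.prems show ?case
    unfolding writes_polys_def if_False by blast
next
  case (Join s t)
  hence "writes_polys x s" "writes_polys x t" unfolding writes_polys_def by blast+
  from writes_polys_binary[OF this, of True] Join.prems show ?case
    unfolding writes_polys_def if_True by blast
next
  case (Var i)
  have "feas_step x (node_store 3 (n # ns) c, o') False = (node_store 6 ns c,
      o' @ elems (inst (names n c) (base_polys @ extra_polys (Var i))) @
      fills (\<lambda>h. unary (names n c h)) var_pieces)"
  proof -
    have c: "c \<le> length x" "n \<le> length x" using Var by auto
    have H: "\<forall>r. Hole r \<in> set (poly_pieces (base_polys @ extra_polys (Var 0)) @ var_pieces) -->
        r = 2 \<or> r = 7" using Hole_node_pieces[of "Var 0"] Hole_var_pieces by auto
    show ?thesis unfolding feas_step[of 3, simplified] feas_hook_simps term_delta_simps if_False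
        sem_node_cmd[OF c(2,1) H] fills_append elems_node_polys sem.simps(1) by simp
  qed
  hence "foldl (feas_step x) (node_store 0 (n # ns) c, o') (enc_term (Var i) @ r) =
      foldl (feas_step x) (node_store 0 ns c,
        o' @ elems (inst (names n c) (base_polys @ extra_polys (Var i))) @
        (fills (\<lambda>h. unary (names n c h)) var_pieces @ enc_nat i @ [False, False])) r"
    by (simp only: enc_term.simps append_assoc feas_step_prefix foldl_feas_step_nat)
  thus ?case unfolding fills_var_pieces by (simp add: table_polys_simps node_polys_def elems_simps)
next
  case Zero
  have "feas_step x (node_store 3 (n # ns) c, o') True = (node_store 0 ns c,
      o' @ elems (inst (names n c) (base_polys @ extra_polys Zero)))"
    unfolding feas_step[of 3, simplified] feas_hook_simps term_delta_simps if_True elems_node_polys[symmetric]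
    using Zero by (subst sem_node_cmd[OF _ _ Hole_node_pieces]) auto
  thus ?case by (simp only: enc_term.simps append_assoc feas_step_prefix)
       (simp add: table_polys_simps node_polys_def)
next
  case One
  have "feas_step x (node_store 4 (n # ns) c, o') False = (node_store 0 ns c,
      o' @ elems (inst (names n c) (base_polys @ extra_polys One)))"
    unfolding feas_step[of 4, simplified] feas_hook_simps term_delta_simps if_False elems_node_polys[symmetric]
    using One by (subst sem_node_cmd[OF _ _ Hole_node_pieces]) auto
  thus ?case by (simp only: enc_term.simps append_assoc feas_step_prefix)
       (simp add: table_polys_simps node_polys_def)
next
  case (Neg t)
  have c: "c \<le> length x" "n \<le> length x" "c + 1 + nodes t \<le> length x + 1"
    using Neg.prems by auto
  let ?o = "o' @ elems (inst (names n c) (base_polys @ extra_polys (Neg Zero)))"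
  have "feas_step x (node_store 4 (n # ns) c, o') True = (node_store 0 (c # ns) (c + 1), ?o)"
    unfolding feas_step[of 4, simplified] feas_hook_simps term_delta_simps if_True
      sem_node_cmd[OF c(2,1) Hole_node_pieces] elems_node_polys sem.simps(5) sem_push_name[OF c(1)]
      sem_push_counter by simp
  hence "foldl (feas_step x) (node_store 0 (n # ns) c, o') (enc_term (Neg t) @ r) =
      foldl (feas_step x) (node_store 0 (c # ns) (c + 1), ?o) (enc_term t @ r)"
    by (simp only: enc_term.simps append_assoc feas_step_prefix)
  also have "... = foldl (feas_step x) (node_store 0 ns (c + 1 + nodes t - 1),
      ?o @ elems (table_polys (node_table t c (c + 1)))) r" using c by (intro Neg.IH) auto
  finally show ?case by (simp add: table_polys_simps node_polys_def elems_simps)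
qed

lemma nodes_le: "nodes t \<le> length (enc_term t)" by (induction t) auto

definition feas_com :: com where
  "feas_com = count_loop 10 term_delta term_count 9 ;;
     IfTop 1 0 (emits (enc_polys [[(1, [])]])) (IfTop 0 0
       (emits (elems [root_poly]) ;; Push 6 1 ;; Push 7 0 ;; auto_loop 0 10 term_delta feas_hook ;;
        emits [False])
       (emits (enc_polys [[(1, [])]])))"

lemma term_count_range: "term_count q b \<in> {- 1, 0, 1}" by (auto simp: term_count_def)

lemma sem_feas_com:
  "snd (sem x feas_com ((\<lambda>_. []), [])) =
     (if x \<in> range enc_term then enc_polys (term_polys (THE t. x = enc_term t))
      else enc_polys [[(1, [])]])"
proof -
  obtain q k where qk: "foldl (count_step term_delta term_count 9) (0, 1) x = (q, k)"
    "sem x (count_loop 10 term_delta term_count 9) (\<lambda>_. [], []) =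
      ((\<lambda>_. [])(0 := [q], 1 := replicate k 0), [])"
    using sem_count_loop[of 10 term_delta 9 term_count "(\<lambda>_. [], [])" x,
        OF term_delta_less _ _ term_count_range] by auto
  show ?thesis
  proof (cases "x \<in> range enc_term")
    case True
    then obtain t where x: "x = enc_term t" by blast
    have "(q, k) = (0, 0)"
      using True qk(1) unfolding term_accepted_iff[symmetric] accepted_def by simp
    have "sem x (Push 7 0) (sem x (Push 6 1) (sem x (emits (elems [root_poly]))
        (((\<lambda>_. [])(0 := [0], 1 := [])), []))) = (node_store 0 [0] 1, elems [root_poly])"
      by (auto simp: node_store_def name_stack_def fun_eq_iff)
    hence 1: "snd (sem x feas_com (\<lambda>_. [], [])) =
        snd (sem x (auto_loop 0 10 term_delta feas_hook) (node_store 0 [0] 1, elems [root_poly])) @ [False]"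
      using qk(2) `(q, k) = (0, 0)` by (simp add: feas_com_def)
    have "sem x (set_reg 0 0) (node_store 0 [0] 1, o') = (node_store 0 [0] 1, o')" for o'
      by (subst sem_set_reg) (auto simp: node_store_def fun_eq_iff)
    hence 2: "sem x (auto_loop 0 10 term_delta feas_hook) (node_store 0 [0] 1, o') =
        foldl (feas_step x) (node_store 0 [0] 1, o') x" for o'
      by (simp add: auto_loop_def feas_step_def[abs_def])
    have "foldl (feas_step x) (node_store 0 [0] 1, elems [root_poly]) (enc_term t @ []) =
        foldl (feas_step x) (node_store 0 [] (1 + nodes t - 1),
          elems [root_poly] @ elems (table_polys (node_table t 0 1))) []"
      using nodes_le[of t] x by (intro foldl_feas_step) auto
    hence "snd (sem x feas_com (\<lambda>_. [], [])) = enc_polys (term_polys t)"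
      unfolding 1 2 using x by (simp add: enc_polys_elems term_polys_def elems_simps)
    moreover have "(THE t. x = enc_term t) = t" using x by (auto simp: inj_enc_term)
    ultimately show ?thesis using True by simp
  next
    case False
    hence "q \<noteq> 0 \<or> k \<noteq> 0"
      using qk(1) unfolding term_accepted_iff[symmetric] accepted_def by simp
    thus ?thesis using False qk(2) by (auto simp: feas_com_def)
  qed
qed

subsection \<open>Solutions of the polynomials\<close>

lemma vec_combinations:
  fixes a b c :: "complex vec"
  assumes "a \<in> carrier_vec d" "b \<in> carrier_vec d"
  shows "a + (-1) *s b = 0\<^sub>v d \<longleftrightarrow> a = b"
    "c \<in> carrier_vec d ==> a + (b + (-1) *s c) = 0\<^sub>v d \<longleftrightarrow> a + b = c"
    "c \<in> carrier_vec d ==> a + ((-1) *s b + (-1) *s c) = 0\<^sub>v d \<longleftrightarrow> a = b + c"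
proof -
  have 1: "x + (y - z) = 0 \<longleftrightarrow> x + y = z" "x + (- y - z) = 0 \<longleftrightarrow> x = y + z"
    "x - y = z \<longleftrightarrow> x = y + z" for x y z :: complex
    by (auto simp: algebra_simps add_eq_0_iff)
  show "a + (-1) *s b = 0\<^sub>v d \<longleftrightarrow> a = b"
    using assms by (auto simp: vec_eq_iff)
  show "c \<in> carrier_vec d ==> a + (b + (-1) *s c) = 0\<^sub>v d \<longleftrightarrow> a + b = c"
    "c \<in> carrier_vec d ==> a + ((-1) *s b + (-1) *s c) = 0\<^sub>v d \<longleftrightarrow> a = b + c"
    using assms by (auto simp: vec_eq_iff 1)
qed

lemma add_eq_self_vec:
  fixes v w :: "complex vec"
  assumes "v \<in> carrier_vec d" "w \<in> carrier_vec d" "v + w = v"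
  shows "w = 0\<^sub>v d"
proof (rule eq_vecI)
  fix i assume i: "i < dim_vec (0\<^sub>v d :: complex vec)"
  have "(v + w) $ i = v $ i" using assms(3) by simp
  thus "w $ i = 0\<^sub>v d $ i" using i assms(1,2) by simp
qed (use assms in auto)

context star_field
begin

lemma eval_poly_mult_vec:
  assumes "\<forall>i. Fmat d d (x i)" "v \<in> V d"
  shows "eval_poly (R d) x [] *v v = 0\<^sub>v d"
    "eval_poly (R d) x ((c, w) # p) *v v =
       of_int c *s (eval_monom (R d) x w *v v) + eval_poly (R d) x p *v v"
    "eval_monom (R d) x [] *v v = v"
    "eval_monom (R d) x (l # w) *v v = eval_letter (R d) x l *v (eval_monom (R d) x w *v v)"
proof -
  have v: "v \<in> carrier_vec d" using assms(2) by simp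
  have m: "eval_monom (R d) x w \<in> carrier_mat d d" for w
    using Fmat_eval_monom[OF assms(1)] by (rule Fmat_carrier)
  have p: "eval_poly (R d) x p \<in> carrier_mat d d" for p
    using Fmat_eval_poly[OF assms(1)] by (rule Fmat_carrier)
  have l: "eval_letter (R d) x l \<in> carrier_mat d d" for l
    using Fmat_eval_letter[OF assms(1)] by (rule Fmat_carrier)
  show "eval_poly (R d) x [] *v v = 0\<^sub>v d"
    using v unfolding eval_poly_R[OF assms(1)] by (intro eq_vecI) auto
  show "eval_monom (R d) x [] *v v = v" using v unfolding eval_monom_R by simp
  show "eval_monom (R d) x (l # w) *v v = eval_letter (R d) x l *v (eval_monom (R d) x w *v v)"
    unfolding eval_monom_R by (rule assoc_mult_mat_vec[OF l m v])
  have "(of_int c \<cdot>\<^sub>m eval_monom (R d) x w) *v v = of_int c *s (eval_monom (R d) x w *v v)"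
    using m[of w] v by (intro eq_vecI) (auto simp: scalar_prod_def sum_distrib_left mult.assoc)
  thus "eval_poly (R d) x ((c, w) # p) *v v =
       of_int c *s (eval_monom (R d) x w *v v) + eval_poly (R d) x p *v v"
    unfolding eval_poly_R[OF assms(1)]
    using add_mult_distrib_mat_vec[of "of_int c \<cdot>\<^sub>m eval_monom (R d) x w" d d "eval_poly (R d) x p" v]
      m[of w] p[of p] v by simp
qed

lemma eval_poly_eq_0_iff:
  assumes "\<forall>i. Fmat d d (x i)"
  shows "eval_poly (R d) x p = 0\<^sub>m d d \<longleftrightarrow> (\<forall>v\<in>V d. eval_poly (R d) x p *v v = 0\<^sub>v d)"
proof
  assume "\<forall>v\<in>V d. eval_poly (R d) x p *v v = 0\<^sub>v d"
  moreover have "0\<^sub>m d d *v v = (0\<^sub>v d :: complex vec)" if "v \<in> V d" for v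
    using V_carrier[OF that] by (intro eq_vecI) auto
  ultimately show "eval_poly (R d) x p = 0\<^sub>m d d"
    using Fmat_carrier[OF Fmat_eval_poly[OF assms]] by (intro mat_eqI[of _ d d]) auto
next
  assume "eval_poly (R d) x p = 0\<^sub>m d d"
  moreover have "0\<^sub>m d d *v v = (0\<^sub>v d :: complex vec)" if "v \<in> V d" for v
    using V_carrier[OF that] by (intro eq_vecI) auto
  ultimately show "\<forall>v\<in>V d. eval_poly (R d) x p *v v = 0\<^sub>v d" by simp
qed

abbreviation Pr :: "(nat => complex mat) => nat => complex mat" where
  "Pr x n \<equiv> x (node_var 0 n)"

abbreviation Ym :: "(nat => complex mat) => nat => complex mat" where
  "Ym x n \<equiv> x (node_var 1 n)"

abbreviation Zm :: "(nat => complex mat) => nat => complex mat" where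
  "Zm x n \<equiv> x (node_var 2 n)"

abbreviation Nm :: "(nat => complex mat) => nat => complex mat" where
  "Nm x n \<equiv> x (node_var 3 n)"

definition join_cond where
  "join_cond d P A B Y Z \<longleftrightarrow> (\<forall>v\<in>V d. P *v (A *v v) = A *v v \<and> P *v (B *v v) = B *v v \<and>
     P *v v = A *v (Y *v v) + B *v (Z *v v))"

definition complements :: "nat => complex mat => complex mat => bool" where
  "complements d P N \<longleftrightarrow> is_projection d P \<and> (\<forall>v\<in>V d. P *v v + N *v v = v)"

primrec node_cond :: "nat => (nat => complex mat) => nat => nat => ol_term => bool" where
  "node_cond d x n c (Var i) = (\<forall>v\<in>V d. Pr x n *v v = x (2 * i + 1) *v v)"
| "node_cond d x n c Zero = (\<forall>v\<in>V d. Pr x n *v v = 0\<^sub>v d)"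
| "node_cond d x n c One = (\<forall>v\<in>V d. Pr x n *v v = v)"
| "node_cond d x n c (Neg t) = (\<forall>v\<in>V d. Pr x n *v v = Nm x c *v v)"
| "node_cond d x n c (Meet s t) = join_cond d (Nm x n) (Nm x c) (Nm x (c + 1)) (Ym x n) (Zm x n)"
| "node_cond d x n c (Join s t) = join_cond d (Pr x n) (Pr x c) (Pr x (c + 1)) (Ym x n) (Zm x n)"

lemma node_polys_iff:
  assumes x: "\<forall>i. Fmat d d (x i)"
  shows "(\<forall>p\<in>set (node_polys n c t). eval_poly (R d) x p = 0\<^sub>m d d) \<longleftrightarrow>
    complements d (Pr x n) (Nm x n) \<and> node_cond d x n c t"
proof -
  let ?P = "Pr x n"
  have l: "eval_letter (R d) x (i, False) = x i" "eval_letter (R d) x (i, True) = mat_adjoint (x i)" for i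
    by (simp_all add: eval_letter_def)
  have xV: "x i *v v \<in> V d" "mat_adjoint (x i) *v v \<in> V d" if "v \<in> V d" for i v
    using that x by (auto intro!: mult_vec_V Fmat_adjoint simp del: Fmat_carrier)
  hence xc: "x i *v v \<in> carrier_vec d" "mat_adjoint (x i) *v v \<in> carrier_vec d" if "v \<in> V d" for i v
    using that V_carrier by blast+
  have letters: "inst_letter (names n c) tP = (node_var 0 n, False)"
    "inst_letter (names n c) tPa = (node_var 0 n, True)"
    "inst_letter (names n c) tY = (node_var 1 n, False)"
    "inst_letter (names n c) tZ = (node_var 2 n, False)"
    "inst_letter (names n c) tN = (node_var 3 n, False)"
    "inst_letter (names n c) (tL k) = (node_var k c, False)"
    "inst_letter (names n c) (tR k) = (node_var k (c + 1), False)" for k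
    by (simp_all add: inst_letter_def t_defs names_def)
  note ev = eval_poly_eq_0_iff[OF x] eval_poly_mult_vec[OF x] l xV xc of_int_1 of_int_minus
  have base: "(\<forall>p\<in>set (inst (names n c) base_polys). eval_poly (R d) x p = 0\<^sub>m d d) \<longleftrightarrow>
      ((\<forall>v\<in>V d. ?P *v (?P *v v) = ?P *v v) \<and> (\<forall>v\<in>V d. ?P *v v = mat_adjoint ?P *v v)) \<and>
      (\<forall>v\<in>V d. ?P *v v + Nm x n *v v = v)"
    by (simp add: inst_def base_polys_def letters ev vec_combinations(1,2)[of _ d] cong: ball_cong)
  also have "(\<forall>v\<in>V d. ?P *v (?P *v v) = ?P *v v) \<and> (\<forall>v\<in>V d. ?P *v v = mat_adjoint ?P *v v) \<longleftrightarrow>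
      is_projection d ?P"
  proof
    have P: "Fmat d d ?P" using x by blast
    note c = Fmat_carrier[OF P]
    note ca = mat_adjoint_carrier[OF c]
    {
      assume eq: "(\<forall>v\<in>V d. ?P *v (?P *v v) = ?P *v v) \<and> (\<forall>v\<in>V d. ?P *v v = mat_adjoint ?P *v v)"
      have "?P * ?P = ?P"
        using eq assoc_mult_mat_vec[OF c c V_carrier] by (intro mat_eqI[OF mult_carrier_mat[OF c c] c]) metis
      moreover have "mat_adjoint ?P = ?P" using eq by (intro mat_eqI[OF ca c]) metis
      ultimately show "is_projection d ?P" using P by (simp add: is_projection_def)
    next
      assume "is_projection d ?P"
      hence "?P * ?P = ?P" "mat_adjoint ?P = ?P" by (simp_all add: is_projection_def)
      thus "(\<forall>v\<in>V d. ?P *v (?P *v v) = ?P *v v) \<and> (\<forall>v\<in>V d. ?P *v v = mat_adjoint ?P *v v)"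
        using assoc_mult_mat_vec[OF c c V_carrier] by metis
    }
  qed
  finally have base': "(\<forall>p\<in>set (inst (names n c) base_polys). eval_poly (R d) x p = 0\<^sub>m d d) \<longleftrightarrow>
      complements d ?P (Nm x n)" unfolding complements_def .
  have extra: "(\<forall>p\<in>set (inst (names n c) (extra_polys t) @
      (case t of Var i => [var_poly n i] | _ => [])). eval_poly (R d) x p = 0\<^sub>m d d) \<longleftrightarrow> node_cond d x n c t"
  proof (cases t)
    case (Var i)
    thus ?thesis by (simp add: inst_def var_poly_def ev vec_combinations(1)[of _ d] cong: ball_cong)
  next
    case Zero
    thus ?thesis by (simp add: inst_def letters ev cong: ball_cong)
  next
    case One
    thus ?thesis by (simp add: inst_def letters ev vec_combinations(1)[of _ d] cong: ball_cong)
  next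
    case (Neg t')
    thus ?thesis by (simp add: inst_def letters ev vec_combinations(1)[of _ d] cong: ball_cong)
  next
    case (Meet s' t')
    thus ?thesis by (auto simp add: inst_def join_polys_def join_cond_def letters ev
          vec_combinations(1,3)[of _ d] cong: ball_cong)
  next
    case (Join s' t')
    thus ?thesis by (auto simp add: inst_def join_polys_def join_cond_def letters ev
          vec_combinations(1,3)[of _ d] cong: ball_cong)
  qed
  have "node_polys n c t = inst (names n c) base_polys @ (inst (names n c) (extra_polys t) @
      (case t of Var i => [var_poly n i] | _ => []))" by (simp add: node_polys_def inst_def)
  thus ?thesis using base' extra by (simp only: set_append ball_Un)
qed

lemma term_polys_iff:
  assumes x: "\<forall>i. Fmat d d (x i)"
  shows "(\<forall>p\<in>set (term_polys t). eval_poly (R d) x p = 0\<^sub>m d d) \<longleftrightarrow>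
    (\<forall>v\<in>V d. Pr x 0 *v v = v) \<and>
    (\<forall>(n, c, u)\<in>set (node_table t 0 1). complements d (Pr x n) (Nm x n) \<and> node_cond d x n c u)"
proof -
  have "x i *v v \<in> V d" if "v \<in> V d" for i v
    using that x by (auto intro!: mult_vec_V simp del: Fmat_carrier)
  hence "eval_poly (R d) x root_poly = 0\<^sub>m d d \<longleftrightarrow> (\<forall>v\<in>V d. Pr x 0 *v v = v)"
    by (simp add: root_poly_def eval_poly_eq_0_iff[OF x] eval_poly_mult_vec[OF x]
        vec_combinations(1)[of _ d] eval_letter_def cong: ball_cong)
  thus ?thesis by (auto simp: term_polys_def table_polys_def node_polys_iff[OF x, symmetric])
qed

lemma complement_range:
  assumes "complements d P N" "Fmat d d N"
  shows "range_sp d N = perp d (range_sp d P)"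
    and "v \<in> V d ==> N *v v \<in> range_sp d N"
proof -
  have P: "is_projection d P" and eq: "\<And>v. v \<in> V d ==> P *v v + N *v v = v"
    using assms(1) by (auto simp: complements_def)
  have V: "P *v v \<in> V d" "N *v v \<in> V d" if "v \<in> V d" for v
    using that P assms(2) by (auto intro: mult_vec_V simp: is_projection_def)
  have self: "b = 0\<^sub>v d" if "a \<in> V d" "b \<in> V d" "a + b = a" for a b
    using that by (intro add_eq_self_vec[of a d b]) auto
  have "P *v v = 0\<^sub>v d \<longleftrightarrow> N *v v = v" if v: "v \<in> V d" for v
    using eq[OF v] v V[OF v] self[of v "P *v v"] by (metis V_carrier comm_add_vec left_zero_vec)
  thus r: "range_sp d N = perp d (range_sp d P)"
    unfolding projection_perp[OF P] by (auto simp: range_sp_def)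
  assume v: "v \<in> V d"
  have "P *v (P *v v) = P *v v" using projection_range[OF P v] by (simp add: range_sp_def)
  with eq[OF V(1)[OF v]] have 0: "N *v (P *v v) = 0\<^sub>v d"
    using V V(1)[OF v] by (intro self[of "P *v v"]) auto
  have "N *v v = N *v (P *v v + N *v v)" using eq[OF v] by simp
  also have "... = N *v (N *v v)"
    using V_carrier[OF V(1)[OF v]] V_carrier[OF V(2)[OF v]] V_carrier[OF V(2)[OF V(2)[OF v]]]
    by (simp add: mult_add_distrib_mat_vec[OF Fmat_carrier[OF assms(2)]] 0)
  finally show "N *v v \<in> range_sp d N" using V(2)[OF v] by (simp add: range_sp_def)
qed

lemma range_join:
  assumes c: "join_cond d P A B Y Z" and F: "Fmat d d P" "Fmat d d Y" "Fmat d d Z"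
    and r: "\<And>v. v \<in> V d ==> A *v v \<in> range_sp d A" "\<And>v. v \<in> V d ==> B *v v \<in> range_sp d B"
  shows "plus_sets (range_sp d A) (range_sp d B) = range_sp d P"
proof
  have "range_sp d A \<subseteq> range_sp d P" "range_sp d B \<subseteq> range_sp d P"
    using c by (fastforce simp: range_sp_def join_cond_def)+
  thus "plus_sets (range_sp d A) (range_sp d B) \<subseteq> range_sp d P"
    using subspaceD(3)[OF subspace_range_sp[OF F(1)]] by (auto simp: plus_sets_def)
  show "range_sp d P \<subseteq> plus_sets (range_sp d A) (range_sp d B)"
  proof
    fix v assume "v \<in> range_sp d P"
    hence v: "v \<in> V d" "P *v v = v" by (auto simp: range_sp_def)
    with c have "v = A *v (Y *v v) + B *v (Z *v v)" by (fastforce simp: join_cond_def)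
    also have "... \<in> plus_sets (range_sp d A) (range_sp d B)"
      using v F by (intro plus_setsI r mult_vec_V)
    finally show "v \<in> plus_sets (range_sp d A) (range_sp d B)" .
  qed
qed

lemma range_eval:
  assumes x: "\<forall>i. Fmat d d (x i)"
    and tab: "\<forall>(n, c, u)\<in>set (node_table t 0 1). complements d (Pr x n) (Nm x n) \<and> node_cond d x n c u"
    and mem: "(n, c, u) \<in> set (node_table t 0 1)"
  shows "eval_term (L d) (\<lambda>i. range_sp d (x (2 * i + 1))) u = range_sp d (Pr x n)" using mem
proof (induction u arbitrary: n c)
  case (Neg u)
  obtain k where k: "(c, k, u) \<in> set (node_table t 0 1)"
    using node_table_children(1)[OF Neg.prems] by blast
  have "range_sp d (Pr x n) = range_sp d (Nm x c)"
    using tab Neg.prems by (fastforce simp: range_sp_def)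
  also have "... = perp d (range_sp d (Pr x c))"
    using tab k x by (intro complement_range) fastforce+
  finally show ?case using Neg.IH[OF k] by simp
next
  case (Meet u w)
  let ?r = "\<lambda>n. range_sp d (Pr x n)" and ?N = "\<lambda>n. range_sp d (Nm x n)"
  obtain k k' where k: "(c, k, u) \<in> set (node_table t 0 1)" "(c + 1, k', w) \<in> set (node_table t 0 1)"
    using node_table_children(2)[of n c u w] Meet.prems by blast
  have C: "complements d (Pr x n) (Nm x n)" "complements d (Pr x c) (Nm x c)"
    "complements d (Pr x (c + 1)) (Nm x (c + 1))" using tab k Meet.prems by fastforce+
  have S: "subspace_over F d (?r n)" "subspace_over F d (?r c)" "subspace_over F d (?r (c + 1))"
    using x by (blast intro: subspace_range_sp)+
  have "node_cond d x n c (Meet u w)" using tab Meet.prems by fastforce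
  from range_join[OF this[unfolded node_cond.simps] x[rule_format] x[rule_format] x[rule_format]
      complement_range(2)[OF C(2) x[rule_format]] complement_range(2)[OF C(3) x[rule_format]]]
  have "plus_sets (?N c) (?N (c + 1)) = ?N n" .
  hence "perp d (?r c \<inter> ?r (c + 1)) = perp d (?r n)"
    unfolding perp_inter[OF S(2,3)] using x complement_range(1)[OF C(1)]
      complement_range(1)[OF C(2)] complement_range(1)[OF C(3)] by metis
  hence "?r c \<inter> ?r (c + 1) = ?r n"
    using perp_perp[OF subspace_inter[OF S(2,3)]] perp_perp[OF S(1)] by metis
  thus ?case using Meet.IH(1)[OF k(1)] Meet.IH(2)[OF k(2)] by simp
next
  case (Join u w)
  obtain k k' where k: "(c, k, u) \<in> set (node_table t 0 1)" "(c + 1, k', w) \<in> set (node_table t 0 1)"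
    using node_table_children(2)[of n c u w] Join.prems by blast
  have P: "is_projection d (Pr x c)" "is_projection d (Pr x (c + 1))"
    using tab k by (fastforce simp: complements_def)+
  have "node_cond d x n c (Join u w)" using tab Join.prems by fastforce
  from range_join[OF this[unfolded node_cond.simps] x[rule_format] x[rule_format] x[rule_format]
      projection_range[OF P(1)] projection_range[OF P(2)]]
  have "plus_sets (range_sp d (Pr x c)) (range_sp d (Pr x (c + 1))) = range_sp d (Pr x n)" .
  thus ?case using Join.IH(1)[OF k(1)] Join.IH(2)[OF k(2)] by simp
qed (use tab in \<open>fastforce simp: range_sp_def\<close>)+

end

context star_field
begin

lemma proj_id: "subspace_over F d U ==> u \<in> U ==> proj d U *v u = u"
  using range_proj[of d U] by (auto simp: range_sp_def)

lemma proj_zero: "subspace_over F d U ==> u \<in> perp d U ==> proj d U *v u = 0\<^sub>v d"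
  using projection_perp[OF is_projection_proj, of d U] range_proj[of d U] by auto

lemma join_witnesses:
  assumes U: "subspace_over F d U" and W: "subspace_over F d W"
  shows "\<exists>Y Z. Fmat d d Y \<and> Fmat d d Z \<and> (\<forall>v\<in>V d. proj d (plus_sets U W) *v v =
     proj d U *v (Y *v v) + proj d W *v (Z *v v))"
proof -
  let ?S = "plus_sets U W"
  note S = subspace_plus[OF U W]
  have "\<exists>u w. u \<in> U \<and> w \<in> W \<and> proj d ?S *v unit_vec d j = u + w" for j
    using proj_decomposes(2)[OF S unit_vec_V, of j] by (auto simp: plus_sets_def)
  then obtain f g where fg: "\<And>j. f j \<in> U" "\<And>j. g j \<in> W"
    "\<And>j. proj d ?S *v unit_vec d j = f j + g j" by metis
  have V: "f j \<in> V d" "g j \<in> V d" for j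
    using fg subspaceD(1)[OF U] subspaceD(1)[OF W] by auto
  show ?thesis
  proof (intro exI conjI ballI)
    show "Fmat d d (cols_mat d d f)" "Fmat d d (cols_mat d d g)"
      using V by (auto intro: Fmat_cols_mat)
    fix v assume v: "v \<in> V d"
    have 1: "comb d d (\<lambda>j. v $ j) f \<in> U" "comb d d (\<lambda>j. v $ j) g \<in> W"
      using fg V_index[OF v] by (auto intro!: comb_in U W)
    have "proj d ?S *v v = comb d d (\<lambda>j. v $ j) f + comb d d (\<lambda>j. v $ j) g"
      unfolding mat_mult_comb_unit[OF proj_decomposes(1)[OF S] v] fg(3)
      using V by (intro comb_add) auto
    thus "proj d ?S *v v =
        proj d U *v (cols_mat d d f *v v) + proj d W *v (cols_mat d d g *v v)"
      unfolding cols_mat_mult[OF V_carrier[OF v]] proj_id[OF U 1(1)] proj_id[OF W 1(2)] .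
  qed
qed

lemma subspace_perp': "subspace_over F d U ==> subspace_over F d (perp d U)"
  using subspaceD(1) by (auto intro: subspace_perp)

lemma proj_perp_add:
  assumes U: "subspace_over F d U" and v: "v \<in> V d"
  shows "proj d U *v v + proj d (perp d U) *v v = v"
proof -
  have U': "subspace_over F d (perp d U)" by (rule subspace_perp'[OF U])
  let ?u = "proj d U *v v" and ?w = "v - proj d U *v v"
  have u: "?u \<in> V d" "?u \<in> perp d (perp d U)"
    using mult_vec_V[OF proj_decomposes(1)[OF U] v] proj_decomposes(2)[OF U v]
    unfolding perp_perp[OF U] by simp_all
  have w: "?w \<in> perp d U" by (rule proj_decomposes(3)[OF U v])
  have e: "v = ?u + ?w"
    using V_dim[OF u(1)] V_dim[OF v] by (intro eq_vecI) (auto simp del: index_mult_mat_vec dim_mult_mat_vec)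
  have "proj d (perp d U) *v v = proj d (perp d U) *v ?u + proj d (perp d U) *v ?w"
    by (subst e, rule mult_add_distrib_mat_vec[OF Fmat_carrier[OF proj_decomposes(1)[OF U']]
          V_carrier[OF u(1)] V_carrier[OF perp_D(2)[OF w]]])
  also have "... = ?w"
    unfolding proj_zero[OF U' u(2)] proj_id[OF U' w] using V_carrier[OF perp_D(2)[OF w]] by simp
  finally show ?thesis using e by simp
qed

lemma ex_join_cond:
  assumes U: "subspace_over F d U" and W: "subspace_over F d W"
  shows "\<exists>Y Z. Fmat d d Y \<and> Fmat d d Z \<and>
    join_cond d (proj d (plus_sets U W)) (proj d U) (proj d W) Y Z"
proof -
  let ?S = "plus_sets U W"
  note S = subspace_plus[OF U W]
  have sub: "u \<in> ?S" if "u \<in> U \<or> u \<in> W" for u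
    using that plus_setsI[of u U "0\<^sub>v d" W] plus_setsI[of "0\<^sub>v d" U u W] subspaceD(2)[OF U]
      subspaceD(2)[OF W] V_carrier[OF subspaceD(1)[OF U]] V_carrier[OF subspaceD(1)[OF W]] by force
  obtain Y Z where "Fmat d d Y" "Fmat d d Z"
    "\<forall>v\<in>V d. proj d ?S *v v = proj d U *v (Y *v v) + proj d W *v (Z *v v)"
    using join_witnesses[OF U W] by blast
  moreover have "proj d ?S *v (proj d U *v v) = proj d U *v v"
    "proj d ?S *v (proj d W *v v) = proj d W *v v" if "v \<in> V d" for v
    using proj_decomposes(2)[OF U that] proj_decomposes(2)[OF W that] by (auto intro: proj_id[OF S] sub)
  ultimately show ?thesis unfolding join_cond_def by blast
qed

definition named ::
    "nat => (nat => complex vec set) => (nat => complex mat) => nat => ol_term => bool" where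
  "named d a x n t \<longleftrightarrow> Pr x n = proj d (eval_term (L d) a t) \<and>
     Nm x n = proj d (perp d (eval_term (L d) a t))"

definition witnesses ::
    "nat => (nat => complex vec set) => ol_term => complex mat => complex mat => bool" where
  "witnesses d a t Y Z \<longleftrightarrow> Fmat d d Y \<and> Fmat d d Z \<and>
    (\<forall>x n c. named d a x n t --> Ym x n = Y --> Zm x n = Z -->
      (\<forall>u. t = Neg u --> named d a x c u) -->
      (\<forall>u w. t = Meet u w \<or> t = Join u w --> named d a x c u \<and> named d a x (c + 1) w) -->
      (\<forall>i. t = Var i --> x (2 * i + 1) = proj d (a i)) --> node_cond d x n c t)"

lemma ex_witnesses:
  assumes a: "\<forall>i. subspace_over F d (a i)"
  shows "\<exists>Y Z. witnesses d a t Y Z"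
proof (cases t)
  case (Meet u w)
  let ?U = "eval_term (L d) a u" and ?W = "eval_term (L d) a w"
  have U: "subspace_over F d ?U" "subspace_over F d ?W" by (rule subspace_eval[OF a])+
  obtain Y Z where "Fmat d d Y" "Fmat d d Z"
    "join_cond d (proj d (perp d (?U \<inter> ?W))) (proj d (perp d ?U)) (proj d (perp d ?W)) Y Z"
    using ex_join_cond[OF subspace_perp'[OF U(1)] subspace_perp'[OF U(2)]] perp_inter[OF U] by auto
  thus ?thesis using Meet by (intro exI[of _ Y] exI[of _ Z]) (simp add: witnesses_def named_def)
next
  case (Join u w)
  obtain Y Z where "Fmat d d Y" "Fmat d d Z"
    "join_cond d (proj d (eval_term (L d) a t)) (proj d (eval_term (L d) a u))
       (proj d (eval_term (L d) a w)) Y Z"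
    using ex_join_cond[OF subspace_eval[OF a] subspace_eval[OF a], of u w] Join by auto
  thus ?thesis using Join by (intro exI[of _ Y] exI[of _ Z]) (simp add: witnesses_def named_def)
next
  case Zero
  have "proj d {0\<^sub>v d} *v v = 0\<^sub>v d" if "v \<in> V d" for v
    using proj_decomposes(2)[OF subspace_0 that] by simp
  thus ?thesis
    using Fmat_zero[of d d] Zero by (intro exI[of _ "0\<^sub>m d d"]) (simp add: witnesses_def named_def)
qed (use Fmat_zero[of d d] proj_id[OF subspace_V] in \<open>auto simp: witnesses_def named_def
      intro!: exI[of _ "0\<^sub>m d d"]\<close>)

lemma term_polys_feasible:
  "t \<in> sat_terms (L d) \<longleftrightarrow> term_polys t \<in> feasible_polys (R d)"
proof
  assume "term_polys t \<in> feasible_polys (R d)"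
  then obtain x where x: "\<forall>i. Fmat d d (x i)"
    and p: "\<forall>p\<in>set (term_polys t). eval_poly (R d) x p = 0\<^sub>m d d"
    unfolding feasible_R by blast
  let ?a = "\<lambda>i. range_sp d (x (2 * i + 1))"
  have root: "\<forall>v\<in>V d. Pr x 0 *v v = v"
    and tab: "\<forall>(n, c, u)\<in>set (node_table t 0 1). complements d (Pr x n) (Nm x n) \<and> node_cond d x n c u"
    using p unfolding term_polys_iff[OF x] by blast+
  have "eval_term (L d) ?a t = range_sp d (Pr x 0)" by (rule range_eval[OF x tab node_table_root])
  also have "... = V d" using root by (auto simp: range_sp_def)
  finally have "eval_term (L d) ?a t = V d" .
  moreover have "\<forall>i. subspace_over F d (?a i)"
    using x by (auto intro!: subspace_range_sp simp del: Fmat_carrier)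
  ultimately show "t \<in> sat_terms (L d)"
    unfolding sat_terms_def by (intro CollectI exI[of _ ?a]) simp
next
  assume "t \<in> sat_terms (L d)"
  then obtain a where a: "\<forall>i. subspace_over F d (a i)" and e: "eval_term (L d) a t = V d"
    by (auto simp: sat_terms_def)
  let ?tbl = "node_table t 0 1"
  have dist: "distinct (map fst ?tbl)" using node_table_names[of 0 1 t] by simp
  define term_of where "term_of n = (case map_of ?tbl n of Some (c, u) => u | None => Zero)" for n
  have term_of: "term_of n = u" if "(n, c, u) \<in> set ?tbl" for n c u
    using map_of_is_SomeI[OF dist that] by (simp add: term_of_def)
  have "\<forall>n. \<exists>YZ. witnesses d a (term_of n) (fst YZ) (snd YZ)"
    using ex_witnesses[OF a] by simp
  from choice[OF this] obtain M where "\<And>n. witnesses d a (term_of n) (fst (M n)) (snd (M n))"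
    by blast
  then obtain Y Z where W: "\<And>n. witnesses d a (term_of n) (Y n) (Z n)" by (rule_tac that)
  define G where "G k n = (if k = 0 then proj d (eval_term (L d) a (term_of n))
      else if k = 1 then Y n else if k = 2 then Z n
      else proj d (perp d (eval_term (L d) a (term_of n))))" for k n :: nat
  define x where "x j = (if odd j then proj d (a (j div 2))
      else if \<exists>k n. k < 4 \<and> j = node_var k n
        then (case (SOME p. fst p < 4 \<and> j = node_var (fst p) (snd p)) of (k, n) => G k n)
        else 0\<^sub>m d d)" for j
  have xG: "x (node_var k n) = G k n" if "k < 4" for k n
  proof -
    have "(SOME p. fst p < 4 \<and> node_var k n = node_var (fst p) (snd p)) = (k, n)"
      using that by (intro some_equality) (auto simp: node_var_inj)
    thus ?thesis using that even_node_var[of k n] by (auto simp: x_def)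
  qed
  have G: "Fmat d d (G k n)" for k n
    using W[of n] proj_decomposes(1) subspace_eval[OF a] subspace_perp'
    by (simp add: G_def witnesses_def)
  have x: "\<forall>i. Fmat d d (x i)"
  proof
    fix i
    show "Fmat d d (x i)" using G proj_decomposes(1)[of d "a (i div 2)"] a Fmat_zero[of d d]
      by (auto simp: x_def split: prod.split)
  qed
  have xP: "Pr x n = proj d (eval_term (L d) a (term_of n))" "Ym x n = Y n" "Zm x n = Z n"
    "named d a x n (term_of n)" for n by (simp_all add: xG G_def named_def)
  have "complements d (Pr x n) (Nm x n) \<and> node_cond d x n c u" if mem: "(n, c, u) \<in> set ?tbl" for n c u
  proof
    show "complements d (Pr x n) (Nm x n)"
      using is_projection_proj[OF subspace_eval[OF a]] proj_perp_add[OF subspace_eval[OF a]] xP(4)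
      by (simp add: complements_def named_def)
    have 1: "\<forall>u. term_of n = Neg u --> named d a x c u"
      using node_table_children(1)[of n c] mem term_of xP(4) by metis
    have 2: "\<forall>u w. term_of n = Meet u w \<or> term_of n = Join u w -->
        named d a x c u \<and> named d a x (c + 1) w"
      using node_table_children(2)[of n c] mem term_of xP(4) by metis
    have 3: "\<forall>i. term_of n = Var i --> x (2 * i + 1) = proj d (a i)" by (simp add: x_def)
    have "node_cond d x n c (term_of n)"
      using W[of n] xP[of n] 1 2 3 unfolding witnesses_def by blast
    thus "node_cond d x n c u" using term_of[OF mem] by simp
  qed
  moreover have "Pr x 0 *v v = v" if "v \<in> V d" for v
    unfolding xP term_of[OF node_table_root] e using that by (rule proj_id[OF subspace_V])
  ultimately have "\<forall>p\<in>set (term_polys t). eval_poly (R d) x p = 0\<^sub>m d d"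
    unfolding term_polys_iff[OF x] by blast
  thus "term_polys t \<in> feasible_polys (R d)" unfolding feasible_R using x by blast
qed

end

lemma inj_enc_polys: "enc_polys ps = enc_polys qs \<longleftrightarrow> ps = qs"
  using prefix_code_inj[OF prefix_code_enc_polys] by (auto dest: injD)

theorem SAT_L_reducible_FEAS_all_dims:
  assumes "star_subfield F"
  shows "SAT_L F \<le>\<^sub>p FEAS_all_dims F"
proof -
  interpret star_field F by unfold_locales (rule assms)
  define f where "f x = snd (sem x feas_com ((\<lambda>_. []), []))" for x
  have "poly_time f" unfolding f_def by (rule poly_time_loop_program)
  moreover have "x \<in> SAT_L F \<longleftrightarrow> f x \<in> FEAS_all_dims F" for x
  proof (cases "x \<in> range enc_term")
    case True
    then obtain t where x: "x = enc_term t" by blast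
    hence "f x = enc_polys (term_polys t)" unfolding f_def sem_feas_com by (simp add: inj_enc_term)
    thus ?thesis using term_polys_feasible[of t]
      by (auto simp: x SAT_L_def FEAS_all_dims_def FEAS_def image_iff inj_enc_term inj_enc_polys)
  next
    case False
    hence "f x = enc_polys [[(1, [])]]" unfolding f_def sem_feas_com by simp
    moreover have "[[(1, [])]] \<notin> feasible_polys (R d)" if "d \<ge> 1" for d
    proof
      assume "[[(1, [])]] \<in> feasible_polys (R d)"
      then obtain x where x: "\<forall>i. Fmat d d (x i)" and e: "eval_poly (R d) x [(1, [])] = 0\<^sub>m d d"
        unfolding feasible_R by auto
      have "1 \<cdot>\<^sub>m 1\<^sub>m d = (0\<^sub>m d d :: complex mat)"
        using e by (simp add: eval_poly_R[OF x] eval_monom_R)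
      hence "(1 \<cdot>\<^sub>m 1\<^sub>m d :: complex mat) $$ (0, 0) = 0\<^sub>m d d $$ (0, 0)"
        by (rule arg_cong)
      thus False using that by simp
    qed
    ultimately show ?thesis
      using False by (auto simp: SAT_L_def FEAS_all_dims_def FEAS_def image_iff inj_enc_polys)
  qed
  ultimately show ?thesis unfolding poly_reducible_def by blast
qed

section \<open>Coordinates in the subspace lattice\<close>

lemma mult_mat_vec_uminus:
  fixes A :: "complex mat"
  assumes "A \<in> carrier_mat n m" "v \<in> carrier_vec m"
  shows "A *v (- v) = - (A *v v)" "(- A) *v v = - (A *v v)"
proof -
  have "- v = (- 1) *s v" using assms(2) by (intro eq_vecI) auto
  moreover have "- (A *v v) = (- 1) *s (A *v v)" using assms by (intro eq_vecI) auto
  ultimately show "A *v (- v) = - (A *v v)" using mult_mat_vec[OF assms, of "- 1"] by simp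
  show "(- A) *v v = - (A *v v)" using assms by (intro uminus_mult_mat_vec) auto
qed

definition le_term :: "ol_term => ol_term => ol_term" where
  "le_term s t = Join (Neg s) (Meet s t)"

context star_field
begin

lemma eval_le_term:
  assumes a: "\<forall>i. subspace_over F d (a i)"
  shows "eval_term (L d) a (le_term s t) = V d \<longleftrightarrow> eval_term (L d) a s \<subseteq> eval_term (L d) a t"
proof -
  let ?U = "eval_term (L d) a s" and ?W = "eval_term (L d) a t"
  have U: "subspace_over F d ?U" and W: "subspace_over F d ?W" by (rule subspace_eval[OF a])+
  have UV: "?U \<subseteq> V d" using subspaceD(1)[OF U] by blast
  note P = subspace_perp[OF UV]
  have "plus_sets (perp d ?U) (?U \<inter> ?W) = V d \<longleftrightarrow> ?U \<subseteq> ?W"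
  proof
    assume eq: "plus_sets (perp d ?U) (?U \<inter> ?W) = V d"
    show "?U \<subseteq> ?W"
    proof
      fix x assume x: "x \<in> ?U"
      then obtain p q where pq: "p \<in> perp d ?U" "q \<in> ?U" "q \<in> ?W" "x = p + q"
        using eq UV unfolding plus_sets_def by blast
      have V: "p \<in> V d" "q \<in> V d" "x \<in> V d" using pq x UV perp_D(2) by auto
      have "p = x - q" using V unfolding pq(4) by (intro eq_vecI) auto
      hence "p \<in> ?U" using subspace_diff[OF U x pq(2)] by simp
      hence "p = 0\<^sub>v d" using inter_perp[OF UV] pq(1) by blast
      thus "x \<in> ?W" using pq V by simp
    qed
  next
    assume "?U \<subseteq> ?W"
    hence e: "?U \<inter> ?W = ?U" by blast
    show "plus_sets (perp d ?U) (?U \<inter> ?W) = V d" unfolding e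
    proof
      show "plus_sets (perp d ?U) ?U \<subseteq> V d"
        using subspaceD(1)[OF subspace_plus[OF P U]] by blast
      show "V d \<subseteq> plus_sets (perp d ?U) ?U"
      proof
        fix v assume v: "v \<in> V d"
        obtain u w where uw: "u \<in> ?U" "w \<in> perp d ?U" "v = u + w"
          using orthogonal_decomposition[OF U v] by blast
        have "v = w + u" using uw UV perp_D(2)[OF uw(2)] by (auto intro!: comm_add_vec[of _ d])
        thus "v \<in> plus_sets (perp d ?U) ?U" using uw plus_setsI by blast
      qed
    qed
  qed
  thus ?thesis by (simp add: le_term_def)
qed

lemma eval_Neg_V:
  assumes a: "\<forall>i. subspace_over F d (a i)"
  shows "eval_term (L d) a (Neg t) = V d \<longleftrightarrow> eval_term (L d) a t = {0\<^sub>v d}"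
proof -
  let ?U = "eval_term (L d) a t"
  have U: "subspace_over F d ?U" by (rule subspace_eval[OF a])
  have "perp d ?U = V d \<longleftrightarrow> ?U = {0\<^sub>v d}"
  proof
    assume "perp d ?U = V d"
    hence "perp d (perp d ?U) = perp d (V d)" by simp
    thus "?U = {0\<^sub>v d}" unfolding perp_perp[OF U] perp_V .
  next
    assume "?U = {0\<^sub>v d}"
    thus "perp d ?U = V d" using perp_0 by simp
  qed
  thus ?thesis by simp
qed

end

text \<open>
  Three embeddings \<open>b1\<close>, \<open>b2\<close>, \<open>b3\<close> of \<open>F^k\<close> onto pairwise orthogonal subspaces with sum \<open>F^d\<close>, where \<open>b2\<close>
  is isometric and \<open>H\<close> is the Gram matrix of \<open>b3\<close>.
\<close>

locale coordinates = star_field +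
  fixes d k :: nat and b1 b2 b3 :: "complex vec => complex vec" and H :: "complex mat"
  assumes b_V: "x \<in> V k ==> b1 x \<in> V d" "x \<in> V k ==> b2 x \<in> V d" "x \<in> V k ==> b3 x \<in> V d"
    and b_add: "x \<in> V k ==> y \<in> V k ==> b1 (x + y) = b1 x + b1 y"
      "x \<in> V k ==> y \<in> V k ==> b2 (x + y) = b2 x + b2 y"
      "x \<in> V k ==> y \<in> V k ==> b3 (x + y) = b3 x + b3 y"
    and b_smult: "c \<in> F ==> x \<in> V k ==> b1 (c *s x) = c *s b1 x"
      "c \<in> F ==> x \<in> V k ==> b2 (c *s x) = c *s b2 x"
      "c \<in> F ==> x \<in> V k ==> b3 (c *s x) = c *s b3 x"
    and b1_inj: "x \<in> V k ==> b1 x = 0\<^sub>v d ==> x = 0\<^sub>v k"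
    and b3_inj: "x \<in> V k ==> b3 x = 0\<^sub>v d ==> x = 0\<^sub>v k"
    and span: "v \<in> V d ==> \<exists>x\<in>V k. \<exists>y\<in>V k. \<exists>z\<in>V k. v = b1 x + b2 y + b3 z"
    and orth: "x \<in> V k ==> y \<in> V k ==> ip (b1 x) (b2 y) = 0"
      "x \<in> V k ==> y \<in> V k ==> ip (b1 x) (b3 y) = 0"
      "x \<in> V k ==> y \<in> V k ==> ip (b2 x) (b3 y) = 0"
    and b2_iso: "x \<in> V k ==> y \<in> V k ==> ip (b2 x) (b2 y) = ip x y"
    and H: "Fmat k k H" "x \<in> V k ==> y \<in> V k ==> ip (b3 x) (b3 y) = ip x (H *v y)"
begin

definition T :: "complex vec => complex vec => complex vec => complex vec" where
  "T x y z = b1 x + b2 y + b3 z"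

abbreviation z0 :: "complex vec" where "z0 \<equiv> 0\<^sub>v k"

lemma b_zero: "b1 z0 = 0\<^sub>v d" "b2 z0 = 0\<^sub>v d" "b3 z0 = 0\<^sub>v d"
proof -
  have z: "0 *s v = (0\<^sub>v n :: complex vec)" if "v \<in> carrier_vec n" for v n
    using that by (intro eq_vecI) auto
  show "b1 z0 = 0\<^sub>v d" "b2 z0 = 0\<^sub>v d" "b3 z0 = 0\<^sub>v d"
    using b_smult[OF F_0 V_zero[of k]] z[OF V_carrier[OF V_zero[of k]]] z[OF V_carrier[OF b_V(1)[OF V_zero]]]
      z[OF V_carrier[OF b_V(2)[OF V_zero]]] z[OF V_carrier[OF b_V(3)[OF V_zero]]] by simp_all
qed

lemma T_V: "x \<in> V k ==> y \<in> V k ==> z \<in> V k ==> T x y z \<in> V d"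
  unfolding T_def by (intro V_add b_V)

lemma T_add:
  assumes "x \<in> V k" "y \<in> V k" "z \<in> V k" "x' \<in> V k" "y' \<in> V k" "z' \<in> V k"
  shows "T x y z + T x' y' z' = T (x + x') (y + y') (z + z')"
proof -
  note dims = V_dim[OF b_V(1)[OF assms(1)]] V_dim[OF b_V(2)[OF assms(2)]] V_dim[OF b_V(3)[OF assms(3)]]
    V_dim[OF b_V(1)[OF assms(4)]] V_dim[OF b_V(2)[OF assms(5)]] V_dim[OF b_V(3)[OF assms(6)]]
  show ?thesis
    unfolding T_def b_add(1)[OF assms(1,4)] b_add(2)[OF assms(2,5)] b_add(3)[OF assms(3,6)]
    using dims by (intro eq_vecI) auto
qed

lemma T_smult:
  assumes "c \<in> F" "x \<in> V k" "y \<in> V k" "z \<in> V k"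
  shows "c *s T x y z = T (c *s x) (c *s y) (c *s z)"
proof -
  note dims = V_dim[OF b_V(1)[OF assms(2)]] V_dim[OF b_V(2)[OF assms(3)]] V_dim[OF b_V(3)[OF assms(4)]]
  show ?thesis
    unfolding T_def b_smult(1)[OF assms(1,2)] b_smult(2)[OF assms(1,3)] b_smult(3)[OF assms(1,4)]
    using dims by (intro eq_vecI) (auto simp: distrib_left)
qed

lemma orth': "x \<in> V k ==> y \<in> V k ==> ip (b2 y) (b1 x) = 0"
  "x \<in> V k ==> y \<in> V k ==> ip (b3 y) (b1 x) = 0"
  "x \<in> V k ==> y \<in> V k ==> ip (b3 y) (b2 x) = 0"
  using orth ip_swap_0[OF V_carrier V_carrier] b_V by metis+

lemma ip_T:
  assumes "x \<in> V k" "y \<in> V k" "z \<in> V k" "x' \<in> V k" "y' \<in> V k" "z' \<in> V k"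
  shows "ip (T x y z) (T x' y' z') = ip (b1 x) (b1 x') + ip y y' + ip z (H *v z')"
proof -
  note c = V_carrier[OF b_V(1)[OF assms(1)]] V_carrier[OF b_V(2)[OF assms(2)]] V_carrier[OF b_V(3)[OF assms(3)]]
    V_carrier[OF b_V(1)[OF assms(4)]] V_carrier[OF b_V(2)[OF assms(5)]] V_carrier[OF b_V(3)[OF assms(6)]]
  show ?thesis unfolding T_def using c assms by (simp add: ip_add[of _ d] orth orth' b2_iso H)
qed

lemma T_zero:
  assumes "x \<in> V k" "y \<in> V k" "z \<in> V k" "T x y z = 0\<^sub>v d"
  shows "x = z0 \<and> y = z0 \<and> z = z0"
proof -
  note c = V_carrier[OF b_V(1)[OF assms(1)]] V_carrier[OF b_V(2)[OF assms(2)]] V_carrier[OF b_V(3)[OF assms(3)]]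
  have zero: "ip w (T x y z) = 0" if "w \<in> carrier_vec d" for w
    unfolding assms(4) using that by simp
  have "ip (b1 x) (b1 x) = 0"
    using zero[OF c(1)] c assms by (simp add: T_def ip_add[of _ d] orth orth')
  hence x: "x = z0" using ip_self_eq_0[OF c(1)] b1_inj[OF assms(1)] by simp
  have "ip (b3 z) (b3 z) = 0"
    using zero[OF c(3)] c assms by (simp add: T_def ip_add[of _ d] orth orth')
  hence z: "z = z0" using ip_self_eq_0[OF c(3)] b3_inj[OF assms(3)] by simp
  have "ip y y = 0"
    using zero[OF c(2)] c assms by (simp add: T_def ip_add[of _ d] orth orth' b2_iso)
  hence "y = z0" using ip_self_eq_0[OF V_carrier[OF assms(2)]] by simp
  with x z show ?thesis by simp
qed

lemma T_eq_iff:
  assumes "x \<in> V k" "y \<in> V k" "z \<in> V k" "x' \<in> V k" "y' \<in> V k" "z' \<in> V k"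
  shows "T x y z = T x' y' z' \<longleftrightarrow> x = x' \<and> y = y' \<and> z = z'"
proof
  assume eq: "T x y z = T x' y' z'"
  have m: "(- 1 :: complex) \<in> F" by (intro F_uminus) simp
  have V': "(- 1) *s x' \<in> V k" "(- 1) *s y' \<in> V k" "(- 1) *s z' \<in> V k"
    using assms m by (auto intro: V_smult)
  have "T (x + (- 1) *s x') (y + (- 1) *s y') (z + (- 1) *s z') = T x y z + (- 1) *s T x' y' z'"
    unfolding T_smult[OF m assms(4-6)] T_add[OF assms(1-3) V'] ..
  also have "... = 0\<^sub>v d"
    unfolding eq using V_dim[OF T_V[OF assms(4-6)]] by (intro eq_vecI) auto
  finally have "x + (- 1) *s x' = z0 \<and> y + (- 1) *s y' = z0 \<and> z + (- 1) *s z' = z0"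
    using assms V' by (intro T_zero V_add)
  moreover have "u = w" if "u + (- 1) *s w = z0" "u \<in> V k" "w \<in> V k" for u w
    using diff_eq_0_vec[of u k w] minus_smult_vec[of u k w] that by simp
  ultimately show "x = x' \<and> y = y' \<and> z = z'" using assms by blast
qed simp

lemma ex_T: "v \<in> V d ==> \<exists>x\<in>V k. \<exists>y\<in>V k. \<exists>z\<in>V k. v = T x y z"
  using span unfolding T_def by blast

definition gr12 :: "complex mat => complex vec set" where
  "gr12 M = {T x (M *v x) z0 | x. x \<in> V k}"

definition gr13 :: "complex mat => complex vec set" where
  "gr13 N = {T x z0 (N *v x) | x. x \<in> V k}"

definition gr23 :: "complex mat => complex vec set" where
  "gr23 A = {T z0 y (- (A *v y)) | y. y \<in> V k}"

definition gr32 :: "complex mat => complex vec set" where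
  "gr32 B = {T z0 (B *v z) z | z. z \<in> V k}"

definition s1 :: "complex vec set" where "s1 = {T x z0 z0 | x. x \<in> V k}"
definition s2 :: "complex vec set" where "s2 = {T z0 y z0 | y. y \<in> V k}"
definition s3 :: "complex vec set" where "s3 = {T z0 z0 z | z. z \<in> V k}"
definition s12 :: "complex vec set" where "s12 = {T x y z0 | x y. x \<in> V k \<and> y \<in> V k}"
definition s13 :: "complex vec set" where "s13 = {T x z0 z | x z. x \<in> V k \<and> z \<in> V k}"
definition s23 :: "complex vec set" where "s23 = {T z0 y z | y z. y \<in> V k \<and> z \<in> V k}"

lemma in_s12: "x \<in> V k ==> y \<in> V k ==> z \<in> V k ==> T x y z \<in> s12 \<longleftrightarrow> z = z0"
  and in_s13: "x \<in> V k ==> y \<in> V k ==> z \<in> V k ==> T x y z \<in> s13 \<longleftrightarrow> y = z0"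
  and in_s23: "x \<in> V k ==> y \<in> V k ==> z \<in> V k ==> T x y z \<in> s23 \<longleftrightarrow> x = z0"
  and in_s1: "x \<in> V k ==> y \<in> V k ==> z \<in> V k ==> T x y z \<in> s1 \<longleftrightarrow> y = z0 \<and> z = z0"
  and in_s2: "x \<in> V k ==> y \<in> V k ==> z \<in> V k ==> T x y z \<in> s2 \<longleftrightarrow> x = z0 \<and> z = z0"
  and in_s3: "x \<in> V k ==> y \<in> V k ==> z \<in> V k ==> T x y z \<in> s3 \<longleftrightarrow> x = z0 \<and> y = z0"
  unfolding s12_def s13_def s23_def s1_def s2_def s3_def using V_zero[of k] by (auto simp: T_eq_iff)

lemma gr12_I: "x \<in> V k ==> v = T x (M *v x) z0 ==> v \<in> gr12 M"
  and gr13_I: "x \<in> V k ==> v = T x z0 (N *v x) ==> v \<in> gr13 N"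
  and gr23_I: "y \<in> V k ==> v = T z0 y (- (A *v y)) ==> v \<in> gr23 A"
  and gr32_I: "z \<in> V k ==> v = T z0 (B *v z) z ==> v \<in> gr32 B"
  unfolding gr12_def gr13_def gr23_def gr32_def by auto

lemma subspace_graph:
  assumes "\<And>x. x \<in> V k ==> f x \<in> V k \<and> g x \<in> V k \<and> h x \<in> V k"
    and "\<And>x y. x \<in> V k ==> y \<in> V k ==> f (x + y) = f x + f y \<and> g (x + y) = g x + g y \<and> h (x + y) = h x + h y"
    and "\<And>c x. c \<in> F ==> x \<in> V k ==>
      f (c *s x) = c *s f x \<and> g (c *s x) = c *s g x \<and> h (c *s x) = c *s h x"
  shows "subspace_over F d {T (f x) (g x) (h x) | x. x \<in> V k}" unfolding subspace_over_def
proof (intro conjI ballI subsetI)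
  show "v \<in> V d" if "v \<in> {T (f x) (g x) (h x) | x. x \<in> V k}" for v
    using that assms(1) by (auto intro: T_V)
  have z: "0 *s v = (0\<^sub>v n :: complex vec)" if "v \<in> carrier_vec n" for v n
    using that by (intro eq_vecI) auto
  have "f z0 = z0 \<and> g z0 = z0 \<and> h z0 = z0"
    using assms(3)[OF F_0 V_zero] z[OF V_carrier] assms(1)[OF V_zero] V_zero[of k] by metis
  hence "0\<^sub>v d = T (f z0) (g z0) (h z0)" by (simp add: T_def b_zero)
  thus "0\<^sub>v d \<in> {T (f x) (g x) (h x) | x. x \<in> V k}" using V_zero[of k] by blast
  show "u + v \<in> {T (f x) (g x) (h x) | x. x \<in> V k}"
    if u: "u \<in> {T (f x) (g x) (h x) | x. x \<in> V k}" and v: "v \<in> {T (f x) (g x) (h x) | x. x \<in> V k}" for u v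
  proof -
    obtain x where x: "x \<in> V k" "u = T (f x) (g x) (h x)" using u by blast
    obtain y where y: "y \<in> V k" "v = T (f y) (g y) (h y)" using v by blast
    note xy = x(1) y(1) x(2) y(2)
    from xy have "u + v = T (f (x + y)) (g (x + y)) (h (x + y))"
      using assms(1,2) by (simp add: T_add)
    thus ?thesis using V_add[OF xy(1,2)] by blast
  qed
  show "c *s u \<in> {T (f x) (g x) (h x) | x. x \<in> V k}"
    if c: "c \<in> F" and u: "u \<in> {T (f x) (g x) (h x) | x. x \<in> V k}" for c u
  proof -
    obtain x where x: "x \<in> V k" "u = T (f x) (g x) (h x)" using u by blast
    hence "c *s u = T (f (c *s x)) (g (c *s x)) (h (c *s x))"
      using assms(1,3) c by (simp add: T_smult)
    thus ?thesis using V_smult[OF c x(1)] by blast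
  qed
qed

lemma mult_V: "Fmat k k M ==> x \<in> V k ==> M *v x \<in> V k" by (rule mult_vec_V)

lemma mat_lin:
  assumes "Fmat k k M" "x \<in> V k" "y \<in> V k"
  shows "M *v (x + y) = M *v x + M *v y" "M *v (c *s x) = c *s (M *v x)"
    "M *v (- x) = - (M *v x)"
  using mult_add_distrib_mat_vec[OF Fmat_carrier[OF assms(1)] V_carrier[OF assms(2)] V_carrier[OF assms(3)]]
    mult_mat_vec[OF Fmat_carrier[OF assms(1)] V_carrier[OF assms(2)]]
    mult_mat_vec_uminus(1)[OF Fmat_carrier[OF assms(1)] V_carrier[OF assms(2)]] by auto

lemma vec_V_simps:
  assumes "x \<in> V k" "y \<in> V k"
  shows "z0 + x = x" "x + z0 = x" "x + y = z0 \<longleftrightarrow> x = - y" "- (- x) = x" "- x \<in> V k" "- x + x = z0"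
    "- (x + y) = - x + - y" "c *s (- x) = - (c *s x)" "c *s z0 = z0" "- z0 = z0"
proof -
  note c = V_carrier[OF assms(1)] V_carrier[OF assms(2)]
  show "z0 + x = x" "x + z0 = x" "- (- x) = x" "- x + x = z0" "- (x + y) = - x + - y"
    "c *s (- x) = - (c *s x)" "c *s z0 = z0" "- z0 = z0" using c by (auto intro!: eq_vecI)
  show "- x \<in> V k" using assms(1) by (rule V_uminus)
  show "x + y = z0 \<longleftrightarrow> x = - y"
  proof
    assume "x + y = z0"
    thus "x = - y" by (rule add_eq_0_vec[OF c])
  next
    assume "x = - y"
    thus "x + y = z0" using c by (auto intro!: eq_vecI)
  qed
qed

lemma subspace_gr:
  assumes "Fmat k k M"
  shows "subspace_over F d (gr12 M)" "subspace_over F d (gr13 M)" "subspace_over F d (gr23 M)"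
    "subspace_over F d (gr32 M)" unfolding gr12_def gr13_def gr23_def gr32_def
  by (rule subspace_graph; simp add: assms mult_V mat_lin vec_V_simps V_add V_smult)+

lemma subspace_s12: "subspace_over F d s1" "subspace_over F d s2" "subspace_over F d s3"
  unfolding s1_def s2_def s3_def by (rule subspace_graph; simp add: vec_V_simps)+

lemma inter_plus_graph:
  assumes "\<And>x y. x \<in> V k ==> y \<in> V k ==> p y + q x = r x y"
    and "\<And>x y. x \<in> V k ==> y \<in> V k ==> r x y \<in> S \<longleftrightarrow> y = f x"
    and "\<And>x. x \<in> V k ==> f x \<in> V k" "\<And>x. x \<in> V k ==> r x (f x) = t x"
  shows "S \<inter> plus_sets {p y | y. y \<in> V k} {q x | x. x \<in> V k} = {t x | x. x \<in> V k}"
proof safe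
  fix v assume v: "v \<in> S" "v \<in> plus_sets {p y | y. y \<in> V k} {q x | x. x \<in> V k}"
  then obtain x y where xy: "x \<in> V k" "y \<in> V k" "v = p y + q x"
    unfolding plus_sets_def by blast
  thus "\<exists>x. v = t x \<and> x \<in> V k" using v(1) assms(1,2,4) by metis
next
  fix x assume x: "x \<in> V k"
  have t: "t x = p (f x) + q x" using assms x by metis
  show "t x \<in> S" using assms(2-4)[OF x] by metis
  show "t x \<in> plus_sets {p y | y. y \<in> V k} {q x | x. x \<in> V k}"
    unfolding t using x assms(3) by (intro plus_setsI) auto
qed

text \<open>Perspectivities compose graphs, so products and sums of matrices become lattice terms.\<close>

lemma step_13:
  assumes A: "Fmat k k A" and M: "Fmat k k M"
  shows "s13 \<inter> plus_sets (gr23 A) (gr12 M) = gr13 (A * M)"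
proof -
  have AM: "(A * M) *v x = A *v (M *v x)" if "x \<in> V k" for x
    using assoc_mult_mat_vec[OF Fmat_carrier[OF A] Fmat_carrier[OF M] V_carrier[OF that]] .
  show ?thesis unfolding gr23_def gr12_def gr13_def
    by (rule inter_plus_graph[where f = "\<lambda>x. - (M *v x)" and
          r = "\<lambda>x y. T x (y + M *v x) (- (A *v y))"])
       (use A M in \<open>simp_all add: T_add mult_V vec_V_simps in_s13 V_add mat_lin AM\<close>)
qed

lemma step_12:
  assumes B: "Fmat k k B" and N: "Fmat k k N"
  shows "s12 \<inter> plus_sets (gr32 B) (gr13 N) = gr12 (- (B * N))"
proof -
  have BN: "(- (B * N)) *v x = - (B *v (N *v x))" if "x \<in> V k" for x
    using assoc_mult_mat_vec[OF Fmat_carrier[OF B] Fmat_carrier[OF N] V_carrier[OF that]]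
      mult_mat_vec_uminus(2)[OF mult_carrier_mat[OF Fmat_carrier[OF B] Fmat_carrier[OF N]] V_carrier[OF that]]
    by simp
  show ?thesis unfolding gr32_def gr12_def gr13_def
    by (rule inter_plus_graph[where f = "\<lambda>x. - (N *v x)" and
          r = "\<lambda>x z. T x (B *v z) (z + N *v x)"])
       (use B N in \<open>simp_all add: T_add mult_V vec_V_simps in_s12 V_add mat_lin BN\<close>)
qed

lemma step_23:
  assumes N: "Fmat k k N"
  shows "s23 \<inter> plus_sets (gr12 (- 1\<^sub>m k)) (gr13 (- N)) = gr23 N"
proof -
  have 1: "(- 1\<^sub>m k) *v x = - x" "(- N) *v x = - (N *v x)" if "x \<in> V k" for x
    using mult_mat_vec_uminus(2)[of "1\<^sub>m k" k k x] mult_mat_vec_uminus(2)[OF Fmat_carrier[OF N], of x]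
      V_carrier[OF that] by simp_all
  show ?thesis unfolding gr23_def gr12_def gr13_def
    by (rule inter_plus_graph[where f = "\<lambda>y. - y" and r = "\<lambda>y x. T (x + y) (- x) (- (N *v y))"])
       (use N in \<open>simp_all add: T_add mult_V vec_V_simps in_s23 V_add 1\<close>)
qed

lemma step_add:
  assumes M: "Fmat k k M" and N: "Fmat k k N"
  shows "s12 \<inter> plus_sets (gr32 (1\<^sub>m k)) (plus_sets s3 (gr12 M) \<inter> plus_sets s2 (gr13 (- N))) = gr12 (M + N)"
proof -
  have 1: "1\<^sub>m k *v x = x" "(- N) *v x = - (N *v x)" "(M + N) *v x = M *v x + N *v x"
    if "x \<in> V k" for x
    using mult_mat_vec_uminus(2)[OF Fmat_carrier[OF N], of x] V_carrier[OF that]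
      add_mult_distrib_mat_vec[OF Fmat_carrier[OF M] Fmat_carrier[OF N], of x] by simp_all
  have inter: "plus_sets s3 (gr12 M) \<inter> plus_sets s2 (gr13 (- N)) =
      {T x (M *v x) (- (N *v x)) | x. x \<in> V k}"
  proof safe
    fix v assume v: "v \<in> plus_sets s3 (gr12 M)" "v \<in> plus_sets s2 (gr13 (- N))"
    obtain x z where xz: "x \<in> V k" "z \<in> V k" "v = T z0 z0 z + T x (M *v x) z0"
      using v(1) by (auto simp: plus_sets_def s3_def gr12_def)
    obtain x' y where xy: "x' \<in> V k" "y \<in> V k" "v = T z0 y z0 + T x' z0 (- (N *v x'))"
      using v(2) by (auto simp: plus_sets_def s2_def gr13_def 1)
    have "v = T x (M *v x) z" "v = T x' y (- (N *v x'))"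
      using xz xy M N by (simp_all add: T_add mult_V vec_V_simps)
    hence "x = x'" "z = - (N *v x')"
      using xz xy M N T_eq_iff[of x "M *v x" z x' y "- (N *v x')"] by (simp_all add: mult_V vec_V_simps)
    thus "\<exists>x. v = T x (M *v x) (- (N *v x)) \<and> x \<in> V k"
      using `v = T x (M *v x) z` xz(1) by blast
  next
    fix x assume x: "x \<in> V k"
    have "T x (M *v x) (- (N *v x)) = T z0 z0 (- (N *v x)) + T x (M *v x) z0"
      "T x (M *v x) (- (N *v x)) = T z0 (M *v x) z0 + T x z0 (- (N *v x))"
      using x M N by (simp_all add: T_add mult_V vec_V_simps)
    moreover have "- (N *v x) \<in> V k" "M *v x \<in> V k"
      using x M N by (simp_all add: mult_V vec_V_simps)
    moreover have "T z0 z0 (- (N *v x)) \<in> s3" "T z0 (M *v x) z0 \<in> s2"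
      "T x (M *v x) z0 \<in> gr12 M" "T x z0 (- (N *v x)) \<in> gr13 (- N)"
      using gr12_I[OF x refl, of M] gr13_I[OF x, of _ "- N"] x M N
      by (simp_all add: in_s3 in_s2 1 mult_V vec_V_simps)
    ultimately show "T x (M *v x) (- (N *v x)) \<in> plus_sets s3 (gr12 M)"
      "T x (M *v x) (- (N *v x)) \<in> plus_sets s2 (gr13 (- N))" using plus_setsI by (metis, metis)
  qed
  have 2: "z + - z = z0" "M *v z + N *v z = N *v z + M *v z" if z: "z \<in> V k" for z
    using V_carrier[OF z] comm_add_vec[OF V_carrier[OF mult_V[OF M z]] V_carrier[OF mult_V[OF N z]]]
    by auto
  show ?thesis unfolding inter unfolding gr32_def gr12_def
    by (rule inter_plus_graph[where f = "\<lambda>x. N *v x" and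
          r = "\<lambda>x z. T x (z + M *v x) (z + - (N *v x))"])
       (use M N in \<open>simp_all add: T_add mult_V vec_V_simps in_s12 V_add 1 2\<close>)
qed

lemma perp_s:
  "perp d s1 = s23" "perp d s2 = s13"
proof -
  show "perp d s1 = s23"
  proof safe
    fix v assume v: "v \<in> perp d s1"
    obtain x y z where xyz: "x \<in> V k" "y \<in> V k" "z \<in> V k" "v = T x y z"
      using ex_T[OF perp_D(2)[OF v]] by blast
    have "T x z0 z0 \<in> s1" using xyz by (auto simp: s1_def)
    from perp_D(1)[OF v this] have "ip (b1 x) (b1 x) = 0"
      using xyz mult_V[OF H(1)] by (simp add: ip_T)
    hence "x = z0" using b1_inj[OF xyz(1)] ip_self_eq_0[OF V_carrier[OF b_V(1)[OF xyz(1)]]] by simp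
    thus "v \<in> s23" using xyz by (auto simp: s23_def)
  next
    fix v assume "v \<in> s23"
    then obtain y z where yz: "y \<in> V k" "z \<in> V k" "v = T z0 y z" by (auto simp: s23_def)
    have "ip (T x z0 z0) v = 0" if x: "x \<in> V k" for x
      using ip_T[OF x V_zero V_zero V_zero yz(1,2)] V_carrier[OF b_V(1)[OF x]] V_carrier[OF yz(1)]
        V_carrier[OF mult_V[OF H(1) yz(2)]] by (simp add: yz(3) b_zero)
    thus "v \<in> perp d s1" unfolding perp_def s1_def yz(3) using T_V[OF V_zero yz(1,2)] by blast
  qed
  show "perp d s2 = s13"
  proof safe
    fix v assume v: "v \<in> perp d s2"
    obtain x y z where xyz: "x \<in> V k" "y \<in> V k" "z \<in> V k" "v = T x y z"
      using ex_T[OF perp_D(2)[OF v]] by blast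
    have "T z0 y z0 \<in> s2" using xyz by (auto simp: s2_def)
    from perp_D(1)[OF v this] have "ip y y = 0"
      using xyz mult_V[OF H(1)] V_carrier[OF b_V(1)[OF xyz(1)]] by (simp add: ip_T b_zero)
    hence "y = z0" using ip_self_eq_0[OF V_carrier[OF xyz(2)]] by simp
    thus "v \<in> s13" using xyz by (auto simp: s13_def)
  next
    fix v assume "v \<in> s13"
    then obtain x z where yz: "x \<in> V k" "z \<in> V k" "v = T x z0 z" by (auto simp: s13_def)
    have "ip (T z0 y z0) v = 0" if y: "y \<in> V k" for y
      using ip_T[OF V_zero y V_zero yz(1) V_zero yz(2)] V_carrier[OF b_V(1)[OF yz(1)]] V_carrier[OF y]
        V_carrier[OF mult_V[OF H(1) yz(2)]] by (simp add: yz(3) b_zero)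
    thus "v \<in> perp d s2"
      unfolding perp_def s2_def yz(3) using T_V[OF yz(1) V_zero yz(2)] by blast
  qed
qed

lemma inter_s: "s23 \<inter> s13 = s3"
proof safe
  fix v assume v: "v \<in> s23" "v \<in> s13"
  then obtain y z where "y \<in> V k" "z \<in> V k" "v = T z0 y z" by (auto simp: s23_def)
  with v(2) show "v \<in> s3" by (auto simp: in_s13 s3_def)
next
  fix v assume "v \<in> s3"
  then obtain z where "z \<in> V k" "v = T z0 z0 z" by (auto simp: s3_def)
  thus "v \<in> s23" "v \<in> s13" by (simp_all add: in_s23 in_s13)
qed

lemma plus_s12: "plus_sets s1 s2 = s12"
proof -
  have eq: "T x z0 z0 + T z0 y z0 = T x y z0" if "x \<in> V k" "y \<in> V k" for x y
    using that by (simp add: T_add vec_V_simps)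
  show ?thesis
  proof safe
    fix v assume "v \<in> plus_sets s1 s2"
    then obtain x y where "x \<in> V k" "y \<in> V k" "v = T x z0 z0 + T z0 y z0"
      unfolding plus_sets_def s1_def s2_def by blast
    thus "v \<in> s12" by (simp add: eq in_s12)
  next
    fix v assume "v \<in> s12"
    then obtain x y where xy: "x \<in> V k" "y \<in> V k" "v = T x z0 z0 + T z0 y z0"
      using eq unfolding s12_def by auto
    thus "v \<in> plus_sets s1 s2" unfolding xy(3) by (intro plus_setsI) (simp_all add: in_s1 in_s2)
  qed
qed

lemma perp_gr23:
  assumes A: "Fmat k k A"
  shows "s23 \<inter> perp d (gr23 A) = gr32 (mat_adjoint A * H)"
proof -
  let ?A = "mat_adjoint A"
  have A': "Fmat k k ?A" by (rule Fmat_adjoint[OF A])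
  have AH: "(?A * H) *v z = ?A *v (H *v z)" if "z \<in> V k" for z
    using assoc_mult_mat_vec[OF Fmat_carrier[OF A'] Fmat_carrier[OF H(1)] V_carrier[OF that]] .
  have ipe: "ip (T z0 y' (- (A *v y'))) (T z0 y z) = ip y' (y - ?A *v (H *v z))"
    if "y' \<in> V k" "y \<in> V k" "z \<in> V k" for y' y z
  proof -
    have m: "A *v y' \<in> V k" "H *v z \<in> V k" "?A *v (H *v z) \<in> V k"
      using that A H(1) A' by (simp_all add: mult_V)
    have "ip (T z0 y' (- (A *v y'))) (T z0 y z) = ip y' y - ip (A *v y') (H *v z)"
      using that m by (simp add: ip_T b_zero vec_V_simps ip_uminus[OF V_carrier[OF m(1)] V_carrier[OF m(2)]])
    also have "... = ip y' (y - ?A *v (H *v z))"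
      unfolding ip_adjoint[OF Fmat_carrier[OF A] V_carrier[OF that(1)] V_carrier[OF m(2)]]
      using ip_diff(1)[OF V_carrier[OF that(1)] V_carrier[OF that(2)] V_carrier[OF m(3)]] by simp
    finally show ?thesis .
  qed
  show ?thesis
  proof safe
    fix v assume v: "v \<in> s23" "v \<in> perp d (gr23 A)"
    then obtain y z where yz: "y \<in> V k" "z \<in> V k" "v = T z0 y z" by (auto simp: s23_def)
    have m: "?A *v (H *v z) \<in> V k" using yz H(1) A' by (simp add: mult_V)
    let ?y = "y - ?A *v (H *v z)"
    have y': "?y \<in> V k" by (rule V_diff[OF yz(1) m])
    hence "T z0 ?y (- (A *v ?y)) \<in> gr23 A" by (auto simp: gr23_def)
    from perp_D(1)[OF v(2) this] have "ip ?y ?y = 0" unfolding yz(3) ipe[OF y' yz(1,2)] .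
    hence "?y = z0" using ip_self_eq_0[OF V_carrier[OF y']] by simp
    hence "y = (?A * H) *v z"
      using diff_eq_0_vec[OF V_carrier[OF yz(1)] V_carrier[OF m]] AH[OF yz(2)] by simp
    thus "v \<in> gr32 (?A * H)" using yz by (auto simp: gr32_def)
  next
    fix v assume "v \<in> gr32 (?A * H)"
    then obtain z where z: "z \<in> V k" "v = T z0 (?A *v (H *v z)) z" by (auto simp: gr32_def AH)
    have m: "?A *v (H *v z) \<in> V k" using z H(1) A' by (simp add: mult_V)
    show "v \<in> s23" using z m by (auto simp: s23_def)
    have "?A *v (H *v z) - ?A *v (H *v z) = z0"
      using V_carrier[OF m] by (intro eq_vecI) (auto simp del: index_mult_mat_vec)
    hence "ip (T z0 y' (- (A *v y'))) v = 0" if "y' \<in> V k" for y'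
      unfolding z(2) ipe[OF that m z(1)] using that by simp
    thus "v \<in> perp d (gr23 A)"
      unfolding perp_def gr23_def z(2) using T_V[OF V_zero m z(1)] by blast
  qed
qed

lemma gr12_le_iff:
  assumes "Fmat k k M" "Fmat k k N"
  shows "gr12 M \<subseteq> gr12 N \<longleftrightarrow> M = N"
proof
  assume le: "gr12 M \<subseteq> gr12 N"
  have "M *v x = N *v x" if x: "x \<in> V k" for x
  proof -
    have "T x (M *v x) z0 \<in> gr12 N" using le x by (auto simp: gr12_def)
    then obtain x' where x': "x' \<in> V k" "T x (M *v x) z0 = T x' (N *v x') z0"
      unfolding gr12_def by blast
    thus ?thesis
      using iffD1[OF T_eq_iff[OF x mult_V[OF assms(1) x] V_zero x'(1) mult_V[OF assms(2) x'(1)] V_zero] x'(2)] by blast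
  qed
  thus "M = N" by (rule mat_eqI[OF Fmat_carrier[OF assms(1)] Fmat_carrier[OF assms(2)]])
qed simp

lemma s2_le_perp_gr12:
  assumes M: "Fmat k k M"
  shows "s2 \<subseteq> perp d (gr12 M) \<longleftrightarrow> M = 0\<^sub>m k k"
proof
  have z: "0\<^sub>m k k *v x = z0" if "x \<in> V k" for x
    using V_carrier[OF that] by (intro eq_vecI) auto
  {
    assume le: "s2 \<subseteq> perp d (gr12 M)"
    have "M *v x = 0\<^sub>m k k *v x" if x: "x \<in> V k" for x
    proof -
      have m: "M *v x \<in> V k" using x M by (simp add: mult_V)
      have "T z0 (M *v x) z0 \<in> perp d (gr12 M)" using le m unfolding s2_def by blast
      moreover have "T x (M *v x) z0 \<in> gr12 M" by (rule gr12_I[OF x refl])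
      ultimately have "ip (T x (M *v x) z0) (T z0 (M *v x) z0) = 0" by (rule perp_D(1))
      hence "ip (M *v x) (M *v x) = 0"
        using ip_T[OF x m V_zero V_zero m V_zero] V_carrier[OF b_V(1)[OF x]]
          V_carrier[OF mult_V[OF H(1) V_zero]] by (simp add: b_zero)
      thus ?thesis using iffD1[OF ip_self_eq_0[OF V_carrier[OF m]]] z[OF x] by simp
    qed
    thus "M = 0\<^sub>m k k" by (rule mat_eqI[OF Fmat_carrier[OF M] zero_carrier_mat])
  next
    assume M0: "M = 0\<^sub>m k k"
    show "s2 \<subseteq> perp d (gr12 M)"
    proof
      fix v assume "v \<in> s2"
      then obtain y where y: "y \<in> V k" "v = T z0 y z0" by (auto simp: s2_def)
      have "ip u v = 0" if u: "u \<in> gr12 M" for u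
      proof -
        obtain x where x: "x \<in> V k" "u = T x z0 z0" using u z unfolding M0 gr12_def by auto
        have "ip u v = ip (b1 x) (b1 z0) + ip z0 y + ip z0 (H *v z0)"
          unfolding x(2) y(2) by (rule ip_T) (use x y in simp_all)
        thus ?thesis
          using V_carrier[OF b_V(1)[OF x(1)]] V_carrier[OF y(1)] V_carrier[OF mult_V[OF H(1) V_zero]]
          by (simp add: b_zero)
      qed
      thus "v \<in> perp d (gr12 M)"
        unfolding perp_def y(2) using T_V[OF V_zero y(1) V_zero] by blast
    qed
  }
qed

end

section \<open>From polynomials to ortholattice terms\<close>

text \<open>
  The even variables name a frame: in coordinates \<open>(x, y, z)\<close>, \<open>tU\<close> is to be the graph
  \<open>x \<mapsto> (x, x, 0)\<close> and \<open>tG\<close> the graph \<open>y \<mapsto> (0, y, y)\<close>. The odd variables are the matrices \<open>X\<close>, represented by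
  \<open>y \<mapsto> (0, y, - X y)\<close>, while the translated polynomials \<open>M\<close> are represented by \<open>x \<mapsto> (x, M x, 0)\<close>.
\<close>

definition tE1 :: ol_term where "tE1 = Var 0"
definition tE2 :: ol_term where "tE2 = Var 2"
definition tU :: ol_term where "tU = Var 4"
definition tG :: ol_term where "tG = Var 6"
definition tE3 :: ol_term where "tE3 = Meet (Neg tE1) (Neg tE2)"
definition tE12 :: ol_term where "tE12 = Join tE1 tE2"
definition tE13 :: ol_term where "tE13 = Neg tE2"
definition tE23 :: ol_term where "tE23 = Neg tE1"
definition tD :: ol_term where "tD = Meet tE23 (Neg tG)"

lemmas frame_defs = tE1_def tE2_def tU_def tG_def tE3_def tE12_def tE13_def tE23_def tD_def

definition op_term :: "ol_term => ol_term => ol_term" where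
  "op_term A G = Meet tE12 (Join tD (Meet tE13 (Join A G)))"

definition adj_term :: "ol_term => ol_term => ol_term" where
  "adj_term A G = Meet tE12 (Join (Meet tE23 (Neg A)) (Meet tE13 (Join tG G)))"

definition add_term :: "ol_term => ol_term => ol_term" where
  "add_term M N = Meet tE12 (Join tG (Meet (Join tE3 M) (Join tE2 (Meet tE13 (Join tG N)))))"

definition coeff_term :: "ol_term => ol_term" where
  "coeff_term C = Meet tE23 (Join (op_term tG tU) (Meet tE13 (Join tG C)))"

definition two_term :: ol_term where
  "two_term = coeff_term (add_term tU tU)"

fun nat_term :: "nat => ol_term" where
  "nat_term n = (if n = 0 then tE1 else
     (if odd n then add_term tU else id) (op_term two_term (nat_term (n div 2))))"

declare nat_term.simps [simp del]

primrec word_term :: "nc_monom => ol_term" where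
  "word_term [] = tU"
| "word_term (l # w) = (if snd l then adj_term else op_term) (Var (2 * fst l + 1)) (word_term w)"

definition summand_term :: "int \<times> nc_monom => ol_term" where
  "summand_term m = (if fst m < 0 then op_term tG else id)
     (op_term (coeff_term (nat_term (nat \<bar>fst m\<bar>))) (word_term (snd m)))"

primrec poly_term :: "nc_poly => ol_term" where
  "poly_term [] = tE1"
| "poly_term (m # p) = add_term (summand_term m) (poly_term p)"

definition poly_cond :: "nc_poly => ol_term" where
  "poly_cond p = le_term tE2 (Neg (poly_term p))"

definition frame_conds :: "ol_term list" where
  "frame_conds =
     [le_term tE2 (Neg tE1),
      le_term tU tE12, Neg (Meet tU tE1), Neg (Meet tU tE2), le_term tE1 (Join tU tE2), le_term tE2 (Join tU tE1),
      le_term tG tE23, Neg (Meet tG tE2), Neg (Meet tG tE3), le_term tE2 (Join tG tE3), le_term tE3 (Join tG tE2),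
      le_term (Meet tE12 (Join tG (Meet tE13 (Join tD tU)))) (op_term tG tU)]"

definition letter_conds :: "ol_term list" where
  "letter_conds = [Neg (Meet tE3 (Var 1)), le_term (Var 1) tE23, le_term tE2 (Join (Var 1) tE3)]"

definition inst_pair :: "nat \<times> nat => nat => nat" where
  "inst_pair = (\<lambda>(i, j) k. if k = 1 then 2 * i + 1 else if k = 3 then 2 * j + 1 else k)"

definition frame_formula :: "ol_term list => nc_poly list => ol_term" where
  "frame_formula cs ps = meets (frame_conds @
     concat (map (\<lambda>p. map (rename (inst_pair p)) cs) (pairs (poly_vars ps))) @ map poly_cond ps) One"

definition op_pre :: "bool list" where
  "op_pre = [True, False, False] @ enc_term tE12 @ [True, False, True] @ enc_term tD @
     [True, False, False] @ enc_term tE13 @ [True, False, True]"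

definition adj_pre :: "bool list" where
  "adj_pre = [True, False, False] @ enc_term tE12 @ [True, False, True] @ [True, False, False] @ enc_term tE23 @
     [False, True, True]"

definition adj_mid :: "bool list" where
  "adj_mid = [True, False, False] @ enc_term tE13 @ [True, False, True] @ enc_term tG"

definition add_pre :: "bool list" where
  "add_pre = [True, False, False] @ enc_term tE12 @ [True, False, True] @ enc_term tG @ [True, False, False] @
     [True, False, True] @ enc_term tE3"

definition add_mid :: "bool list" where
  "add_mid = [True, False, True] @ enc_term tE2 @ [True, False, False] @ enc_term tE13 @ [True, False, True] @
     enc_term tG"

definition coeff_pre :: "bool list" where
  "coeff_pre = [True, False, False] @ enc_term tE23 @ [True, False, True] @ enc_term (op_term tG tU) @
     [True, False, False] @ enc_term tE13 @ [True, False, True] @ enc_term tG"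

definition cond_pre :: "bool list" where
  "cond_pre = [True, False, True] @ enc_term (Neg tE2) @ [True, False, False] @ enc_term tE2 @ [False, True, True]"

lemma enc_term_simps:
  "enc_term (op_term A G) = op_pre @ enc_term A @ enc_term G"
  "enc_term (adj_term A G) = adj_pre @ enc_term A @ adj_mid @ enc_term G"
  "enc_term (add_term A G) = add_pre @ enc_term A @ add_mid @ enc_term G"
  "enc_term (coeff_term C) = coeff_pre @ enc_term C"
  "enc_term (poly_cond p) = cond_pre @ enc_term (poly_term p)"
  by (simp_all add: op_pre_def adj_pre_def adj_mid_def add_pre_def add_mid_def coeff_pre_def cond_pre_def
      op_term_def adj_term_def add_term_def coeff_term_def poly_cond_def le_term_def)

definition poly_tab :: "nat => bool => bool list" where
  "poly_tab q b =
     (if q = 0 then if b then [True, False, False] @ cond_pre else enc_term One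
      else if q = 1 then if b then add_pre else enc_term tE1
      else if q = 2 then (if b then op_pre @ enc_term tG else []) @ op_pre @ coeff_pre
      else if q = 3 then if b then [] else enc_term tE1
      else if q = 4 then []
      else if q = 5 then (if b then add_pre @ enc_term tU @ add_mid else []) @ op_pre @ enc_term two_term
      else if q = 6 then if b then [] else enc_term tU @ add_mid
      else if q = 7 then (if b then adj_pre else op_pre) @ [False, False, False, True, True]
      else if q = 11 \<and> \<not> b then b # adj_mid
      else [b])"

lemma poly_tab_simps:
  "poly_tab 0 b = (if b then [True, False, False] @ cond_pre else enc_term One)"
  "poly_tab (Suc 0) b = (if b then add_pre else enc_term tE1)"
  "poly_tab 2 b = (if b then op_pre @ enc_term tG else []) @ op_pre @ coeff_pre"
  "poly_tab 3 b = (if b then [] else enc_term tE1)"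
  "poly_tab 4 b = []"
  "poly_tab 5 b = (if b then add_pre @ enc_term tU @ add_mid else []) @ op_pre @ enc_term two_term"
  "poly_tab 6 b = (if b then [] else enc_term tU @ add_mid)"
  "poly_tab 7 b = (if b then adj_pre else op_pre) @ [False, False, False, True, True]"
  "poly_tab 8 b = [b]" "poly_tab 9 b = [b]" "poly_tab 10 b = [b]"
  "poly_tab 11 b = (if b then [b] else b # adj_mid)" "poly_tab 12 b = [b]" "poly_tab 13 b = [b]"
  unfolding poly_tab_def by simp_all

definition tab_step :: "nat \<times> bool list => bool => nat \<times> bool list" where
  "tab_step = (\<lambda>(q, o') b. (poly_delta q b, o' @ poly_tab q b))"

lemma tab_step: "tab_step (q, u) b = (poly_delta q b, u @ poly_tab q b)" by (simp add: tab_step_def)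

lemma foldl_tab_step_coeff:
  "foldl tab_step (3, u) (enc_nat n @ r) = foldl tab_step (6, u @ enc_term (nat_term n)) r" (is "?A n u")
  "n > 0 ==> foldl tab_step (4, u) (enc_nat n @ r) = foldl tab_step (6, u @ enc_term (nat_term n)) r"
proof -
  have "?A n u \<and> (n > 0 -->
      foldl tab_step (4, u) (enc_nat n @ r) = foldl tab_step (6, u @ enc_term (nat_term n)) r)" for u
  proof (induction n arbitrary: u rule: less_induct)
    case (less n)
    show ?case
    proof (cases "n = 0")
      case True
      thus ?thesis by (simp add: enc_nat_0 tab_step poly_delta_simps poly_tab_simps nat_term.simps)
    next
      case False
      hence n: "enc_nat n = True # odd n # enc_nat (n div 2)" "even n ==> n div 2 > 0" "n div 2 < n"
        by (auto simp: enc_nat_pos)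
      have t: "nat_term n = (if odd n then add_term tU else id) (op_term two_term (nat_term (n div 2)))"
        using False by (subst nat_term.simps) simp
      show ?thesis using less.IH[OF n(3)] n(2) unfolding n(1) t
        by (cases "odd n") (simp_all add: tab_step poly_delta_simps poly_tab_simps enc_term_simps del: enc_term.simps)
    qed
  qed
  thus "?A n u"
    "n > 0 ==> foldl tab_step (4, u) (enc_nat n @ r) = foldl tab_step (6, u @ enc_term (nat_term n)) r"
    by auto
qed

lemma foldl_tab_step_index:
  "foldl tab_step (8, u) (enc_nat n @ r) = foldl tab_step (6, u @ enc_nat n) r"
  "foldl tab_step (11, u) (enc_nat n @ r) = foldl tab_step (6, u @ enc_nat n @ adj_mid) r"
proof -
  have n: "butlast (enc_nat n) @ False # xs = enc_nat n @ xs" for xs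
    using arg_cong[OF enc_nat_snoc[of n], of "\<lambda>x. x @ xs"] by simp
  show "foldl tab_step (8, u) (enc_nat n @ r) = foldl tab_step (6, u @ enc_nat n) r"
    using foldl_enc_nat(1)[of tab_step "\<lambda>q a. (q, a)" 8 10 "\<lambda>a b. a @ [b]" 9 u n r] n[of "[]"]
    by (simp add: tab_step poly_delta_simps poly_tab_simps foldl_snoc_id)
  show "foldl tab_step (11, u) (enc_nat n @ r) = foldl tab_step (6, u @ enc_nat n @ adj_mid) r"
    using foldl_enc_nat(1)[of tab_step "\<lambda>q a. (q, a)" 11 13 "\<lambda>a b. a @ [b]" 12 u n r] n[of adj_mid]
    by (simp add: tab_step poly_delta_simps poly_tab_simps foldl_snoc_id)
qed

lemma foldl_tab_step_word:
  "foldl tab_step (6, u) (enc_list enc_letter w @ r) = foldl tab_step (1, u @ enc_term (word_term w) @ add_mid) r"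
proof (induction w arbitrary: u)
  case (Cons l w)
  obtain i b where l: "l = (i, b)" by fastforce
  show ?case unfolding l enc_list.simps enc_letter_simp using Cons foldl_tab_step_index
    by (cases b) (simp_all add: tab_step poly_delta_simps poly_tab_simps enc_term_simps enc_odd_var[simplified])
qed (simp add: tab_step poly_delta_simps poly_tab_simps)

lemma foldl_tab_step_poly:
  "foldl tab_step (1, u) (enc_list enc_summand p @ r) = foldl tab_step (0, u @ enc_term (poly_term p)) r"
proof (induction p arbitrary: u)
  case (Cons m p)
  obtain c w where m: "m = (c, w)" by fastforce
  have "nat \<bar>c\<bar> > 0" if "c < 0" using that by simp
  thus ?case unfolding m enc_list.simps enc_summand_simp enc_int_def
    using Cons foldl_tab_step_coeff[where n = "nat \<bar>c\<bar>"] foldl_tab_step_word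
    by (cases "c < 0") (simp_all add: tab_step poly_delta_simps poly_tab_simps enc_term_simps summand_term_def
        del: enc_term.simps)
qed (simp add: tab_step poly_delta_simps poly_tab_simps)

lemma transduce_enc_polys:
  "transduce poly_delta poly_tab (enc_polys ps) = enc_term (meets (map poly_cond ps) One)"
proof -
  have "foldl tab_step (0, u) (enc_list (enc_list enc_summand) ps) =
      (0, u @ enc_term (meets (map poly_cond ps) One))" for u
  proof (induction ps arbitrary: u)
    case (Cons p ps)
    thus ?case
      using foldl_tab_step_poly by (simp add: tab_step poly_delta_simps poly_tab_simps meets_simps enc_term_simps)
  qed (simp add: tab_step poly_delta_simps poly_tab_simps meets_simps)
  from this[of "[]"] show ?thesis
    by (simp add: transduce_def enc_polys_def tab_step_def del: enc_term.simps)
qed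

definition inst_pieces :: "nat => piece list" where
  "inst_pieces k = (if k = 1 then [Const [True, True], Hole 2] else if k = 3 then [Const [True, True], Hole 4]
     else [Const (enc_nat k)])"

lemma poly_time_frame_formula:
  "\<exists>f. poly_time f \<and> (\<forall>ps. f (enc_polys ps) = enc_term (frame_formula cs ps)) \<and>
     (\<forall>x. x \<notin> range enc_polys --> f x = enc_term Zero)"
proof -
  define tpl where "tpl = concat (map (\<lambda>c. Const [True, False, False] # term_pieces inst_pieces c) cs)"
  define pre where "pre = concat (map (\<lambda>c. [True, False, False] @ enc_term c) frame_conds)"
  define f where "f x = (if accepted poly_delta poly_count 14 x
     then pre @ concat (map (\<lambda>a. concat (map (\<lambda>b. fills (holes a b) tpl)
         (occs poly_delta poly_store poly_fin x))) (occs poly_delta poly_store poly_fin x)) @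
       concat (map (\<lambda>tab. transduce poly_delta tab x) [poly_tab])
     else enc_term Zero)" for x
  have "Hole r \<in> set tpl ==> r = 2 \<or> r = 4" for r
    unfolding tpl_def by (auto dest!: Hole_term_pieces simp: inst_pieces_def split: if_splits)
  hence "poly_time f" unfolding f_def
    by (intro poly_time_scan[of 15]) (auto simp: poly_delta_less poly_count_def)
  moreover have "f (enc_polys ps) = enc_term (frame_formula cs ps)" for ps
  proof -
    have one: "fills (holes (enc_nat i) (enc_nat j)) (Const [True, False, False] # term_pieces inst_pieces c) =
        [True, False, False] @ enc_term (rename (inst_pair (i, j)) c)" for i j c
      unfolding fills_Cons by (subst fills_term_pieces[where f = "inst_pair (i, j)"])
         (auto simp: fills_Cons fills_Nil holes_def inst_pair_def inst_pieces_def enc_odd_var[simplified])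
    have tpl: "fills (holes (enc_nat i) (enc_nat j)) tpl =
        concat (map (\<lambda>c. [True, False, False] @ enc_term c) (map (rename (inst_pair (i, j))) cs))" for i j
    proof -
      have "fills v (concat (map g xs)) = concat (map (\<lambda>c. fills v (g c)) xs)" for v g and xs :: "ol_term list"
        by (induction xs) (simp_all add: fills_append fills_Nil)
      thus ?thesis unfolding tpl_def by (simp only: one map_map comp_def)
    qed
    have f: "f (enc_polys ps) = pre @ concat (map (\<lambda>(a, b). fills (holes a b) tpl)
        (pairs (map enc_nat (poly_vars ps)))) @ enc_term (meets (map poly_cond ps) One)"
      using poly_accepted_iff[of "enc_polys ps"]
      by (simp add: f_def occs_enc_polys transduce_enc_polys concat_pairs del: map_map)
    have cc: "concat (map (\<lambda>x. concat (h x)) xs) = concat (concat (map h xs))"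
      for h :: "nat \<times> nat => bool list list" and xs by (induction xs) auto
    note f
    also have "pre @ concat (map (\<lambda>(a, b). fills (holes a b) tpl) (pairs (map enc_nat (poly_vars ps)))) @
        enc_term (meets (map poly_cond ps) One) = enc_term (frame_formula cs ps)"
      unfolding frame_formula_def meets_append pre_def enc_meets pairs_map
      by (simp add: tpl comp_def case_prod_beta map_concat cc)
    finally show ?thesis .
  qed
  moreover have "f x = enc_term Zero" if "x \<notin> range enc_polys" for x
    using that by (simp add: f_def poly_accepted_iff)
  ultimately show ?thesis by blast
qed

lemma neg_mat_simps:
  fixes A B :: "complex mat"
  assumes "A \<in> carrier_mat k k" "B \<in> carrier_mat k k"
  shows "- (1\<^sub>m k) * A = - A" "A * - B = - (A * B)" "- A * B = - (A * B)" "- (- A) = A" "A * 1\<^sub>m k = A"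
proof -
  show "A * - B = - (A * B)" using assms by (intro uminus_mult_right_mat) auto
  show "- A * B = - (A * B)" using assms by (intro uminus_mult_left_mat) auto
  have "- (1\<^sub>m k) * A = - (1\<^sub>m k * A)" using assms by (intro uminus_mult_left_mat) auto
  thus "- (1\<^sub>m k) * A = - A" using assms by simp
  show "- (- A) = A" by (intro eq_matI) auto
  show "A * 1\<^sub>m k = A" using assms by simp
qed

lemma mat_adjoint_uminus_one: "mat_adjoint (- 1\<^sub>m k) = (- 1\<^sub>m k :: complex mat)"
proof (rule eq_matI)
  fix i j assume "i < dim_row (- 1\<^sub>m k :: complex mat)" "j < dim_col (- 1\<^sub>m k :: complex mat)"
  thus "mat_adjoint (- 1\<^sub>m k) $$ (i, j) = (- 1\<^sub>m k :: complex mat) $$ (i, j)"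
    using mat_adjoint_index[of "- 1\<^sub>m k" k k i j] by auto
qed (auto simp: mat_adjoint_def)

context star_field
begin

lemma Fmat_uminus:
  assumes "Fmat n m A"
  shows "Fmat n m (- A)"
proof (rule FmatI)
  note A = Fmat_carrier[OF assms]
  show "- A \<in> carrier_mat n m" using A by simp
  fix i j assume "i < n" "j < m"
  thus "(- A) $$ (i, j) \<in> F"
    using A F_uminus[OF Fmat_index[OF assms]] by (simp del: Fmat_carrier)
qed

end

context coordinates
begin

lemmas Fmat_intros = Fmat_mult Fmat_uminus Fmat_one Fmat_adjoint Fmat_add Fmat_zero H(1)

abbreviation E :: "(nat => complex vec set) => ol_term => complex vec set" where
  "E a t \<equiv> eval_term (L d) a t"

definition framed :: "(nat => complex vec set) => bool" where
  "framed a \<longleftrightarrow> (\<forall>i. subspace_over F d (a i)) \<and> a 0 = s1 \<and> a 2 = s2 \<and> a 4 = gr12 (1\<^sub>m k) \<and> a 6 = gr23 (- 1\<^sub>m k)"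

lemma framedD: "framed a ==> \<forall>i. subspace_over F d (a i)" by (simp add: framed_def)

lemma frame_eval:
  assumes "framed a"
  shows "E a tE1 = s1" "E a tE2 = s2" "E a tE3 = s3" "E a tE12 = s12" "E a tE13 = s13" "E a tE23 = s23"
    "E a tU = gr12 (1\<^sub>m k)" "E a tG = gr23 (- 1\<^sub>m k)" "E a tD = gr32 (- H)"
proof -
  have "s23 \<inter> perp d (gr23 (- 1\<^sub>m k)) = gr32 (- H)"
    unfolding perp_gr23[OF Fmat_uminus[OF Fmat_one]] mat_adjoint_uminus_one
    using neg_mat_simps(1)[OF Fmat_carrier[OF H(1)] Fmat_carrier[OF H(1)]] by simp
  moreover have "a 0 = s1" "a 2 = s2" "a 4 = gr12 (1\<^sub>m k)" "a 6 = gr23 (- 1\<^sub>m k)"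
    using assms by (simp_all add: framed_def)
  ultimately show "E a tE1 = s1" "E a tE2 = s2" "E a tE3 = s3" "E a tE12 = s12" "E a tE13 = s13" "E a tE23 = s23"
    "E a tU = gr12 (1\<^sub>m k)" "E a tG = gr23 (- 1\<^sub>m k)" "E a tD = gr32 (- H)"
    by (simp_all only: frame_defs eval_term.simps L_simps perp_s inter_s plus_s12)
qed

lemma eval_op_gram:
  assumes a: "framed a" and A: "Fmat k k A" "E a s = gr23 A" and M: "Fmat k k M" "E a t = gr12 M"
  shows "E a (op_term s t) = gr12 (H * (A * M))"
proof -
  have "E a (op_term s t) = gr12 (- ((- H) * (A * M)))"
    using A M by (simp add: op_term_def frame_eval[OF a] step_13 step_12 Fmat_intros)
  also have "- ((- H) * (A * M)) = H * (A * M)"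
    using neg_mat_simps(3,4)[OF Fmat_carrier[OF H(1)] Fmat_carrier[OF Fmat_mult[OF A(1) M(1)]]]
      neg_mat_simps(4)[OF Fmat_carrier[OF Fmat_mult[OF H(1) Fmat_mult[OF A(1) M(1)]]]
        Fmat_carrier[OF H(1)]] by simp
  finally show ?thesis .
qed

lemma gram_one:
  assumes "H * H = 1\<^sub>m k"
  shows "H = 1\<^sub>m k"
proof -
  have "H *v x = x" if x: "x \<in> V k" for x
  proof -
    have m: "H *v x \<in> V k" using x H(1) by (simp add: mult_V)
    let ?y = "H *v x - x"
    have y: "?y \<in> V k" by (rule V_diff[OF m x])
    have "H *v (H *v x) = x"
      using assoc_mult_mat_vec[OF Fmat_carrier[OF H(1)] Fmat_carrier[OF H(1)] V_carrier[OF x]]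
        V_carrier[OF x] by (simp add: assms)
    hence "H *v ?y = x - H *v x"
      using mult_minus_distrib_mat_vec[OF Fmat_carrier[OF H(1)] V_carrier[OF m] V_carrier[OF x]] by simp
    also have "... = - ?y"
      using V_dim[OF x] V_dim[OF m] by (intro eq_vecI) (auto simp del: index_mult_mat_vec dim_mult_mat_vec)
    finally have "ip (b3 ?y) (b3 ?y) = - ip ?y ?y"
      using H(2)[OF y y] ip_uminus[OF V_carrier[OF y] V_carrier[OF y]] by simp
    hence "(\<Sum>i<d. (cmod (b3 ?y $ i))\<^sup>2) = - (\<Sum>i<k. (cmod (?y $ i))\<^sup>2)"
      unfolding ip_self[OF V_carrier[OF b_V(3)[OF y]]] ip_self[OF V_carrier[OF y]] of_real_minus[symmetric]
        of_real_eq_iff .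
    moreover have "(\<Sum>i<d. (cmod (b3 ?y $ i))\<^sup>2) \<ge> 0" "(\<Sum>i<k. (cmod (?y $ i))\<^sup>2) \<ge> 0"
      by (auto intro: sum_nonneg)
    ultimately have "ip ?y ?y = 0"
      unfolding ip_self[OF V_carrier[OF y]] of_real_eq_0_iff by linarith
    hence "?y = z0" using ip_self_eq_0[OF V_carrier[OF y]] by simp
    thus ?thesis using diff_eq_0_vec[OF V_carrier[OF m] V_carrier[OF x]] by simp
  qed
  thus ?thesis by (intro mat_eqI[OF Fmat_carrier[OF H(1)] one_carrier_mat])
       (simp add: one_mult_mat_vec[OF V_carrier])
qed

text \<open>
  The last frame condition compares \<open>tG\<close> with its orthogonal complement \<open>tD\<close> in the plane of the second and
  third axis; it says that the Gram matrix of the third axis is an involution.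
\<close>

lemma gram_cond:
  assumes a: "framed a"
    and le: "E a (Meet tE12 (Join tG (Meet tE13 (Join tD tU)))) \<subseteq> E a (op_term tG tU)"
  shows "H = 1\<^sub>m k"
proof (rule gram_one, rule mat_eqI)
  note neg1 = Fmat_uminus[OF Fmat_one]
  fix z assume z: "z \<in> V k"
  have m: "H *v z \<in> V k" "- z \<in> V k" using z H(1) by (simp_all add: mult_V V_uminus)
  have 1: "1\<^sub>m k *v x = x" "(- 1\<^sub>m k) *v x = - x" "(- H) *v x = - (H *v x)" if "x \<in> V k" for x
    using mult_mat_vec_uminus(2)[of "1\<^sub>m k" k k x] mult_mat_vec_uminus(2)[OF Fmat_carrier[OF H(1)], of x]
      V_carrier[OF that] by simp_all
  have gr: "T z0 (- z) (- z) \<in> gr23 (- 1\<^sub>m k)" "T z0 (- (H *v z)) z \<in> gr32 (- H)"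
    "T (H *v z) (H *v z) z0 \<in> gr12 (1\<^sub>m k)"
    using gr23_I[OF m(2), of _ "- 1\<^sub>m k"] gr32_I[OF z, of _ "- H"] gr12_I[OF m(1), of _ "1\<^sub>m k"] z m
    by (simp_all add: 1 vec_V_simps)
  have "T z0 (- (H *v z)) z + T (H *v z) (H *v z) z0 = T (H *v z) z0 z"
    using z m by (simp add: T_add vec_V_simps)
  hence "T (H *v z) z0 z \<in> plus_sets (gr32 (- H)) (gr12 (1\<^sub>m k))"
    using plus_setsI[OF gr(2,3)] by simp
  hence 13: "T (H *v z) z0 z \<in> s13 \<inter> plus_sets (gr32 (- H)) (gr12 (1\<^sub>m k))"
    by (rule IntI[OF iffD2[OF in_s13[OF m(1) V_zero z] refl]])
  have "T z0 (- z) (- z) + T (H *v z) z0 z = T (H *v z) (- z) z0"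
    using z m by (simp add: T_add vec_V_simps)
  hence "T (H *v z) (- z) z0 \<in>
      plus_sets (gr23 (- 1\<^sub>m k)) (s13 \<inter> plus_sets (gr32 (- H)) (gr12 (1\<^sub>m k)))"
    using plus_setsI[OF gr(1) 13] by simp
  hence "T (H *v z) (- z) z0 \<in>
      s12 \<inter> plus_sets (gr23 (- 1\<^sub>m k)) (s13 \<inter> plus_sets (gr32 (- H)) (gr12 (1\<^sub>m k)))"
    by (rule IntI[OF iffD2[OF in_s12[OF m V_zero] refl]])
  moreover have "E a (op_term tG tU) = gr12 (- H)"
    using eval_op_gram[OF a neg1 frame_eval(8)[OF a] Fmat_one frame_eval(7)[OF a]]
      neg_mat_simps[OF Fmat_carrier[OF H(1)] one_carrier_mat] by simp
  ultimately have "T (H *v z) (- z) z0 \<in> gr12 (- H)"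
    using le unfolding eval_term.simps L_simps frame_eval[OF a] by blast
  then obtain x where x: "x \<in> V k" "T (H *v z) (- z) z0 = T x ((- H) *v x) z0"
    unfolding gr12_def by blast
  hence "H *v z = x" "- z = - (H *v x)"
    using T_eq_iff[OF m V_zero x(1) mult_V[OF Fmat_uminus[OF H(1)] x(1)] V_zero] by (auto simp: 1)
  hence "H *v z = x" "- (- z) = - (- (H *v x))" by simp_all
  hence "z = H *v (H *v z)"
    unfolding vec_V_simps(4)[OF z z] vec_V_simps(4)[OF mult_V[OF H(1) x(1)] z] by simp
  thus "(H * H) *v z = 1\<^sub>m k *v z"
    using assoc_mult_mat_vec[OF Fmat_carrier[OF H(1)] Fmat_carrier[OF H(1)] V_carrier[OF z]] V_carrier[OF z]
    by simp
qed (use Fmat_carrier[OF H(1)] in auto)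

end

locale orthonormal_coordinates = coordinates F d k b1 b2 b3 "1\<^sub>m k"
  for F d k b1 b2 b3
begin

lemma eval_op:
  assumes a: "framed a" and A: "Fmat k k A" "E a s = gr23 A" and M: "Fmat k k M" "E a t = gr12 M"
  shows "E a (op_term s t) = gr12 (A * M)"
  using eval_op_gram[OF assms] left_mult_one_mat[OF Fmat_carrier[OF Fmat_mult[OF A(1) M(1)]]] by simp

lemma eval_adj:
  assumes a: "framed a" and A: "Fmat k k A" "E a s = gr23 A" and M: "Fmat k k M" "E a t = gr12 M"
  shows "E a (adj_term s t) = gr12 (mat_adjoint A * M)"
proof -
  note A' = Fmat_adjoint[OF A(1)]
  have "E a (adj_term s t) = gr12 (- (mat_adjoint A * - M))"
    using A A' M neg_mat_simps(1)[OF Fmat_carrier[OF M(1)] Fmat_carrier[OF M(1)]]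
    by (simp add: adj_term_def frame_eval[OF a] perp_gr23 step_13 step_12 Fmat_intros
        neg_mat_simps(5)[OF Fmat_carrier[OF A'] Fmat_carrier[OF A']])
  also have "- (mat_adjoint A * - M) = mat_adjoint A * M"
    using neg_mat_simps(2)[OF Fmat_carrier[OF A'] Fmat_carrier[OF M(1)]]
      neg_mat_simps(4)[OF Fmat_carrier[OF Fmat_mult[OF A' M(1)]] one_carrier_mat] by simp
  finally show ?thesis .
qed

lemma gr32_one: "gr32 (1\<^sub>m k) = gr23 (- 1\<^sub>m k)"
proof -
  have "1\<^sub>m k *v x = x" "- ((- 1\<^sub>m k) *v x) = x" if "x \<in> V k" for x
    using mult_mat_vec_uminus(2)[of "1\<^sub>m k" k k x] V_carrier[OF that] by simp_all
  thus ?thesis unfolding gr32_def gr23_def by force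
qed

lemma eval_add:
  assumes a: "framed a" and M: "Fmat k k M" "E a s = gr12 M" and N: "Fmat k k N" "E a t = gr12 N"
  shows "E a (add_term s t) = gr12 (M + N)"
proof -
  have "s13 \<inter> plus_sets (gr23 (- 1\<^sub>m k)) (gr12 N) = gr13 (- N)"
    using step_13[OF Fmat_uminus[OF Fmat_one] N(1)]
      neg_mat_simps(1)[OF Fmat_carrier[OF N(1)] Fmat_carrier[OF N(1)]] by simp
  thus ?thesis
    using step_add[OF M(1) N(1)] M N by (simp add: add_term_def frame_eval[OF a] gr32_one)
qed

lemma eval_neg:
  assumes a: "framed a" and M: "Fmat k k M" "E a t = gr12 M"
  shows "E a (op_term tG t) = gr12 (- M)"
  using eval_op[OF a Fmat_uminus[OF Fmat_one] frame_eval(8)[OF a] M]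
    neg_mat_simps(1)[OF Fmat_carrier[OF M(1)] Fmat_carrier[OF M(1)]] by simp

lemma eval_coeff:
  assumes a: "framed a" and M: "Fmat k k M" "E a t = gr12 M"
  shows "E a (coeff_term t) = gr23 M"
proof -
  have "s13 \<inter> plus_sets (gr23 (- 1\<^sub>m k)) (gr12 M) = gr13 (- M)"
    using step_13[OF Fmat_uminus[OF Fmat_one] M(1)]
      neg_mat_simps(1)[OF Fmat_carrier[OF M(1)] Fmat_carrier[OF M(1)]] by simp
  thus ?thesis using step_23[OF M(1)] M eval_neg[OF a Fmat_one frame_eval(7)[OF a]]
    by (simp add: coeff_term_def frame_eval[OF a])
qed

lemma smult_one: "c \<in> F ==> Fmat k k (c \<cdot>\<^sub>m 1\<^sub>m k)"
  by (intro Fmat_smult Fmat_one)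

lemma smult_one_mult: "Fmat k k M ==> (c \<cdot>\<^sub>m 1\<^sub>m k) * M = c \<cdot>\<^sub>m M"
  using mult_smult_assoc_mat[OF one_carrier_mat Fmat_carrier, of k k M c] left_mult_one_mat[OF Fmat_carrier, of k k M]
  by simp

lemma eval_two:
  assumes a: "framed a"
  shows "E a two_term = gr23 (2 \<cdot>\<^sub>m 1\<^sub>m k)"
proof -
  have "1\<^sub>m k + 1\<^sub>m k = (2 \<cdot>\<^sub>m 1\<^sub>m k :: complex mat)"
    by (intro eq_matI) auto
  thus ?thesis
    unfolding two_term_def using eval_coeff[OF a _ eval_add[OF a Fmat_one frame_eval(7)[OF a] Fmat_one
        frame_eval(7)[OF a]]] Fmat_add[OF Fmat_one Fmat_one, of k] by simp
qed

lemma gr12_zero: "gr12 (0\<^sub>m k k) = s1"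
proof -
  have "0\<^sub>m k k *v x = z0" if "x \<in> V k" for x
    using V_carrier[OF that] by (intro eq_vecI) auto
  thus ?thesis unfolding gr12_def s1_def by force
qed

lemma eval_nat:
  assumes a: "framed a"
  shows "E a (nat_term n) = gr12 (of_nat n \<cdot>\<^sub>m 1\<^sub>m k)"
proof (induction n rule: less_induct)
  case (less n)
  show ?case
  proof (cases "n = 0")
    case True
    moreover have "(0 :: complex) \<cdot>\<^sub>m 1\<^sub>m k = 0\<^sub>m k k"
      by (intro eq_matI) auto
    ultimately show ?thesis using frame_eval(1)[OF a] by (simp add: nat_term.simps gr12_zero)
  next
    case False
    let ?m = "n div 2"
    have IH: "E a (nat_term ?m) = gr12 (of_nat ?m \<cdot>\<^sub>m 1\<^sub>m k)"
      using False by (intro less) simp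
    have two: "Fmat k k (2 \<cdot>\<^sub>m 1\<^sub>m k)"
      using F_of_nat[of 2] by (intro smult_one) simp
    have "(2 :: complex) \<cdot>\<^sub>m 1\<^sub>m k * (of_nat ?m \<cdot>\<^sub>m 1\<^sub>m k) = of_nat (2 * ?m) \<cdot>\<^sub>m 1\<^sub>m k"
      unfolding smult_one_mult[OF smult_one[OF F_of_nat]] by (intro eq_matI) auto
    hence dbl: "E a (op_term two_term (nat_term ?m)) = gr12 (of_nat (2 * ?m) \<cdot>\<^sub>m 1\<^sub>m k)"
      using eval_op[OF a two eval_two[OF a] smult_one[OF F_of_nat] IH] by simp
    show ?thesis
    proof (cases "even n")
      case True
      thus ?thesis using dbl False by (subst nat_term.simps) simp
    next
      case odd: False
      have "1\<^sub>m k + of_nat (2 * ?m) \<cdot>\<^sub>m 1\<^sub>m k = (of_nat (Suc (2 * ?m)) \<cdot>\<^sub>m 1\<^sub>m k :: complex mat)"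
        by (intro eq_matI) auto
      moreover have "Suc (2 * ?m) = n" using odd by (metis odd_two_times_div_two_succ Suc_eq_plus1)
      ultimately show ?thesis
        using eval_add[OF a Fmat_one frame_eval(7)[OF a] smult_one[OF F_of_nat] dbl] odd False
        by (subst nat_term.simps) simp
    qed
  qed
qed

definition letter_graphs :: "(nat => complex vec set) => (nat => complex mat) => nat set => bool" where
  "letter_graphs a X I \<longleftrightarrow> (\<forall>i. Fmat k k (X i)) \<and> (\<forall>i\<in>I. a (2 * i + 1) = gr23 (X i))"

lemma eval_word:
  assumes a: "framed a" and X: "letter_graphs a X I" "fst ` set w \<subseteq> I"
  shows "E a (word_term w) = gr12 (eval_monom (R k) X w)" using X(2)
proof (induction w)
  case Nil
  thus ?case using frame_eval(7)[OF a] by (simp add: eval_monom_R)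
next
  case (Cons l w)
  have X': "\<forall>i. Fmat k k (X i)" using X by (simp add: letter_graphs_def)
  have l: "Fmat k k (X (fst l))" "E a (Var (2 * fst l + 1)) = gr23 (X (fst l))"
    using X Cons.prems by (auto simp: letter_graphs_def)
  have IH: "E a (word_term w) = gr12 (eval_monom (R k) X w)" using Cons by auto
  show ?case
    using eval_op[OF a l Fmat_eval_monom[OF X'] IH] eval_adj[OF a l Fmat_eval_monom[OF X'] IH]
    by (cases l) (auto simp: eval_monom_R eval_letter_def)
qed

lemma eval_poly_term:
  assumes a: "framed a" and X: "letter_graphs a X I" "\<forall>m\<in>set p. fst ` set (snd m) \<subseteq> I"
  shows "E a (poly_term p) = gr12 (eval_poly (R k) X p)" using X(2)
proof (induction p)
  have X': "\<forall>i. Fmat k k (X i)" using X by (simp add: letter_graphs_def)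
  {
    case Nil
    thus ?case using frame_eval(1)[OF a] by (simp add: eval_poly_R[OF X'] gr12_zero)
  next
    case (Cons m p)
    obtain c w where m: "m = (c, w)" by fastforce
    let ?W = "eval_monom (R k) X w"
    have W: "Fmat k k ?W" "E a (word_term w) = gr12 ?W"
      using Fmat_eval_monom[OF X'] eval_word[OF a X(1), of w] Cons.prems by (auto simp: m)
    define n where "n = nat \<bar>c\<bar>"
    let ?n = "of_nat n :: complex"
    have c: "of_int c = (if c < 0 then - ?n else ?n)" by (simp add: n_def)
    have "E a (op_term (coeff_term (nat_term n)) (word_term w)) = gr12 (?n \<cdot>\<^sub>m ?W)"
      using eval_op[OF a smult_one[OF F_of_nat] eval_coeff[OF a smult_one[OF F_of_nat] eval_nat[OF a]] W]
      by (simp only: smult_one_mult[OF W(1)])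
    moreover from eval_neg[OF a Fmat_smult[OF F_of_nat W(1)] this] have
      "E a (op_term tG (op_term (coeff_term (nat_term n)) (word_term w))) = gr12 (- (?n \<cdot>\<^sub>m ?W))" .
    moreover have "- (?n \<cdot>\<^sub>m ?W) = (- ?n) \<cdot>\<^sub>m ?W" by (intro eq_matI) auto
    ultimately have "E a (summand_term m) = gr12 (of_int c \<cdot>\<^sub>m ?W)"
      unfolding summand_term_def m fst_conv snd_conv n_def[symmetric] c by (cases "c < 0") simp_all
    moreover have "E a (poly_term p) = gr12 (eval_poly (R k) X p)" using Cons by auto
    ultimately show ?case using eval_add[OF a Fmat_smult[OF F_of_int W(1)] _ Fmat_eval_poly[OF X']]
      by (simp add: eval_poly_R[OF X'] m)
  }
qed

lemma eval_poly_cond: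
  assumes a: "framed a" and X: "letter_graphs a X I" "\<forall>m\<in>set p. fst ` set (snd m) \<subseteq> I"
  shows "E a (poly_cond p) = V d \<longleftrightarrow> eval_poly (R k) X p = 0\<^sub>m k k"
  using s2_le_perp_gr12[OF Fmat_eval_poly[of k X p]] X(1)
  by (simp add: poly_cond_def eval_le_term[OF framedD[OF a]] eval_poly_term[OF assms] frame_eval[OF a]
      letter_graphs_def)

end

subsection \<open>Coordinates from a frame\<close>

context star_field
begin

text \<open>
  \<open>F = K + K \<delta>\<close> for the real subfield \<open>K\<close> and a purely imaginary \<open>\<delta>\<close>, so a sum of norms is
  a sum of two sums of squares.
\<close>

lemma sum_norms_eq_norm:
  fixes z :: "nat => complex"
  assumes "pythagorean F" and z: "\<forall>i<n. z i \<in> F"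
  shows "\<exists>w\<in>F. of_real (\<Sum>i<n. (cmod (z i))\<^sup>2) = w * cnj w"
proof -
  have sq: "\<exists>y\<in>F \<inter> \<real>. (\<Sum>i<n. (f i)\<^sup>2) = y\<^sup>2" if "\<forall>i<n. f i \<in> F \<inter> \<real>"
    for f :: "nat => complex"
  proof -
    have "(\<Sum>i<n. (f i)\<^sup>2) = sum_list (map (\<lambda>x. x\<^sup>2) (map f [0..<n]))"
      by (simp add: sum_list_distinct_conv_sum_set comp_def atLeast0LessThan)
    moreover have "set (map f [0..<n]) \<subseteq> F \<inter> \<real>" using that by auto
    ultimately have "(\<Sum>i<n. (f i)\<^sup>2) \<in> sums_of_squares (F \<inter> \<real>)"
      unfolding sums_of_squares_def by blast
    thus ?thesis using assms(1) unfolding pythagorean_def by blast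
  qed
  have norms: "of_real (\<Sum>i<n. (cmod (z i))\<^sup>2) = (\<Sum>i<n. z i * cnj (z i))"
    by (simp add: complex_norm_square del: of_real_power)
  show ?thesis
  proof (cases "F \<subseteq> \<real>")
    case True
    then obtain y where y: "y \<in> F" "y \<in> \<real>" "(\<Sum>i<n. (z i)\<^sup>2) = y\<^sup>2"
      using sq[of z] z by blast
    have "cnj (z i) = z i" if "i < n" for i using z True that by (auto simp: Reals_cnj_iff)
    hence "(\<Sum>i<n. z i * cnj (z i)) = y * cnj y"
      using y by (simp add: power2_eq_square Reals_cnj_iff)
    thus ?thesis using norms y(1) by auto
  next
    case False
    then obtain y where y: "y \<in> F" "y \<notin> \<real>" by blast
    define \<delta> where "\<delta> = y - cnj y"
    have \<delta>: "\<delta> \<in> F" "\<delta> \<noteq> 0" "cnj \<delta> = - \<delta>"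
      using y by (auto simp: \<delta>_def Reals_cnj_iff)
    define a b where "a i = (z i + cnj (z i)) / 2" and "b i = (z i - cnj (z i)) / (2 * \<delta>)" for i
    have two: "2 \<in> F" using F_of_nat[of 2] by simp
    have ab: "a i \<in> F \<inter> \<real>" "b i \<in> F \<inter> \<real>" if "i < n" for i
    proof -
      have "cnj (a i) = a i" by (simp add: a_def add.commute)
      moreover have "cnj (b i) = b i" using \<delta>(2) by (simp add: b_def \<delta>(3) field_simps)
      ultimately show "a i \<in> F \<inter> \<real>" "b i \<in> F \<inter> \<real>"
        using z that two \<delta>(1) by (auto simp: Reals_cnj_iff a_def b_def)
    qed
    obtain A where A: "A \<in> F" "A \<in> \<real>" "(\<Sum>i<n. (a i)\<^sup>2) = A\<^sup>2"
      using sq[of a] ab by blast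
    obtain B where B: "B \<in> F" "B \<in> \<real>" "(\<Sum>i<n. (b i)\<^sup>2) = B\<^sup>2"
      using sq[of b] ab by blast
    have zz: "z i * cnj (z i) = (a i)\<^sup>2 - \<delta>\<^sup>2 * (b i)\<^sup>2" for i
      using \<delta>(2) by (simp add: a_def b_def power2_eq_square field_simps)
    have "(\<Sum>i<n. z i * cnj (z i)) = A\<^sup>2 - \<delta>\<^sup>2 * B\<^sup>2"
      by (simp only: zz sum_subtractf sum_distrib_left[symmetric] A(3) B(3))
    also have "... = (A + \<delta> * B) * cnj (A + \<delta> * B)"
      using A(2) B(2) \<delta>(3) by (simp add: Reals_cnj_iff power2_eq_square algebra_simps)
    finally show ?thesis
      using norms A(1) B(1) \<delta>(1) by (auto intro!: bexI[of _ "A + \<delta> * B"])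
  qed
qed

lemma mult_comb:
  assumes b: "\<And>i. i < n ==> b i \<in> carrier_vec d"
  shows "comb d n (\<lambda>i. c i * e i) b = comb d n c (\<lambda>i. e i *s b i)"
proof (rule eq_vecI)
  fix j assume "j < dim_vec (comb d n c (\<lambda>i. e i *s b i))"
  hence j: "j < d" by (simp add: comb_def)
  hence "(e i *s b i) $ j = e i * b i $ j" if "i < n" for i using b[OF that] by simp
  thus "comb d n (\<lambda>i. c i * e i) b $ j = comb d n c (\<lambda>i. e i *s b i) $ j"
    using j by (simp add: comb_def mult.assoc)
qed (simp add: comb_def)

lemma ex_isometry:
  assumes p: "pythagorean F" and U: "subspace_over F d U"
  shows "\<exists>k M. Fmat d k M \<and> (\<forall>x\<in>V k. M *v x \<in> U) \<and> (\<forall>u\<in>U. \<exists>x\<in>V k. u = M *v x) \<and>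
     (\<forall>x\<in>V k. \<forall>y\<in>V k. ip (M *v x) (M *v y) = ip x y)"
proof -
  obtain k b where fam: "orthogonal_family d U k b" and span: "\<forall>x\<in>U. x = project d k b x"
    using ex_orthogonal_basis[OF U] by blast
  have b: "b i \<in> U" "b i \<in> V d" "b i \<noteq> 0\<^sub>v d" if "i < k" for i
    using fam subspaceD(1)[OF U] that by (auto simp: orthogonal_family_def)
  have "\<exists>w\<in>F. ip (b i) (b i) = w * cnj w" if "i < k" for i
    unfolding ip_self[OF V_carrier[OF b(2)[OF that]]]
    by (rule sum_norms_eq_norm[OF p]) (use V_index[OF b(2)[OF that]] in blast)
  then obtain w where w: "\<And>i. i < k ==> w i \<in> F" "\<And>i. i < k ==> ip (b i) (b i) = w i * cnj (w i)"
    by metis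
  have w0: "w i \<noteq> 0" if "i < k" for i
    using w(2)[OF that] ip_self_eq_0[OF V_carrier[OF b(2)[OF that]]] b(3)[OF that] by auto
  define e where "e i = inverse (w i) *s b i" for i
  have eU: "e i \<in> U" "e i \<in> V d" "e i \<in> carrier_vec d" if "i < k" for i
  proof -
    show "e i \<in> U"
      unfolding e_def by (rule subspaceD(4)[OF U F_inverse[OF w(1)[OF that]] b(1)[OF that]])
    thus "e i \<in> V d" by (rule subspaceD(1)[OF U])
    thus "e i \<in> carrier_vec d" by (rule V_carrier)
  qed
  have ipe: "ip (e i) (e j) = (if i = j then 1 else 0)" if "i < k" "j < k" for i j
  proof -
    note c = V_carrier[OF b(2)[OF that(1)]] V_carrier[OF b(2)[OF that(2)]]
    have "ip (e i) (e j) = inverse (w j) * (cnj (inverse (w i)) * ip (b i) (b j))"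
      unfolding e_def using c by (simp only: ip_smult[of _ d] smult_carrier_vec)
    thus ?thesis
      using fam that w(2)[OF that(1)] w0[OF that(1)] by (auto simp: orthogonal_family_def field_simps)
  qed
  define M where "M = cols_mat d k e"
  have M: "Fmat d k M" unfolding M_def by (rule Fmat_cols_mat) (rule eU(2))
  have Mc: "M *v x = comb d k (\<lambda>j. x $ j) e" if "x \<in> V k" for x
    unfolding M_def by (rule cols_mat_mult[OF V_carrier[OF that]])
  have MU: "M *v x \<in> U" if "x \<in> V k" for x
    unfolding Mc[OF that] by (rule comb_in[OF U V_index[OF that] eU(1)])
  moreover have "\<exists>x\<in>V k. u = M *v x" if u: "u \<in> U" for u
  proof -
    define x where "x = vec k (\<lambda>i. ip (b i) u / ip (b i) (b i) * w i)"
    have uV: "u \<in> V d" using subspaceD(1)[OF U u] .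
    have x: "x \<in> V k"
      by (rule V_I) (auto simp: x_def intro!: F_mult F_divide w(1) ip_in[OF b(2) uV] ip_in[OF b(2) b(2)])
    have "u = comb d k (\<lambda>i. ip (b i) u / ip (b i) (b i)) b"
      using span u unfolding project_def by blast
    also have "... = comb d k (\<lambda>j. x $ j * inverse (w j)) b"
      using w0 unfolding comb_def by (intro arg_cong[where f = "vec d"] ext sum.cong) (auto simp: x_def)
    also have "... = M *v x" unfolding Mc[OF x] e_def by (rule mult_comb[OF V_carrier[OF b(2)]])
    finally show ?thesis using x by blast
  qed
  moreover have "ip (M *v x) (M *v y) = ip x y" if x: "x \<in> V k" and y: "y \<in> V k" for x y
  proof -
    have Me: "ip (e j) (M *v x) = x $ j" if "j < k" for j
    proof -
      have "ip (e j) (M *v x) = (\<Sum>i<k. x $ i * ip (e j) (e i))"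
        unfolding Mc[OF x] by (rule ip_comb[OF eU(3)[OF that] eU(3)])
      also have "... = (\<Sum>i<k. if i = j then x $ j else 0)"
        using that by (intro sum.cong) (auto simp: ipe)
      finally show ?thesis using that by simp
    qed
    have Mx: "M *v x \<in> carrier_vec d" by (rule V_carrier[OF mult_vec_V[OF M x]])
    have "ip (M *v x) (M *v y) = (\<Sum>j<k. y $ j * ip (M *v x) (e j))"
      unfolding Mc[OF y] by (rule ip_comb[OF Mx eU(3)])
    also have "... = (\<Sum>j<k. cnj (x $ j) * y $ j)"
      using ip_swap[OF eU(3) Mx] Me by (intro sum.cong) auto
    also have "... = ip x y" using ip_sum[OF V_dim[OF x] V_dim[OF y]] by simp
    finally show ?thesis .
  qed
  ultimately show ?thesis using M by blast
qed

lemma linear_in_subspace: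
  assumes U: "subspace_over F d U" and P: "Fmat d k P" "\<And>j. j < k ==> P *v unit_vec k j \<in> U"
    and x: "x \<in> V k"
  shows "P *v x \<in> U"
  unfolding mat_mult_comb_unit[OF P(1) x] using comb_in[OF U V_index[OF x] P(2)] by simp

lemma mult_cols_unit:
  assumes "\<And>j. j < k ==> f j \<in> V d" "j < k"
  shows "cols_mat d k f *v unit_vec k j = f j"
proof (rule eq_vecI)
  fix i assume "i < dim_vec (f j)"
  hence "i < d" using V_dim[OF assms(1)[OF assms(2)]] by simp
  thus "(cols_mat d k f *v unit_vec k j) $ i = f j $ i"
    using mult_unit_vec_index[OF cols_mat_carrier, of i d j k f] assms(2) by (simp add: cols_mat_def)
qed (use V_dim[OF assms(1)[OF assms(2)]] in \<open>auto simp: cols_mat_def\<close>)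

lemma graph_matrix:
  assumes M: "Fmat d k M" "\<And>x. x \<in> V k ==> M *v x \<in> A" "\<And>u. u \<in> A ==> \<exists>x\<in>V k. u = M *v x"
    and A: "subspace_over F d A" and B: "subspace_over F d B" and C: "subspace_over F d C"
    and le: "C \<subseteq> plus_sets A B" "A \<subseteq> plus_sets C B" "C \<inter> B = {0\<^sub>v d}"
  shows "\<exists>N. Fmat d k N \<and> (\<forall>x\<in>V k. N *v x \<in> B) \<and> C = {M *v x + N *v x | x. x \<in> V k}"
proof -
  have BV: "B \<subseteq> V d" and CV: "C \<subseteq> V d"
    using subspaceD(1)[OF B] subspaceD(1)[OF C] by blast+
  have "\<exists>f\<in>B. M *v unit_vec k j + f \<in> C" if "j < k" for j
  proof -
    have "M *v unit_vec k j \<in> plus_sets C B" using M(2)[OF unit_vec_V] le(2) by blast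
    then obtain c b where cb: "c \<in> C" "b \<in> B" "M *v unit_vec k j = c + b"
      unfolding plus_sets_def by blast
    have "c + b + - b = c"
      using V_dim[OF subspaceD(1)[OF C cb(1)]] V_dim[OF subspaceD(1)[OF B cb(2)]] by (intro eq_vecI) auto
    thus ?thesis using cb subspace_uminus[OF B cb(2)] by metis
  qed
  then obtain f where f: "\<And>j. j < k ==> f j \<in> B" "\<And>j. j < k ==> M *v unit_vec k j + f j \<in> C"
    by metis
  have fV: "f j \<in> V d" if "j < k" for j using f(1)[OF that] BV by blast
  define N where "N = cols_mat d k f"
  have N: "Fmat d k N" unfolding N_def by (rule Fmat_cols_mat[OF fV])
  have Ne: "N *v unit_vec k j = f j" if "j < k" for j
    unfolding N_def by (rule mult_cols_unit[OF fV that])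
  have NB: "N *v x \<in> B" if "x \<in> V k" for x
    using linear_in_subspace[OF B N _ that] Ne f(1) by metis
  have dist: "(M + N) *v x = M *v x + N *v x" if "x \<in> V k" for x
    by (rule add_mult_distrib_mat_vec[OF Fmat_carrier[OF M(1)] Fmat_carrier[OF N] V_carrier[OF that]])
  have MNC: "M *v x + N *v x \<in> C" if "x \<in> V k" for x
  proof -
    have "(M + N) *v x \<in> C"
      using f(2) by (intro linear_in_subspace[OF C Fmat_add[OF M(1) N] _ that]) (simp only: dist[OF unit_vec_V] Ne)
    thus ?thesis by (simp only: dist[OF that])
  qed
  have "\<exists>x\<in>V k. c = M *v x + N *v x" if c: "c \<in> C" for c
  proof -
    obtain p q where pq: "p \<in> A" "q \<in> B" "c = p + q"
      using c le(1) unfolding plus_sets_def by blast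
    obtain x where x: "x \<in> V k" "p = M *v x" using M(3)[OF pq(1)] by blast
    have V: "p \<in> carrier_vec d" "q \<in> carrier_vec d" "N *v x \<in> carrier_vec d"
      using subspaceD(1)[OF A pq(1)] subspaceD(1)[OF B pq(2)] subspaceD(1)[OF B NB[OF x(1)]] V_carrier by blast+
    have "(p + q) - (p + N *v x) = q - N *v x"
      using V by (intro eq_vecI) (auto simp del: index_mult_mat_vec dim_mult_mat_vec)
    moreover have "(p + q) - (p + N *v x) \<in> C"
      using subspace_diff[OF C c MNC[OF x(1)]] by (simp only: pq(3) x(2))
    ultimately have "q - N *v x \<in> C \<inter> B"
      using subspace_diff[OF B pq(2) NB[OF x(1)]] by simp
    hence "q = N *v x" using le(3) diff_eq_0_vec[OF V(2,3)] by blast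
    thus ?thesis using x pq(3) by blast
  qed
  hence "C = {M *v x + N *v x | x. x \<in> V k}" using MNC by blast
  thus ?thesis using N NB by blast
qed

lemma graph_surj:
  assumes graph: "C = {M *v x + N *v x | x. x \<in> V k}" "\<And>x. x \<in> V k ==> M *v x \<in> A"
      "\<And>x. x \<in> V k ==> N *v x \<in> B"
    and A: "subspace_over F d A" and B: "subspace_over F d B"
    and le: "B \<subseteq> plus_sets C A" "A \<inter> B = {0\<^sub>v d}" and u: "u \<in> B"
  shows "\<exists>x\<in>V k. u = N *v x"
proof -
  obtain x p where x: "x \<in> V k" "p \<in> A" "u = (M *v x + N *v x) + p"
    using u le(1) unfolding graph(1) plus_sets_def by blast
  have V: "p \<in> carrier_vec d" "u \<in> carrier_vec d" "M *v x \<in> carrier_vec d" "N *v x \<in> carrier_vec d"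
    using subspaceD(1)[OF A x(2)] subspaceD(1)[OF B u] subspaceD(1)[OF A graph(2)[OF x(1)]]
      subspaceD(1)[OF B graph(3)[OF x(1)]] V_carrier by blast+
  have "u - N *v x = M *v x + p"
    unfolding x(3) using V by (intro eq_vecI) (auto simp del: index_mult_mat_vec dim_mult_mat_vec)
  hence "u - N *v x \<in> A \<inter> B"
    using subspaceD(3)[OF A graph(2)[OF x(1)] x(2)] subspace_diff[OF B u graph(3)[OF x(1)]] by simp
  hence "u = N *v x" using le(2) diff_eq_0_vec[OF V(2,4)] by blast
  thus ?thesis using x(1) by blast
qed

lemma graph_inj:
  assumes graph: "C = {M *v x + N *v x | x. x \<in> V k}" "\<And>x. x \<in> V k ==> M *v x \<in> A" "A \<subseteq> V d"
    and iso: "\<And>x. x \<in> V k ==> ip (M *v x) (M *v x) = ip x x"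
    and "C \<inter> A = {0\<^sub>v d}" and x: "x \<in> V k" "N *v x = 0\<^sub>v d"
  shows "x = 0\<^sub>v k"
proof -
  have V: "M *v x \<in> V d" using graph(2)[OF x(1)] graph(3) by blast
  have "M *v x + N *v x = M *v x" unfolding x(2) using V_carrier[OF V] by simp
  hence "M *v x \<in> C"
    unfolding graph(1) using x(1) by (metis (mono_tags, lifting) mem_Collect_eq)
  hence "M *v x \<in> C \<inter> A" using graph(2)[OF x(1)] by blast
  hence "ip x x = 0" using assms(5) iso[OF x(1)] ip_zero(1)[OF zero_carrier_vec] by auto
  thus ?thesis using ip_self_eq_0[OF V_carrier[OF x(1)]] by simp
qed

lemma ex_coordinates:
  assumes p: "pythagorean F" and d: "d \<ge> 1" and a: "\<forall>i. subspace_over F d (a i)"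
    and conds: "\<And>c. c \<in> set frame_conds ==> eval_term (L d) a c = V d"
  shows "\<exists>k b1 b2 b3. k \<ge> 1 \<and> orthonormal_coordinates F d k b1 b2 b3 \<and> coordinates.framed F d k b1 b2 b3 a"
proof -
  define e1 e2 u g where "e1 = a 0" and "e2 = a 2" and "u = a 4" and "g = a 6"
  define e3 where "e3 = perp d e1 \<inter> perp d e2"
  have s: "subspace_over F d e1" "subspace_over F d e2" "subspace_over F d u" "subspace_over F d g"
    using a by (simp_all add: e1_def e2_def u_def g_def)
  have sV: "e1 \<subseteq> V d" "e2 \<subseteq> V d" "u \<subseteq> V d" "g \<subseteq> V d"
    using s subspaceD(1) by blast+
  have s3: "subspace_over F d e3" unfolding e3_def by (intro subspace_inter subspace_perp sV)
  have leI: "eval_term (L d) a x \<subseteq> eval_term (L d) a y" if "le_term x y \<in> set frame_conds" for x y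
    using conds[OF that] eval_le_term[OF a] by blast
  have negI: "eval_term (L d) a x = {0\<^sub>v d}" if "Neg x \<in> set frame_conds" for x
    using conds[OF that] eval_Neg_V[OF a] by blast
  have fr: "e2 \<subseteq> perp d e1" "u \<subseteq> plus_sets e1 e2" "u \<inter> e1 = {0\<^sub>v d}" "u \<inter> e2 = {0\<^sub>v d}"
    "e1 \<subseteq> plus_sets u e2" "e2 \<subseteq> plus_sets u e1" "g \<subseteq> perp d e1" "g \<inter> e2 = {0\<^sub>v d}" "g \<inter> e3 = {0\<^sub>v d}"
    "e2 \<subseteq> plus_sets g e3" "e3 \<subseteq> plus_sets g e2"
    using leI[of tE2 "Neg tE1"] leI[of tU tE12] negI[of "Meet tU tE1"] negI[of "Meet tU tE2"]
      leI[of tE1 "Join tU tE2"] leI[of tE2 "Join tU tE1"] leI[of tG tE23] negI[of "Meet tG tE2"]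
      negI[of "Meet tG tE3"] leI[of tE2 "Join tG tE3"] leI[of tE3 "Join tG tE2"]
    unfolding e1_def e2_def e3_def u_def g_def
    by (simp_all only: frame_conds_def list.set insert_iff simp_thms frame_defs eval_term.simps L_simps)
  have e12: "e1 \<inter> e2 = {0\<^sub>v d}" and e23: "e2 \<inter> e3 = {0\<^sub>v d}"
    using inter_perp[OF sV(1)] inter_perp[OF sV(2)] fr(1) s s3 subspaceD(2) unfolding e3_def by blast+
  have u21: "u \<subseteq> plus_sets e2 e1"
  proof
    fix v assume "v \<in> u"
    then obtain x y where xy: "x \<in> e1" "y \<in> e2" "v = x + y"
      using fr(2) unfolding plus_sets_def by blast
    hence "v = y + x" using comm_add_vec[OF V_carrier V_carrier] sV by blast
    thus "v \<in> plus_sets e2 e1" using plus_setsI[OF xy(2,1)] by simp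
  qed
  have split2: "\<exists>x\<in>e2. \<exists>y\<in>e3. v = x + y" if v: "v \<in> perp d e1" for v
  proof -
    have vV: "v \<in> V d" using perp_D(2)[OF v] .
    obtain x y where xy: "x \<in> e2" "y \<in> perp d e2" "v = x + y"
      using orthogonal_decomposition[OF s(2) vV] by blast
    have V: "x \<in> V d" "y \<in> V d" using xy(1) sV(2) perp_D(2)[OF xy(2)] by blast+
    have "v - x = y" unfolding xy(3) using V_dim[OF V(1)] V_dim[OF V(2)] by (intro eq_vecI) auto
    moreover have "v - x \<in> perp d e1"
      using fr(1) xy(1) by (intro subspace_diff[OF subspace_perp[OF sV(1)] v]) blast
    ultimately have "y \<in> e3" using xy(2) by (simp add: e3_def)
    thus ?thesis using xy by blast
  qed
  have g23: "g \<subseteq> plus_sets e2 e3" using split2 fr(7) plus_setsI by blast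
  obtain k M where M: "Fmat d k M" "\<forall>x\<in>V k. M *v x \<in> e2" "\<forall>v\<in>e2. \<exists>x\<in>V k. v = M *v x"
      "\<forall>x\<in>V k. \<forall>y\<in>V k. ip (M *v x) (M *v y) = ip x y"
    using ex_isometry[OF p s(2)] by blast
  note M' = M(2)[rule_format] M(3)[rule_format] M(4)[rule_format]
  obtain N1 where N1: "Fmat d k N1" "\<forall>x\<in>V k. N1 *v x \<in> e1" "u = {M *v x + N1 *v x | x. x \<in> V k}"
    using graph_matrix[OF M(1) M'(1,2) s(2,1,3) u21 fr(6,3)] by blast
  obtain N3 where N3: "Fmat d k N3" "\<forall>x\<in>V k. N3 *v x \<in> e3" "g = {M *v x + N3 *v x | x. x \<in> V k}"
    using graph_matrix[OF M(1) M'(1,2) s(2) s3 s(4) g23 fr(10,9)] by blast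
  note N1' = N1(2)[rule_format] and N3' = N3(2)[rule_format]
  have surj1: "\<exists>x\<in>V k. v = N1 *v x" if "v \<in> e1" for v
    using graph_surj[OF N1(3) M'(1) N1' s(2,1) fr(5) _ that] e12 by blast
  have surj3: "\<exists>x\<in>V k. v = N3 *v x" if "v \<in> e3" for v
    by (rule graph_surj[OF N3(3) M'(1) N3' s(2) s3 fr(11) e23 that])
  have inj1: "x = 0\<^sub>v k" if "x \<in> V k" "N1 *v x = 0\<^sub>v d" for x
    by (rule graph_inj[OF N1(3) M'(1) sV(2) M'(3) fr(4) that]) assumption
  have inj3: "x = 0\<^sub>v k" if "x \<in> V k" "N3 *v x = 0\<^sub>v d" for x
    by (rule graph_inj[OF N3(3) M'(1) sV(2) M'(3) fr(8) that]) assumption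
  define H where "H = mat_adjoint N3 * N3"
  interpret co: coordinates F d k "(*v) N1" "(*v) M" "(*v) N3" H
  proof unfold_locales
    show "Fmat k k H" unfolding H_def by (rule Fmat_mult[OF Fmat_adjoint[OF N3(1)] N3(1)])
    show "ip (N3 *v x) (N3 *v y) = ip x (H *v y)" if "x \<in> V k" "y \<in> V k" for x y
      unfolding ip_adjoint[OF Fmat_carrier[OF N3(1)] V_carrier[OF that(1)] V_carrier[OF mult_vec_V[OF N3(1) that(2)]]]
        H_def assoc_mult_mat_vec[OF Fmat_carrier[OF Fmat_adjoint[OF N3(1)]] Fmat_carrier[OF N3(1)] V_carrier[OF that(2)]] ..
    show "\<exists>x\<in>V k. \<exists>y\<in>V k. \<exists>z\<in>V k. v = N1 *v x + M *v y + N3 *v z" if v: "v \<in> V d" for v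
    proof -
      obtain v1 w where w: "v1 \<in> e1" "w \<in> perp d e1" "v = v1 + w"
        using orthogonal_decomposition[OF s(1) v] by blast
      obtain v2 v3 where v23: "v2 \<in> e2" "v3 \<in> e3" "w = v2 + v3"
        using split2[OF w(2)] by blast
      have "v = v1 + v2 + v3"
        unfolding w(3) v23(3) using assoc_add_vec[of v1 d v2 v3] w(1) v23(1,2) sV subspaceD(1)[OF s3]
          V_carrier by (metis subsetD)
      thus ?thesis using surj1[OF w(1)] M'(2)[OF v23(1)] surj3[OF v23(2)] by blast
    qed
    show "N1 *v (c *s x) = c *s (N1 *v x)" "M *v (c *s x) = c *s (M *v x)"
      "N3 *v (c *s x) = c *s (N3 *v x)" if "x \<in> V k" for c x
      by (rule mult_mat_vec[OF Fmat_carrier[OF N1(1)] V_carrier[OF that]]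
          mult_mat_vec[OF Fmat_carrier[OF M(1)] V_carrier[OF that]]
          mult_mat_vec[OF Fmat_carrier[OF N3(1)] V_carrier[OF that]])+
    fix x y assume xy: "x \<in> V k" "y \<in> V k"
    show "ip (N1 *v x) (M *v y) = 0"
      by (rule perp_D(1)[OF subsetD[OF fr(1) M'(1)[OF xy(2)]] N1'[OF xy(1)]])
    show "ip (N1 *v x) (N3 *v y) = 0"
      by (rule perp_D(1)[OF IntD1[OF N3'[OF xy(2), unfolded e3_def]] N1'[OF xy(1)]])
    show "ip (M *v x) (N3 *v y) = 0"
      by (rule perp_D(1)[OF IntD2[OF N3'[OF xy(2), unfolded e3_def]] M'(1)[OF xy(1)]])
  qed (fact inj1 inj3 M'(3) mult_vec_V[OF N1(1)] mult_vec_V[OF M(1)] mult_vec_V[OF N3(1)]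
      mult_add_distrib_mat_vec[OF Fmat_carrier[OF N1(1)] V_carrier V_carrier]
      mult_add_distrib_mat_vec[OF Fmat_carrier[OF M(1)] V_carrier V_carrier]
      mult_add_distrib_mat_vec[OF Fmat_carrier[OF N3(1)] V_carrier V_carrier])+
  note z = co.b_zero
  have r0: "w + 0\<^sub>v d = w" "0\<^sub>v d + w = w" if "w \<in> V d" for w
    using V_carrier[OF that] by simp_all
  have T1: "co.T x (0\<^sub>v k) (0\<^sub>v k) = N1 *v x" "co.T (0\<^sub>v k) x (0\<^sub>v k) = M *v x"
    "co.T x x (0\<^sub>v k) = M *v x + N1 *v x" "co.T (0\<^sub>v k) x x = M *v x + N3 *v x" if "x \<in> V k" for x
  proof -
    note V = mult_vec_V[OF N1(1) that] mult_vec_V[OF M(1) that] mult_vec_V[OF N3(1) that]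
    show "co.T x (0\<^sub>v k) (0\<^sub>v k) = N1 *v x" "co.T (0\<^sub>v k) x (0\<^sub>v k) = M *v x"
      "co.T (0\<^sub>v k) x x = M *v x + N3 *v x"
      unfolding co.T_def z r0[OF V(1)] r0[OF V(2)] r0[OF V_zero] by (rule refl)+
    have "co.T x x (0\<^sub>v k) = N1 *v x + M *v x"
      unfolding co.T_def z by (rule r0(1)[OF V_add[OF V(1,2)]])
    also have "... = M *v x + N1 *v x"
      by (rule comm_add_vec[OF V_carrier[OF V(1)] V_carrier[OF V(2)]])
    finally show "co.T x x (0\<^sub>v k) = M *v x + N1 *v x" .
  qed
  have one: "1\<^sub>m k *v x = x" "- ((- 1\<^sub>m k) *v x) = x" if "x \<in> V k" for x
    using mult_mat_vec_uminus(2)[of "1\<^sub>m k" k k x] V_carrier[OF that] by simp_all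
  have "co.framed a" unfolding co.framed_def
  proof (intro conjI)
    have "e1 = (\<lambda>x. N1 *v x) ` V k" using surj1 N1' by blast
    also have "... = (\<lambda>x. co.T x (0\<^sub>v k) (0\<^sub>v k)) ` V k"
      by (rule image_cong[OF refl T1(1)[symmetric]])
    finally show "a 0 = co.s1" unfolding e1_def co.s1_def Setcompr_eq_image .
    have "e2 = (\<lambda>x. M *v x) ` V k" using M'(1,2) by blast
    also have "... = (\<lambda>x. co.T (0\<^sub>v k) x (0\<^sub>v k)) ` V k"
      by (rule image_cong[OF refl T1(2)[symmetric]])
    finally show "a 2 = co.s2" unfolding e2_def co.s2_def Setcompr_eq_image .
    show "a 4 = co.gr12 (1\<^sub>m k)"
      unfolding u_def[symmetric] co.gr12_def N1(3) Setcompr_eq_image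
      by (rule image_cong[OF refl]) (simp only: T1(3) one(1))
    show "a 6 = co.gr23 (- 1\<^sub>m k)"
      unfolding g_def[symmetric] co.gr23_def N3(3) Setcompr_eq_image
      by (rule image_cong[OF refl]) (simp only: T1(4) one(2))
  qed (rule a)
  have "H = 1\<^sub>m k"
    by (rule co.gram_cond[OF `co.framed a`], rule leI) (simp add: frame_conds_def)
  hence "orthonormal_coordinates F d k ((*v) N1) ((*v) M) ((*v) N3)"
    unfolding orthonormal_coordinates_def using co.coordinates_axioms by simp
  moreover have "k \<ge> 1"
  proof (rule ccontr)
    assume "\<not> k \<ge> 1"
    hence x0: "x = 0\<^sub>v k" if "x \<in> V k" for x using V_dim[OF that] by (intro eq_vecI) auto
    obtain x y w where xyw: "x \<in> V k" "y \<in> V k" "w \<in> V k" "unit_vec d 0 = N1 *v x + M *v y + N3 *v w"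
      using co.span[OF unit_vec_V[of d 0]] by blast
    have "unit_vec d 0 = (0\<^sub>v d :: complex vec)"
      using xyw(4) unfolding x0[OF xyw(1)] x0[OF xyw(2)] x0[OF xyw(3)] z r0[OF V_zero] .
    thus False using d by (auto dest!: arg_cong[of _ _ "\<lambda>w. w $ 0"])
  qed
  ultimately show ?thesis using `co.framed a` by blast
qed

end

lemma poly_vars_subset:
  assumes "p \<in> set ps"
  shows "\<forall>m\<in>set p. fst ` set (snd m) \<subseteq> set (poly_vars ps)"
proof
  fix m assume "m \<in> set p"
  hence "set (map fst (snd m)) \<subseteq> set (concat (map (\<lambda>(c, w). map fst w) p))"
    by (induction p) (auto simp: case_prod_beta)
  also have "... \<subseteq> set (poly_vars ps)"
    using assms unfolding poly_vars_def by (induction ps) auto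
  finally show "fst ` set (snd m) \<subseteq> set (poly_vars ps)" by simp
qed

context coordinates
begin

lemma T_000: "T z0 z0 z0 = 0\<^sub>v d" by (simp add: T_def b_zero)

lemma add_uminus_V: "x \<in> V k ==> x + - x = z0" using uminus_r_inv_vec[OF V_carrier] .

lemma neg_V: "x \<in> V k ==> - x \<in> V k" by (rule V_uminus)

end

context orthonormal_coordinates
begin

lemma gr32_neg_one: "gr32 (- 1\<^sub>m k) = gr23 (1\<^sub>m k)"
proof safe
  have one: "1\<^sub>m k *v x = x" "(- 1\<^sub>m k) *v x = - x" if "x \<in> V k" for x
    using mult_mat_vec_uminus(2)[of "1\<^sub>m k" k k x] V_carrier[OF that] by simp_all
  fix v
  {
    assume "v \<in> gr32 (- 1\<^sub>m k)"
    then obtain z where z: "z \<in> V k" "v = T z0 ((- 1\<^sub>m k) *v z) z"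
      unfolding gr32_def by blast
    show "v \<in> gr23 (1\<^sub>m k)" by (rule gr23_I[OF neg_V[OF z(1)]])
         (simp only: z(2) one[OF z(1)] one[OF neg_V[OF z(1)]] vec_V_simps(4)[OF z(1,1)])
  next
    assume "v \<in> gr23 (1\<^sub>m k)"
    then obtain y where y: "y \<in> V k" "v = T z0 y (- (1\<^sub>m k *v y))"
      unfolding gr23_def by blast
    show "v \<in> gr32 (- 1\<^sub>m k)" by (rule gr32_I[OF neg_V[OF y(1)]])
         (simp only: y(2) one[OF y(1)] one[OF neg_V[OF y(1)]] vec_V_simps(4)[OF y(1,1)])
  }
qed

lemma frame_conds_hold:
  assumes a: "framed a" and c: "c \<in> set frame_conds"
  shows "E a c = V d"
proof -
  note fe = frame_eval[OF a]
  have one: "1\<^sub>m k *v x = x" "(- 1\<^sub>m k) *v x = - x" if "x \<in> V k" for x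
    using mult_mat_vec_uminus(2)[of "1\<^sub>m k" k k x] V_carrier[OF that] by simp_all
  have gU: "gr12 (1\<^sub>m k) = {T x x z0 | x. x \<in> V k}"
    unfolding gr12_def Setcompr_eq_image by (rule image_cong[OF refl]) (simp only: one)
  have gG: "gr23 (- 1\<^sub>m k) = {T z0 x x | x. x \<in> V k}"
    unfolding gr23_def Setcompr_eq_image by (rule image_cong[OF refl]) (simp only: one vec_V_simps(4))
  have 1: "s2 \<subseteq> s23" unfolding s2_def s23_def using V_zero by blast
  have 2: "gr12 (1\<^sub>m k) \<subseteq> s12" "gr23 (- 1\<^sub>m k) \<subseteq> s23"
    unfolding gU gG s12_def s23_def by blast+
  have mem: "T x x z0 \<in> gr12 (1\<^sub>m k)" "T z0 x x \<in> gr23 (- 1\<^sub>m k)" "T x z0 z0 \<in> s1" "T z0 x z0 \<in> s2" "T z0 z0 x \<in> s3"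
    if "x \<in> V k" for x using that unfolding gU gG s1_def s2_def s3_def by blast+
  have zero: "0\<^sub>v d \<in> gr12 (1\<^sub>m k)" "0\<^sub>v d \<in> gr23 (- 1\<^sub>m k)" "0\<^sub>v d \<in> s1" "0\<^sub>v d \<in> s2" "0\<^sub>v d \<in> s3"
    using mem[OF V_zero] unfolding T_000 by blast+
  have triv: "T x x z0 \<in> s1 ==> x = z0" "T x x z0 \<in> s2 ==> x = z0" "T z0 x x \<in> s2 ==> x = z0" "T z0 x x \<in> s3 ==> x = z0"
    if "x \<in> V k" for x
    using in_s1[OF that that V_zero] in_s2[OF that that V_zero] in_s2[OF V_zero that that] in_s3[OF V_zero that that]
    by blast+
  have 3: "gr12 (1\<^sub>m k) \<inter> s1 = {0\<^sub>v d}" "gr12 (1\<^sub>m k) \<inter> s2 = {0\<^sub>v d}"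
    "gr23 (- 1\<^sub>m k) \<inter> s2 = {0\<^sub>v d}" "gr23 (- 1\<^sub>m k) \<inter> s3 = {0\<^sub>v d}"
  proof -
    have U: "v = 0\<^sub>v d" if v: "v \<in> gr12 (1\<^sub>m k)" "v \<in> s1 \<or> v \<in> s2" for v
    proof -
      obtain x where x: "x \<in> V k" "v = T x x z0" using v(1) unfolding gU by blast
      have "x = z0" using v(2) triv(1,2)[OF x(1)] unfolding x(2) by blast
      thus ?thesis using x(2) T_000 by simp
    qed
    have G: "v = 0\<^sub>v d" if v: "v \<in> gr23 (- 1\<^sub>m k)" "v \<in> s2 \<or> v \<in> s3" for v
    proof -
      obtain x where x: "x \<in> V k" "v = T z0 x x" using v(1) unfolding gG by blast
      have "x = z0" using v(2) triv(3,4)[OF x(1)] unfolding x(2) by blast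
      thus ?thesis using x(2) T_000 by simp
    qed
    show "gr12 (1\<^sub>m k) \<inter> s1 = {0\<^sub>v d}" "gr12 (1\<^sub>m k) \<inter> s2 = {0\<^sub>v d}"
      "gr23 (- 1\<^sub>m k) \<inter> s2 = {0\<^sub>v d}" "gr23 (- 1\<^sub>m k) \<inter> s3 = {0\<^sub>v d}"
      using U G zero by blast+
  qed
  have 4: "s1 \<subseteq> plus_sets (gr12 (1\<^sub>m k)) s2" "s2 \<subseteq> plus_sets (gr12 (1\<^sub>m k)) s1"
    "s2 \<subseteq> plus_sets (gr23 (- 1\<^sub>m k)) s3" "s3 \<subseteq> plus_sets (gr23 (- 1\<^sub>m k)) s2"
  proof -
    have "T x z0 z0 \<in> plus_sets (gr12 (1\<^sub>m k)) s2 \<and> T z0 x z0 \<in> plus_sets (gr12 (1\<^sub>m k)) s1 \<and>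
        T z0 x z0 \<in> plus_sets (gr23 (- 1\<^sub>m k)) s3 \<and> T z0 z0 x \<in> plus_sets (gr23 (- 1\<^sub>m k)) s2"
      if x: "x \<in> V k" for x
    proof -
      note n = neg_V[OF x] and z = V_zero[of k]
      note m = mem(1,2)[OF x] mem(3-5)[OF n]
      show ?thesis
        using plus_setsI[OF m(1,4)] plus_setsI[OF m(1,3)] plus_setsI[OF m(2,5)] plus_setsI[OF m(2,4)]
        unfolding T_add[OF x x z z n z] T_add[OF x x z n z z] T_add[OF z x x z z n] T_add[OF z x x z n z]
          add_uminus_V[OF x] vec_V_simps(1)[OF z z] vec_V_simps(2)[OF x x] by blast
    qed
    thus "s1 \<subseteq> plus_sets (gr12 (1\<^sub>m k)) s2" "s2 \<subseteq> plus_sets (gr12 (1\<^sub>m k)) s1"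
      "s2 \<subseteq> plus_sets (gr23 (- 1\<^sub>m k)) s3" "s3 \<subseteq> plus_sets (gr23 (- 1\<^sub>m k)) s2"
      unfolding s1_def s2_def s3_def by blast+
  qed
  have "s12 \<inter> plus_sets (gr23 (- 1\<^sub>m k)) (s13 \<inter> plus_sets (gr32 (- 1\<^sub>m k)) (gr12 (1\<^sub>m k))) = gr12 (- 1\<^sub>m k)"
    using step_13[OF Fmat_one Fmat_one] step_12[OF Fmat_one Fmat_one] by (simp add: gr32_neg_one gr32_one)
  moreover have "E a (op_term tG tU) = gr12 (- 1\<^sub>m k)" by (rule eval_neg[OF a Fmat_one fe(7)])
  ultimately have 5: "E a (Meet tE12 (Join tG (Meet tE13 (Join tD tU)))) \<subseteq> E a (op_term tG tU)"
    by (simp add: fe)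
  have le: "E a (le_term x y) = V d" if "E a x \<subseteq> E a y" for x y
    using that eval_le_term[OF framedD[OF a]] by blast
  have neg: "E a (Neg x) = V d" if "E a x = {0\<^sub>v d}" for x
    using that eval_Neg_V[OF framedD[OF a]] by blast
  have "\<forall>c\<in>set frame_conds. E a c = V d" unfolding frame_conds_def list.set ball_simps
    by (intro conjI le neg 5; simp only: eval_term.simps L_simps fe perp_s 1 2 3 4 plus_s12 inter_s)
  thus ?thesis using c by blast
qed

lemma letter_conds_iff:
  assumes a: "framed a"
  shows "(\<forall>c\<in>set letter_conds. E a c = V d) \<longleftrightarrow> (\<exists>X. Fmat k k X \<and> a 1 = gr23 X)"
proof -
  note fe = frame_eval[OF a]
  have conds: "(\<forall>c\<in>set letter_conds. E a c = V d) \<longleftrightarrow>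
      s3 \<inter> a 1 = {0\<^sub>v d} \<and> a 1 \<subseteq> s23 \<and> s2 \<subseteq> plus_sets (a 1) s3"
  proof -
    have "(\<forall>c\<in>set letter_conds. E a c = V d) \<longleftrightarrow>
        E a (Meet tE3 (Var 1)) = {0\<^sub>v d} \<and> E a (Var 1) \<subseteq> E a tE23 \<and> E a tE2 \<subseteq> E a (Join (Var 1) tE3)"
      unfolding letter_conds_def list.set ball_simps eval_le_term[OF framedD[OF a]] eval_Neg_V[OF framedD[OF a]]
      by simp
    thus ?thesis unfolding eval_term.simps L_simps fe .
  qed
  have a1: "subspace_over F d (a 1)" using framedD[OF a] by blast
  show ?thesis unfolding conds
  proof
    assume h: "s3 \<inter> a 1 = {0\<^sub>v d} \<and> a 1 \<subseteq> s23 \<and> s2 \<subseteq> plus_sets (a 1) s3"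
    have "\<exists>x\<in>V k. T z0 (unit_vec k j) (- x) \<in> a 1" if "j < k" for j
    proof -
      have "T z0 (unit_vec k j) z0 \<in> plus_sets (a 1) s3"
        using h unit_vec_V[of k j] unfolding s2_def by blast
      then obtain v z where vz: "v \<in> a 1" "z \<in> V k" "T z0 (unit_vec k j) z0 = v + T z0 z0 z"
        unfolding plus_sets_def s3_def by blast
      have "v \<in> s23" using h vz(1) by blast
      then obtain y w where yw: "y \<in> V k" "w \<in> V k" "v = T z0 y w"
        unfolding s23_def by blast
      have "T z0 (unit_vec k j) z0 = T z0 y (w + z)" using vz yw by (simp add: T_add vec_V_simps)
      hence "unit_vec k j = y" "z0 = w + z"
        using T_eq_iff[OF V_zero unit_vec_V V_zero V_zero yw(1) V_add[OF yw(2) vz(2)]] by blast+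
      moreover from this(2) have "w = - z" using vec_V_simps(3)[OF yw(2) vz(2)] by simp
      ultimately show ?thesis using vz(1,2) unfolding yw(3) by blast
    qed
    then obtain x where x: "\<And>j. j < k ==> x j \<in> V k" "\<And>j. j < k ==> T z0 (unit_vec k j) (- x j) \<in> a 1"
      by metis
    define X where "X = cols_mat k k x"
    have X: "Fmat k k X" unfolding X_def by (rule Fmat_cols_mat[OF x(1)])
    have Xv: "X *v y = comb k k (\<lambda>j. y $ j) x" if "y \<in> V k" for y
      unfolding X_def by (rule cols_mat_mult[OF V_carrier[OF that]])
    have partial: "T z0 (comb k n c (unit_vec k)) (- comb k n c x) \<in> a 1"
      if "n \<le> k" "\<And>i. i < n ==> c i \<in> F" for n c using that
    proof (induction n)
      case 0
      have "comb k 0 c b = z0" for b by (auto simp: comb_def)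
      thus ?case using T_000 subspaceD(2)[OF a1] vec_V_simps(10)[OF V_zero V_zero] by simp
    next
      case (Suc n)
      have u: "comb k n c (unit_vec k) \<in> V k" "comb k n c x \<in> V k" "c n \<in> F" "n < k"
        using Suc.prems x(1) unit_vec_V by (auto intro!: comb_in[OF subspace_V])
      have cu: "c n *s unit_vec k n \<in> V k" "c n *s x n \<in> V k"
        using V_smult[OF u(3)] unit_vec_V x(1)[OF u(4)] by blast+
      have "T z0 (comb k (Suc n) c (unit_vec k)) (- comb k (Suc n) c x) =
          T z0 (comb k n c (unit_vec k)) (- comb k n c x) + c n *s T z0 (unit_vec k n) (- x n)"
        using u cu x(1)[OF u(4)] unit_vec_V[of k n] V_carrier[OF x(1)[OF u(4)]]
        by (simp add: comb_Suc T_add T_smult vec_V_simps)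
      moreover have "T z0 (comb k n c (unit_vec k)) (- comb k n c x) \<in> a 1" using Suc by simp
      ultimately show ?case
        using subspaceD(3)[OF a1 _ subspaceD(4)[OF a1 u(3) x(2)[OF u(4)]]] by simp
    qed
    have sub: "T z0 y (- (X *v y)) \<in> a 1" if y: "y \<in> V k" for y
      using partial[where c = "\<lambda>i. y $ i", OF order_refl V_index[OF y]] unfolding Xv[OF y] comb_unit[OF V_carrier[OF y]] .
    have "v \<in> gr23 X" if v: "v \<in> a 1" for v
    proof -
      have "v \<in> s23" using h v by blast
      then obtain y w where yw: "y \<in> V k" "w \<in> V k" "v = T z0 y w"
        unfolding s23_def by blast
      have m: "X *v y \<in> V k" by (rule mult_V[OF X yw(1)])
      have "v - T z0 y (- (X *v y)) = v + (- 1) *s T z0 y (- (X *v y))"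
        by (rule minus_smult_vec[OF V_carrier V_carrier])
          (use subspaceD(1)[OF a1 v] subspaceD(1)[OF a1 sub[OF yw(1)]] in simp_all)
      also have "... = T z0 y w + T z0 (- y) (X *v y)"
      proof -
        have "(- 1) *s z0 = z0" "(- 1) *s y = - y" "(- 1) *s (- (X *v y)) = X *v y"
          using V_dim[OF yw(1)] V_dim[OF m]
          by (auto intro!: eq_vecI simp del: index_mult_mat_vec dim_mult_mat_vec)
        thus ?thesis
          using T_smult[OF F_uminus[OF F_1] V_zero yw(1) neg_V[OF m]] by (simp only: yw(3))
      qed
      also have "... = T z0 z0 (w + X *v y)"
        by (simp only: T_add[OF V_zero yw(1,2) V_zero neg_V[OF yw(1)] m] add_uminus_V[OF yw(1)]
            vec_V_simps(1)[OF V_zero V_zero])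
      finally have "T z0 z0 (w + X *v y) \<in> a 1"
        using subspace_diff[OF a1 v sub[OF yw(1)]] by simp
      hence "T z0 z0 (w + X *v y) \<in> s3 \<inter> a 1"
        unfolding s3_def using V_add[OF yw(2) m] by blast
      hence "w + X *v y = z0" using h T_zero[OF V_zero V_zero V_add[OF yw(2) m]] by blast
      hence "w = - (X *v y)" using vec_V_simps(3)[OF yw(2) m] by simp
      thus ?thesis using gr23_I[OF yw(1)] yw(3) by simp
    qed
    hence "a 1 = gr23 X" using sub unfolding gr23_def by blast
    thus "\<exists>X. Fmat k k X \<and> a 1 = gr23 X" using X by blast
  next
    assume "\<exists>X. Fmat k k X \<and> a 1 = gr23 X"
    then obtain X where X: "Fmat k k X" "a 1 = gr23 X" by blast
    have XV: "X *v y \<in> V k" if "y \<in> V k" for y by (rule mult_V[OF X(1) that])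
    have "v = 0\<^sub>v d" if v: "v \<in> s3" "v \<in> gr23 X" for v
    proof -
      obtain y where y: "y \<in> V k" "v = T z0 y (- (X *v y))"
        using v(2) unfolding gr23_def by blast
      hence "y = z0" using v(1) in_s3[OF V_zero y(1) neg_V[OF XV[OF y(1)]]] by simp
      moreover have "X *v z0 = z0" using Fmat_carrier[OF X(1)] by (intro eq_vecI) auto
      ultimately show ?thesis using y(2) T_000 by simp
    qed
    moreover have "0\<^sub>v d \<in> s3" "0\<^sub>v d \<in> gr23 X"
      using in_s3[OF V_zero V_zero V_zero] T_000 subspaceD(2)[OF a1] X(2) by simp_all
    ultimately have 1: "s3 \<inter> gr23 X = {0\<^sub>v d}" by blast
    have 2: "gr23 X \<subseteq> s23" unfolding gr23_def s23_def using neg_V[OF XV] by blast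
    have "T z0 y z0 = T z0 y (- (X *v y)) + T z0 z0 (X *v y)" if "y \<in> V k" for y
      using that XV[OF that] neg_V[OF XV[OF that]] by (simp add: T_add vec_V_simps)
    hence 3: "s2 \<subseteq> plus_sets (gr23 X) s3"
      unfolding s2_def s3_def gr23_def plus_sets_def using XV by blast
    show "s3 \<inter> a 1 = {0\<^sub>v d} \<and> a 1 \<subseteq> s23 \<and> s2 \<subseteq> plus_sets (a 1) s3"
      unfolding X(2) using 1 2 3 by blast
  qed
qed

lemma framed_inst:
  assumes "framed a"
  shows "framed (\<lambda>m. a (inst_pair (i, j) m))"
  using assms by (simp add: framed_def inst_pair_def)

lemma frame_formula_iff:
  assumes a: "framed a"
  shows "E a (frame_formula (letter_conds @ cs) ps) = V d \<longleftrightarrow>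
     (\<exists>X. letter_graphs a X (set (poly_vars ps)) \<and> (\<forall>p\<in>set ps. eval_poly (R k) X p = 0\<^sub>m k k)) \<and>
     (\<forall>i\<in>set (poly_vars ps). \<forall>j\<in>set (poly_vars ps). \<forall>c\<in>set cs. E (\<lambda>m. a (inst_pair (i, j) m)) c = V d)"
proof -
  let ?I = "set (poly_vars ps)"
  have vars: "\<forall>m\<in>set p. fst ` set (snd m) \<subseteq> ?I" if "p \<in> set ps" for p
    using that by (rule poly_vars_subset)
  have letter: "(\<forall>c\<in>set letter_conds. E (\<lambda>m. a (inst_pair (i, j) m)) c = V d) \<longleftrightarrow>
      (\<exists>X. Fmat k k X \<and> a (2 * i + 1) = gr23 X)" for i j
  proof -
    have "inst_pair (i, j) 1 = 2 * i + 1" by (simp add: inst_pair_def)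
    thus ?thesis using letter_conds_iff[OF framed_inst[OF a], of i j] by (simp only:)
  qed
  have letters: "(\<forall>i\<in>?I. \<exists>X. Fmat k k X \<and> a (2 * i + 1) = gr23 X) \<longleftrightarrow> (\<exists>X. letter_graphs a X ?I)"
  proof
    assume "\<forall>i\<in>?I. \<exists>X. Fmat k k X \<and> a (2 * i + 1) = gr23 X"
    then obtain X where X: "\<forall>i\<in>?I. Fmat k k (X i) \<and> a (2 * i + 1) = gr23 (X i)"
      unfolding bchoice_iff by blast
    have "letter_graphs a (\<lambda>i. if i \<in> ?I then X i else 1\<^sub>m k) ?I"
      unfolding letter_graphs_def
    proof (intro conjI allI ballI)
      show "Fmat k k (if i \<in> ?I then X i else 1\<^sub>m k)" for i
        using X Fmat_one by (cases "i \<in> ?I") simp_all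
      show "a (2 * i + 1) = gr23 (if i \<in> ?I then X i else 1\<^sub>m k)" if "i \<in> ?I" for i
        using X that by (simp only: if_True)
    qed
    thus "\<exists>X. letter_graphs a X ?I" by blast
  next
    assume "\<exists>X. letter_graphs a X ?I"
    thus "\<forall>i\<in>?I. \<exists>X. Fmat k k X \<and> a (2 * i + 1) = gr23 X"
      unfolding letter_graphs_def by blast
  qed
  define C where "C i j cs \<longleftrightarrow> (\<forall>c\<in>set cs. E (\<lambda>m. a (inst_pair (i, j) m)) c = V d)" for i j cs
  define P where "P \<longleftrightarrow> (\<forall>p\<in>set ps. E a (poly_cond p) = V d)"
  have inst: "(\<forall>c\<in>set (map (rename (inst_pair (i, j))) cs). E a c = V d) \<longleftrightarrow> C i j cs" for i j cs
    unfolding C_def by (simp add: eval_rename del: L_simps)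
  have all: "(\<forall>c\<in>set (concat (map (\<lambda>p. map (rename (inst_pair p)) cs) (pairs xs))). E a c = V d) \<longleftrightarrow>
      (\<forall>i\<in>set xs. \<forall>j\<in>set xs. C i j cs)" for cs xs
    unfolding inst[symmetric] by (fastforce simp del: L_simps eval_rename)
  have one: "E a One = V d" by simp
  have "E a (frame_formula (letter_conds @ cs) ps) = V d \<longleftrightarrow>
      (\<forall>c\<in>set frame_conds. E a c = V d) \<and> (\<forall>i\<in>?I. \<forall>j\<in>?I. C i j (letter_conds @ cs)) \<and> P"
    unfolding frame_formula_def eval_meets[OF framedD[OF a]] set_append ball_Un all P_def
    using one by simp
  also have "... \<longleftrightarrow> (\<forall>i\<in>?I. \<forall>j\<in>?I. C i j letter_conds \<and> C i j cs) \<and> P"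
    using frame_conds_hold[OF a] unfolding C_def set_append ball_Un by blast
  also have "... \<longleftrightarrow> (\<forall>i\<in>?I. \<forall>j\<in>?I. C i j letter_conds) \<and> (\<forall>i\<in>?I. \<forall>j\<in>?I. C i j cs) \<and> P"
    by blast
  also have "(\<forall>i\<in>?I. \<forall>j\<in>?I. C i j letter_conds) \<longleftrightarrow> (\<exists>X. letter_graphs a X ?I)"
    unfolding C_def letter letters[symmetric] by blast
  finally have "E a (frame_formula (letter_conds @ cs) ps) = V d \<longleftrightarrow>
      (\<exists>X. letter_graphs a X ?I \<and> P) \<and> (\<forall>i\<in>?I. \<forall>j\<in>?I. C i j cs)"
    by blast
  moreover have "P \<longleftrightarrow> (\<forall>p\<in>set ps. eval_poly (R k) X p = 0\<^sub>m k k)" if "letter_graphs a X ?I" for X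
    unfolding P_def using eval_poly_cond[OF a that vars] by (intro ball_cong refl)
  ultimately show ?thesis unfolding C_def by blast
qed

lemma ex_framed:
  assumes "\<forall>i. Fmat k k (X i)"
  shows "\<exists>a. framed a \<and> letter_graphs a X UNIV"
proof -
  define a where "a i = (if odd i then gr23 (X (i div 2)) else if i = 0 then s1 else if i = 2 then s2
     else if i = 4 then gr12 (1\<^sub>m k) else gr23 (- 1\<^sub>m k))" for i
  have "\<forall>i. subspace_over F d (a i)"
    unfolding a_def using subspace_gr(1)[OF Fmat_one] subspace_gr(3)[OF Fmat_uminus[OF Fmat_one]]
      subspace_gr(3)[OF assms[rule_format]] subspace_s12(1,2) by presburger
  moreover have "a 0 = s1" "a 2 = s2" "a 4 = gr12 (1\<^sub>m k)" "a 6 = gr23 (- 1\<^sub>m k)"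
    by (simp_all add: a_def)
  ultimately have "framed a" unfolding framed_def by blast
  moreover have "letter_graphs a X UNIV" using assms by (simp add: letter_graphs_def a_def)
  ultimately show ?thesis by blast
qed

end

definition block :: "nat => nat => complex vec => complex vec" where
  "block k q x = vec (3 * k) (\<lambda>r. if q * k \<le> r \<and> r < q * k + k then x $ (r - q * k) else 0)"

lemma dim_block [simp]: "dim_vec (block k q x) = 3 * k" by (simp add: block_def)

lemma block_less: "q < 3 ==> i < k ==> q * k + i < 3 * (k :: nat)"
  using mult_le_mono1[of q 2 k] by linarith

lemma sum_three: "(\<Sum>i<3 * (k :: nat). f i) = (\<Sum>i<k. f i) + (\<Sum>i<k. f (k + i)) + (\<Sum>i<k. f (2 * k + i) :: complex)"
proof -
  have add: "(\<Sum>i<m + n. g i) = (\<Sum>i<m. g i) + (\<Sum>i<n. g (m + i))" for m n and g :: "nat => complex"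
    by (induction n) (simp_all add: add.assoc)
  have "3 * k = 2 * k + k" "2 * k = k + k" for k :: nat by simp_all
  thus ?thesis using add[where g = f] by metis
qed

lemma block_index: "p < 3 ==> q < 3 ==> i < k ==> block k q x $ (p * k + i) = (if p = q then x $ i else 0)"
proof -
  assume "p < 3" "q < 3" and i: "i < k"
  hence "p \<in> {0, 1, 2}" "q \<in> {0, 1, 2}" by auto
  thus ?thesis using i by (auto simp: block_def)
qed

lemma vec3_eqI:
  assumes "dim_vec u = 3 * k" "dim_vec v = 3 * k" "\<And>p i. p < 3 ==> i < k ==> u $ (p * k + i) = v $ (p * k + i)"
  shows "u = v"
proof (rule eq_vecI)
  fix r assume "r < dim_vec v"
  hence r: "r < 3 * k" and k: "k > 0" using assms(2) by auto
  hence "r div k < 3" "r mod k < k" by (simp_all add: less_mult_imp_div_less)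
  from assms(3)[OF this] show "u $ r = v $ r" by simp
qed (use assms in simp)

context star_field
begin

lemma ip_block:
  assumes "p < 3" "q < 3" "dim_vec x = k" "dim_vec y = k"
  shows "ip (block k p x) (block k q y) = (if p = q then ip x y else 0)"
proof -
  have "ip (block k p x) (block k q y) = (\<Sum>i<3 * k. cnj (block k p x $ i) * block k q y $ i)"
    by (rule ip_sum) simp_all
  also have "... = (\<Sum>i<k. cnj (block k p x $ (0 * k + i)) * block k q y $ (0 * k + i)) +
      (\<Sum>i<k. cnj (block k p x $ (1 * k + i)) * block k q y $ (1 * k + i)) +
      (\<Sum>i<k. cnj (block k p x $ (2 * k + i)) * block k q y $ (2 * k + i))"
    by (simp add: sum_three)
  also have "... = (\<Sum>i<k. if p = 0 \<and> q = 0 then cnj (x $ i) * y $ i else 0) +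
      (\<Sum>i<k. if p = 1 \<and> q = 1 then cnj (x $ i) * y $ i else 0) +
      (\<Sum>i<k. if p = 2 \<and> q = 2 then cnj (x $ i) * y $ i else 0)"
    by (intro arg_cong2[where f = "(+)"] sum.cong refl)
       (simp_all only: block_index[OF _ assms(1)] block_index[OF _ assms(2)] lessThan_iff, auto)
  also have "... = (if p = q then (\<Sum>i<k. cnj (x $ i) * y $ i) else 0)"
  proof -
    have "p \<in> {0, 1, 2}" "q \<in> {0, 1, 2}" using assms(1,2) by auto
    thus ?thesis by auto
  qed
  finally show ?thesis using ip_sum[OF assms(3,4)] by simp
qed

lemma block_V: "x \<in> V k ==> block k q x \<in> V (3 * k)"
proof (rule V_I)
  fix i assume x: "x \<in> V k" and i: "i < 3 * k"
  thus "block k q x $ i \<in> F"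
    using V_index[OF x, of "i - q * k"] by (simp add: block_def) linarith
qed simp

lemma standard_coordinates: "orthonormal_coordinates F (3 * k) k (block k 0) (block k 1) (block k 2)"
proof unfold_locales
  have lin: "block k q (x + y) = block k q x + block k q y" "block k q (c *s x) = c *s block k q x"
    if "x \<in> V k" "y \<in> V k" "q < 3" for x y q c
    using V_dim[OF that(1)] V_dim[OF that(2)] that(3) by (auto intro!: eq_vecI simp: block_def)
  have inj: "x = 0\<^sub>v k" if "x \<in> V k" "q < 3" "block k q x = 0\<^sub>v (3 * k)" for x q
  proof (rule eq_vecI)
    fix i assume "i < dim_vec (0\<^sub>v k :: complex vec)"
    hence i: "i < k" "q * k + i < 3 * k" using block_less[OF that(2)] by auto
    hence "x $ i = block k q x $ (q * k + i)" using block_index[OF that(2,2) i(1)] by simp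
    thus "x $ i = 0\<^sub>v k $ i" using i by (simp add: that(3))
  qed (simp add: V_dim[OF that(1)])
  show "Fmat k k (1\<^sub>m k)" by (rule Fmat_one)
  fix x y assume x: "x \<in> V k" and y: "y \<in> V k"
  note d = V_dim[OF x] V_dim[OF y]
  show "block k 0 (x + y) = block k 0 x + block k 0 y" "block k 1 (x + y) = block k 1 x + block k 1 y"
    "block k 2 (x + y) = block k 2 x + block k 2 y" by (rule lin(1)[OF x y]; simp)+
  show "ip (block k 0 x) (block k 1 y) = 0" "ip (block k 0 x) (block k 2 y) = 0"
    "ip (block k 1 x) (block k 2 y) = 0" "ip (block k 1 x) (block k 1 y) = ip x y"
    "ip (block k 2 x) (block k 2 y) = ip x (1\<^sub>m k *v y)"
    using ip_block[OF _ _ d] one_mult_mat_vec[OF V_carrier[OF y]] by simp_all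
  show "block k 0 x \<in> V (3 * k)" "block k 1 x \<in> V (3 * k)" "block k 2 x \<in> V (3 * k)"
    by (rule block_V[OF x])+
  show "block k 0 (c *s x) = c *s block k 0 x" "block k 1 (c *s x) = c *s block k 1 x"
    "block k 2 (c *s x) = c *s block k 2 x" for c by (rule lin(2)[OF x x]; simp)+
  show "x = 0\<^sub>v k" if "block k 0 x = 0\<^sub>v (3 * k)" by (rule inj[OF x _ that]) simp
  show "x = 0\<^sub>v k" if "block k 2 x = 0\<^sub>v (3 * k)" by (rule inj[OF x _ that]) simp
next
  fix v assume v: "v \<in> V (3 * k)"
  define w where "w q = vec k (\<lambda>i. v $ (q * k + i))" for q
  have wV: "w q \<in> V k" if "q < 3" for q
  proof (rule V_I)
    fix i assume "i < k"
    moreover from this have "q * k + i < 3 * k" using block_less[OF that] by simp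
    ultimately show "w q $ i \<in> F" using V_index[OF v] by (simp add: w_def)
  qed (simp add: w_def)
  have "v = block k 0 (w 0) + block k 1 (w 1) + block k 2 (w 2)"
  proof (rule vec3_eqI[of _ k])
    fix p i :: nat
    assume pi: "p < 3" "i < k"
    hence "p * k + i < 3 * k" by (rule block_less)
    moreover have "p = 0 \<or> p = 1 \<or> p = 2" using pi(1) by linarith
    ultimately have "(block k 0 (w 0) + block k 1 (w 1) + block k 2 (w 2)) $ (p * k + i) = w p $ i"
      using block_index[OF pi(1) _ pi(2)] by (elim disjE) simp_all
    thus "v $ (p * k + i) = (block k 0 (w 0) + block k 1 (w 1) + block k 2 (w 2)) $ (p * k + i)"
      using pi by (simp add: w_def)
  qed (simp_all add: V_dim[OF v])
  moreover have "w 0 \<in> V k" "w 1 \<in> V k" "w 2 \<in> V k" by (rule wV; simp)+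
  ultimately show "\<exists>x\<in>V k. \<exists>y\<in>V k. \<exists>z\<in>V k. v = block k 0 x + block k 1 y + block k 2 z"
    by blast
qed

lemma Zero_not_sat: "Zero \<notin> (\<Union>d\<in>{1..}. sat_terms (subspace_lattice F d))"
proof
  assume "Zero \<in> (\<Union>d\<in>{1..}. sat_terms (subspace_lattice F d))"
  then obtain d where d: "d \<ge> 1" "V d = {0\<^sub>v d}" by (auto simp: sat_terms_def)
  hence "unit_vec d 0 = (0\<^sub>v d :: complex vec)" using unit_vec_V[of d 0] by blast
  thus False using d(1) by (auto dest!: arg_cong[of _ _ "\<lambda>w. w $ 0"])
qed

lemma FEAS_all_dims_iff:
  "enc_polys ps \<in> FEAS_all_dims F \<longleftrightarrow>
   (\<exists>k\<ge>1. \<exists>X. (\<forall>i. Fmat k k (X i)) \<and> (\<forall>p\<in>set ps. eval_poly (R k) X p = 0\<^sub>m k k))"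
  by (auto simp: FEAS_all_dims_def FEAS_def inj_enc_polys image_iff feasible_R)

lemma SAT_L_iff:
  "enc_term t \<in> SAT_L F \<longleftrightarrow> (\<exists>d\<ge>1. \<exists>a. (\<forall>i. subspace_over F d (a i)) \<and> eval_term (L d) a t = V d)"
  by (auto simp: SAT_L_def inj_enc_term image_iff sat_terms_def)

lemma frame_formula_feasible:
  assumes p: "pythagorean F"
  shows "enc_term (frame_formula letter_conds ps) \<in> SAT_L F \<longleftrightarrow> enc_polys ps \<in> FEAS_all_dims F"
proof
  assume "enc_term (frame_formula letter_conds ps) \<in> SAT_L F"
  then obtain d a where d: "d \<ge> 1" and a: "\<forall>i. subspace_over F d (a i)"
    and e: "eval_term (L d) a (frame_formula letter_conds ps) = V d" unfolding SAT_L_iff by blast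
  have "eval_term (L d) a c = V d" if "c \<in> set frame_conds" for c
    using e that unfolding frame_formula_def eval_meets[OF a] set_append by blast
  then obtain k b1 b2 b3 where k: "k \<ge> 1" and "orthonormal_coordinates F d k b1 b2 b3"
    and fr: "coordinates.framed F d k b1 b2 b3 a" using ex_coordinates[OF p d a] by blast
  then interpret orthonormal_coordinates F d k b1 b2 b3 by blast
  obtain X where "letter_graphs a X (set (poly_vars ps))" "\<forall>p\<in>set ps. eval_poly (R k) X p = 0\<^sub>m k k"
    using e frame_formula_iff[OF fr, of "[]" ps] unfolding append_Nil2 by blast
  thus "enc_polys ps \<in> FEAS_all_dims F"
    unfolding FEAS_all_dims_iff letter_graphs_def using k by blast
next
  assume "enc_polys ps \<in> FEAS_all_dims F"
  then obtain k X where k: "k \<ge> 1" and X: "\<forall>i. Fmat k k (X i)"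
    and e: "\<forall>p\<in>set ps. eval_poly (R k) X p = 0\<^sub>m k k"
    unfolding FEAS_all_dims_iff by blast
  interpret orthonormal_coordinates F "3 * k" k "block k 0" "block k (Suc 0)" "block k 2"
    using standard_coordinates by simp
  obtain a where a: "framed a" "letter_graphs a X UNIV" using ex_framed[OF X] by blast
  hence "letter_graphs a X (set (poly_vars ps))" unfolding letter_graphs_def by blast
  hence "eval_term (L (3 * k)) a (frame_formula letter_conds ps) = V (3 * k)"
    using frame_formula_iff[OF a(1), of "[]" ps] e unfolding append_Nil2 by auto
  thus "enc_term (frame_formula letter_conds ps) \<in> SAT_L F"
    unfolding SAT_L_iff using framedD[OF a(1)] k by (intro exI[of _ "3 * k"] conjI exI[of _ a]) simp_all
qed

lemma frame_formula_reduction: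
  assumes "\<And>ps. enc_term (frame_formula cs ps) \<in> SAT_L F \<longleftrightarrow> enc_polys ps \<in> A" "A \<subseteq> range enc_polys"
  shows "A \<le>\<^sub>p SAT_L F"
proof -
  obtain f where f: "poly_time f" "\<forall>ps. f (enc_polys ps) = enc_term (frame_formula cs ps)"
    "\<forall>x. x \<notin> range enc_polys --> f x = enc_term Zero"
    using poly_time_frame_formula[of cs] by blast
  have zero: "enc_term Zero \<notin> SAT_L F"
    using Zero_not_sat unfolding SAT_L_def by (metis (no_types, lifting) imageE inj_enc_term)
  have "x \<in> A \<longleftrightarrow> f x \<in> SAT_L F" for x
  proof (cases "x \<in> range enc_polys")
    case True
    then obtain ps where "x = enc_polys ps" by blast
    thus ?thesis using f(2) assms(1)[of ps] by simp
  next
    case False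
    hence "x \<notin> A" using assms(2) by blast
    thus ?thesis using zero unfolding f(3)[rule_format, OF False] by blast
  qed
  thus ?thesis unfolding poly_reducible_def using f(1) by blast
qed

end

theorem FEAS_all_dims_reducible_SAT_L:
  assumes "star_subfield F" "pythagorean F"
  shows "FEAS_all_dims F \<le>\<^sub>p SAT_L F"
proof -
  interpret star_field F by unfold_locales (rule assms)
  have "FEAS_all_dims F \<subseteq> range enc_polys" unfolding FEAS_all_dims_def FEAS_def by blast
  from frame_formula_reduction[OF frame_formula_feasible[OF assms(2)] this] show ?thesis .
qed

section \<open>Roots of polynomials over a real closed field\<close>

lemma sum_square_split:
  fixes h :: "nat => nat => complex"
  assumes "\<And>i j. h i j = h j i"
  shows "(\<Sum>j<n. \<Sum>i<n. h i j) = 2 * (\<Sum>j<n. \<Sum>i<j. h i j) + (\<Sum>i<n. h i i)"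
proof (induction n)
  case (Suc n)
  have "(\<Sum>i<n. h n i) = (\<Sum>i<n. h i n)" using assms by simp
  with Suc show ?case by (simp add: sum.distrib algebra_simps)
qed simp

context star_field
begin

definition Fpoly :: "complex poly => bool" where
  "Fpoly p \<longleftrightarrow> (\<forall>i. coeff p i \<in> F)"

text \<open>Newton's identities: the logarithmic derivative of \<open>\<Prod> (1 - y X)\<close> is the negated series of power sums.\<close>

lemma newton_identity:
  fixes y :: "'i => complex"
  assumes "finite A"
  shows "fps_deriv (\<Prod>i\<in>A. fps_of_poly [:1, - y i:]) =
     - (\<Prod>i\<in>A. fps_of_poly [:1, - y i:]) * Abs_fps (\<lambda>n. \<Sum>i\<in>A. y i ^ Suc n)"
  using assms
proof (induction A)
  case empty
  have "Abs_fps (\<lambda>n. 0) = (0 :: complex fps)" by (simp add: fps_eq_iff)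
  thus ?case by simp
next
  case (insert a A)
  let ?E = "\<Prod>i\<in>A. fps_of_poly [:1, - y i:]" and ?G = "Abs_fps (\<lambda>n. \<Sum>i\<in>A. y i ^ Suc n)"
  let ?e = "fps_of_poly [:1, - y a:]" and ?g = "Abs_fps (\<lambda>n. y a ^ Suc n)"
  have e: "?e = 1 - fps_const (y a) * fps_X" by (simp add: fps_of_poly_pCons)
  have "fps_deriv ?e = - fps_const (y a)" by (simp add: e)
  moreover have "?e * ?g = fps_const (y a)"
  proof (rule fps_ext)
    fix n
    have "fps_nth ((1 - fps_const (y a) * fps_X) * ?g) n = fps_nth ?g n - y a * (if n = 0 then 0 else fps_nth ?g (n - 1))"
      by (simp add: left_diff_distrib mult.assoc)
    also have "... = fps_nth (fps_const (y a)) n" by (cases n) auto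
    finally show "fps_nth (?e * ?g) n = fps_nth (fps_const (y a)) n" by (simp add: e)
  qed
  moreover have "Abs_fps (\<lambda>n. \<Sum>i\<in>insert a A. y i ^ Suc n) = ?g + ?G"
    using insert(1,2) by (simp add: fps_eq_iff)
  moreover have "(\<Prod>i\<in>insert a A. fps_of_poly [:1, - y i:]) = ?e * ?E"
    using insert(1,2) by simp
  moreover have "fps_deriv (f * h) = - (f * h) * (u + v)"
    if "fps_deriv f = - c" "f * u = c" "fps_deriv h = - h * v" for f h u v c :: "complex fps"
  proof -
    have "fps_deriv (f * h) = f * fps_deriv h + fps_deriv f * h" by simp
    also have "... = - (f * h) * (u + v)"
      unfolding that(1,3) that(2)[symmetric] by (simp add: algebra_simps)
    finally show ?thesis .
  qed
  ultimately show ?case using insert.IH by metis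
qed

lemma reflect_linear: "reflect_poly [:- c, 1:] = [:1, - c :: complex:]"
  by (cases "c = 0") (auto simp: reflect_poly_pCons reflect_poly_pCons' cCons_def)

lemma Fpoly_iff_power_sums:
  fixes y :: "'i => complex"
  assumes A: "finite A"
  shows "Fpoly (\<Prod>i\<in>A. [:- y i, 1:]) \<longleftrightarrow> (\<forall>n. (\<Sum>i\<in>A. y i ^ Suc n) \<in> F)"
proof -
  let ?P = "\<Prod>i\<in>A. [:- y i, 1:]" and ?E = "\<Prod>i\<in>A. fps_of_poly [:1, - y i:]"
  let ?s = "\<lambda>n. \<Sum>i\<in>A. y i ^ Suc n"
  have E: "fps_nth ?E n = (if degree ?P < n then 0 else coeff ?P (degree ?P - n))" for n
    by (simp add: coeff_reflect_poly[symmetric] reflect_poly_prod reflect_linear fps_of_poly_prod[symmetric]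
        del: fps_of_poly_pCons)
  have FE: "Fpoly ?P \<longleftrightarrow> (\<forall>n. fps_nth ?E n \<in> F)"
  proof
    assume "\<forall>n. fps_nth ?E n \<in> F"
    hence "coeff ?P i \<in> F" if "i \<le> degree ?P" for i
      using E[of "degree ?P - i"] that by (metis diff_diff_cancel diff_le_self not_less)
    thus "Fpoly ?P" unfolding Fpoly_def by (metis F_0 coeff_eq_0 not_less)
  qed (simp add: E Fpoly_def)
  have "coeff ?P (degree ?P) = 1" by (rule monic_prod) simp
  hence E0: "fps_nth ?E 0 = 1" using E[of 0] by simp
  have newton: "of_nat (Suc n) * fps_nth ?E (Suc n) = - (\<Sum>i=0..n. fps_nth ?E i * ?s (n - i))" for n
    using arg_cong[OF newton_identity[OF A, of y], of "\<lambda>f. fps_nth f n"]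
    by (simp add: fps_mult_nth sum_negf)
  show ?thesis unfolding FE
  proof (intro iffI allI)
    fix n
    {
      assume "\<forall>n. fps_nth ?E n \<in> F"
      thus "?s n \<in> F"
      proof (induction n rule: less_induct)
        case (less n)
        have "(\<Sum>i=0..n. fps_nth ?E i * ?s (n - i)) = ?s n + (\<Sum>i=Suc 0..n. fps_nth ?E i * ?s (n - i))"
          using E0 by (simp add: sum.atLeast_Suc_atMost)
        hence "?s n = - (of_nat (Suc n) * fps_nth ?E (Suc n)) - (\<Sum>i=Suc 0..n. fps_nth ?E i * ?s (n - i))"
          unfolding newton by simp
        moreover have "of_nat (Suc n) * fps_nth ?E (Suc n) \<in> F"
          using less.prems F_of_nat by blast
        moreover have "(\<Sum>i=Suc 0..n. fps_nth ?E i * ?s (n - i)) \<in> F"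
        proof (rule F_sum)
          fix i assume "i \<in> {Suc 0..n}"
          thus "fps_nth ?E i * ?s (n - i) \<in> F"
            using less.prems less.IH[of "n - i"] by (intro F_mult) simp_all
        qed
        ultimately show ?case by auto
      qed
    next
      assume s: "\<forall>n. ?s n \<in> F"
      show "fps_nth ?E n \<in> F"
      proof (induction n rule: less_induct)
        case (less n)
        show ?case
        proof (cases n)
          case (Suc m)
          have "(\<Sum>i=0..m. fps_nth ?E i * ?s (m - i)) \<in> F"
          proof (rule F_sum)
            fix i assume "i \<in> {0..m}"
            thus "fps_nth ?E i * ?s (m - i) \<in> F"
              using s less.IH[of i] Suc by (intro F_mult) simp_all
          qed
          moreover have "fps_nth ?E n = - (\<Sum>i=0..m. fps_nth ?E i * ?s (m - i)) / of_nat (Suc m)"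
            using newton[of m] Suc by (simp add: field_simps del: of_nat_Suc)
          ultimately show ?thesis by (simp only: F_divide[OF F_uminus F_of_nat])
        qed (simp add: E0)
      qed
    }
  qed
qed

text \<open>The resolvent of Laplace's proof of the fundamental theorem of algebra.\<close>

lemma Fpoly_resolvent:
  fixes z :: "nat => complex"
  assumes "Fpoly (\<Prod>i<n. [:- z i, 1:])" "t \<in> F"
  shows "Fpoly (\<Prod>(j, i)\<in>(SIGMA j:{..<n}. {..<j}). [:- (z i + z j + t * z i * z j), 1:])"
proof -
  define q where "q a b = a + b + t * a * b" for a b :: complex
  have s: "(\<Sum>i<n. z i ^ r) \<in> F" for r
  proof (cases r)
    case (Suc m)
    thus ?thesis using assms(1) unfolding Suc Fpoly_iff_power_sums[OF finite_lessThan] by blast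
  qed simp
  have both: "(\<Sum>j<n. \<Sum>i<n. z i ^ a * z j ^ b * q (z i) (z j) ^ r) \<in> F" for a b r
  proof (induction r arbitrary: a b)
    case 0
    have "(\<Sum>j<n. \<Sum>i<n. z i ^ a * z j ^ b * q (z i) (z j) ^ 0) = (\<Sum>j<n. z j ^ b) * (\<Sum>i<n. z i ^ a)"
      unfolding sum_product by (simp add: mult.commute)
    thus ?case using F_mult[OF s s, of b a] by simp
  next
    case (Suc r)
    have "z i ^ a * z j ^ b * q (z i) (z j) ^ Suc r = z i ^ Suc a * z j ^ b * q (z i) (z j) ^ r +
        z i ^ a * z j ^ Suc b * q (z i) (z j) ^ r + t * (z i ^ Suc a * z j ^ Suc b * q (z i) (z j) ^ r)" for i j
      by (simp add: q_def algebra_simps)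
    hence "(\<Sum>j<n. \<Sum>i<n. z i ^ a * z j ^ b * q (z i) (z j) ^ Suc r) =
        (\<Sum>j<n. \<Sum>i<n. z i ^ Suc a * z j ^ b * q (z i) (z j) ^ r) +
        (\<Sum>j<n. \<Sum>i<n. z i ^ a * z j ^ Suc b * q (z i) (z j) ^ r) +
        t * (\<Sum>j<n. \<Sum>i<n. z i ^ Suc a * z j ^ Suc b * q (z i) (z j) ^ r)"
      by (simp only: sum.distrib sum_distrib_left)
    thus ?case using F_add[OF F_add[OF Suc Suc] F_mult[OF assms(2) Suc]] by (simp only:)
  qed
  have diag: "(\<Sum>i<n. z i ^ a * q (z i) (z i) ^ r) \<in> F" for a r
  proof (induction r arbitrary: a)
    case (Suc r)
    have "z i ^ a * q (z i) (z i) ^ Suc r = 2 * (z i ^ Suc a * q (z i) (z i) ^ r) +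
        t * (z i ^ Suc (Suc a) * q (z i) (z i) ^ r)" for i by (simp add: q_def algebra_simps)
    hence "(\<Sum>i<n. z i ^ a * q (z i) (z i) ^ Suc r) = 2 * (\<Sum>i<n. z i ^ Suc a * q (z i) (z i) ^ r) +
        t * (\<Sum>i<n. z i ^ Suc (Suc a) * q (z i) (z i) ^ r)"
      by (simp only: sum.distrib sum_distrib_left)
    moreover have "2 \<in> F" using F_of_nat[of 2] by simp
    ultimately show ?case using F_add[OF F_mult[OF _ Suc] F_mult[OF assms(2) Suc]] by (simp only:)
  qed (simp add: s)
  have "(\<Sum>j<n. \<Sum>i<j. q (z i) (z j) ^ r) \<in> F" for r
  proof -
    have "(\<Sum>j<n. \<Sum>i<n. q (z i) (z j) ^ r) =
        2 * (\<Sum>j<n. \<Sum>i<j. q (z i) (z j) ^ r) + (\<Sum>i<n. q (z i) (z i) ^ r)"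
      by (rule sum_square_split) (simp add: q_def algebra_simps)
    hence "(\<Sum>j<n. \<Sum>i<j. q (z i) (z j) ^ r) =
        ((\<Sum>j<n. \<Sum>i<n. q (z i) (z j) ^ r) - (\<Sum>i<n. q (z i) (z i) ^ r)) / of_nat 2"
      by simp
    moreover have "... \<in> F"
      using both[of 0 0 r] diag[of 0 r] by (intro F_divide F_diff F_of_nat) simp_all
    ultimately show ?thesis by (simp only:)
  qed
  hence "(\<Sum>x\<in>(SIGMA j:{..<n}. {..<j}). (case x of (j, i) => q (z i) (z j)) ^ r) \<in> F" for r
    by (simp add: sum.Sigma case_prod_beta)
  hence "Fpoly (\<Prod>x\<in>(SIGMA j:{..<n}. {..<j}). [:- (case x of (j, i) => q (z i) (z j)), 1:])"
    by (subst Fpoly_iff_power_sums) blast+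
  thus ?thesis by (simp add: case_prod_beta q_def)
qed

lemma Fpoly_quotient:
  assumes "Fpoly (m * q)" "Fpoly m" "m \<noteq> 0"
  shows "Fpoly q"
proof (rule ccontr)
  assume "\<not> Fpoly q"
  define I where "I = {i. coeff q i \<notin> F}"
  have "I \<noteq> {}" using `\<not> Fpoly q` by (auto simp: I_def Fpoly_def)
  moreover have "finite I"
    by (rule finite_subset[of _ "{..degree q}"]) (auto simp: I_def intro: le_degree)
  ultimately have j: "Max I \<in> I" "\<And>i. i \<in> I ==> i \<le> Max I" by auto
  define j where "j = Max I"
  let ?d = "degree m"
  have "coeff (m * q) (?d + j) = (\<Sum>i\<le>?d + j. coeff m i * coeff q (?d + j - i))"
    by (simp add: coeff_mult)
  also have "... = coeff m ?d * coeff q j + (\<Sum>i\<in>{..?d + j} - {?d}. coeff m i * coeff q (?d + j - i))"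
    by (subst sum.remove[of _ ?d]) auto
  finally have "coeff q j = (coeff (m * q) (?d + j) - (\<Sum>i\<in>{..?d + j} - {?d}. coeff m i * coeff q (?d + j - i))) / coeff m ?d"
    using assms(3) by (simp add: field_simps)
  moreover have "(\<Sum>i\<in>{..?d + j} - {?d}. coeff m i * coeff q (?d + j - i)) \<in> F"
  proof (rule F_sum)
    fix i assume i: "i \<in> {..?d + j} - {?d}"
    show "coeff m i * coeff q (?d + j - i) \<in> F"
    proof (cases "i < ?d")
      case True
      hence "coeff q (?d + j - i) \<in> F"
        using j(2)[of "?d + j - i"] by (fastforce simp: I_def j_def)
      thus ?thesis using assms(2) by (auto simp: Fpoly_def)
    next
      case False
      hence "coeff m i = 0" using i by (intro coeff_eq_0) auto
      thus ?thesis by simp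
    qed
  qed
  ultimately have "coeff q j \<in> F" using assms(1,2) by (auto simp: Fpoly_def)
  thus False using j(1) by (simp add: I_def j_def)
qed

end

locale real_closed_star_field = star_field +
  assumes real_closed: "real_closed_subfield F"
begin

lemma no_neg_one: "x \<in> F ==> x\<^sup>2 \<noteq> - 1"
proof
  assume x: "x \<in> F" "x\<^sup>2 = - 1"
  hence "- 1 = (\<Sum>x\<leftarrow>[x]. x\<^sup>2)" "set [x] \<subseteq> F" by simp_all
  hence "- 1 \<in> sums_of_squares F" unfolding sums_of_squares_def by blast
  thus False using real_closed unfolding real_closed_subfield_def by blast
qed

text \<open>For \<open>y = z - cnj z\<close> with \<open>y = \<plusminus> w\<^sup>2\<close>, the element \<open>cnj w / w\<close> is a square root of \<open>- 1\<close>.\<close>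

lemma F_real: "F \<subseteq> \<real>"
proof
  fix z assume z: "z \<in> F"
  show "z \<in> \<real>"
  proof (rule ccontr)
    assume "z \<notin> \<real>"
    define y where "y = z - cnj z"
    have y: "y \<in> F" "y \<noteq> 0" "cnj y = - y"
      using z `z \<notin> \<real>` by (auto simp: y_def Reals_cnj_iff)
    obtain w where w: "w \<in> F" "y = w\<^sup>2 \<or> y = - (w\<^sup>2)"
      using real_closed y(1) unfolding real_closed_subfield_def by blast
    have "(cnj w)\<^sup>2 = cnj y \<or> (cnj w)\<^sup>2 = - cnj y" "w \<noteq> 0"
      using w(2) y(2) by auto
    hence "(cnj w)\<^sup>2 = - (w\<^sup>2)"
      using w(2) y(3) by (metis complex_cnj_minus complex_cnj_power minus_minus)
    with `w \<noteq> 0` have "(cnj w)\<^sup>2 / w\<^sup>2 = - 1" by simp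
    hence "(cnj w / w)\<^sup>2 = - 1" by (simp add: power_divide)
    moreover have "cnj w / w \<in> F" using w(1) by auto
    ultimately show False using no_neg_one by blast
  qed
qed

lemma sqrt_F:
  assumes "complex_of_real x \<in> F" "x \<ge> 0"
  shows "complex_of_real (sqrt x) \<in> F"
proof -
  obtain y where y: "y \<in> F" "of_real x = y\<^sup>2 \<or> of_real x = - (y\<^sup>2)"
    using real_closed assms(1) unfolding real_closed_subfield_def by blast
  then obtain r where r: "y = of_real r" using F_real by (auto elim: Reals_cases)
  hence "complex_of_real x = of_real (r\<^sup>2) \<or> complex_of_real x = of_real (- (r\<^sup>2))"
    using y(2) by simp
  hence "x = r\<^sup>2 \<or> x = - (r\<^sup>2)" unfolding of_real_eq_iff .
  hence "x = r\<^sup>2" using assms(2) zero_le_power2[of r] by linarith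
  hence "sqrt x = r \<or> sqrt x = - r" by (auto simp: abs_if)
  thus ?thesis using y(1) r by auto
qed

definition gauss :: "complex => bool" where
  "gauss z \<longleftrightarrow> of_real (Re z) \<in> F \<and> of_real (Im z) \<in> F"

lemma gauss_add: "gauss x ==> gauss y ==> gauss (x + y)"
  and gauss_diff: "gauss x ==> gauss y ==> gauss (x - y)"
  and gauss_mult: "gauss x ==> gauss y ==> gauss (x * y)" by (auto simp: gauss_def)

lemma gauss_uminus: "gauss x ==> gauss (- x)" by (auto simp: gauss_def)

lemma gauss_F: "x \<in> F ==> gauss x" using F_real by (auto simp: gauss_def elim!: Reals_cases)

lemma gauss_sqrt:
  assumes "gauss (r\<^sup>2)"
  shows "gauss r"
proof -
  define w where "w = r\<^sup>2"
  have w: "of_real (Re w) \<in> F" "of_real (Im w) \<in> F"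
    using assms unfolding gauss_def w_def by blast+
  have "complex_of_real ((Re w)\<^sup>2 + (Im w)\<^sup>2) \<in> F" using w by auto
  hence n: "of_real (cmod w) \<in> F" unfolding cmod_def by (rule sqrt_F) simp
  have two: "2 \<in> F" using F_of_nat[of 2] by simp
  define p q where "p = sqrt ((cmod w + Re w) / 2)" and "q = sqrt ((cmod w - Re w) / 2)"
  have "complex_of_real ((cmod w + Re w) / 2) \<in> F" "complex_of_real ((cmod w - Re w) / 2) \<in> F"
    using F_divide[OF F_add[OF n w(1)] two] F_divide[OF F_diff[OF n w(1)] two] by simp_all
  hence pq: "complex_of_real p \<in> F" "complex_of_real q \<in> F"
    using abs_Re_le_cmod[of w] unfolding p_def q_def by (intro sqrt_F; simp)+
  have re: "Re (csqrt w) = p" and im: "Im (csqrt w) = q \<or> Im (csqrt w) = - q"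
    by (auto simp: p_def q_def sgn_if)
  have "complex_of_real (Im (csqrt w)) \<in> F"
    using im by (rule disjE) (simp_all only: of_real_minus pq F_uminus)
  hence "gauss (csqrt w)" unfolding gauss_def re using pq by blast
  moreover have "r = csqrt w \<or> r = - csqrt w"
    using power2_eq_iff[of r "csqrt w"] by (simp add: w_def)
  ultimately show ?thesis using gauss_uminus by auto
qed

lemma gauss_roots:
  assumes s: "gauss (x + y)" and u: "gauss (x * y)"
  shows "gauss x"
proof -
  have "(2 * x - (x + y))\<^sup>2 = (x + y) * (x + y) - (2 * 2) * (x * y)"
    by (simp add: power2_eq_square algebra_simps)
  moreover have two: "gauss 2" "gauss (1 / 2)"
    using gauss_F[OF F_of_nat[of 2]] gauss_F[OF F_divide[OF F_1 F_of_nat[of 2]]] by simp_all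
  ultimately have "gauss (2 * x - (x + y))"
    using gauss_diff[OF gauss_mult[OF s s] gauss_mult[OF gauss_mult[OF two(1,1)] u]]
    by - (rule gauss_sqrt, simp only:)
  hence "gauss (1 / 2 * ((2 * x - (x + y)) + (x + y)))" by (intro gauss_mult gauss_add s two)
  thus ?thesis by simp
qed

lemma ex_gauss_root:
  assumes "Fpoly p" "degree p = 2 ^ m * n" "odd n"
  shows "\<exists>z. poly p z = 0 \<and> gauss z" using assms
proof (induction m arbitrary: p n)
  case 0
  hence "\<forall>i. coeff p i \<in> F" "odd (degree p)" unfolding Fpoly_def by simp_all
  hence "\<exists>x\<in>F. poly p x = 0"
    using real_closed unfolding real_closed_subfield_def by blast
  thus ?case using gauss_F by blast
next
  case (Suc m)
  let ?N = "degree p"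
  have N: "?N > 0" using Suc.prems by (auto intro!: Nat.gr0I)
  obtain z where z: "smult (lead_coeff p) (\<Prod>i<?N. [:- z i, 1:]) = p"
    using complex_poly_decompose' by blast
  have p0: "lead_coeff p \<noteq> 0" using N by auto
  have "Fpoly (smult (inverse (lead_coeff p)) p)" using Suc.prems(1) by (auto simp: Fpoly_def)
  moreover have "smult (inverse (lead_coeff p)) p = (\<Prod>i<?N. [:- z i, 1:])"
  proof -
    have "smult (inverse (lead_coeff p)) (smult (lead_coeff p) q) = q" for q using p0 by simp
    from this[of "\<Prod>i<?N. [:- z i, 1:]"] show ?thesis unfolding z .
  qed
  ultimately have Fz: "Fpoly (\<Prod>i<?N. [:- z i, 1:])" by simp
  let ?D = "SIGMA j:{..<?N}. {..<j}"
  have card: "2 * card ?D = ?N * (?N - 1)"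
  proof -
    have "2 * (\<Sum>j<k. j) = k * (k - 1)" for k :: nat
    proof (induction k)
      case (Suc k)
      thus ?case by (cases k) (simp_all add: algebra_simps)
    qed simp
    thus ?thesis by simp
  qed
  have "even ?N" using Suc.prems(2) by simp
  hence oddN: "odd (?N - 1)" using N by simp
  have "2 * card ?D = 2 * (2 ^ m * (n * (?N - 1)))" unfolding card using Suc.prems(2) by simp
  hence cardD: "card ?D = 2 ^ m * (n * (?N - 1))" by simp
  have root: "\<exists>x\<in>?D. gauss (z (snd x) + z (fst x) + of_nat t * z (snd x) * z (fst x))" for t :: nat
  proof -
    let ?y = "\<lambda>(j, i). [:- (z i + z j + of_nat t * z i * z j), 1:]"
    have "Fpoly (prod ?y ?D)" by (rule Fpoly_resolvent[OF Fz F_of_nat])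
    moreover have "degree (prod ?y ?D) = (\<Sum>x\<in>?D. degree (?y x))"
      by (rule degree_prod_sum_eq) auto
    moreover have "(\<Sum>x\<in>?D. degree (?y x)) = (\<Sum>x\<in>?D. 1)" by (intro sum.cong) auto
    ultimately have "\<exists>c. poly (prod ?y ?D) c = 0 \<and> gauss c"
      using Suc.prems(3) oddN cardD by (intro Suc.IH[of _ "n * (?N - 1)"]) auto
    then obtain c where c: "poly (prod ?y ?D) c = 0" "gauss c" by blast
    have "finite ?D" by simp
    then obtain x where x: "x \<in> ?D" "poly (?y x) c = 0"
      using c(1) prod_zero_iff[of ?D "\<lambda>x. poly (?y x) c"] unfolding poly_prod by blast
    hence "c = z (snd x) + z (fst x) + of_nat t * z (snd x) * z (fst x)"
      by (cases x) (simp add: algebra_simps)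
    thus ?thesis using x(1) c(2) by blast
  qed
  then obtain x where x: "\<And>t :: nat. x t \<in> ?D"
    "\<And>t. gauss (z (snd (x t)) + z (fst (x t)) + of_nat t * z (snd (x t)) * z (fst (x t)))"
    by metis
  have "finite (range x)" by (rule finite_subset[of _ ?D]) (use x(1) in blast, simp)
  hence "\<not> inj x" using finite_imageD infinite_UNIV_nat by blast
  then obtain t t' where t: "t \<noteq> t'" "x t = x t'" by (auto simp: inj_def)
  obtain j i where ji: "x t = (j, i)" "j < ?N" using x(1)[of t] by (cases "x t") auto
  let ?s = "z i + z j" and ?u = "z i * z j"
  have g: "gauss (?s + of_nat t * ?u)" "gauss (?s + of_nat t' * ?u)"
    using x(2)[of t] x(2)[of t'] unfolding t(2)[symmetric] ji by (simp_all add: mult.assoc)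
  have c: "gauss (1 / (of_nat t - of_nat t'))" "gauss (of_nat t)"
    by (intro gauss_F F_divide F_diff F_of_nat F_1)+
  have u: "?u = 1 / (of_nat t - of_nat t') * ((?s + of_nat t * ?u) - (?s + of_nat t' * ?u))"
    using t(1) by (simp add: field_simps)
  have gu: "gauss ?u" by (subst u) (intro gauss_mult gauss_diff g c)
  have "gauss ((?s + of_nat t * ?u) - of_nat t * ?u)" by (intro gauss_diff g gauss_mult c gu)
  hence "gauss (z j + z i)" "gauss (z j * z i)" using gu by (simp_all add: add.commute mult.commute)
  hence "gauss (z j)" by (rule gauss_roots)
  moreover have "poly p (z j) = 0"
  proof -
    have "poly (smult c (\<Prod>i<?N. [:- z i, 1:])) (z j) = 0" for c
      using ji(2) by (auto simp: poly_prod)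
    from this[of "lead_coeff p"] show ?thesis unfolding z .
  qed
  ultimately show ?case by blast
qed

lemma ex_gauss_root':
  assumes "Fpoly p" "degree p > 0"
  shows "\<exists>z. poly p z = 0 \<and> gauss z"
proof -
  have "\<exists>m k. n = 2 ^ m * k \<and> odd k" if "n > 0" for n :: nat using that
  proof (induction n rule: less_induct)
    case (less n)
    show ?case
    proof (cases "even n")
      case True
      then obtain k where k: "n = 2 * k" by blast
      then obtain m l where "k = 2 ^ m * l \<and> odd l" using less.IH[of k] less.prems by auto
      hence "n = 2 ^ Suc m * l \<and> odd l" using k by simp
      thus ?thesis by blast
    next
      case False
      hence "n = 2 ^ 0 * n \<and> odd n" by simp
      thus ?thesis by blast
    qed
  qed
  thus ?thesis using ex_gauss_root[OF assms(1)] assms(2) by metis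
qed

end

section \<open>Common eigenvectors\<close>

definition pact :: "complex mat => complex vec => complex poly => complex vec" where
  "pact A v p = fold_coeffs (\<lambda>a w. a *s v + A *v w) p (0\<^sub>v (dim_vec v))"

context
  fixes A :: "complex mat" and k :: nat
  assumes A: "A \<in> carrier_mat k k"
begin

lemma pact_0: "v \<in> carrier_vec k ==> pact A v 0 = 0\<^sub>v k" by (simp add: pact_def)

lemma mult_zero: "A *v 0\<^sub>v k = 0\<^sub>v k" using A by (intro eq_vecI) auto

lemma pact_pCons:
  assumes "v \<in> carrier_vec k"
  shows "pact A v (pCons a p) = a *s v + A *v pact A v p"
proof (cases "a = 0 \<and> p = 0")
  case True
  have "0 *s v + A *v 0\<^sub>v k = 0\<^sub>v k"
    unfolding mult_zero using assms by (intro eq_vecI) auto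
  with True show ?thesis using pact_0[OF assms] by simp
qed (use assms in \<open>auto simp: pact_def\<close>)

lemma pact_carrier: "v \<in> carrier_vec k ==> pact A v p \<in> carrier_vec k"
  using A by (induction p) (auto simp: pact_0 pact_pCons)

lemma pact_add:
  assumes v: "v \<in> carrier_vec k"
  shows "pact A v (p + q) = pact A v p + pact A v q"
proof (induction p q rule: poly_induct2)
  case 0
  thus ?case using v by (simp add: pact_0)
next
  case (pCons a p b q)
  let ?x = "A *v pact A v p" and ?y = "A *v pact A v q"
  have xy: "?x \<in> carrier_vec k" "?y \<in> carrier_vec k"
    using mult_mat_vec_carrier[OF A pact_carrier[OF v]] by blast+
  have "A *v (pact A v p + pact A v q) = ?x + ?y"
    by (rule mult_add_distrib_mat_vec[OF A pact_carrier[OF v] pact_carrier[OF v]])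
  hence "pact A v (pCons a p + pCons b q) = (a + b) *s v + (?x + ?y)"
    using pCons v by (simp add: pact_pCons)
  also have "... = (a *s v + ?x) + (b *s v + ?y)"
    using v xy by (intro eq_vecI) (auto simp: algebra_simps simp del: index_mult_mat_vec dim_mult_mat_vec)
  finally show ?case using v by (simp add: pact_pCons)
qed

lemma pact_smult:
  assumes v: "v \<in> carrier_vec k"
  shows "pact A v (smult c p) = c *s pact A v p"
proof (induction p)
  case 0
  thus ?case using v pact_0[OF v] by (intro eq_vecI) simp_all
next
  case (pCons a p)
  let ?x = "A *v pact A v p"
  have x: "?x \<in> carrier_vec k" by (rule mult_mat_vec_carrier[OF A pact_carrier[OF v]])
  have "A *v (c *s pact A v p) = c *s ?x" by (rule mult_mat_vec[OF A pact_carrier[OF v]])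
  hence "pact A v (smult c (pCons a p)) = (c * a) *s v + c *s ?x"
    using pCons v by (simp add: pact_pCons)
  also have "... = c *s (a *s v + ?x)"
    using v x by (intro eq_vecI) (auto simp: algebra_simps simp del: index_mult_mat_vec dim_mult_mat_vec)
  finally show ?case using v by (simp add: pact_pCons)
qed

lemma pact_mult:
  assumes v: "v \<in> carrier_vec k"
  shows "pact A v (p * q) = pact A (pact A v q) p"
proof (induction p)
  case 0
  thus ?case using v by (simp add: pact_0 pact_carrier)
next
  case (pCons a p)
  have "0 *s v + A *v pact A v (p * q) = A *v pact A v (p * q)"
    using v A by (intro eq_vecI) (auto simp del: index_mult_mat_vec)
  thus ?case using pCons v by (simp add: pact_add pact_smult pact_pCons pact_carrier)
qed

lemma pact_linear:
  assumes "w \<in> carrier_vec k"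
  shows "pact A w [:c, 1:] = c *s w + A *v w"
proof -
  have "1 *s w + A *v 0\<^sub>v k = w" unfolding mult_zero using assms by (intro eq_vecI) auto
  thus ?thesis using assms by (simp add: pact_pCons pact_0)
qed

end

context star_field
begin

lemma pact_in:
  assumes A: "A \<in> carrier_mat k k" and W: "subspace_over F k W" "\<And>w. w \<in> W ==> A *v w \<in> W" and v: "v \<in> W"
    and "Fpoly p"
  shows "pact A v p \<in> W"
proof -
  have vc: "v \<in> carrier_vec k" by (rule V_carrier[OF subspaceD(1)[OF W(1) v]])
  show ?thesis using assms(5)
proof (induction p)
  case 0
  thus ?case unfolding pact_0[OF A vc] by (intro subspaceD(2)[OF W(1)])
next
  case (pCons a p)
  have "a \<in> F" "Fpoly p"
    using pCons.prems coeff_pCons_0[of a p] coeff_pCons_Suc[of a p] unfolding Fpoly_def by metis+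
  thus ?case unfolding pact_pCons[OF A vc]
    by (intro subspaceD(3)[OF W(1) subspaceD(4)[OF W(1) _ v] W(2)] pCons.IH)
qed
qed

lemma ex_annihilator:
  assumes A: "Fmat k k A" and v: "v \<in> V k"
  shows "\<exists>q. Fpoly q \<and> q \<noteq> 0 \<and> pact A v q = 0\<^sub>v k"
proof -
  note Ac = Fmat_carrier[OF A] and vc = V_carrier[OF v]
  define w where "w i = ((*v) A ^^ i) v" for i
  have wV: "w i \<in> V k" for i unfolding w_def by (induction i) (simp_all add: v mult_vec_V[OF A])
  have "\<exists>c. (\<forall>i\<in>{..k}. c i \<in> F) \<and> (\<exists>i\<in>{..k}. c i \<noteq> 0) \<and> (\<forall>j<k. (\<Sum>i\<in>{..k}. c i * w i $ j) = 0)"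
    by (rule linear_relation) (auto intro: V_index[OF wV])
  then obtain c where c: "\<forall>i\<le>k. c i \<in> F" "\<exists>i\<le>k. c i \<noteq> 0" "\<forall>j<k. (\<Sum>i\<le>k. c i * w i $ j) = 0"
    by auto
  define q where "q n = (\<Sum>i<n. monom (c i) i)" for n
  have mon: "pact A v (monom b i) = b *s w i" for b i
  proof (induction i)
    case 0
    have "b *s v + 0\<^sub>v k = b *s v" using vc by simp
    thus ?case
      using pact_pCons[OF Ac vc, of b 0] pact_0[OF Ac vc] mult_zero[OF Ac] by (simp add: monom_0 w_def)
  next
    case (Suc i)
    have "0 *s v + A *v (b *s w i) = b *s (A *v w i)"
      unfolding mult_mat_vec[OF Ac V_carrier[OF wV]] using vc Ac
      by (intro eq_vecI) (auto simp del: index_mult_mat_vec)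
    thus ?case using pact_pCons[OF Ac vc, of 0 "monom b i"] Suc by (simp add: monom_Suc w_def)
  qed
  have "pact A v (q n) = comb k n c w" for n
  proof (induction n)
    case 0
    thus ?case using pact_0[OF Ac vc] by (auto simp: q_def comb_def)
  next
    case (Suc n)
    thus ?case using comb_Suc[OF V_carrier[OF wV]] by (simp add: q_def pact_add[OF Ac vc] mon)
  qed
  moreover have "comb k (Suc k) c w = 0\<^sub>v k"
    using c(3) by (intro eq_vecI) (auto simp: comb_def lessThan_Suc_atMost)
  moreover have co: "coeff (q (Suc k)) i = (if i \<le> k then c i else 0)" for i
    by (simp add: q_def coeff_sum coeff_monom lessThan_Suc_atMost)
  moreover have "q (Suc k) \<noteq> 0" using co c(2) by (metis coeff_0)
  moreover have "Fpoly (q (Suc k))" using co c(1) by (simp add: Fpoly_def)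
  ultimately show ?thesis by metis
qed

definition good_matrix :: "nat => complex mat => bool" where
  "good_matrix k A \<longleftrightarrow> Fmat k k A \<and>
     (alg_closed_subfield F \<or> real_closed_subfield F \<and> mat_adjoint A = A)"

lemma ex_eigenvector:
  assumes A: "good_matrix k A" and W: "subspace_over F k W" "\<And>w. w \<in> W ==> A *v w \<in> W"
    and v: "v \<in> W" "v \<noteq> 0\<^sub>v k"
  shows "\<exists>\<mu>\<in>F. \<exists>w\<in>W. w \<noteq> 0\<^sub>v k \<and> A *v w = \<mu> *s w"
proof -
  have AF: "Fmat k k A" using A unfolding good_matrix_def by blast
  note Ac = Fmat_carrier[OF AF]
  have vV: "v \<in> V k" by (rule subspaceD(1)[OF W(1) v(1)])
  note vc = V_carrier[OF vV]
  let ?P = "\<lambda>q. Fpoly q \<and> q \<noteq> 0 \<and> pact A v q = 0\<^sub>v k"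
  obtain q where q: "?P q" "\<And>p. ?P p ==> degree q \<le> degree p"
    using ex_has_least_nat[of ?P _ degree] ex_annihilator[OF AF vV] by blast
  have deg: "degree q > 0"
  proof (rule ccontr)
    assume "\<not> degree q > 0"
    hence "degree q = 0" by simp
    then obtain c where c: "q = [:c:]" by (rule degree_eq_zeroE)
    have "c *s v + 0\<^sub>v k = c *s v" using vc by simp
    hence z: "c *s v = 0\<^sub>v k"
      using q(1) pact_pCons[OF Ac vc, of c 0] pact_0[OF Ac vc] mult_zero[OF Ac] by (simp add: c)
    have "c \<noteq> 0" using q(1) by (auto simp: c)
    have "v = 0\<^sub>v k"
    proof (rule eq_vecI)
      fix i assume "i < dim_vec (0\<^sub>v k :: complex vec)"
      thus "v $ i = 0\<^sub>v k $ i"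
        using arg_cong[OF z, of "\<lambda>u. u $ i"] `c \<noteq> 0` vc by simp
    qed (use vc in simp)
    thus False using v(2) by blast
  qed
  have factor: "\<exists>w\<in>W. w \<noteq> 0\<^sub>v k \<and> pact A w m = 0\<^sub>v k" if m: "q = m * p" "Fpoly m" "degree m > 0" for m p
  proof -
    have p: "Fpoly p" "p \<noteq> 0" "m \<noteq> 0" using q(1) m Fpoly_quotient[of m p] by auto
    hence "degree p < degree q" using m by (simp add: degree_mult_eq)
    hence "pact A v p \<noteq> 0\<^sub>v k" using q(2)[of p] p by auto
    moreover have "pact A v p \<in> W" by (rule pact_in[OF Ac W v(1) p(1)])
    moreover have "pact A (pact A v p) m = 0\<^sub>v k"
      using pact_mult[OF Ac vc, of m p] q(1) m(1) by simp
    ultimately show ?thesis by blast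
  qed
  have linear: ?thesis if z: "z \<in> F" "poly q z = 0" for z
  proof -
    obtain p where p: "q = [:- z, 1:] * p" using z(2) unfolding poly_eq_0_iff_dvd dvd_def by blast
    have "Fpoly [:- z, 1:]" using z(1) by (auto simp: Fpoly_def coeff_pCons split: nat.splits)
    then obtain w where w: "w \<in> W" "w \<noteq> 0\<^sub>v k" "pact A w [:- z, 1:] = 0\<^sub>v k"
      using factor[OF p] by auto
    have wc: "w \<in> carrier_vec k" by (rule V_carrier[OF subspaceD(1)[OF W(1) w(1)]])
    have eq: "(- z) *s w + A *v w = 0\<^sub>v k" using w(3) unfolding pact_linear[OF Ac wc] .
    have "A *v w = z *s w"
    proof (rule eq_vecI)
      fix i assume "i < dim_vec (z *s w)"
      thus "(A *v w) $ i = (z *s w) $ i"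
        using arg_cong[OF eq, of "\<lambda>u. u $ i"] wc Ac by (simp del: index_mult_mat_vec)
    qed (use wc Ac in simp)
    thus ?thesis using w z(1) by blast
  qed
  show ?thesis
  proof (cases "alg_closed_subfield F")
    case True
    then obtain z where "z \<in> F" "poly q z = 0"
      using q(1) deg unfolding alg_closed_subfield_def Fpoly_def by blast
    thus ?thesis by (rule linear)
  next
    case False
    hence "real_closed_subfield F" and sym: "mat_adjoint A = A"
      using A unfolding good_matrix_def by blast+
    then interpret real_closed_star_field F by unfold_locales
    obtain z where z: "poly q z = 0" "gauss z" using ex_gauss_root'[of q] q(1) deg by blast
    show ?thesis
    proof (cases "Im z = 0")
      case True
      hence "z = of_real (Re z)" by (simp add: complex_eq_iff)
      hence "z \<in> F" using z(2) unfolding gauss_def by metis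
      thus ?thesis using z(1) by (rule linear)
    next
      case im: False
      define a b where "a = complex_of_real (Re z)" and "b = complex_of_real (Im z)"
      have ab: "a \<in> F" "b \<in> F" "b \<noteq> 0" "cnj a = a" "cnj b = b"
        using z(2) im by (simp_all add: gauss_def a_def b_def)
      have z_ab: "z = a + \<i> * b" "cnj z = a - \<i> * b"
        by (simp_all add: complex_eq_iff a_def b_def)
      have "\<forall>i. coeff q i \<in> \<real>" using q(1) F_real by (auto simp: Fpoly_def)
      hence z': "poly q (cnj z) = 0" using poly_cnj_real[of q z] z(1) by simp
      obtain p where p: "q = [:- z, 1:] * p" using z(1) unfolding poly_eq_0_iff_dvd dvd_def by blast
      have "cnj z \<noteq> z" using im by (simp add: complex_eq_iff)
      hence "poly p (cnj z) = 0" using z' by (simp add: p)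
      then obtain r where r: "p = [:- cnj z, 1:] * r" unfolding poly_eq_0_iff_dvd dvd_def by blast
      let ?m = "[:a * a + b * b, - 2 * a, 1:]"
      have "[:- z, 1:] * [:- cnj z, 1:] = ?m"
        unfolding z_ab(2) unfolding z_ab(1) by (simp add: algebra_simps)
      hence m: "q = ?m * r" unfolding p r by (metis mult.assoc)
      have two: "- 2 * a \<in> F" "a * a + b * b \<in> F"
        using F_mult[OF F_uminus[OF F_of_nat[of 2]] ab(1)] F_add[OF F_mult[OF ab(1,1)] F_mult[OF ab(2,2)]] by simp_all
      hence "Fpoly ?m" by (auto simp: Fpoly_def coeff_pCons split: nat.splits)
      then obtain w where w: "w \<in> W" "w \<noteq> 0\<^sub>v k" "pact A w ?m = 0\<^sub>v k"
        using factor[OF m] by auto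
      have wV: "w \<in> V k" by (rule subspaceD(1)[OF W(1) w(1)])
      define u where "u = A *v w"
      have uV: "u \<in> V k" unfolding u_def by (rule mult_vec_V[OF AF wV])
      note wc = V_carrier[OF wV] and uc = V_carrier[OF uV]
      define x where "x = A *v u"
      have xc: "x \<in> carrier_vec k" unfolding x_def by (rule V_carrier[OF mult_vec_V[OF AF uV]])
      have "pact A w ?m = (a * a + b * b) *s w + ((- 2 * a) *s u + x)"
        unfolding pact_pCons[OF Ac wc, of "a * a + b * b"] pact_linear[OF Ac wc]
          mult_add_distrib_mat_vec[OF Ac smult_carrier_vec[THEN iffD2, OF wc] uc[unfolded u_def]]
          mult_mat_vec[OF Ac wc] x_def u_def ..
      hence "ip w ((a * a + b * b) *s w + ((- 2 * a) *s u + x)) = 0" using w(3) wc by simp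
      hence e: "(a * a + b * b) * ip w w + (- 2 * a * ip w u + ip w x) = 0"
        using wc uc xc by (simp add: ip_add[of _ k] ip_smult[of _ k])
      have adj: "ip (A *v y) y' = ip y (A *v y')" if "y \<in> carrier_vec k" "y' \<in> carrier_vec k" for y y'
        using ip_adjoint[OF Ac that] unfolding sym .
      have wu: "ip u w = ip w u" "ip w x = ip u u"
        using adj[OF wc wc] adj[OF wc uc] by (simp_all add: u_def x_def)
      let ?y = "u - a *s w"
      have yc: "?y \<in> carrier_vec k" using uc wc by simp
      have "ip ?y ?y = ip u u - a * ip u w - (a * ip w u - a * (a * ip w w))"
        using uc wc ab(4) by (simp add: ip_diff[of _ k] ip_smult[of _ k] algebra_simps)
      also have "... = ((a * a + b * b) * ip w w + (- 2 * a * ip w u + ip w x)) - b * b * ip w w"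
        unfolding wu by (simp add: algebra_simps)
      finally have "ip ?y ?y = - (b * b * ip w w)" unfolding e by simp
      hence "complex_of_real (\<Sum>i<k. (cmod (?y $ i))\<^sup>2) = of_real (- ((Im z)\<^sup>2 * (\<Sum>i<k. (cmod (w $ i))\<^sup>2)))"
        unfolding ip_self[OF yc] ip_self[OF wc] by (simp add: b_def power2_eq_square)
      hence "(\<Sum>i<k. (cmod (?y $ i))\<^sup>2) = - ((Im z)\<^sup>2 * (\<Sum>i<k. (cmod (w $ i))\<^sup>2))"
        unfolding of_real_eq_iff .
      moreover have "(\<Sum>i<k. (cmod (?y $ i))\<^sup>2) \<ge> 0" "(\<Sum>i<k. (cmod (w $ i))\<^sup>2) \<ge> 0"
        by (auto intro: sum_nonneg)
      moreover from this have "(Im z)\<^sup>2 * (\<Sum>i<k. (cmod (w $ i))\<^sup>2) \<ge> 0" by simp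
      ultimately have "(Im z)\<^sup>2 * (\<Sum>i<k. (cmod (w $ i))\<^sup>2) = 0" by linarith
      hence "ip w w = 0" using im unfolding ip_self[OF wc] by simp
      thus ?thesis using w(2) ip_self_eq_0[OF wc] by blast
    qed
  qed
qed

lemma ex_common_eigenvector:
  assumes S: "\<And>A. A \<in> S ==> good_matrix k A" "\<And>A B. A \<in> S ==> B \<in> S ==> A * B = B * A"
    and k: "k \<ge> 1" and "finite S"
  shows "\<exists>v\<in>V k. v \<noteq> 0\<^sub>v k \<and> (\<forall>A\<in>S. \<exists>\<mu>\<in>F. A *v v = \<mu> *s v)"
proof -
  have SF: "Fmat k k A" if "A \<in> S" for A using S(1)[OF that] unfolding good_matrix_def by blast
  have "\<exists>W. subspace_over F k W \<and> (\<exists>v\<in>W. v \<noteq> 0\<^sub>v k) \<and> (\<forall>B\<in>S. \<forall>w\<in>W. B *v w \<in> W) \<and>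
      (\<forall>A\<in>S'. \<exists>\<mu>\<in>F. \<forall>w\<in>W. A *v w = \<mu> *s w)" if "finite S'" "S' \<subseteq> S" for S'
    using that
  proof (induction S')
    case empty
    have "unit_vec k 0 \<noteq> (0\<^sub>v k :: complex vec)"
      using k by (auto dest!: arg_cong[of _ _ "\<lambda>w. w $ 0"])
    thus ?case using subspace_V[of k] unit_vec_V[of k 0] mult_vec_V[OF SF] by blast
  next
    case (insert A S')
    then obtain W v where W: "subspace_over F k W" "v \<in> W" "v \<noteq> 0\<^sub>v k" "\<forall>B\<in>S. \<forall>w\<in>W. B *v w \<in> W"
        "\<forall>A\<in>S'. \<exists>\<mu>\<in>F. \<forall>w\<in>W. A *v w = \<mu> *s w" by blast
    have AS: "A \<in> S" using insert by blast
    obtain \<mu> w where \<mu>: "\<mu> \<in> F" "w \<in> W" "w \<noteq> 0\<^sub>v k" "A *v w = \<mu> *s w"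
      using ex_eigenvector[OF S(1)[OF AS] W(1) _ W(2,3)] W(4) AS by blast
    have WV: "x \<in> V k" if "x \<in> W" for x by (rule subspaceD(1)[OF W(1) that])
    note Ac = Fmat_carrier[OF SF[OF AS]]
    define W' where "W' = {x \<in> W. A *v x = \<mu> *s x}"
    have "subspace_over F k W'" unfolding subspace_over_def
    proof (intro conjI ballI subsetI)
      show "x \<in> V k" if "x \<in> W'" for x using that WV unfolding W'_def by blast
      have "A *v 0\<^sub>v k = \<mu> *s 0\<^sub>v k"
        unfolding mult_zero[OF Ac] by (intro eq_vecI) auto
      thus "0\<^sub>v k \<in> W'" unfolding W'_def using subspaceD(2)[OF W(1)] by blast
      show "x + y \<in> W'" if xy: "x \<in> W'" "y \<in> W'" for x y
      proof -
        have xy': "x \<in> W" "y \<in> W" "A *v x = \<mu> *s x" "A *v y = \<mu> *s y"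
          using xy unfolding W'_def by blast+
        have "A *v (x + y) = \<mu> *s (x + y)"
          unfolding mult_add_distrib_mat_vec[OF Ac V_carrier[OF WV[OF xy'(1)]] V_carrier[OF WV[OF xy'(2)]]] xy'(3,4)
          using smult_add_distrib_vec[OF V_carrier[OF WV[OF xy'(1)]] V_carrier[OF WV[OF xy'(2)]], of \<mu>] by simp
        thus ?thesis unfolding W'_def using subspaceD(3)[OF W(1) xy'(1,2)] by blast
      qed
      show "c *s x \<in> W'" if c: "c \<in> F" and x: "x \<in> W'" for c x
      proof -
        have x': "x \<in> W" "A *v x = \<mu> *s x" using x unfolding W'_def by blast+
        have "A *v (c *s x) = \<mu> *s (c *s x)"
          unfolding mult_mat_vec[OF Ac V_carrier[OF WV[OF x'(1)]]] x'(2) by (simp add: smult_smult_assoc mult.commute)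
        thus ?thesis unfolding W'_def using subspaceD(4)[OF W(1) c x'(1)] by blast
      qed
    qed
    moreover have "B *v x \<in> W'" if B: "B \<in> S" and x: "x \<in> W'" for B x
    proof -
      have x': "x \<in> W" "A *v x = \<mu> *s x" using x unfolding W'_def by blast+
      note Bc = Fmat_carrier[OF SF[OF B]] and xc = V_carrier[OF WV[OF x'(1)]]
      have "A *v (B *v x) = B *v (A *v x)"
        using S(2)[OF AS B] assoc_mult_mat_vec[OF Ac Bc xc] assoc_mult_mat_vec[OF Bc Ac xc] by simp
      hence "A *v (B *v x) = \<mu> *s (B *v x)" unfolding x'(2) mult_mat_vec[OF Bc xc] .
      thus ?thesis unfolding W'_def using W(4) B x'(1) by blast
    qed
    moreover have "w \<in> W'" unfolding W'_def using \<mu> by blast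
    ultimately show ?case
      using \<mu>(1,3) W(5) unfolding W'_def by (intro exI[of _ W']) (unfold W'_def, blast)
  qed
  from this[OF `finite S` order_refl] show ?thesis using subspaceD(1) by blast
qed

end

section \<open>Commutative polynomials\<close>

definition commute_conds :: "ol_term list" where
  "commute_conds =
     [le_term (op_term (Var 1) (op_term (Var 3) tU)) (op_term (Var 3) (op_term (Var 1) tU)),
      le_term (op_term (Var 1) (adj_term (Var 3) tU)) (adj_term (Var 3) (op_term (Var 1) tU))]"

definition hermitian_conds :: "ol_term list" where
  "hermitian_conds = [le_term (op_term (Var 1) tU) (adj_term (Var 1) tU)]"

context orthonormal_coordinates
begin

lemma field_conds_iff:
  assumes a: "framed a" and X: "Fmat k k X" "a 1 = gr23 X" and Y: "Fmat k k Y" "a 3 = gr23 Y"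
  shows "(\<forall>c\<in>set commute_conds. E a c = V d) \<longleftrightarrow> X * Y = Y * X \<and> X * mat_adjoint Y = mat_adjoint Y * X"
    and "(\<forall>c\<in>set hermitian_conds. E a c = V d) \<longleftrightarrow> mat_adjoint X = X"
proof -
  note U = Fmat_one[of k] frame_eval(7)[OF a]
  have X': "E a (Var 1) = gr23 X" and Y': "E a (Var 3) = gr23 Y" using X(2) Y(2) by simp_all
  note ad = Fmat_adjoint[OF X(1)] Fmat_adjoint[OF Y(1)]
  have one: "M * 1\<^sub>m k = M" if "Fmat k k M" for M
    using right_mult_one_mat[OF Fmat_carrier[OF that]] .
  have 1: "E a (op_term (Var 1) tU) = gr12 X" "E a (op_term (Var 3) tU) = gr12 Y"
    "E a (adj_term (Var 1) tU) = gr12 (mat_adjoint X)" "E a (adj_term (Var 3) tU) = gr12 (mat_adjoint Y)"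
    using eval_op[OF a X(1) X' U] eval_op[OF a Y(1) Y' U] eval_adj[OF a X(1) X' U] eval_adj[OF a Y(1) Y' U]
    unfolding one[OF X(1)] one[OF Y(1)] one[OF ad(1)] one[OF ad(2)] by blast+
  have 2: "E a (op_term (Var 1) (op_term (Var 3) tU)) = gr12 (X * Y)"
    "E a (op_term (Var 3) (op_term (Var 1) tU)) = gr12 (Y * X)"
    "E a (op_term (Var 1) (adj_term (Var 3) tU)) = gr12 (X * mat_adjoint Y)"
    "E a (adj_term (Var 3) (op_term (Var 1) tU)) = gr12 (mat_adjoint Y * X)"
    using eval_op[OF a X(1) X' Y(1) 1(2)] eval_op[OF a Y(1) Y' X(1) 1(1)]
      eval_op[OF a X(1) X' ad(2) 1(4)] eval_adj[OF a Y(1) Y' X(1) 1(1)] by blast+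
  show "(\<forall>c\<in>set commute_conds. E a c = V d) \<longleftrightarrow> X * Y = Y * X \<and> X * mat_adjoint Y = mat_adjoint Y * X"
    unfolding commute_conds_def list.set ball_simps eval_le_term[OF framedD[OF a]] 2
      gr12_le_iff[OF Fmat_mult[OF X(1) Y(1)] Fmat_mult[OF Y(1) X(1)]]
      gr12_le_iff[OF Fmat_mult[OF X(1) ad(2)] Fmat_mult[OF ad(2) X(1)]] by blast
  show "(\<forall>c\<in>set hermitian_conds. E a c = V d) \<longleftrightarrow> mat_adjoint X = X"
    unfolding hermitian_conds_def list.set ball_simps eval_le_term[OF framedD[OF a]] 1
      gr12_le_iff[OF X(1) ad(1)] by auto
qed

end

context star_field
begin

abbreviation S :: "complex star_ring" where
  "S \<equiv> field_star_ring F"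

lemma S_simps [simp]:
  "carrier S = F" "monoid.mult S = (*)" "monoid.one S = 1" "ring.zero S = 0" "ring.add S = (+)" "star S = cnj"
  by (simp_all add: field_star_ring_def)

lemma add_pow_S:
  assumes x: "x \<in> F"
  shows "[c] \<cdot>\<^bsub>S\<^esub> x = of_int c * x"
proof -
  have pow: "x [^]\<^bsub>add_monoid S\<^esub> (n :: nat) = of_nat n * x" for n
    by (induction n) (simp_all add: nat_pow_def algebra_simps)
  show ?thesis
  proof (cases "c < 0")
    case False
    thus ?thesis unfolding add_pow_def int_pow_def2 if_not_P[OF False] pow by (simp add: of_nat_nat)
  next
    case True
    let ?y = "of_nat (nat (- c)) * x"
    have y: "?y = - (of_int c * x)" using True by (simp add: of_nat_nat)
    have "inv\<^bsub>add_monoid S\<^esub> ?y = of_int c * x" unfolding m_inv_def y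
    proof (rule the_equality, goal_cases)
      case 1
      show ?case using F_mult[OF F_of_int x] by simp
    next
      case (2 z)
      hence "- (of_int c * x) + z = 0" by simp
      thus ?case by (simp add: add_eq_0_iff2)
    qed
    thus ?thesis unfolding add_pow_def int_pow_def2 if_P[OF True] pow .
  qed
qed

lemma eval_monom_S:
  "eval_monom S x [] = 1"
  "eval_monom S x (l # w) = eval_letter S x l * eval_monom S x w" by (simp_all add: eval_monom_def)

lemma eval_letter_S: "eval_letter S x (i, b) = (if b then cnj (x i) else x i)"
  by (simp add: eval_letter_def)

lemma eval_monom_S_in: "\<forall>i. x i \<in> F ==> eval_monom S x w \<in> F"
proof (induction w)
  case (Cons l w)
  thus ?case by (cases l) (auto simp: eval_monom_S eval_letter_S)
qed (simp add: eval_monom_S)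

lemma eval_poly_S:
  assumes "\<forall>i. x i \<in> F"
  shows "eval_poly S x [] = 0"
    "eval_poly S x ((c, w) # p) = of_int c * eval_monom S x w + eval_poly S x p"
  using add_pow_S[OF eval_monom_S_in[OF assms]] by (simp_all add: eval_poly_def)

lemma FEAS_S_iff:
  "enc_polys ps \<in> FEAS S \<longleftrightarrow> (\<exists>x. (\<forall>i. x i \<in> F) \<and> (\<forall>p\<in>set ps. eval_poly S x p = 0))"
  by (auto simp: FEAS_def inj_enc_polys image_iff feasible_polys_def)

lemma eval_monom_eigen:
  assumes X: "\<forall>i. Fmat k k (X i)" and v: "v \<in> V k" and x: "\<forall>i. x i \<in> F"
    and eig: "\<forall>i\<in>I. X i *v v = x i *s v \<and> mat_adjoint (X i) *v v = cnj (x i) *s v"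
    and "fst ` set w \<subseteq> I"
  shows "eval_monom (R k) X w *v v = eval_monom S x w *s v" using assms(5)
proof (induction w)
  case Nil
  have "1 *s v = v" by (intro eq_vecI) auto
  thus ?case using V_carrier[OF v] by (simp add: eval_monom_R eval_monom_S)
next
  case (Cons l w)
  obtain i b where l: "l = (i, b)" by fastforce
  have L: "eval_letter (R k) X l *v v = eval_letter S x l *s v"
    using eig Cons.prems by (auto simp: l eval_letter_S eval_letter_def)
  note c = Fmat_carrier[OF Fmat_eval_letter[OF X, of l]] Fmat_carrier[OF Fmat_eval_monom[OF X, of w]] V_carrier[OF v]
  have "eval_monom (R k) X (l # w) *v v = eval_letter (R k) X l *v (eval_monom S x w *s v)"
    unfolding eval_monom_R assoc_mult_mat_vec[OF c] using Cons by auto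
  also have "... = eval_monom S x (l # w) *s v"
    unfolding mult_mat_vec[OF c(1,3)] L by (simp add: eval_monom_S smult_smult_assoc mult.commute)
  finally show ?case .
qed

lemma eval_poly_eigen:
  assumes X: "\<forall>i. Fmat k k (X i)" and v: "v \<in> V k" and x: "\<forall>i. x i \<in> F"
    and eig: "\<forall>i\<in>I. X i *v v = x i *s v \<and> mat_adjoint (X i) *v v = cnj (x i) *s v"
    and "\<forall>m\<in>set p. fst ` set (snd m) \<subseteq> I"
  shows "eval_poly (R k) X p *v v = eval_poly S x p *s v" using assms(5)
proof (induction p)
  case Nil
  have "0\<^sub>m k k *v v = 0 *s v" using V_carrier[OF v] by (intro eq_vecI) auto
  thus ?case by (simp add: eval_poly_R[OF X] eval_poly_S[OF x])
next
  case (Cons m p)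
  obtain c w where m: "m = (c, w)" by fastforce
  have w: "eval_monom (R k) X w *v v = eval_monom S x w *s v"
    using Cons.prems by (intro eval_monom_eigen[OF X v x eig]) (auto simp: m)
  note C = Fmat_carrier[OF Fmat_eval_monom[OF X, of w]] Fmat_carrier[OF Fmat_eval_poly[OF X, of p]] V_carrier[OF v]
  have "(of_int c \<cdot>\<^sub>m eval_monom (R k) X w) *v v = of_int c *s (eval_monom (R k) X w *v v)"
    using C by (intro eq_vecI) auto
  hence "eval_poly (R k) X (m # p) *v v =
      of_int c *s (eval_monom S x w *s v) + eval_poly S x p *s v"
    unfolding m eval_poly_R[OF X] add_mult_distrib_mat_vec[OF smult_carrier_mat[OF C(1)] C(2,3)] w
    using Cons by simp
  also have "... = eval_poly S x (m # p) *s v"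
    unfolding m eval_poly_S[OF x] by (intro eq_vecI) (auto simp: algebra_simps)
  finally show ?case .
qed

lemma adjoint_eigenvalue:
  assumes A: "Fmat k k A" and v: "v \<in> V k" "v \<noteq> 0\<^sub>v k"
    and eig: "A *v v = \<nu> *s v" "mat_adjoint A *v v = \<mu> *s v"
  shows "\<mu> = cnj \<nu>"
proof -
  note vc = V_carrier[OF v(1)]
  have "cnj \<nu> * ip v v = \<mu> * ip v v"
    using ip_adjoint[OF Fmat_carrier[OF A] vc vc] unfolding eig ip_smult[OF vc vc] .
  thus ?thesis using ip_self_eq_0[OF vc] v(2) by simp
qed

lemma alg_closed_pythagorean:
  assumes "alg_closed_subfield F"
  shows "pythagorean F" unfolding pythagorean_def
proof
  fix s assume "s \<in> sums_of_squares (F \<inter> \<real>)"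
  then obtain xs where xs: "s = (\<Sum>x\<leftarrow>xs. x\<^sup>2)" "set xs \<subseteq> F \<inter> \<real>"
    unfolding sums_of_squares_def by blast
  have "s \<in> F \<and> s \<in> \<real> \<and> Re s \<ge> 0"
    using xs(2) unfolding xs(1) by (induction xs) (auto simp: power2_eq_square elim!: Reals_cases)
  hence s: "s \<in> F" "s \<in> \<real>" "Re s \<ge> 0" by blast+
  have "\<forall>i. coeff [:- s, 0, 1:] i \<in> F"
    using s(1) by (auto simp: coeff_pCons split: nat.splits)
  moreover have "degree [:- s, 0, 1:] > 0" by simp
  ultimately obtain y where y: "y \<in> F" "poly [:- s, 0, 1:] y = 0"
    using assms unfolding alg_closed_subfield_def by blast
  hence sy: "s = y\<^sup>2" by (simp add: power2_eq_square)
  obtain r where r: "s = of_real r" "r \<ge> 0" using s by (auto elim: Reals_cases)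
  hence "y\<^sup>2 = (of_real (sqrt r))\<^sup>2" using sy by (simp flip: of_real_power)
  hence "y = of_real (sqrt r) \<or> y = - of_real (sqrt r)" unfolding power2_eq_iff .
  hence "y \<in> \<real>" by auto
  thus "\<exists>y\<in>F \<inter> \<real>. s = y\<^sup>2" using y(1) sy by blast
qed

lemma real_closed_pythagorean:
  assumes "real_closed_subfield F"
  shows "pythagorean F" "F \<subseteq> \<real>"
proof -
  interpret real_closed_star_field F by unfold_locales (rule assms)
  show "F \<subseteq> \<real>" by (rule F_real)
  show "pythagorean F" unfolding pythagorean_def
  proof
    fix s assume "s \<in> sums_of_squares (F \<inter> \<real>)"
    then obtain xs where xs: "s = (\<Sum>x\<leftarrow>xs. x\<^sup>2)" "set xs \<subseteq> F \<inter> \<real>"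
      unfolding sums_of_squares_def by blast
    have "s \<in> F \<and> s \<in> \<real> \<and> Re s \<ge> 0"
      using xs(2) unfolding xs(1) by (induction xs) (auto simp: power2_eq_square elim!: Reals_cases)
    then obtain r where r: "s = of_real r" "r \<ge> 0" "of_real r \<in> F"
      by (auto elim: Reals_cases)
    have "s = (of_real (sqrt r))\<^sup>2" using r(1,2) by (simp flip: of_real_power)
    thus "\<exists>y\<in>F \<inter> \<real>. s = y\<^sup>2"
      using sqrt_F[OF r(3,2)] Reals_of_real by blast
  qed
qed

definition field_conds :: "ol_term list" where
  "field_conds = commute_conds @ (if F \<subseteq> \<real> then hermitian_conds else [])"

lemma mat_adjoint_mult:
  assumes "Fmat k k A" "Fmat k k B"
  shows "mat_adjoint (A * B) = mat_adjoint B * mat_adjoint A"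
proof (rule eq_matI)
  note c = Fmat_carrier[OF assms(1)] Fmat_carrier[OF assms(2)]
  note ad = mat_adjoint_carrier[OF c(1)] mat_adjoint_carrier[OF c(2)]
  fix i j assume "i < dim_row (mat_adjoint B * mat_adjoint A)" "j < dim_col (mat_adjoint B * mat_adjoint A)"
  hence ij: "i < k" "j < k" using ad by auto
  have "mat_adjoint (A * B) $$ (i, j) = cnj ((A * B) $$ (j, i))"
    by (rule mat_adjoint_index[OF mult_carrier_mat[OF c] ij])
  also have "... = (\<Sum>l<k. cnj (A $$ (j, l)) * cnj (B $$ (l, i)))"
    using ij c by (simp add: scalar_prod_def atLeast0LessThan)
  also have "... = (\<Sum>l<k. mat_adjoint B $$ (i, l) * mat_adjoint A $$ (l, j))"
    using ij c by (intro sum.cong) (auto simp: mat_adjoint_index[of _ k k] mult.commute)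
  also have "... = (mat_adjoint B * mat_adjoint A) $$ (i, j)"
    using ij ad by (simp add: scalar_prod_def atLeast0LessThan)
  finally show "mat_adjoint (A * B) $$ (i, j) = (mat_adjoint B * mat_adjoint A) $$ (i, j)" .
next
  note c = Fmat_carrier[OF assms(1)] Fmat_carrier[OF assms(2)]
  show "dim_row (mat_adjoint (A * B)) = dim_row (mat_adjoint B * mat_adjoint A)"
    "dim_col (mat_adjoint (A * B)) = dim_col (mat_adjoint B * mat_adjoint A)"
    using mat_adjoint_carrier[OF mult_carrier_mat[OF c]]
      mult_carrier_mat[OF mat_adjoint_carrier[OF c(2)] mat_adjoint_carrier[OF c(1)]] by auto
qed

lemma frame_formula_field:
  assumes F: "real_closed_subfield F \<or> alg_closed_subfield F"
  shows "enc_term (frame_formula (letter_conds @ field_conds) ps) \<in> SAT_L F \<longleftrightarrow> enc_polys ps \<in> FEAS S"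
proof
  let ?I = "set (poly_vars ps)"
  have p: "pythagorean F" using F alg_closed_pythagorean real_closed_pythagorean by blast
  assume "enc_term (frame_formula (letter_conds @ field_conds) ps) \<in> SAT_L F"
  then obtain d a where d: "d \<ge> 1" and a: "\<forall>i. subspace_over F d (a i)"
    and e: "eval_term (L d) a (frame_formula (letter_conds @ field_conds) ps) = V d"
    unfolding SAT_L_iff by blast
  have "eval_term (L d) a c = V d" if "c \<in> set frame_conds" for c
    using e that unfolding frame_formula_def eval_meets[OF a] set_append by blast
  then obtain k b1 b2 b3 where k: "k \<ge> 1" and "orthonormal_coordinates F d k b1 b2 b3"
    and fr: "coordinates.framed F d k b1 b2 b3 a" using ex_coordinates[OF p d a] by blast
  then interpret orthonormal_coordinates F d k b1 b2 b3 by blast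
  obtain X where X: "letter_graphs a X ?I" "\<forall>p\<in>set ps. eval_poly (R k) X p = 0\<^sub>m k k"
    and conds: "\<forall>i\<in>?I. \<forall>j\<in>?I. \<forall>c\<in>set field_conds. E (\<lambda>m. a (inst_pair (i, j) m)) c = V d"
    using e frame_formula_iff[OF fr, of field_conds ps] by blast
  have XF: "\<forall>i. Fmat k k (X i)" using X(1) unfolding letter_graphs_def by blast
  have gr: "a (inst_pair (i, j) 1) = gr23 (X i)" "a (inst_pair (i, j) 3) = gr23 (X j)"
    if "i \<in> ?I" "j \<in> ?I" for i j
    using X(1) that by (simp_all add: letter_graphs_def inst_pair_def)
  have comm: "X i * X j = X j * X i" "X i * mat_adjoint (X j) = mat_adjoint (X j) * X i"
    if "i \<in> ?I" "j \<in> ?I" for i j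
    using conds that field_conds_iff(1)[OF framed_inst[OF fr] XF[rule_format] gr(1)[OF that] XF[rule_format] gr(2)[OF that]]
    unfolding field_conds_def set_append by blast+
  have herm: "mat_adjoint (X i) = X i" if "i \<in> ?I" "F \<subseteq> \<real>" for i
    using conds that field_conds_iff(2)[OF framed_inst[OF fr] XF[rule_format] gr(1)[OF that(1,1)] XF[rule_format] gr(2)[OF that(1,1)]]
    unfolding field_conds_def set_append by (simp only: if_True) blast
  define Ms where "Ms = X ` ?I \<union> (\<lambda>i. mat_adjoint (X i)) ` ?I"
  have "good_matrix k A" if A: "A \<in> Ms" for A
  proof -
    have "Fmat k k A" using A XF Fmat_adjoint unfolding Ms_def by blast
    moreover have "mat_adjoint A = A" if "real_closed_subfield F"
    proof -
      obtain i where i: "i \<in> ?I" "A = X i \<or> A = mat_adjoint (X i)"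
        using A unfolding Ms_def by blast
      have "mat_adjoint (X i) = X i" by (rule herm[OF i(1) real_closed_pythagorean(2)[OF that]])
      thus ?thesis using i(2) by auto
    qed
    ultimately show ?thesis unfolding good_matrix_def using F by blast
  qed
  moreover have "A * B = B * A" if AB: "A \<in> Ms" "B \<in> Ms" for A B
  proof -
    have adj: "mat_adjoint (X i) * mat_adjoint (X j) = mat_adjoint (X j) * mat_adjoint (X i)"
      if "i \<in> ?I" "j \<in> ?I" for i j
      using comm(1)[OF that] mat_adjoint_mult[OF XF[rule_format] XF[rule_format], of i j]
        mat_adjoint_mult[OF XF[rule_format] XF[rule_format], of j i] by simp
    obtain i j where "i \<in> ?I" "j \<in> ?I" "A = X i \<or> A = mat_adjoint (X i)" "B = X j \<or> B = mat_adjoint (X j)"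
      using AB unfolding Ms_def by blast
    thus ?thesis using comm adj by (elim disjE) simp_all
  qed
  moreover have "finite Ms" by (simp add: Ms_def)
  ultimately obtain v where v: "v \<in> V k" "v \<noteq> 0\<^sub>v k" "\<forall>A\<in>Ms. \<exists>\<mu>\<in>F. A *v v = \<mu> *s v"
    using ex_common_eigenvector[of Ms k] k by blast
  have "\<forall>i\<in>?I. \<exists>x. x \<in> F \<and> X i *v v = x *s v"
    using v(3) unfolding Ms_def by blast
  then obtain x0 where x0: "\<forall>i\<in>?I. x0 i \<in> F \<and> X i *v v = x0 i *s v"
    unfolding bchoice_iff by blast
  define x where "x i = (if i \<in> ?I then x0 i else 0)" for i
  have xF: "\<forall>i. x i \<in> F" using x0 by (simp add: x_def)
  have eig: "\<forall>i\<in>?I. X i *v v = x i *s v \<and> mat_adjoint (X i) *v v = cnj (x i) *s v"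
  proof
    fix i assume i: "i \<in> ?I"
    have 1: "X i *v v = x i *s v" using x0 i by (simp add: x_def)
    obtain \<mu> where 2: "mat_adjoint (X i) *v v = \<mu> *s v"
      using v(3) i unfolding Ms_def by blast
    show "X i *v v = x i *s v \<and> mat_adjoint (X i) *v v = cnj (x i) *s v"
      using 1 2 adjoint_eigenvalue[OF XF[rule_format] v(1,2) 1 2] by blast
  qed
  have "eval_poly S x p = 0" if p: "p \<in> set ps" for p
  proof -
    have "eval_poly S x p *s v = eval_poly (R k) X p *v v"
      by (rule eval_poly_eigen[OF XF v(1) xF eig poly_vars_subset[OF p], symmetric])
    also have "... = 0\<^sub>v k" using X(2) p V_carrier[OF v(1)] by (auto intro!: eq_vecI)
    finally have z: "eval_poly S x p *s v = 0\<^sub>v k" .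
    show ?thesis
    proof (rule ccontr)
      assume ne: "eval_poly S x p \<noteq> 0"
      have "v = 0\<^sub>v k"
      proof (rule eq_vecI)
        fix i assume "i < dim_vec (0\<^sub>v k :: complex vec)"
        thus "v $ i = 0\<^sub>v k $ i"
          using arg_cong[OF z, of "\<lambda>u. u $ i"] ne V_dim[OF v(1)] by simp
      qed (simp add: V_dim[OF v(1)])
      thus False using v(2) by blast
    qed
  qed
  thus "enc_polys ps \<in> FEAS S" unfolding FEAS_S_iff using xF by blast
next
  let ?I = "set (poly_vars ps)"
  assume "enc_polys ps \<in> FEAS S"
  then obtain x where x: "\<forall>i. x i \<in> F" and zero: "\<forall>p\<in>set ps. eval_poly S x p = 0"
    unfolding FEAS_S_iff by blast
  define X where "X i = x i \<cdot>\<^sub>m 1\<^sub>m 1" for i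
  have X: "\<forall>i. Fmat 1 1 (X i)"
    unfolding X_def using Fmat_smult[OF x[rule_format] Fmat_one] by blast
  have XI: "X i *v v = x i *s v" "mat_adjoint (X i) = cnj (x i) \<cdot>\<^sub>m 1\<^sub>m 1"
    "mat_adjoint (X i) *v v = cnj (x i) *s v" if "v \<in> V 1" for i v
  proof -
    have s: "(c \<cdot>\<^sub>m 1\<^sub>m 1) *v v = c *s v" for c
      using V_dim[OF that] by (intro eq_vecI) (auto simp: scalar_prod_def)
    show "X i *v v = x i *s v" unfolding X_def by (rule s)
    show ad: "mat_adjoint (X i) = cnj (x i) \<cdot>\<^sub>m 1\<^sub>m 1"
    proof (rule eq_matI)
      fix r c assume "r < dim_row (cnj (x i) \<cdot>\<^sub>m 1\<^sub>m 1)" "c < dim_col (cnj (x i) \<cdot>\<^sub>m 1\<^sub>m 1)"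
      thus "mat_adjoint (X i) $$ (r, c) = (cnj (x i) \<cdot>\<^sub>m 1\<^sub>m 1) $$ (r, c)"
        using mat_adjoint_index[OF Fmat_carrier[OF X[rule_format]], of r c i] by (simp add: X_def)
    qed (use mat_adjoint_carrier[OF Fmat_carrier[OF X[rule_format]], of i] in auto)
    show "mat_adjoint (X i) *v v = cnj (x i) *s v" unfolding ad by (rule s)
  qed
  have comm: "(a \<cdot>\<^sub>m 1\<^sub>m 1) * (b \<cdot>\<^sub>m 1\<^sub>m 1) = (b \<cdot>\<^sub>m 1\<^sub>m 1) * (a \<cdot>\<^sub>m 1\<^sub>m 1 :: complex mat)" for a b
    by (intro eq_matI) (auto simp: scalar_prod_def)
  have pz: "eval_poly (R 1) X p = 0\<^sub>m 1 1" if p: "p \<in> set ps" for p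
  proof (rule mat_eqI[OF Fmat_carrier[OF Fmat_eval_poly[OF X]] zero_carrier_mat])
    fix v assume v: "v \<in> V 1"
    have "eval_poly (R 1) X p *v v = eval_poly S x p *s v"
      by (rule eval_poly_eigen[OF X v x _ poly_vars_subset[OF p]]) (use XI[OF v] in blast)
    also have "... = 0\<^sub>m 1 1 *v v"
      using zero p V_dim[OF v] by (intro eq_vecI) (auto simp: scalar_prod_def)
    finally show "eval_poly (R 1) X p *v v = 0\<^sub>m 1 1 *v v" .
  qed
  interpret orthonormal_coordinates F 3 1 "block 1 0" "block 1 (Suc 0)" "block 1 2"
    using standard_coordinates[of 1] by simp
  obtain a where a: "framed a" "letter_graphs a X UNIV" using ex_framed[OF X] by blast
  have lg: "letter_graphs a X ?I" using a(2) unfolding letter_graphs_def by blast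
  have "E (\<lambda>m. a (inst_pair (i, j) m)) c = V 3" if c: "c \<in> set field_conds" for i j c
  proof -
    have gr: "a (inst_pair (i, j) 1) = gr23 (X i)" "a (inst_pair (i, j) 3) = gr23 (X j)"
    proof -
      have "inst_pair (i, j) 1 = 2 * i + 1" "inst_pair (i, j) 3 = 2 * j + 1"
        by (simp_all add: inst_pair_def)
      thus "a (inst_pair (i, j) 1) = gr23 (X i)" "a (inst_pair (i, j) 3) = gr23 (X j)"
        using a(2) unfolding letter_graphs_def by (simp_all only: UNIV_I ball_simps ball_UNIV)
    qed
    note iffs = field_conds_iff[OF framed_inst[OF a(1)] X[rule_format] gr(1) X[rule_format] gr(2)]
    have "X i * X j = X j * X i \<and> X i * mat_adjoint (X j) = mat_adjoint (X j) * X i"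
      unfolding XI(2)[OF V_zero] unfolding X_def using comm by blast
    moreover have "mat_adjoint (X i) = X i" if "F \<subseteq> \<real>"
    proof -
      have "cnj (x i) = x i" using that x by (auto simp: Reals_cnj_iff)
      thus ?thesis using XI(2)[OF V_zero, of i] by (simp only: X_def)
    qed
    ultimately show ?thesis
      using c iffs unfolding field_conds_def set_append by (cases "F \<subseteq> \<real>") (simp_all only: if_True if_False list.set, blast+)
  qed
  hence "eval_term (L 3) a (frame_formula (letter_conds @ field_conds) ps) = V 3"
    unfolding frame_formula_iff[OF a(1)] using lg pz by blast
  thus "enc_term (frame_formula (letter_conds @ field_conds) ps) \<in> SAT_L F"
    unfolding SAT_L_iff using framedD[OF a(1)] by (intro exI[of _ 3] conjI exI[of _ a]) simp_all
qed

end

theorem FEAS_reducible_SAT_L: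
  assumes "star_subfield F" "real_closed_subfield F \<or> alg_closed_subfield F"
  shows "FEAS (field_star_ring F) \<le>\<^sub>p SAT_L F"
proof -
  interpret star_field F by unfold_locales (rule assms)
  have "FEAS S \<subseteq> range enc_polys" unfolding FEAS_def by blast
  from frame_formula_reduction[OF frame_formula_field[OF assms(2)] this] show ?thesis .
qed

theorem proposition6p13:
  fixes F :: "complex set"
  assumes "star_subfield F"
  shows "(SAT \<le>\<^sub>p SAT_L F \<and> SAT_L F \<le>\<^sub>p FEAS_all_dims F) \<and>
         (pythagorean F \<longrightarrow> FEAS_all_dims F \<le>\<^sub>p SAT_L F) \<and>
         (real_closed_subfield F \<or> alg_closed_subfield F \<longrightarrow>
            FEAS (field_star_ring F) \<le>\<^sub>p SAT_L F)"
  using SAT_reducible_SAT_L[OF assms] SAT_L_reducible_FEAS_all_dims[OF assms]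
    FEAS_all_dims_reducible_SAT_L[OF assms] FEAS_reducible_SAT_L[OF assms] by blast

end
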